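(* (1) There exist closed hyperbolic $3$-manifolds $M$ such that $b_1(M)=5$ and $c_1(M)=1$. (2) There exist compact $3$-manifolds $M$ with toroidal boundary such that $b_1(M)=4$ and $c_1(M)=1$.
   Context: For a group $G$, the co-rank $c_1(G)$ is the maximal rank $k$ of a free group $F_k$ onto which $G$ admits a surjective homomorphism, and $b_1(G)=\dim_{\mathbb{Q}}(G^{ab}\otimes\mathbb{Q})$ where $G^{ab}=G/[G,G]$. For a (connected) manifold $M$, $c_1(M)=c_1(\pi_1(M))$ and $b_1(M)=b_1(\pi_1(M))$ is the first Betti number. "Toroidal boundary" means that the boundary of $M$ is nonempty and each of its components is a torus. *)

theory Defs
  imports
    "HOL-Analysis.Analysis"
    "HOL-Algebra.Free_Abelian_Groups"
    "HOL-Algebra.Generated_Groups"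
    "HOL-Library.Extended_Nat"
    "Jordan_Normal_Form.Missing_VectorSpace"
begin

section \<open>Free groups and co-rank\<close>

text \<open>A letter \<open>(i, True)\<close> is the generator with index \<open>i\<close>, and \<open>(i, False)\<close> is its inverse.\<close>

definition fg_words :: "nat \<Rightarrow> (nat \<times> bool) list set" where
  "fg_words k = lists ({..<k} \<times> UNIV)"

definition fg_cancel :: "nat \<Rightarrow> ((nat \<times> bool) list \<times> (nat \<times> bool) list) set" where
  "fg_cancel k = {(u @ [(i, b), (i, \<not> b)] @ v, u @ v) | u v i b.
     u \<in> fg_words k \<and> v \<in> fg_words k \<and> i < k}"

definition fg_rel :: "nat \<Rightarrow> ((nat \<times> bool) list \<times> (nat \<times> bool) list) set" where
  "fg_rel k = Restr ((fg_cancel k \<union> converse (fg_cancel k))\<^sup>*) (fg_words k)"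

definition free_group :: "nat \<Rightarrow> (nat \<times> bool) list set monoid" where
  "free_group k =
     \<lparr>carrier = fg_words k // fg_rel k,
      monoid.mult = (\<lambda>A B. \<Union>u\<in>A. \<Union>v\<in>B. fg_rel k `` {u @ v}),
      one = fg_rel k `` {[]}\<rparr>"

text \<open>The supremum is taken in \<^typ>\<open>enat\<close>, so that it is \<open>\<infinity>\<close>, and not a junk value, for a group
  with free quotients of unbounded rank. The index set always contains \<open>0\<close>, hence a finite
  value of the supremum is attained.\<close>

definition corank :: "('a, 'b) monoid_scheme \<Rightarrow> enat" where
  "corank G = (SUP k \<in> {k. epi G (free_group k) \<noteq> {}}. enat k)"

section \<open>The first Betti number of a group\<close>

definition abelianization :: "('a, 'b) monoid_scheme \<Rightarrow> 'a set monoid" where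
  "abelianization G = G Mod derived G (carrier G)"

text \<open>The tensor product \<open>A \<otimes> \<rat>\<close> over the integers of a (multiplicatively written) abelian
  group \<open>A\<close> with the rationals is the free abelian group on the pairs \<open>(a, q)\<close> modulo the
  subgroup generated by the bilinearity relations.\<close>

definition tensor_free :: "('a, 'b) monoid_scheme \<Rightarrow> ('a \<times> rat \<Rightarrow>\<^sub>0 int) monoid" where
  "tensor_free A = free_Abelian_group (carrier A \<times> UNIV)"

definition tensor_relations :: "('a, 'b) monoid_scheme \<Rightarrow> ('a \<times> rat \<Rightarrow>\<^sub>0 int) set" where
  "tensor_relations A = generate (tensor_free A)
     ({frag_of (a \<otimes>\<^bsub>A\<^esub> b, q) - frag_of (a, q) - frag_of (b, q) | a b q.
         a \<in> carrier A \<and> b \<in> carrier A} \<union>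
      {frag_of (a, q + r) - frag_of (a, q) - frag_of (a, r) | a q r. a \<in> carrier A})"

text \<open>The scalar \<open>q\<close> acts by \<open>q \<bullet> (a \<otimes> r) = a \<otimes> (q * r)\<close>. The ring multiplication and unit of
  the record are not part of a module.\<close>

definition tensor_rat :: "('a, 'b) monoid_scheme \<Rightarrow> (rat, ('a \<times> rat \<Rightarrow>\<^sub>0 int) set) module" where
  "tensor_rat A =
     \<lparr>carrier = carrier (tensor_free A Mod tensor_relations A),
      monoid.mult = undefined, one = undefined,
      zero = \<one>\<^bsub>tensor_free A Mod tensor_relations A\<^esub>,
      add = (\<lambda>C D. C \<otimes>\<^bsub>tensor_free A Mod tensor_relations A\<^esub> D),
      smult = (\<lambda>q C. \<Union>c\<in>C. tensor_relations A #>\<^bsub>tensor_free A\<^esub>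
                 frag_extend (\<lambda>(a, r). frag_of (a, q * r)) c)\<rparr>"

abbreviation rat_field :: "rat ring" where
  "rat_field \<equiv> \<lparr>carrier = UNIV, monoid.mult = (*), one = 1, zero = 0, add = (+)\<rparr>"

definition betti1 :: "('a, 'b) monoid_scheme \<Rightarrow> enat" where
  "betti1 G =
     (let V = tensor_rat (abelianization G) in
      if vectorspace.fin_dim rat_field V then enat (vectorspace.dim rat_field V) else \<infinity>)"

section \<open>The fundamental group\<close>

definition loops_at :: "'a topology \<Rightarrow> 'a \<Rightarrow> (real \<Rightarrow> 'a) set" where
  "loops_at X x = {p. pathin X p \<and> p 0 = x \<and> p 1 = x}"

definition loop_homotopy :: "'a topology \<Rightarrow> 'a \<Rightarrow> ((real \<Rightarrow> 'a) \<times> (real \<Rightarrow> 'a)) set" where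
  "loop_homotopy X x = {(p, q). p \<in> loops_at X x \<and> q \<in> loops_at X x \<and>
     homotopic_with (\<lambda>r. r 0 = x \<and> r 1 = x) (top_of_set {0..1}) X p q}"

text \<open>Same as \<^const>\<open>joinpaths\<close>, which is restricted to type class topologies.\<close>

definition loop_join :: "(real \<Rightarrow> 'a) \<Rightarrow> (real \<Rightarrow> 'a) \<Rightarrow> real \<Rightarrow> 'a" where
  "loop_join p q = (\<lambda>t. if t \<le> 1/2 then p (2 * t) else q (2 * t - 1))"

definition fundamental_group :: "'a topology \<Rightarrow> 'a \<Rightarrow> (real \<Rightarrow> 'a) set monoid" where
  "fundamental_group X x =
     \<lparr>carrier = loops_at X x // loop_homotopy X x,
      monoid.mult = (\<lambda>A B. \<Union>p\<in>A. \<Union>q\<in>B. loop_homotopy X x `` {loop_join p q}),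
      one = loop_homotopy X x `` {\<lambda>_. x}\<rparr>"

section \<open>3-manifolds\<close>

definition half_space3 :: "(real^3) set" where
  "half_space3 = {v. v $ 3 \<ge> 0}"

text \<open>Manifolds are connected and nonempty, and may have boundary. A manifold has at most
  continuum many points, so up to homeomorphism every manifold is a topology on subsets of
  \<open>real^3\<close>, that is, one of type \<^typ>\<open>(real^3) set topology\<close>; quotients of subsets of
  \<open>real^3\<close> are literally of this form.\<close>

definition manifold3 :: "'a topology \<Rightarrow> bool" where
  "manifold3 X \<longleftrightarrow>
     topspace X \<noteq> {} \<and> connected_space X \<and> Hausdorff_space X \<and> second_countable X \<and>
     (\<forall>p\<in>topspace X. \<exists>U V. openin X U \<and> p \<in> U \<and> openin (top_of_set half_space3) V \<and>
        subtopology X U homeomorphic_space top_of_set V)"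

definition manifold3_interior :: "'a topology \<Rightarrow> 'a set" where
  "manifold3_interior X = {p \<in> topspace X. \<exists>U (V :: (real^3) set).
     openin X U \<and> p \<in> U \<and> open V \<and> subtopology X U homeomorphic_space top_of_set V}"

definition manifold3_boundary :: "'a topology \<Rightarrow> 'a set" where
  "manifold3_boundary X = topspace X - manifold3_interior X"

definition closed_manifold3 :: "'a topology \<Rightarrow> bool" where
  "closed_manifold3 X \<longleftrightarrow> manifold3 X \<and> compact_space X \<and> manifold3_boundary X = {}"

definition torus :: "(complex \<times> complex) topology" where
  "torus = prod_topology (top_of_set (sphere 0 1)) (top_of_set (sphere 0 1))"

definition toroidal_boundary :: "'a topology \<Rightarrow> bool" where
  "toroidal_boundary X \<longleftrightarrow> manifold3_boundary X \<noteq> {} \<and>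
     (\<forall>C \<in> connected_components_of (subtopology X (manifold3_boundary X)).
        subtopology X C homeomorphic_space torus)"

section \<open>Hyperbolic 3-manifolds\<close>

text \<open>The upper half-space model of hyperbolic 3-space, whose metric induces the Euclidean
  topology.\<close>

definition hyp3 :: "(real^3) set" where
  "hyp3 = {v. v $ 3 > 0}"

definition hyp3_dist :: "real^3 \<Rightarrow> real^3 \<Rightarrow> real" where
  "hyp3_dist v w = arcosh (1 + (dist v w)\<^sup>2 / (2 * v $ 3 * w $ 3))"

definition hyp3_isometry :: "(real^3 \<Rightarrow> real^3) \<Rightarrow> bool" where
  "hyp3_isometry g \<longleftrightarrow> bij_betw g hyp3 hyp3 \<and>
     (\<forall>v\<in>hyp3. \<forall>w\<in>hyp3. hyp3_dist (g v) (g w) = hyp3_dist v w)"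

text \<open>An atlas of charts with values in hyperbolic space whose transition maps are locally
  restrictions of isometries of hyperbolic space.\<close>

definition hyperbolic_atlas3 :: "'a topology \<Rightarrow> ('a set \<times> ('a \<Rightarrow> real^3)) set \<Rightarrow> bool" where
  "hyperbolic_atlas3 X \<A> \<longleftrightarrow>
     (\<Union>(U, f)\<in>\<A>. U) = topspace X \<and>
     (\<forall>(U, f)\<in>\<A>. openin X U \<and> open (f ` U) \<and> f ` U \<subseteq> hyp3 \<and>
        homeomorphic_map (subtopology X U) (top_of_set (f ` U)) f) \<and>
     (\<forall>(U, f)\<in>\<A>. \<forall>(V, g)\<in>\<A>. \<forall>p\<in>U \<inter> V.
        \<exists>W \<gamma>. openin X W \<and> p \<in> W \<and> W \<subseteq> U \<inter> V \<and> hyp3_isometry \<gamma> \<and>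
              (\<forall>w\<in>W. g w = \<gamma> (f w)))"

text \<open>On a closed manifold a hyperbolic structure is automatically complete, so this is the same
  as a complete Riemannian metric of constant curvature \<open>-1\<close>.\<close>

definition closed_hyperbolic_manifold3 :: "'a topology \<Rightarrow> bool" where
  "closed_hyperbolic_manifold3 X \<longleftrightarrow> closed_manifold3 X \<and> (\<exists>\<A>. hyperbolic_atlas3 X \<A>)"

text \<open>Basepoints are immaterial since manifolds are connected, hence path connected.\<close>

definition manifold_corank :: "'a topology \<Rightarrow> 'a \<Rightarrow> enat" where
  "manifold_corank X x = corank (fundamental_group X x)"

definition manifold_betti1 :: "'a topology \<Rightarrow> 'a \<Rightarrow> enat" where
  "manifold_betti1 X x = betti1 (fundamental_group X x)"

end

theory Submission
  imports Defs "HOL-Number_Theory.Cong" "HOL-Computational_Algebra.Primes" "HOL-Library.Function_Algebras"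
begin

text \<open>Both manifolds are glued from copies of a right-angled polyhedron: 24 regular dodecahedra for
  the closed one, and 8 ideal octahedra with truncated vertices for the other one. Reflections in the
  faces tile hyperbolic space, so the reflections composed with the gluing maps act on it (or on the
  complement of a family of horoballs) as the fundamental group \<open>G\<close>, which is generated by the faces
  of the cells with one relation for each face and each edge. Homomorphisms and twisted cocycles
  of \<open>G\<close> are therefore labellings of the faces that satisfy linear equations, and these are solved by
  certificates. The first Betti number comes from cocycles modulo one prime: a
  labelling that vanishes on the free faces is divisible by every power of the prime.

  If \<open>G\<close> maps onto a free group of rank at least 2, then two of the induced classes \<open>u\<close>, \<open>v\<close> in
  \<open>H\<^sup>1(G; \<int>)\<close> are independent modulo every \<open>e\<close>, their cup product vanishes, and for
  every combination of \<open>u\<close> and \<open>v\<close> that is nonzero modulo \<open>e\<close> the induced character of order \<open>e\<close> with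
  values in \<open>(\<int>/r)\<^sup>*\<close> has twisted cocycles that are not coboundaries. In the closed case (\<open>e = 2\<close>, \<open>r = 11\<close>) every
  plane in \<open>H\<^sup>1\<close> meets a hyperplane all of whose characters have only coboundaries. In the other
  case (\<open>e = 3\<close>, \<open>r = 7\<close>) the cup product leaves 14 Pluecker vectors modulo 3, and each
  of these planes contains such a character.\<close>


section \<open>Quotients by deck groups\<close>

locale deck_action =
 fixes X :: "'a::real_normed_vector set" and G :: "('a => 'a) set"
 assumes G_id: "id \<in> G"
  and G_comp: "!!g h. g \<in> G ==> h \<in> G ==> g \<circ> h \<in> G"
  and G_inv: "!!g. g \<in> G ==> \<exists>h\<in>G. h \<circ> g = id & g \<circ> h = id"
  and G_cont: "!!g. g \<in> G ==> continuous_on X g"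
  and G_im: "!!g x. g \<in> G ==> x \<in> X ==> g x \<in> X"
  and even_nbhd: "!!x. x \<in> X ==>
   \<exists>U. openin (top_of_set X) U & x \<in> U & (\<forall>g\<in>G. g ~= id --> g ` U \<inter> U = {})"
begin

definition orb :: "'a => 'a set" where "orb x = (%g. g x) ` G"

definition quot :: "'a set topology" where
 "quot = topology (%V. V \<subseteq> orb ` X & openin (top_of_set X) {x\<in>X. orb x \<in> V})"

definition deck_group :: "('a => 'a) monoid" where
 "deck_group = \<lparr>carrier = G, monoid.mult = (\<circ>), one = id\<rparr>"

lemma orb_self: "x \<in> orb x"
 using G_id by (metis id_apply image_eqI orb_def)

lemma orb_apply: "g \<in> G ==> orb (g x) = orb x"
proof -
 assume g: "g \<in> G"
 then obtain h where h: "h \<in> G" "!!x. h (g x) = x" using G_inv by (metis comp_apply id_apply)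
 have "k (g x) \<in> orb x" if "k \<in> G" for k using G_comp[OF that g] unfolding orb_def by (intro image_eqI[of _ _ "k \<circ> g"]) auto
 moreover have "k x \<in> orb (g x)" if "k \<in> G" for k
  using G_comp[OF that h(1)] h(2) unfolding orb_def by (intro image_eqI[of _ _ "k \<circ> h"]) auto
 ultimately show ?thesis unfolding orb_def by blast
qed

lemma orb_eqD: "orb x = orb y ==> \<exists>g\<in>G. y = g x"
 using orb_self[of y] by (auto simp: orb_def)

lemma openin_G_image:
 assumes "g \<in> G" "openin (top_of_set X) U"
 shows "openin (top_of_set X) (g ` U)"
proof -
 obtain h where h: "h \<in> G" "!!x. h (g x) = x" "!!x. g (h x) = x" using G_inv[OF assms(1)] by (auto simp: fun_eq_iff)
 have "U \<subseteq> X" using assms(2) openin_imp_subset by blast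
 have "g ` U = X \<inter> h -` U"
 proof safe
  fix x assume "x \<in> U" thus "g x \<in> X" using \<open>U \<subseteq> X\<close> G_im[OF assms(1)] by blast
 next
  fix x assume "x \<in> U" thus "g x \<in> h -` U" using h(2) by simp
 next
  fix x assume "h x \<in> U" thus "x \<in> g ` U" by (metis h(3) imageI)
 qed
 moreover have "openin (top_of_set X) (X \<inter> h -` U)" using G_cont[OF h(1)] G_im[OF h(1)] assms(2)
  by (intro continuous_openin_preimage[where T = X]) auto
 ultimately show ?thesis by simp
qed

lemma istopology_quot: "istopology (%V. V \<subseteq> orb ` X & openin (top_of_set X) {x\<in>X. orb x \<in> V})"
 unfolding istopology_def
proof (intro conjI allI impI)
 fix S T assume ST: "S \<subseteq> orb ` X & openin (top_of_set X) {x \<in> X. orb x \<in> S}"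
  "T \<subseteq> orb ` X & openin (top_of_set X) {x \<in> X. orb x \<in> T}"
 have "{x \<in> X. orb x \<in> S \<inter> T} = {x \<in> X. orb x \<in> S} \<inter> {x \<in> X. orb x \<in> T}" by blast
 thus "openin (top_of_set X) {x \<in> X. orb x \<in> S \<inter> T}" using openin_Int[of "top_of_set X" "{x \<in> X. orb x \<in> S}"] ST by simp
 show "S \<inter> T \<subseteq> orb ` X" using ST(1) by blast
next
 fix K assume K: "\<forall>V\<in>K. V \<subseteq> orb ` X & openin (top_of_set X) {x \<in> X. orb x \<in> V}"
 thus "\<Union>K \<subseteq> orb ` X" by blast
 have "{x \<in> X. orb x \<in> \<Union>K} = \<Union>((%V. {x \<in> X. orb x \<in> V}) ` K)" by blast
 thus "openin (top_of_set X) {x \<in> X. orb x \<in> \<Union>K}" using K by (auto intro!: openin_Union)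
qed

lemma openin_quot: "openin quot V \<longleftrightarrow> V \<subseteq> orb ` X & openin (top_of_set X) {x\<in>X. orb x \<in> V}"
 unfolding quot_def by (simp add: topology_inverse'[OF istopology_quot])

lemma topspace_quot: "topspace quot = orb ` X"
proof
 show "topspace quot \<subseteq> orb ` X" unfolding topspace_def using openin_quot by blast
 have "{x \<in> X. orb x \<in> orb ` X} = X" by blast
 hence "openin quot (orb ` X)" unfolding openin_quot by simp
 thus "orb ` X \<subseteq> topspace quot" by (rule openin_subset)
qed

lemma continuous_map_orb: "continuous_map (top_of_set X) quot orb"
 unfolding continuous_map by (auto simp: topspace_quot openin_quot)

lemma open_orb_image:
 assumes "openin (top_of_set X) U"
 shows "openin quot (orb ` U)"
proof -
 have "U \<subseteq> X" using assms openin_imp_subset by blast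
 have "{x\<in>X. orb x \<in> orb ` U} = (\<Union>g\<in>G. g ` U)"
 proof safe
  fix x u assume "orb x = orb u" "x \<in> X" "u \<in> U"
  thus "x \<in> (\<Union>g\<in>G. g ` U)" using orb_eqD[of u x] by auto
 next
  fix g u assume "g \<in> G" "u \<in> U"
  thus "g u \<in> X" using \<open>U \<subseteq> X\<close> G_im by blast
 next
  fix g u assume "g \<in> G" "u \<in> U"
  thus "orb (g u) \<in> orb ` U" by (simp add: orb_apply)
 qed
 moreover have "openin (top_of_set X) (\<Union>g\<in>G. g ` U)" using openin_G_image assms by blast
 ultimately show ?thesis unfolding openin_quot using \<open>U \<subseteq> X\<close> by auto
qed

lemma open_map_orb: "open_map (top_of_set X) quot orb"
 unfolding open_map_def using open_orb_image by blast

lemma G_free: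
 assumes "g \<in> G" "h \<in> G" "x \<in> X" "g x = h x"
 shows "g = h"
proof -
 obtain k where k: "k \<in> G" "!!x. k (h x) = x" "h \<circ> k = id" using G_inv[OF assms(2)] by (auto simp: fun_eq_iff)
 obtain U where U: "x \<in> U" "\<forall>g\<in>G. g ~= id --> g ` U \<inter> U = {}" using even_nbhd[OF assms(3)] by blast
 have kg: "k \<circ> g \<in> G" using G_comp k(1) assms(1) by blast
 have "(k \<circ> g) x = x" using assms(4) k(2) by simp
 hence "(k \<circ> g) ` U \<inter> U ~= {}" using U(1) by (metis IntI empty_iff imageI)
 hence "k \<circ> g = id" using U(2) kg by blast
 hence "h \<circ> (k \<circ> g) = h" by simp
 thus ?thesis using k(3) by (simp add: o_assoc)
qed

lemma even_nbhd_homeo: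
 assumes "x \<in> X"
 obtains U where "openin (top_of_set X) U" "x \<in> U" "!!g. g \<in> G ==> g ~= id ==> g ` U \<inter> U = {}"
  "inj_on orb U" "homeomorphic_map (top_of_set U) (subtopology quot (orb ` U)) orb"
proof -
 obtain U where U: "openin (top_of_set X) U" "x \<in> U" "!!g. g \<in> G ==> g ~= id ==> g ` U \<inter> U = {}"
  using even_nbhd[OF assms] by blast
 have UX: "U \<subseteq> X" using U(1) openin_imp_subset by blast
 have inj: "inj_on orb U"
 proof
  fix a b assume ab: "a \<in> U" "b \<in> U" "orb a = orb b"
  then obtain g where g: "g \<in> G" "b = g a" using orb_eqD by blast
  show "a = b"
  proof (cases "g = id")
   case False
   hence "g ` U \<inter> U = {}" using U(3) g by blast
   thus ?thesis using ab g by blast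
  qed (use g in simp)
 qed
 have om: "open_map (top_of_set U) (subtopology quot (orb ` U)) orb" unfolding open_map_def
 proof (intro allI impI)
  fix V assume V: "openin (top_of_set U) V"
  hence "openin (top_of_set X) V" using U(1) openin_trans by blast
  hence "openin quot (orb ` V)" by (rule open_orb_image)
  moreover have "orb ` V = orb ` V \<inter> orb ` U" using V openin_imp_subset by blast
  ultimately show "openin (subtopology quot (orb ` U)) (orb ` V)" by (metis openin_subtopology)
 qed
 have cm: "continuous_map (top_of_set U) (subtopology quot (orb ` U)) orb" unfolding continuous_map_in_subtopology
  using continuous_map_from_subtopology_mono[OF continuous_map_orb UX] by simp
 have im: "orb ` topspace (top_of_set U) = topspace (subtopology quot (orb ` U))" by (simp add: topspace_quot image_mono[OF UX] inf_absorb2)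
 have hm: "homeomorphic_map (top_of_set U) (subtopology quot (orb ` U)) orb" unfolding homeomorphic_map_def
  using continuous_open_imp_quotient_map[OF cm om im] inj by simp
 show ?thesis by (rule that[OF U(1) U(2) U(3) inj hm])
qed

lemma pullback_covering:
 fixes K :: "'c::real_normed_vector set" and f :: "'c => 'a set"
 assumes f: "continuous_map (top_of_set K) quot f"
 shows "covering_space {(k, x). k \<in> K & x \<in> X & orb x = f k} fst K"
  (is "covering_space ?E fst K")
proof
 show "continuous_on ?E fst" by (intro continuous_intros)
 have fK: "\<exists>x\<in>X. orb x = f k" if "k \<in> K" for k
 proof -
  have "f k \<in> topspace quot" using continuous_map_image_subset_topspace[OF f] that by auto
  thus ?thesis unfolding topspace_quot by blast
 qed
 show "fst ` ?E = K"
 proof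
  show "fst ` ?E \<subseteq> K" by auto
  show "K \<subseteq> fst ` ?E"
  proof
   fix k assume "k \<in> K"
   with fK obtain x where "x \<in> X" "orb x = f k" by blast
   hence "(k, x) \<in> ?E" using \<open>k \<in> K\<close> by simp
   thus "k \<in> fst ` ?E" by (rule image_eqI[rotated]) simp
  qed
 qed
 fix k assume k: "k \<in> K"
 then obtain x where x: "x \<in> X" "orb x = f k" using fK by blast
 obtain U where U: "openin (top_of_set X) U" "x \<in> U"
  "!!g. g \<in> G ==> g ~= id ==> g ` U \<inter> U = {}" "inj_on orb U"
  and hU: "homeomorphic_map (top_of_set U) (subtopology quot (orb ` U)) orb" using even_nbhd_homeo[OF x(1)] by metis
 have UX: "U \<subseteq> X" using U(1) openin_imp_subset by blast
 obtain r where r: "homeomorphic_maps (top_of_set U) (subtopology quot (orb ` U)) orb r" using hU homeomorphic_map_maps by blast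
 define T where "T = {j\<in>K. f j \<in> orb ` U}"
 define v where "v g = {(j, y). j \<in> T & y \<in> g ` U & orb y = f j}" for g
 have opT: "openin (top_of_set K) T" using openin_continuous_map_preimage[OF f open_orb_image[OF U(1)]] by (simp add: T_def)
 have rU: "r (f j) \<in> U" "orb (r (f j)) = f j" if "j \<in> T" for j
 proof -
  have "f j \<in> topspace (subtopology quot (orb ` U))" using that UX by (auto simp: T_def topspace_quot)
  moreover have "r ` topspace (subtopology quot (orb ` U)) \<subseteq> U"
   using r by (metis continuous_map_image_subset_topspace homeomorphic_maps_def topspace_euclidean_subtopology)
  ultimately show "r (f j) \<in> U" "orb (r (f j)) = f j" using r unfolding homeomorphic_maps_def by blast+
 qed
 have "continuous_map (top_of_set T) (subtopology quot (orb ` U)) f" unfolding continuous_map_in_subtopology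
 proof
  have "T \<subseteq> K" by (auto simp: T_def)
  thus "continuous_map (top_of_set T) quot f" by (rule continuous_map_from_subtopology_mono[OF f])
 qed (auto simp: T_def)
 moreover have "continuous_map (subtopology quot (orb ` U)) (top_of_set U) r" using r by (simp add: homeomorphic_maps_def)
 ultimately have "continuous_map (top_of_set T) (top_of_set U) (r \<circ> f)" using continuous_map_compose by blast
 hence contr: "continuous_on T (%j. r (f j))" by (simp add: o_def)
 show "\<exists>T. k \<in> T & openin (top_of_set K) T &
   (\<exists>v. \<Union>v = ?E \<inter> fst -` T & (\<forall>u\<in>v. openin (top_of_set ?E) u) &
    pairwise disjnt v & (\<forall>u\<in>v. \<exists>q. homeomorphism u T fst q))"
 proof (intro exI conjI)
  show "k \<in> T" using k x U(2) by (force simp: T_def)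
  show "openin (top_of_set K) T" by (rule opT)
  show "\<Union>(v ` G) = ?E \<inter> fst -` T"
  proof (intro subset_antisym subsetI)
   fix z assume "z \<in> \<Union>(v ` G)"
   then obtain g j y where "z = (j, y)" "(j, y) \<in> v g" "g \<in> G" by (metis UN_E surj_pair)
   thus "z \<in> ?E \<inter> fst -` T" using UX G_im by (auto simp: v_def T_def)
  next
   fix z assume "z \<in> ?E \<inter> fst -` T"
   then obtain j y where *: "z = (j, y)" "y \<in> X" "orb y = f j" "j \<in> T" by auto
   hence "orb (r (f j)) = orb y" using rU by simp
   then obtain g where "g \<in> G" "y = g (r (f j))" using orb_eqD by blast
   thus "z \<in> \<Union> (v ` G)" using * rU by (auto simp: v_def)
  qed
  show "\<forall>u\<in>v ` G. openin (top_of_set ?E) u"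
  proof
   fix u assume "u \<in> v ` G"
   then obtain g where g: "g \<in> G" "u = v g" by blast
   have "u = ?E \<inter> (T \<times> g ` U)" using g UX G_im by (auto simp: v_def T_def)
   moreover have "openin (top_of_set (K \<times> X)) (T \<times> g ` U)" using openin_Times[OF opT openin_G_image[OF g(1) U(1)]] by blast
   moreover have "?E \<subseteq> K \<times> X" by blast
   ultimately show "openin (top_of_set ?E) u" by (metis (no_types, lifting) openin_subtopology_Int2 subtopology_subtopology inf.absorb_iff2)
  qed
  show "pairwise disjnt (v ` G)"
  proof (rule pairwiseI)
   fix u w assume uw: "u \<in> v ` G" "w \<in> v ` G" "u ~= w"
   then obtain g h where gh: "g \<in> G" "h \<in> G" "u = v g" "w = v h" by blast
   show "disjnt u w"
   proof (rule ccontr)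
    assume "~ disjnt u w"
    then obtain a b where ab: "a \<in> U" "b \<in> U" "g a = h b" using gh by (auto simp: disjnt_def v_def)
    obtain k where kk: "k \<in> G" "!!x. k (h x) = x" "h \<circ> k = id" using G_inv[OF gh(2)] by (auto simp: fun_eq_iff)
    have "(k \<circ> g) a = b" using ab(3) kk(2) by simp
    hence "(k \<circ> g) ` U \<inter> U ~= {}" using ab by blast
    hence "k \<circ> g = id" using U(3) G_comp[OF kk(1) gh(1)] by blast
    hence "h \<circ> (k \<circ> g) = h" by simp
    hence "g = h" using kk(3) by (simp add: o_assoc)
    thus False using uw gh by simp
   qed
  qed
  show "\<forall>u\<in>v ` G. \<exists>q. homeomorphism u T fst q"
  proof
   fix u assume "u \<in> v ` G"
   then obtain g where g: "g \<in> G" "u = v g" by blast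
   have "homeomorphism u T fst (%j. (j, g (r (f j))))"
   proof (rule homeomorphismI)
    show "continuous_on u fst" by (intro continuous_intros)
    show "continuous_on T (%j. (j, g (r (f j))))"
     using UX rU(1) by (intro continuous_intros continuous_on_compose2[OF G_cont[OF g(1)] contr]) auto
    show "fst ` u \<subseteq> T" using g by (auto simp: v_def)
    show "(%j. (j, g (r (f j)))) ` T \<subseteq> u" using g rU by (auto simp: v_def orb_apply)
    show "(fst x, g (r (f (fst x)))) = x" if xu: "x \<in> u" for x
    proof -
     obtain j a where xa: "x = (j, g a)" "j \<in> T" "a \<in> U" "orb (g a) = f j" using xu unfolding g(2) v_def by (cases x) auto
     hence "orb a = f j" using g orb_apply by simp
     hence "a = r (f j)" using rU[OF xa(2)] U(4) xa(3) by (metis inj_onD)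
     thus ?thesis using xa by simp
    qed
    show "fst (j, g (r (f j))) = j" if "j \<in> T" for j by simp
   qed
   thus "\<exists>q. homeomorphism u T fst q" by blast
  qed
 qed
qed

lemma lift_exists:
 fixes K :: "'c::real_normed_vector set"
 assumes f: "continuous_map (top_of_set K) quot f" and K: "convex K" "z \<in> K"
  and a: "a \<in> X" "orb a = f z"
 obtains l where "continuous_on K l" "l ` K \<subseteq> X" "l z = a" "!!y. y \<in> K ==> orb (l y) = f y"
proof -
 let ?E = "{(k, x). k \<in> K & x \<in> X & orb x = f k}"
 obtain l where l: "continuous_on K l" "l \<in> K \<rightarrow> ?E" "l z = (z, a)" "!!y. y \<in> K ==> fst (l y) = id y"
 proof (rule covering_space_lift_strong[OF pullback_covering[OF f], of "(z, a)" z K id])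
  show "simply_connected K" "locally path_connected K"
   using K(1) by (auto intro: convex_imp_simply_connected convex_imp_locally_path_connected)
 qed (use K a in \<open>auto simp: continuous_on_id\<close>)
 show ?thesis
 proof (rule that[of "snd \<circ> l"])
  show "continuous_on K (snd \<circ> l)" using l(1) by (auto intro!: continuous_intros simp: o_def)
  show "(snd \<circ> l) ` K \<subseteq> X" using l(2) by (fastforce simp: Pi_iff)
  show "(snd \<circ> l) z = a" using l(3) by simp
  show "orb ((snd \<circ> l) y) = f y" if "y \<in> K" for y using l(2,4) that by (fastforce simp: Pi_iff)
 qed
qed

lemma lift_unique:
 fixes K :: "'c::real_normed_vector set"
 assumes l: "continuous_on K l" "l ` K \<subseteq> X" and m: "continuous_on K m" "m ` K \<subseteq> X"
  and K: "connected K" "z \<in> K" "l z = m z" and eq: "!!y. y \<in> K ==> orb (l y) = orb (m y)"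
  and y: "y \<in> K"
 shows "l y = m y"
proof -
 define f where "f = (%k. orb (l k))"
 have f: "continuous_map (top_of_set K) quot f" using continuous_map_compose[of "top_of_set K" "top_of_set X" l quot orb] l continuous_map_orb
  by (auto simp: f_def o_def)
 have "(y, l y) = (y, m y)"
 proof (rule covering_space_lift_unique[OF pullback_covering[OF f], of "%y. (y, l y)" z "%y. (y, m y)" K id])
  show "(z, l z) = (z, m z)" using K by simp
  show "continuous_on K (%y. (y, l y))" "continuous_on K (%y. (y, m y))" using l m by (auto intro!: continuous_intros)
 qed (use l m K y eq in \<open>auto simp: f_def\<close>)
 thus ?thesis by simp
qed

end

locale sc_deck_action = deck_action X G for X :: "'a::real_normed_vector set" and G +
 fixes x0 :: 'a
 assumes sc: "simply_connected X" and x0: "x0 \<in> X"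
begin

definition is_lift :: "(real => 'a set) => (real => 'a) => bool" where
 "is_lift p l \<longleftrightarrow> continuous_on {0..1} l & l ` {0..1} \<subseteq> X & l 0 = x0 & (\<forall>t\<in>{0..1}. orb (l t) = p t)"

definition dk :: "(real => 'a set) => 'a => 'a" where
 "dk p = (THE g. g \<in> G & (\<exists>l. is_lift p l & l 1 = g x0))"

lemma loops_atD:
 assumes "p \<in> loops_at quot (orb x0)"
 shows "continuous_map (top_of_set {0..1}) quot p" "p 0 = orb x0" "p 1 = orb x0" using assms by (auto simp: loops_at_def pathin_def)

lemma lift_loop:
 assumes "p \<in> loops_at quot (orb x0)"
 obtains l where "is_lift p l"
proof -
 note p = loops_atD[OF assms]
 obtain l where "continuous_on {0..1} l" "l ` {0..1} \<subseteq> X" "l 0 = x0" "!!y. y \<in> {0..1} ==> orb (l y) = p y"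
  using lift_exists[OF p(1), of 0 x0] x0 p(2) by auto
 hence "is_lift p l" by (simp add: is_lift_def)
 thus ?thesis by (rule that)
qed

lemma is_lift_unique: "is_lift p l ==> is_lift p m ==> t \<in> {0..1} ==> l t = m t"
 using lift_unique[of "{0..1::real}" l m 0 t] by (auto simp: is_lift_def)

lemma dk_eqI:
 assumes "is_lift p l" "l 1 = g x0" "g \<in> G"
 shows "dk p = g" unfolding dk_def
proof (rule the_equality)
 show "g \<in> G & (\<exists>l. is_lift p l & l 1 = g x0)" using assms by blast
 fix h assume "h \<in> G & (\<exists>l. is_lift p l & l 1 = h x0)"
 then obtain m where "is_lift p m" "m 1 = h x0" "h \<in> G" by blast
 thus "h = g" using is_lift_unique[OF assms(1), of m 1] assms(2,3) G_free x0 by auto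
qed

lemma dk_lift:
 assumes "p \<in> loops_at quot (orb x0)" "is_lift p l"
 shows "dk p \<in> G" "l 1 = dk p x0"
proof -
 have "orb x0 = orb (l 1)" using assms loops_atD(3) by (auto simp: is_lift_def)
 then obtain g where "g \<in> G" "l 1 = g x0" using orb_eqD by blast
 thus "dk p \<in> G" "l 1 = dk p x0" using dk_eqI[OF assms(2)] by auto
qed

lemma dk_homotopic:
 assumes p: "p \<in> loops_at quot (orb x0)" and q: "q \<in> loops_at quot (orb x0)"
  and h: "homotopic_with (%r. r 0 = orb x0 & r 1 = orb x0) (top_of_set {0..1}) quot p q"
 shows "dk p = dk q"
proof -
 obtain h where h: "continuous_map (prod_topology (top_of_set {0..1::real}) (top_of_set {0..1::real})) quot h"
  and h01: "!!t. h (0, t) = p t" "!!t. h (1, t) = q t"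
  and he: "!!s. s \<in> {0..1} ==> h (s, 0) = orb x0 & h (s, 1) = orb x0" using h unfolding homotopic_with_def by blast
 let ?K = "{0..1} \<times> {0..1} :: (real \<times> real) set"
 have hK: "continuous_map (top_of_set ?K) quot h" using h by simp
 obtain l where l: "continuous_on ?K l" "l ` ?K \<subseteq> X" "l (0, 0) = x0" "!!y. y \<in> ?K ==> orb (l y) = h y"
  using lift_exists[OF hK, of "(0,0)" x0] x0 he[of 0] by (auto simp: convex_Times)
 have sub: "continuous_on {0..1} (%t. l (s, t))" "continuous_on {0..1} (%t. l (t, s))"
  "(%t. l (s, t)) ` {0..1} \<subseteq> X" "(%t. l (t, s)) ` {0..1} \<subseteq> X" if "s \<in> {0..1}" for s
  using l(2) that by (auto intro!: continuous_on_compose2[OF l(1)] continuous_intros)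
 have lp: "is_lift p (%t. l (0, t))" using sub(1,3)[of 0] l(3,4) h01 by (auto simp: is_lift_def)
 have "l (1, 0) = x0" using lift_unique[OF sub(2)[of 0] sub(4)[of 0], of "%_. x0" 0 1] x0 l(3,4) he by auto
 hence lq: "is_lift q (%t. l (1, t))" using sub(1,3)[of 1] l(4) h01 by (auto simp: is_lift_def)
 have g: "dk p \<in> G" "l (0, 1) = dk p x0" using dk_lift[OF p lp] by auto
 have "l (1, 1) = dk p x0" using lift_unique[OF sub(2)[of 1] sub(4)[of 1], of "%_. dk p x0" 0 1] g G_im x0 l(4) he orb_apply by auto
 thus ?thesis using dk_eqI[OF lq _ g(1)] by simp
qed

lemma homotopic_dk:
 assumes p: "p \<in> loops_at quot (orb x0)" and q: "q \<in> loops_at quot (orb x0)" and eq: "dk p = dk q"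
 shows "homotopic_with (%r. r 0 = orb x0 & r 1 = orb x0) (top_of_set {0..1}) quot p q"
proof -
 obtain l where l: "is_lift p l" using lift_loop[OF p] .
 obtain m where m: "is_lift q m" using lift_loop[OF q] .
 have "l 1 = m 1" using dk_lift[OF p l] dk_lift[OF q m] eq by simp
 hence "homotopic_paths X l m" using sc l m unfolding simply_connected_eq_homotopic_paths is_lift_def
  by (simp add: path_def path_image_def pathstart_def pathfinish_def)
 hence "homotopic_with (%r. r 0 = x0 & r 1 = l 1) (top_of_set {0..1}) (top_of_set X) l m"
  using l by (simp add: homotopic_paths_def pathstart_def pathfinish_def is_lift_def)
 moreover have "orb (l 1) = orb x0" using l loops_atD(3)[OF p] by (auto simp: is_lift_def)
 ultimately have "homotopic_with (%r. r 0 = orb x0 & r 1 = orb x0) (top_of_set {0..1}) quot (orb \<circ> l) (orb \<circ> m)"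
  using homotopic_with_compose_continuous_map_left[OF _ continuous_map_orb] by fastforce
 thus ?thesis by (rule homotopic_with_eq) (use l m in \<open>auto simp: is_lift_def\<close>)
qed

lemma loop_homotopy_iff:
 "(p, q) \<in> loop_homotopy quot (orb x0) \<longleftrightarrow>
  p \<in> loops_at quot (orb x0) & q \<in> loops_at quot (orb x0) & dk p = dk q"
 using dk_homotopic homotopic_dk unfolding loop_homotopy_def by blast

lemma dk_join:
 assumes p: "p \<in> loops_at quot (orb x0)" and q: "q \<in> loops_at quot (orb x0)"
 shows "loop_join p q \<in> loops_at quot (orb x0)" "dk (loop_join p q) = dk p \<circ> dk q"
proof -
 obtain l where l: "is_lift p l" using lift_loop[OF p] .
 obtain m where m: "is_lift q m" using lift_loop[OF q] .
 note dl = dk_lift[OF p l] and dm = dk_lift[OF q m]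
 let ?n = "l +++ (dk p \<circ> m)"
 have "path (dk p \<circ> m)" unfolding path_def by (rule continuous_on_compose[OF _ continuous_on_subset[OF G_cont[OF dl(1)]]])
   (use m in \<open>auto simp: is_lift_def\<close>)
 moreover have "pathfinish l = pathstart (dk p \<circ> m)" using dl(2) m by (simp add: pathfinish_def pathstart_def is_lift_def)
 ultimately have n: "path ?n" using l by (simp add: path_def[of l] is_lift_def)
 have nX: "?n ` {0..1} \<subseteq> X" using l m G_im[OF dl(1)] by (auto simp: joinpaths_def is_lift_def image_subset_iff)
 have on: "orb (?n t) = loop_join p q t" if "t \<in> {0..1}" for t
  using that l m orb_apply[OF dl(1)] by (auto simp: joinpaths_def loop_join_def is_lift_def)
 have "continuous_map (top_of_set {0..1}) quot (orb \<circ> ?n)"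
  using n nX continuous_map_orb by (intro continuous_map_compose[of _ "top_of_set X"]) (auto simp: path_def)
 hence "continuous_map (top_of_set {0..1}) quot (loop_join p q)" by (rule continuous_map_eq) (use on in auto)
 thus jl: "loop_join p q \<in> loops_at quot (orb x0)"
  using loops_atD[OF p] loops_atD[OF q] by (simp add: loops_at_def pathin_def loop_join_def)
 have "is_lift (loop_join p q) ?n" using n nX on l by (auto simp: is_lift_def path_def joinpaths_def)
 thus "dk (loop_join p q) = dk p \<circ> dk q" by (rule dk_eqI) (use dm dl G_comp in \<open>auto simp: joinpaths_def\<close>)
qed

lemma dk_surj:
 assumes "g \<in> G"
 shows "\<exists>p \<in> loops_at quot (orb x0). dk p = g"
proof -
 have "path_connected X" using sc by (rule simply_connected_imp_path_connected)
 then obtain l where l: "path l" "path_image l \<subseteq> X" "pathstart l = x0" "pathfinish l = g x0"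
  using x0 G_im[OF assms x0] unfolding path_connected_def by blast
 have "continuous_map (top_of_set {0..1}) quot (orb \<circ> l)"
  using l continuous_map_orb by (intro continuous_map_compose[of _ "top_of_set X"]) (auto simp: path_def path_image_def)
 hence "orb \<circ> l \<in> loops_at quot (orb x0)"
  using l orb_apply[OF assms] by (simp add: loops_at_def pathin_def pathstart_def pathfinish_def)
 moreover have "dk (orb \<circ> l) = g"
  by (rule dk_eqI[of _ l]) (use l assms in \<open>auto simp: is_lift_def path_def path_image_def pathstart_def pathfinish_def\<close>)
 ultimately show ?thesis by blast
qed

definition loop_class :: "('a => 'a) => (real => 'a set) set" where
 "loop_class g = {p \<in> loops_at quot (orb x0). dk p = g}"

lemma loop_homotopy_image:
 "p \<in> loops_at quot (orb x0) ==> loop_homotopy quot (orb x0) `` {p} = loop_class (dk p)"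
 by (auto simp: loop_homotopy_iff loop_class_def)

theorem fundamental_group_iso: "loop_class \<in> iso deck_group (fundamental_group quot (orb x0))"
proof -
 let ?F = "fundamental_group quot (orb x0)"
 let ?L = "loops_at quot (orb x0)"
 have "dk ` ?L \<subseteq> G" using dk_lift(1) lift_loop by (metis image_subsetI)
 moreover have "G \<subseteq> dk ` ?L" using dk_surj by (metis imageI subsetI)
 ultimately have dkL: "dk ` ?L = G" by (rule subset_antisym)
 have "carrier ?F = (%p. loop_homotopy quot (orb x0) `` {p}) ` ?L"
  unfolding fundamental_group_def quotient_def by (simp only: partial_object.simps) blast
 also have "... = (%p. loop_class (dk p)) ` ?L" by (rule image_cong[OF refl loop_homotopy_image])
 also have "... = loop_class ` G" by (subst dkL[symmetric]) (rule image_image[symmetric])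
 finally have carr: "carrier ?F = loop_class ` G" .
 have mult: "loop_class g \<otimes>\<^bsub>?F\<^esub> loop_class h = loop_class (g \<circ> h)" if gh: "g \<in> G" "h \<in> G" for g h
 proof -
  have "(\<Union>p\<in>loop_class g. \<Union>q\<in>loop_class h. loop_homotopy quot (orb x0) `` {loop_join p q})
    = (\<Union>p\<in>loop_class g. \<Union>q\<in>loop_class h. loop_class (g \<circ> h))"
   by (intro SUP_cong refl) (auto simp: loop_homotopy_image dk_join loop_class_def[of g] loop_class_def[of h])
  also have "... = loop_class (g \<circ> h)"
   using dk_surj[OF gh(1)] dk_surj[OF gh(2)] by (auto simp: loop_class_def[of g] loop_class_def[of h])
  finally show ?thesis by (simp add: fundamental_group_def)
 qed
 have inj: "inj_on loop_class G" using dk_surj by (auto simp: inj_on_def loop_class_def)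
 show ?thesis by (rule isoI) (use carr mult inj in \<open>auto simp: hom_def deck_group_def bij_betw_def\<close>)
qed

end

section \<open>Rational vector spaces of abelian groups\<close>

abbreviation rat_add :: "rat monoid" where
 "rat_add \<equiv> \<lparr>carrier = UNIV, monoid.mult = (+), one = 0\<rparr>"

lemma comm_group_rat_add: "comm_group rat_add"
 by (rule comm_groupI) (auto intro: exI[of _ "- _"])

lemma field_rat: "field rat_field"
proof -
 have cr: "cring rat_field"
 proof (rule cringI)
  show "abelian_group rat_field" by (rule abelian_groupI) (auto simp: algebra_simps intro: exI[of _ "- _"])
  show "Group.comm_monoid rat_field" by (rule comm_monoidI) auto
 qed (auto simp: algebra_simps)
 interpret cring rat_field by (rule cr)
 have "Units rat_field = UNIV - {0}"
 proof -
  have "\<exists>y. y * x = 1 & x * y = 1" if "x ~= 0" for x :: rat using that by (intro exI[of _ "inverse x"]) auto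
  thus ?thesis by (auto simp: Units_def)
 qed
 thus ?thesis by (intro field_intro2) (auto simp: cr)
qed

lemma rat_functional_exists:
 fixes scale :: "rat => 'b::ab_group_add => 'b"
 assumes "vector_space scale" "v \<notin> Modules.module.span scale S"
 obtains L :: "'b => rat" where "!!x y. L (x + y) = L x + L y" "!!x. x \<in> S ==> L x = 0" "L v = 1"
proof -
 interpret vector_space_pair scale "(*) :: rat => rat => rat"
  using assms(1) by (auto simp: vector_space_pair_def vector_space_def algebra_simps)
 obtain B where B: "B \<subseteq> S" "vs1.independent B" "S \<subseteq> vs1.span B" using vs1.maximal_independent_subset by blast
 have v: "v \<notin> vs1.span B" using assms(2) vs1.span_mono[OF B(1)] by blast
 hence "vs1.independent (insert v B)" using B(2) by (simp add: vs1.independent_insert)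
 from linear_independent_extend[OF this, of "%x. if x = v then 1 else 0"]
 obtain L where L: "Vector_Spaces.linear scale (*) L" "\<forall>x\<in>insert v B. L x = (if x = v then 1 else 0)" by blast
 have "L x = 0" if "x \<in> B" for x using L(2) that v vs1.span_base[OF that] by auto
 hence "L x = 0" if "x \<in> S" for x using linear_eq_0_on_span[OF L(1)] B(3) that by blast
 thus ?thesis using that[of L] L(2) linear_add[OF L(1)] by simp
qed

locale rat_tensor = comm_group A for A :: "('a, 'b) monoid_scheme"
begin

abbreviation "F \<equiv> tensor_free A"
abbreviation "R \<equiv> tensor_relations A"
abbreviation "V \<equiv> tensor_rat A"

definition cls where "cls c = R #>\<^bsub>F\<^esub> c"

definition scl :: "rat => ('a \<times> rat \<Rightarrow>\<^sub>0 int) => 'a \<times> rat \<Rightarrow>\<^sub>0 int" where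
 "scl q = frag_extend (%(a, r). frag_of (a, q * r))"

definition Rel where
 "Rel = {frag_of (a \<otimes>\<^bsub>A\<^esub> b, q) - frag_of (a, q) - frag_of (b, q) | a b q. a \<in> carrier A & b \<in> carrier A} \<union>
   {frag_of (a, q + r) - frag_of (a, q) - frag_of (a, r) | a q r. a \<in> carrier A}"

lemma F_iff: "c \<in> carrier F \<longleftrightarrow> Poly_Mapping.keys c \<subseteq> carrier A \<times> UNIV"
 by (simp add: tensor_free_def)

lemma F_simps [simp]: "x \<otimes>\<^bsub>F\<^esub> y = x + y" "\<one>\<^bsub>F\<^esub> = 0"
 by (simp_all add: tensor_free_def)

lemma F_of [simp]: "frag_of (a, q) \<in> carrier F \<longleftrightarrow> a \<in> carrier A"
 by (simp add: F_iff)

sublocale F: comm_group F unfolding tensor_free_def by (rule abelian_free_Abelian_group)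

lemma F_inv [simp]: "x \<in> carrier F ==> inv\<^bsub>F\<^esub> x = - x"
 by (simp add: tensor_free_def)

lemma F_closed [simp, intro]:
 "x \<in> carrier F ==> y \<in> carrier F ==> x + y \<in> carrier F"
 "x \<in> carrier F ==> y \<in> carrier F ==> x - y \<in> carrier F"
 "x \<in> carrier F ==> - x \<in> carrier F" "0 \<in> carrier F"
proof -
 assume x: "x \<in> carrier F"
 show m: "- x \<in> carrier F" using x F.inv_closed[OF x] by simp
next
 assume x: "x \<in> carrier F" "y \<in> carrier F"
 show "x + y \<in> carrier F" using F.m_closed[OF x] by simp
 show "x - y \<in> carrier F" using F.m_closed[OF x(1) F.inv_closed[OF x(2)]] x by simp
qed (use F.one_closed in simp)

lemma Rel_sub: "Rel \<subseteq> carrier F"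
 by (auto simp: Rel_def)

lemma R_gen: "R = generate F Rel"
 by (simp add: tensor_relations_def Rel_def)

lemma R_subgroup: "subgroup R F"
 unfolding R_gen by (rule F.generate_is_subgroup[OF Rel_sub])

lemma R_normal: "R \<lhd> F"
 using R_subgroup F.normal_iff_subgroup by blast

lemma R_sub: "R \<subseteq> carrier F" by (rule subgroup.subset[OF R_subgroup])

lemma R_add: "x \<in> R ==> y \<in> R ==> x + y \<in> R"
 using subgroup.m_closed[OF R_subgroup, of x y] by simp

lemma R_minus: "x \<in> R ==> - x \<in> R"
 using subgroup.m_inv_closed[OF R_subgroup, of x] R_sub by (simp add: subset_iff)

lemma R_diff: "x \<in> R ==> y \<in> R ==> x - y \<in> R"
 using R_add[of x "- y"] R_minus[of y] by simp

lemma R_zero: "0 \<in> R" using subgroup.one_closed[OF R_subgroup] by simp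

lemma Rel_R: "x \<in> Rel ==> x \<in> R" unfolding R_gen by (rule generate.incl)

lemma cls_mem: "c \<in> carrier F ==> x \<in> cls c \<longleftrightarrow> x - c \<in> R"
proof -
 have "x = h + c \<longleftrightarrow> x - c = h" for h by (simp add: algebra_simps eq_diff_eq)
 thus ?thesis unfolding cls_def r_coset_def by auto
qed

lemma cls_eq:
 assumes "c \<in> carrier F" "d \<in> carrier F"
 shows "cls c = cls d \<longleftrightarrow> c - d \<in> R"
proof
 assume "cls c = cls d"
 moreover have "c \<in> cls c" using assms R_zero by (simp add: cls_mem)
 ultimately show "c - d \<in> R" using cls_mem[OF assms(2)] by simp
next
 assume cd: "c - d \<in> R"
 have "x \<in> cls c \<longleftrightarrow> x \<in> cls d" for x using R_add[of "x - c" "c - d"] R_diff[of "x - d" "c - d"] cd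
  by (auto simp: cls_mem[OF assms(1)] cls_mem[OF assms(2)])
 thus "cls c = cls d" by blast
qed

lemma V_simps:
 "carrier V = cls ` carrier F"
 "\<zero>\<^bsub>V\<^esub> = cls 0"
 "c \<in> carrier F ==> d \<in> carrier F ==> cls c \<oplus>\<^bsub>V\<^esub> cls d = cls (c + d)"
proof -
 show "carrier V = cls ` carrier F" by (auto simp: tensor_rat_def FactGroup_def RCOSETS_def cls_def)
 have "cls 0 = R" using subgroup.subset[OF R_subgroup] by (auto simp: cls_def r_coset_def)
 thus "\<zero>\<^bsub>V\<^esub> = cls 0" by (simp add: tensor_rat_def FactGroup_def)
 show "cls c \<oplus>\<^bsub>V\<^esub> cls d = cls (c + d)" if "c \<in> carrier F" "d \<in> carrier F"
  using normal.rcos_sum[OF R_normal that] by (simp add: tensor_rat_def FactGroup_def cls_def)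
qed

lemma scl_add [simp]: "scl q (x + y) = scl q x + scl q y" "scl q (x - y) = scl q x - scl q y"
 "scl q (- x) = - scl q x" "scl q 0 = 0" "scl q (frag_of (a, r)) = frag_of (a, q * r)"
 by (simp_all add: scl_def frag_extend_add frag_extend_diff frag_extend_minus)

lemma F_induct [consumes 1, case_names zero of diff]:
 assumes "c \<in> carrier F" "P 0" "!!a r. a \<in> carrier A ==> P (frag_of (a, r))"
  "!!x y. x \<in> carrier F ==> y \<in> carrier F ==> P x ==> P y ==> P (x - y)"
 shows "P c"
proof -
 have "c \<in> carrier F & P c" using assms(1) unfolding F_iff
 proof (induction c rule: frag_induction)
  case (one x) thus ?case using assms(3) by (cases x) (auto simp: F_iff)
 next
  case (diff a b) thus ?case using assms(4) F_closed(2)[of a b] by (auto simp: F_iff)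
 qed (use assms in auto)
 thus ?thesis by blast
qed

lemma scl_closed [simp, intro]: "c \<in> carrier F ==> scl q c \<in> carrier F"
 by (induction c rule: F_induct) auto

lemma scl_R:
 assumes "c \<in> R"
 shows "scl q c \<in> R"
proof -
 have rel: "scl q h \<in> R" if h: "h \<in> Rel" for h
 proof -
  consider (1) a b r where "h = frag_of (a \<otimes>\<^bsub>A\<^esub> b, r) - frag_of (a, r) - frag_of (b, r)" "a \<in> carrier A" "b \<in> carrier A"
   | (2) a r s where "h = frag_of (a, r + s) - frag_of (a, r) - frag_of (a, s)" "a \<in> carrier A" using h unfolding Rel_def by blast
  hence "scl q h \<in> Rel"
  proof cases
   case 1 thus ?thesis unfolding Rel_def by auto
  next
   case 2
   have "scl q h = frag_of (a, q * r + q * s) - frag_of (a, q * r) - frag_of (a, q * s)" unfolding 2 by (simp add: algebra_simps)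
   thus ?thesis unfolding Rel_def using 2 by blast
  qed
  thus ?thesis by (rule Rel_R)
 qed
 have "c \<in> generate F Rel" using assms R_gen by simp
 thus ?thesis
 proof (induction c rule: generate.induct)
  case one show ?case using R_zero by simp
 next
  case (incl h) thus ?case by (rule rel)
 next
  case (inv h)
  hence "h \<in> carrier F" using Rel_sub by blast
  thus ?case using R_minus[OF rel[OF inv]] by simp
 next
  case (eng h1 h2)
  thus ?case using R_add[of "scl q h1" "scl q h2"] by simp
 qed
qed

lemma V_smult: "c \<in> carrier F ==> q \<odot>\<^bsub>V\<^esub> cls c = cls (scl q c)"
proof -
 assume c: "c \<in> carrier F"
 have eq: "cls (scl q d) = cls (scl q c)" if "d \<in> cls c" for d
 proof -
  have dR: "d - c \<in> R" using that c by (simp add: cls_mem)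
  hence "d \<in> carrier F" using R_sub F_closed(1)[of "d - c" c] c by auto
  moreover have "scl q d - scl q c \<in> R" using scl_R[OF dR, of q] by simp
  ultimately show ?thesis using c by (simp add: cls_eq)
 qed
 have "c \<in> cls c" using c R_zero by (simp add: cls_mem)
 have "q \<odot>\<^bsub>V\<^esub> cls c = (\<Union>d\<in>cls c. cls (scl q d))" by (simp add: tensor_rat_def cls_def scl_def)
 also have "... = (\<Union>d\<in>cls c. cls (scl q c))" using eq by (intro SUP_cong refl)
 also have "... = cls (scl q c)" using \<open>c \<in> cls c\<close> by blast
 finally show ?thesis .
qed

lemma scl_distr: "c \<in> carrier F ==> scl (p + q) c - (scl p c + scl q c) \<in> R"
proof (induction c rule: F_induct)
 case (of a r)
 have "frag_of (a, p * r + q * r) - frag_of (a, p * r) - frag_of (a, q * r) \<in> Rel" unfolding Rel_def using of by blast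
 thus ?case using Rel_R by (simp add: algebra_simps)
next
 case (diff x y)
 show ?case using R_diff[OF diff(3,4)] by (simp add: algebra_simps)
qed (simp add: R_zero)

lemma scl_mult: "c \<in> carrier F ==> scl (p * q) c = scl p (scl q c)"
 by (induction c rule: F_induct) (auto simp: mult.assoc)

lemma scl_one: "c \<in> carrier F ==> scl 1 c = c"
 by (induction c rule: F_induct) auto

lemma vectorspace_V: "vectorspace rat_field V"
proof -
 interpret field rat_field by (rule field_rat)
 have car: "!!v. v \<in> carrier V ==> \<exists>c\<in>carrier F. v = cls c" by (auto simp: V_simps)
 have "abelian_group V"
 proof (rule abelian_groupI)
  fix x assume "x \<in> carrier V"
  then obtain c where c: "c \<in> carrier F" "x = cls c" using car by blast
  show "\<exists>y\<in>carrier V. y \<oplus>\<^bsub>V\<^esub> x = \<zero>\<^bsub>V\<^esub>"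
   using c by (intro bexI[of _ "cls (- c)"]) (auto simp: V_simps)
 next
  fix x y z assume "x \<in> carrier V" "y \<in> carrier V" "z \<in> carrier V"
  then obtain c d e where "c \<in> carrier F" "x = cls c" "d \<in> carrier F" "y = cls d" "e \<in> carrier F" "z = cls e" using car by metis
  thus "x \<oplus>\<^bsub>V\<^esub> y \<oplus>\<^bsub>V\<^esub> z = x \<oplus>\<^bsub>V\<^esub> (y \<oplus>\<^bsub>V\<^esub> z)" by (simp add: V_simps add.assoc)
 next
  fix x y assume "x \<in> carrier V" "y \<in> carrier V"
  then obtain c d where "c \<in> carrier F" "x = cls c" "d \<in> carrier F" "y = cls d" using car by metis
  thus "x \<oplus>\<^bsub>V\<^esub> y = y \<oplus>\<^bsub>V\<^esub> x" "x \<oplus>\<^bsub>V\<^esub> y \<in> carrier V" by (simp_all add: V_simps add.commute)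
 next
  fix x assume "x \<in> carrier V"
  then obtain c where "c \<in> carrier F" "x = cls c" using car by blast
  thus "\<zero>\<^bsub>V\<^esub> \<oplus>\<^bsub>V\<^esub> x = x" by (simp add: V_simps)
 qed (simp add: V_simps)
 moreover have "module_axioms rat_field V"
 proof
  fix a b :: rat and x assume "x \<in> carrier V"
  then obtain c where c: "c \<in> carrier F" "x = cls c" using car by blast
  show "a \<odot>\<^bsub>V\<^esub> x \<in> carrier V" using c by (simp add: V_smult V_simps)
  show "(a \<oplus>\<^bsub>rat_field\<^esub> b) \<odot>\<^bsub>V\<^esub> x = a \<odot>\<^bsub>V\<^esub> x \<oplus>\<^bsub>V\<^esub> b \<odot>\<^bsub>V\<^esub> x"
   using c scl_distr[OF c(1), of a b] by (simp add: V_smult V_simps cls_eq)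
  show "(a \<otimes>\<^bsub>rat_field\<^esub> b) \<odot>\<^bsub>V\<^esub> x = a \<odot>\<^bsub>V\<^esub> (b \<odot>\<^bsub>V\<^esub> x)"
   using c by (simp add: V_smult scl_mult)
  show "\<one>\<^bsub>rat_field\<^esub> \<odot>\<^bsub>V\<^esub> x = x" using c by (simp add: V_smult scl_one)
 next
  fix a :: rat and x y assume "x \<in> carrier V" "y \<in> carrier V"
  then obtain c d where "c \<in> carrier F" "x = cls c" "d \<in> carrier F" "y = cls d" using car by metis
  thus "a \<odot>\<^bsub>V\<^esub> (x \<oplus>\<^bsub>V\<^esub> y) = a \<odot>\<^bsub>V\<^esub> x \<oplus>\<^bsub>V\<^esub> a \<odot>\<^bsub>V\<^esub> y" by (simp add: V_smult V_simps)
 qed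
 ultimately show ?thesis unfolding vectorspace_def Module.module_def using field_rat is_cring by blast
qed

lemma functional_of_hom:
 assumes f: "!!x y. x \<in> carrier A ==> y \<in> carrier A ==> f (x \<otimes>\<^bsub>A\<^esub> y) = f x + (f y :: rat)"
 obtains L where "!!x y. x \<in> carrier V ==> y \<in> carrier V ==> L (x \<oplus>\<^bsub>V\<^esub> y) = L x + L y"
  "!!q x. x \<in> carrier V ==> L (q \<odot>\<^bsub>V\<^esub> x) = q * L x"
  "!!a q. a \<in> carrier A ==> L (cls (frag_of (a, q))) = q * f a"
proof -
 interpret Q: comm_group rat_add by (rule comm_group_rat_add)
 have "(%(a, q). q * f a) ` (carrier A \<times> UNIV) \<subseteq> carrier rat_add" by simp
 then obtain h where h: "h \<in> hom F rat_add"
  "!!x. x \<in> carrier A \<times> UNIV ==> h (frag_of x) = (case x of (a, q) => q * f a)"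
  unfolding tensor_free_def by (rule Q.free_Abelian_group_universal) blast
 have hadd: "h (x + y) = h x + h y" if "x \<in> carrier F" "y \<in> carrier F" for x y using hom_mult[OF h(1) that] by simp
 have h0: "h 0 = 0" using hadd[of 0 0] by simp
 have hm: "h (- x) = - h x" if "x \<in> carrier F" for x using hadd[of x "- x"] h0 that by simp
 have hd: "h (x - y) = h x - h y" if "x \<in> carrier F" "y \<in> carrier F" for x y using hadd[of x "- y"] hm that by simp
 have hof: "a \<in> carrier A ==> h (frag_of (a, q)) = q * f a" for a q using h(2) by simp
 have rel: "h x = 0" if x: "x \<in> Rel" for x
 proof -
  consider (1) a b r where "x = frag_of (a \<otimes>\<^bsub>A\<^esub> b, r) - frag_of (a, r) - frag_of (b, r)" "a \<in> carrier A" "b \<in> carrier A"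
   | (2) a r s where "x = frag_of (a, r + s) - frag_of (a, r) - frag_of (a, s)" "a \<in> carrier A" using x unfolding Rel_def by blast
  thus ?thesis
  proof cases
   case 1 thus ?thesis unfolding 1 by (simp add: hd hof f) (simp add: distrib_left)
  next
   case 2 thus ?thesis unfolding 2 by (simp add: hd hof) (simp add: distrib_right)
  qed
 qed
 have hR: "h c = 0" if "c \<in> R" for c using that unfolding R_gen
 proof (induction c rule: generate.induct)
  case one show ?case using h0 by simp
 next
  case (incl x) thus ?case by (rule rel)
 next
  case (inv x) thus ?case using rel[OF inv] Rel_sub hm by (auto simp: subset_iff)
 next
  case (eng x y)
  hence "x \<in> carrier F" "y \<in> carrier F" using R_sub unfolding R_gen by blast+
  thus ?case using eng hadd by simp
 qed
 define L where "L C = h (SOME c. c \<in> carrier F & C = cls c)" for C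
 have L: "L (cls c) = h c" if c: "c \<in> carrier F" for c
 proof -
  have "(SOME d. d \<in> carrier F & cls c = cls d) \<in> carrier F & cls c = cls (SOME d. d \<in> carrier F & cls c = cls d)"
   by (rule someI[of _ c]) (use c in simp)
  then obtain d where d: "d = (SOME d. d \<in> carrier F & cls c = cls d)" "d \<in> carrier F" "cls c = cls d" by blast
  hence "h (c - d) = 0" using hR cls_eq c by blast
  thus ?thesis using hd[OF c d(2)] unfolding L_def d(1)[symmetric] by simp
 qed
 have hs: "h (scl q c) = q * h c" if "c \<in> carrier F" for q c using that by (induction c rule: F_induct) (auto simp: h0 hof hd algebra_simps)
 show ?thesis
 proof (rule that)
  fix x y assume "x \<in> carrier V" "y \<in> carrier V"
  then obtain c d where "c \<in> carrier F" "x = cls c" "d \<in> carrier F" "y = cls d" by (auto simp: V_simps)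
  thus "L (x \<oplus>\<^bsub>V\<^esub> y) = L x + L y" by (simp add: V_simps L hadd)
 next
  fix q x assume "x \<in> carrier V"
  then obtain c where "c \<in> carrier F" "x = cls c" by (auto simp: V_simps)
  thus "L (q \<odot>\<^bsub>V\<^esub> x) = q * L x" by (simp add: V_smult L hs)
 next
  fix a q assume "a \<in> carrier A"
  thus "L (cls (frag_of (a, q))) = q * f a" by (simp add: L hof)
 qed
qed

lemma functional_lincomb:
 assumes add: "!!x y. x \<in> carrier V ==> y \<in> carrier V ==> L (x \<oplus>\<^bsub>V\<^esub> y) = L x + (L y :: rat)"
  and sm: "!!q x. x \<in> carrier V ==> L (q \<odot>\<^bsub>V\<^esub> x) = q * L x"
  and B: "finite B" "B \<subseteq> carrier V"
 shows "L (module.lincomb V a B) = (\<Sum>b\<in>B. a b * L b)"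
proof -
 interpret V: vectorspace rat_field V by (rule vectorspace_V)
 show ?thesis using B
 proof (induction B rule: finite_induct)
  case empty
  have "L (\<zero>\<^bsub>V\<^esub>) = 0" using sm[of "\<zero>\<^bsub>V\<^esub>" 0] V.smult_l_null by simp
  thus ?case by (simp add: V.lincomb_def)
 next
  case (insert b B)
  have "V.lincomb a (B \<union> {b}) = a b \<odot>\<^bsub>V\<^esub> b \<oplus>\<^bsub>V\<^esub> V.lincomb a B"
   by (rule V.lincomb_insert) (use insert in auto)
  thus ?case using insert add sm by simp
 qed
qed

lemma tensor_dim:
 fixes f :: "nat => 'a => rat" and g :: "nat => 'a"
 assumes hom: "!!i x y. i < n ==> x \<in> carrier A ==> y \<in> carrier A ==> f i (x \<otimes>\<^bsub>A\<^esub> y) = f i x + f i y"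
  and g: "!!i. i < n ==> g i \<in> carrier A"
  and fg: "!!i j. i < n ==> j < n ==> f i (g j) = (if i = j then 1 else 0)"
  and det: "!!h x. (!!x y. x \<in> carrier A ==> y \<in> carrier A ==> h (x \<otimes>\<^bsub>A\<^esub> y) = h x + (h y :: rat)) ==>
   (!!j. j < n ==> h (g j) = 0) ==> x \<in> carrier A ==> h x = 0"
 shows "vectorspace.fin_dim rat_field V & vectorspace.dim rat_field V = n"
proof -
 interpret V: vectorspace rat_field V by (rule vectorspace_V)
 define e where "e j = cls (frag_of (g j, 1))" for j
 define B where "B = e ` {..<n}"
 have e: "e j \<in> carrier V" if "j < n" for j using g[OF that] by (simp add: e_def V_simps)
 have BV: "B \<subseteq> carrier V" "finite B" using e by (auto simp: B_def)
 define good where "good i L \<longleftrightarrow> (\<forall>x\<in>carrier V. \<forall>y\<in>carrier V. L (x \<oplus>\<^bsub>V\<^esub> y) = L x + L y) &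
   (\<forall>q. \<forall>x\<in>carrier V. L (q \<odot>\<^bsub>V\<^esub> x) = q * L x) & (\<forall>j<n. L (e j) = f i (g j))" for i L
 have "\<exists>L. i < n --> good i L" for i
 proof (cases "i < n")
  case True
  obtain L where L: "!!x y. x \<in> carrier V ==> y \<in> carrier V ==> L (x \<oplus>\<^bsub>V\<^esub> y) = L x + L y"
   "!!q x. x \<in> carrier V ==> L (q \<odot>\<^bsub>V\<^esub> x) = q * L x"
   "!!a q. a \<in> carrier A ==> L (cls (frag_of (a, q))) = q * f i a" by (rule functional_of_hom[OF hom[OF True]]) blast+
  have "good i L" unfolding good_def using L g by (simp add: e_def)
  thus ?thesis by blast
 qed blast
 hence "\<forall>i. \<exists>L. i < n --> good i L" by blast
 from choice[OF this] obtain L where "\<forall>i. i < n --> good i (L i)" by (elim exE)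
 hence Lg: "good i (L i)" if "i < n" for i using that by simp
 have Ladd: "L i (x \<oplus>\<^bsub>V\<^esub> y) = L i x + L i y" if "i < n" "x \<in> carrier V" "y \<in> carrier V" for i x y
  using Lg[OF that(1)] that unfolding good_def by simp
 have Lsm: "L i (q \<odot>\<^bsub>V\<^esub> x) = q * L i x" if "i < n" "x \<in> carrier V" for i q x
  using Lg[OF that(1)] that unfolding good_def by simp
 have Le: "L i (e j) = f i (g j)" if "i < n" "j < n" for i j using Lg[OF that(1)] that unfolding good_def by simp
 have inj: "inj_on e {..<n}"
 proof
  fix i j assume "i \<in> {..<n}" "j \<in> {..<n}" "e i = e j"
  thus "i = j" using Le[of i i] Le[of i j] fg[of i i] fg[of i j] by (auto split: if_splits)
 qed
 hence card: "card B = n" by (simp add: B_def card_image)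
 have li: "V.lin_indpt B"
 proof (rule V.finite_lin_indpt2)
  fix a assume a: "V.lincomb a B = \<zero>\<^bsub>V\<^esub>"
  show "\<forall>v\<in>B. a v = \<zero>\<^bsub>rat_field\<^esub>"
  proof
   fix v assume "v \<in> B"
   then obtain i where i: "i < n" "v = e i" by (auto simp: B_def)
   have "L i \<zero>\<^bsub>V\<^esub> = 0" using Lsm[OF i(1), of "\<zero>\<^bsub>V\<^esub>" 0] V.lmult_0 by simp
   hence "0 = (\<Sum>b\<in>B. a b * L i b)" using functional_lincomb[OF Ladd[OF i(1)] Lsm[OF i(1)] BV(2,1), of a] a by simp
   also have "... = (\<Sum>j<n. a (e j) * L i (e j))" unfolding B_def by (rule sum.reindex[OF inj, unfolded o_def])
   also have "... = (\<Sum>j<n. if j = i then a (e j) else 0)" using i Le fg by (intro sum.cong) auto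
   also have "... = a v" using i by (simp add: sum.delta)
   finally show "a v = \<zero>\<^bsub>rat_field\<^esub>" by simp
  qed
 qed (use BV in auto)
 have sp: "V.gen_set B"
 proof (rule ccontr)
  assume "~ V.gen_set B"
  then obtain v where "v \<in> carrier V" "v \<notin> V.span B" using V.span_is_subset2[OF BV(1)] by blast
  then obtain c where c: "c \<in> carrier F" "cls c \<notin> V.span B" by (auto simp: V_simps)
  have sub: "submodule rat_field (V.span B) V" by (rule V.span_is_submodule[OF BV(1)])
  have sa: "cls (x + y) \<in> V.span B" if "x \<in> carrier F" "y \<in> carrier F" "cls x \<in> V.span B" "cls y \<in> V.span B" for x y
   using submodule.m_closed[OF sub that(3,4)] that by (simp add: V_simps)
  have ss: "cls (scl q x) \<in> V.span B" if "x \<in> carrier F" "cls x \<in> V.span B" for q x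
   using submodule.smult_closed[OF sub _ that(2), of q] that(1) by (simp add: V_smult)
  have cF: "frag_cmul k x \<in> carrier F" if "x \<in> carrier F" for k x using that keys_cmul[of k x] by (auto simp: F_iff)
  have cs: "cls (frag_cmul k x) = cls (scl (of_int k) x)" if x: "x \<in> carrier F" for k x
  proof -
   have "frag_cmul k x - scl (of_int k) x \<in> R"
   proof (induction k rule: int_induct[of _ 0])
    case base thus ?case using scl_distr[OF x, of 0 0] R_minus by fastforce
   next
    case (step1 k)
    show ?case using R_diff[OF step1(2) scl_distr[OF x, of "of_int k" 1]] by (simp add: frag_cmul_distrib scl_one x algebra_simps)
   next
    case (step2 k)
    show ?case using R_add[OF step2(2) scl_distr[OF x, of "of_int k - 1" 1]] by (simp add: frag_cmul_diff_distrib scl_one x algebra_simps)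
   qed
   thus ?thesis using x cF by (simp add: cls_eq)
  qed
  define \<iota> where "\<iota> c = (%b. of_int (Poly_Mapping.lookup c b) :: rat)" for c :: "'a \<times> rat \<Rightarrow>\<^sub>0 int"
  define S where "S = \<iota> ` (Rel \<union> {frag_of (g j, q) | j q. j < n})"
  have W: "vector_space (%(q :: rat) (w :: 'a \<times> rat => rat) b. q * w b)"
   by unfold_locales (simp_all add: fun_eq_iff algebra_simps)
  then interpret W: vector_space "%(q :: rat) (w :: 'a \<times> rat => rat) b. q * w b" .
  define P where "P w \<longleftrightarrow> (\<exists>N>0. \<exists>d\<in>carrier F. (\<forall>b. of_int N * w b = \<iota> d b) & cls d \<in> V.span B)" for w
  have PS: "P w" if "w \<in> W.span S" for w using that
  proof (rule W.span_induct)
   show "W.subspace (Collect P)" unfolding W.subspace_def mem_Collect_eq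
   proof (intro conjI ballI allI)
    have "cls 0 \<in> V.span B" using V.span_zero V_simps(2) by simp
    thus "P 0" unfolding P_def by (intro exI[of _ 1] conjI bexI[of _ 0]) (simp_all add: \<iota>_def)
   next
    fix x y assume "x \<in> Collect P" "y \<in> Collect P"
    then obtain N d M e where *: "N > 0" "d \<in> carrier F" "\<forall>b. of_int N * x b = \<iota> d b" "cls d \<in> V.span B"
     "M > 0" "e \<in> carrier F" "\<forall>b. of_int M * y b = \<iota> e b" "cls e \<in> V.span B" unfolding P_def mem_Collect_eq by metis
    have "of_int (N * M) * (x + y) b = \<iota> (frag_cmul M d + frag_cmul N e) b" for b
     using *(3,7)[rule_format, of b] by (simp add: \<iota>_def lookup_add algebra_simps)
    moreover have "cls (frag_cmul M d + frag_cmul N e) \<in> V.span B" using * by (intro sa) (simp_all add: cF cs ss)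
    ultimately show "P (x + y)" unfolding P_def using *(1,2,5,6) cF by (intro exI[of _ "N * M"] conjI bexI[of _ "frag_cmul M d + frag_cmul N e"]) auto
   next
    fix q :: rat and x assume "x \<in> Collect P"
    then obtain N d where *: "N > 0" "d \<in> carrier F" "\<forall>b. of_int N * x b = \<iota> d b" "cls d \<in> V.span B" unfolding P_def by auto
    obtain k m where km: "quotient_of q = (k, m)" by fastforce
    note q = quotient_of_div[OF km] quotient_of_denom_pos[OF km]
    have "of_int (N * m) * (q * x b) = \<iota> (frag_cmul k d) b" for b
     using *(3)[rule_format, of b] q(2) by (simp add: \<iota>_def q(1) algebra_simps)
    thus "P (%b. q * x b)" unfolding P_def using * q(2) cF cs ss by (intro exI[of _ "N * m"] conjI bexI[of _ "frag_cmul k d"]) auto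
   qed
   fix w assume "w \<in> S"
   then obtain d where d: "w = \<iota> d" "d \<in> Rel \<or> (\<exists>j q. d = frag_of (g j, q) & j < n)" unfolding S_def by blast
   have "d \<in> carrier F & cls d \<in> V.span B" using d(2)
   proof (elim disjE exE conjE)
    assume "d \<in> Rel"
    hence "d \<in> carrier F" "cls d = cls 0" using Rel_sub Rel_R cls_eq[of d 0] by auto
    thus ?thesis using V.span_zero V_simps(2) by simp
   next
    fix j q assume j: "d = frag_of (g j, q)" "j < n"
    have "e j \<in> V.span B" using V.in_own_span[OF BV(1)] j(2) by (auto simp: B_def)
    thus ?thesis using ss[of "frag_of (g j, 1)" q] g[OF j(2)] j(1) by (simp add: e_def)
   qed
   thus "P w" unfolding P_def d(1) by (intro exI[of _ 1] conjI bexI[of _ d]) auto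
  qed
  have "\<iota> c \<notin> W.span S"
  proof
   assume "\<iota> c \<in> W.span S"
   hence "P (\<iota> c)" by (rule PS)
   then obtain N d where *: "N > 0" "\<forall>b. of_int N * \<iota> c b = \<iota> d b" "cls d \<in> V.span B" unfolding P_def by blast
   have "of_int (N * Poly_Mapping.lookup c b) = (of_int (Poly_Mapping.lookup d b) :: rat)" for b using *(2)[rule_format, of b] by (simp add: \<iota>_def)
   hence "d = frag_cmul N c" by (intro poly_mapping_eqI) (simp only: of_int_eq_iff lookup_frag_cmul)
   hence "cls (scl (of_int N) c) \<in> V.span B" using *(3) cs[OF c(1)] by simp
   from ss[OF _ this, of "1 / of_int N"] have "cls c \<in> V.span B" using c(1) *(1) scl_mult[OF c(1), symmetric] by (simp add: scl_one)
   thus False using c(2) by blast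
  qed
  then obtain L where L: "!!x y. L (x + y) = L x + L y" "!!x. x \<in> S ==> L x = 0" "L (\<iota> c) = (1 :: rat)"
   by (rule rat_functional_exists[OF W]) blast
  have Ld: "L (\<iota> (x - y)) = L (\<iota> x) - L (\<iota> y)" for x y
  proof -
   have "\<iota> x = \<iota> (x - y) + \<iota> y" by (simp add: \<iota>_def fun_eq_iff lookup_minus)
   thus ?thesis using L(1) by simp
  qed
  have Lof: "L (\<iota> (frag_of (a, q))) = 0" if "a \<in> carrier A" for a q
  proof (rule det[of "%a. L (\<iota> (frag_of (a, q)))" a, OF _ _ that])
   fix x y assume "x \<in> carrier A" "y \<in> carrier A"
   hence "frag_of (x \<otimes>\<^bsub>A\<^esub> y, q) - frag_of (x, q) - frag_of (y, q) \<in> Rel" unfolding Rel_def by blast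
   hence "L (\<iota> (frag_of (x \<otimes>\<^bsub>A\<^esub> y, q) - frag_of (x, q) - frag_of (y, q))) = 0" by (intro L(2)) (simp add: S_def)
   thus "L (\<iota> (frag_of (x \<otimes>\<^bsub>A\<^esub> y, q))) = L (\<iota> (frag_of (x, q))) + L (\<iota> (frag_of (y, q)))" by (simp add: Ld)
  next
   fix j assume "j < n"
   hence "\<iota> (frag_of (g j, q)) \<in> S" unfolding S_def by blast
   thus "L (\<iota> (frag_of (g j, q))) = 0" by (rule L(2))
  qed
  have "L (\<iota> c) = 0" using c(1)
  proof (induction c rule: F_induct)
   case zero show ?case using Ld[of 0 0] by simp
  qed (simp_all add: Lof Ld)
  thus False using L(3) by simp
 qed
 have "V.fin_dim" unfolding V.fin_dim_def using BV sp by blast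
 moreover have "V.dim = n" using V.dim_basis[of B] BV li sp card by (simp add: V.basis_def)
 ultimately show ?thesis ..
qed

end

lemma (in group) comm_group_abelianization: "comm_group (abelianization G)"
 unfolding abelianization_def by (rule derived_quot_is_comm_group)

lemma iso_inv:
 assumes "group G" "\<phi> \<in> iso G H"
 obtains \<psi> where "\<psi> \<in> iso H G" "!!x. x \<in> carrier G ==> \<psi> (\<phi> x) = x" "!!y. y \<in> carrier H ==> \<phi> (\<psi> y) = y"
proof -
 have b: "bij_betw \<phi> (carrier G) (carrier H)" using assms(2) by (simp add: iso_def)
 show ?thesis
 proof (rule that[of "inv_into (carrier G) \<phi>"])
  show "inv_into (carrier G) \<phi> \<in> iso H G" by (rule group.iso_set_sym[OF assms])
  show "inv_into (carrier G) \<phi> (\<phi> x) = x" if "x \<in> carrier G" for x using b that by (simp add: bij_betw_def)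
  show "\<phi> (inv_into (carrier G) \<phi> y) = y" if "y \<in> carrier H" for y using b that by (simp add: bij_betw_def f_inv_into_f)
 qed
qed

lemma betti1_iso_eqI:
 fixes f :: "nat => 'a => int" and G :: "('a, 'b) monoid_scheme" and H :: "('c, 'd) monoid_scheme"
 assumes G: "group G" and H: "group H" and \<phi>: "\<phi> \<in> iso G H"
  and hom: "!!i x y. i < n ==> x \<in> carrier G ==> y \<in> carrier G ==> f i (x \<otimes>\<^bsub>G\<^esub> y) = f i x + f i y"
  and g: "!!i. i < n ==> g i \<in> carrier G"
  and fg: "!!i j. i < n ==> j < n ==> f i (g j) = (if i = j then 1 else 0)"
  and det: "!!h x. (!!x y. x \<in> carrier G ==> y \<in> carrier G ==> h (x \<otimes>\<^bsub>G\<^esub> y) = h x + (h y :: rat)) ==>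
   (!!j. j < n ==> h (g j) = 0) ==> x \<in> carrier G ==> h x = 0"
 shows "betti1 H = enat n"
proof -
 interpret H: group H by (rule H)
 let ?D = "derived H (carrier H)"
 have N: "?D \<lhd> H" using H.derived_self_is_normal by blast
 interpret N: normal ?D H by (rule N)
 interpret A: comm_group "abelianization H" by (rule H.comm_group_abelianization)
 interpret T: rat_tensor "abelianization H" ..
 obtain \<psi> where \<psi>: "\<psi> \<in> iso H G" "!!x. x \<in> carrier G ==> \<psi> (\<phi> x) = x" using iso_inv[OF G \<phi>] by metis
 have h: "\<psi> \<in> hom H G" "\<phi> \<in> hom G H" "\<phi> ` carrier G = carrier H"
  using \<psi>(1) \<phi> by (simp_all add: iso_def bij_betw_def)
 note \<phi>c = hom_in_carrier[OF h(2)] and \<psi>c = hom_in_carrier[OF h(1)]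
 define c where "c x = ?D #>\<^bsub>H\<^esub> \<phi> x" for x
 have car: "carrier (abelianization H) = c ` carrier G" unfolding c_def abelianization_def FactGroup_def RCOSETS_def h(3)[symmetric] by auto
 have cm: "c x \<otimes>\<^bsub>abelianization H\<^esub> c y = c (x \<otimes>\<^bsub>G\<^esub> y)" if "x \<in> carrier G" "y \<in> carrier G" for x y
  using N.rcos_sum[OF \<phi>c[OF that(1)] \<phi>c[OF that(2)]] hom_mult[OF h(2) that] by (simp add: abelianization_def FactGroup_def c_def)
 have "\<exists>F. i < n --> (\<forall>x\<in>carrier G. F (c x) = (of_int (f i x) :: rat))" for i
 proof (cases "i < n")
  case i: True
  have Q: "group rat_add" using comm_group_rat_add by (rule comm_group.axioms(2))
  define u where "u y = (of_int (f i (\<psi> y)) :: rat)" for y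
  have u: "u (x \<otimes>\<^bsub>H\<^esub> y) = u x + u y" if "x \<in> carrier H" "y \<in> carrier H" for x y
   using hom[OF i \<psi>c[OF that(1)] \<psi>c[OF that(2)]] hom_mult[OF h(1) that] by (simp add: u_def)
  interpret gh: group_hom H rat_add u using H Q u by (simp add: group_hom_def group_hom_axioms_def hom_def)
  have "?D \<subseteq> kernel H rat_add u" unfolding derived_def
  proof (rule H.generate_subgroup_incl)
   show "subgroup (kernel H rat_add u) H" by (rule gh.subgroup_kernel)
   have inv: "u (inv\<^bsub>H\<^esub> x) = - u x" if "x \<in> carrier H" for x
    using u[of "\<one>\<^bsub>H\<^esub>" "\<one>\<^bsub>H\<^esub>"] u[of x "inv\<^bsub>H\<^esub> x"] that by simp
   show "derived_set H (carrier H) \<subseteq> kernel H rat_add u" using u inv by (auto simp: kernel_def)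
  qed
  then obtain F where "!!x. x \<in> carrier H ==> F (r_coset H ?D x) = u x"
   using gh.FactGroup_universal_kernel[OF N] by blast
  hence "\<forall>x\<in>carrier G. F (c x) = of_int (f i x)" using \<phi>c \<psi>(2) by (simp add: c_def u_def)
  thus ?thesis by blast
 qed blast
 hence "\<forall>i. \<exists>F. i < n --> (\<forall>x\<in>carrier G. F (c x) = (of_int (f i x) :: rat))" by blast
 from choice[OF this] obtain F where F0: "\<forall>i. i < n --> (\<forall>x\<in>carrier G. F i (c x) = (of_int (f i x) :: rat))" by (elim exE)
 have F: "F i (c x) = of_int (f i x)" if "i < n" "x \<in> carrier G" for i x using F0 that by simp
 have 1: "F i (x \<otimes>\<^bsub>abelianization H\<^esub> y) = F i x + F i y"
  if i: "i < n" and xy: "x \<in> carrier (abelianization H)" "y \<in> carrier (abelianization H)" for i x y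
 proof -
  obtain a b where ab: "x = c a" "y = c b" "a \<in> carrier G" "b \<in> carrier G" using xy unfolding car by blast
  have "a \<otimes>\<^bsub>G\<^esub> b \<in> carrier G" using ab G by (simp add: group.is_monoid monoid.m_closed)
  thus ?thesis unfolding ab(1,2) cm[OF ab(3,4)] using F[OF i] hom[OF i ab(3,4)] ab(3,4) by simp
 qed
 have 2: "c (g i) \<in> carrier (abelianization H)" if "i < n" for i unfolding car using g that by blast
 have 3: "F i (c (g j)) = (if i = j then 1 else 0)" if "i < n" "j < n" for i j using F g fg that by simp
 have 4: "h x = 0"
  if h: "!!x y. x \<in> carrier (abelianization H) ==> y \<in> carrier (abelianization H) ==>
    h (x \<otimes>\<^bsub>abelianization H\<^esub> y) = h x + (h y :: rat)"
   and h0: "!!j. j < n ==> h (c (g j)) = 0" and x: "x \<in> carrier (abelianization H)" for h x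
 proof -
  obtain a where a: "x = c a" "a \<in> carrier G" using x unfolding car by blast
  have "h (c a) = 0"
  proof (rule det[of "%a. h (c a)", OF _ _ a(2)])
   fix x y assume xy: "x \<in> carrier G" "y \<in> carrier G"
   have "c x \<in> carrier (abelianization H)" "c y \<in> carrier (abelianization H)" using xy car by blast+
   thus "h (c (x \<otimes>\<^bsub>G\<^esub> y)) = h (c x) + h (c y)" using h cm[OF xy] by metis
  qed (use h0 in simp)
  thus "h x = 0" using a by simp
 qed
 have *: "vectorspace.fin_dim rat_field (tensor_rat (abelianization H)) &
   vectorspace.dim rat_field (tensor_rat (abelianization H)) = n"
 proof (rule T.tensor_dim[of n F "%i. c (g i)"])
  fix h :: "'c set => rat" and x
  assume "!!x y. x \<in> carrier (abelianization H) ==> y \<in> carrier (abelianization H) ==>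
    h (x \<otimes>\<^bsub>abelianization H\<^esub> y) = h x + h y" "!!j. j < n ==> h (c (g j)) = 0" "x \<in> carrier (abelianization H)"
  thus "h x = 0" by (rule 4)
 qed (use 1 2 3 in simp_all)
 show ?thesis using * by (simp add: betti1_def Let_def)
qed

section \<open>Free quotients\<close>

definition fg_eval :: "('h, 'x) monoid_scheme => (nat => 'h) => (nat \<times> bool) list => 'h" where
 "fg_eval H s w = foldr (%(i, b) h. (if b then s i else inv\<^bsub>H\<^esub> s i) \<otimes>\<^bsub>H\<^esub> h) w \<one>\<^bsub>H\<^esub>"

lemma fg_eval_simps [simp]:
 "fg_eval H s [] = \<one>\<^bsub>H\<^esub>"
 "fg_eval H s ((i, b) # w) = (if b then s i else inv\<^bsub>H\<^esub> s i) \<otimes>\<^bsub>H\<^esub> fg_eval H s w"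
 by (simp_all add: fg_eval_def)

lemma fg_words_Cons [simp]: "(i, b) # w \<in> fg_words k \<longleftrightarrow> i < k & w \<in> fg_words k"
 and fg_words_Nil [simp]: "[] \<in> fg_words k"
 and fg_words_append [simp]: "u @ v \<in> fg_words k \<longleftrightarrow> u \<in> fg_words k & v \<in> fg_words k"
 by (auto simp: fg_words_def)

lemma (in group) fg_eval_closed:
 assumes "!!i. i < k ==> s i \<in> carrier G" "w \<in> fg_words k"
 shows "fg_eval G s w \<in> carrier G" using assms(2)
proof (induction w)
 case (Cons l w) thus ?case using assms(1) by (cases l) auto
qed simp

lemma (in group) fg_eval_append:
 assumes s: "!!i. i < k ==> s i \<in> carrier G" and "u \<in> fg_words k" "v \<in> fg_words k"
 shows "fg_eval G s (u @ v) = fg_eval G s u \<otimes> fg_eval G s v" using assms(2)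
proof (induction u)
 case Nil thus ?case using fg_eval_closed[of k s v, OF s assms(3)] by simp
next
 case (Cons l u)
 obtain i b where l: "l = (i, b)" by (cases l)
 have "fg_eval G s u \<in> carrier G" "fg_eval G s v \<in> carrier G"
  using Cons.prems l fg_eval_closed[of k s u, OF s] fg_eval_closed[of k s v, OF s] assms(3) by auto
 thus ?case using Cons l s by (simp add: m_assoc)
qed

lemma fg_rel_words: "(u, v) \<in> fg_rel k ==> u \<in> fg_words k & v \<in> fg_words k"
 by (auto simp: fg_rel_def)

lemma fg_rel_equiv: "equiv (fg_words k) (fg_rel k)"
proof (rule equivI)
 show "fg_rel k \<subseteq> fg_words k \<times> fg_words k" by (auto simp: fg_rel_def)
 show "refl_on (fg_words k) (fg_rel k)" by (auto simp: refl_on_def fg_rel_def)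
 have "sym ((fg_cancel k \<union> converse (fg_cancel k))\<^sup>*)" by (rule sym_rtrancl) (auto simp: sym_def)
 thus "sym (fg_rel k)" unfolding fg_rel_def by (auto simp: sym_def)
 show "trans (fg_rel k)" unfolding fg_rel_def by (auto simp: trans_def intro: rtrancl_trans)
qed

lemma (in group) fg_eval_rel:
 assumes s: "!!i. i < k ==> s i \<in> carrier G" and r: "(u, v) \<in> fg_rel k"
 shows "fg_eval G s u = fg_eval G s v"
proof -
 have c: "fg_eval G s x = fg_eval G s y" if xy: "(x, y) \<in> fg_cancel k" for x y
 proof -
  obtain a b i e where *: "x = a @ [(i, e), (i, ~ e)] @ b" "y = a @ b" "a \<in> fg_words k" "b \<in> fg_words k" "i < k"
   using xy unfolding fg_cancel_def by auto
  have si: "s i \<in> carrier G" and B: "fg_eval G s b \<in> carrier G" using s * fg_eval_closed[of k s b, OF s *(4)] by auto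
  have "fg_eval G s ([(i, e), (i, ~ e)] @ b) = fg_eval G s b" using si B by (cases e) (simp_all add: m_assoc[symmetric])
  moreover have "[(i, e), (i, ~ e)] @ b \<in> fg_words k" using * by simp
  ultimately show ?thesis unfolding *(1,2)
   using fg_eval_append[of k s a "[(i, e), (i, ~ e)] @ b", OF s *(3)] fg_eval_append[of k s a b, OF s *(3,4)] by simp
 qed
 have "(u, v) \<in> (fg_cancel k \<union> converse (fg_cancel k))\<^sup>*" using r by (simp add: fg_rel_def)
 thus ?thesis by (induction rule: rtrancl_induct) (use c in fastforce)+
qed

lemma fg_rel_append:
 assumes "(u, u') \<in> fg_rel k" "(v, v') \<in> fg_rel k"
 shows "(u @ v, u' @ v') \<in> fg_rel k"
proof -
 let ?S = "fg_cancel k \<union> converse (fg_cancel k)"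
 note w = fg_rel_words[OF assms(1)] fg_rel_words[OF assms(2)]
 have l: "(a @ x, a @ y) \<in> ?S" and r: "(x @ a, y @ a) \<in> ?S" if "(x, y) \<in> ?S" "a \<in> fg_words k" for x y a
 proof -
  have "(a @ x, a @ y) \<in> fg_cancel k & (x @ a, y @ a) \<in> fg_cancel k" if xy: "(x, y) \<in> fg_cancel k" for x y
  proof -
   obtain p q i e where *: "x = p @ [(i, e), (i, ~ e)] @ q" "y = p @ q" "p \<in> fg_words k" "q \<in> fg_words k" "i < k"
    using xy unfolding fg_cancel_def by auto
   have "a @ x = (a @ p) @ [(i, e), (i, ~ e)] @ q" "a @ y = (a @ p) @ q" "a @ p \<in> fg_words k"
    "x @ a = p @ [(i, e), (i, ~ e)] @ (q @ a)" "y @ a = p @ (q @ a)" "q @ a \<in> fg_words k"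
    using * \<open>a \<in> fg_words k\<close> by simp_all
   thus ?thesis unfolding fg_cancel_def using *(3-5) by blast
  qed
  thus "(a @ x, a @ y) \<in> ?S" "(x @ a, y @ a) \<in> ?S" using that(1) by auto
 qed
 have "(u @ v, u' @ v) \<in> ?S\<^sup>*"
 proof -
  have "(u, u') \<in> ?S\<^sup>*" using assms(1) by (simp add: fg_rel_def)
  thus ?thesis
  proof (induction rule: rtrancl_induct)
   case (step y z) thus ?case using r[of y z v] w by (meson rtrancl.rtrancl_into_rtrancl)
  qed simp
 qed
 moreover have "(u' @ v, u' @ v') \<in> ?S\<^sup>*"
 proof -
  have "(v, v') \<in> ?S\<^sup>*" using assms(2) by (simp add: fg_rel_def)
  thus ?thesis
  proof (induction rule: rtrancl_induct)
   case (step y z) thus ?case using l[of y z u'] w by (meson rtrancl.rtrancl_into_rtrancl)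
  qed simp
 qed
 ultimately show ?thesis using w by (auto simp: fg_rel_def)
qed

definition fg_class :: "nat => (nat \<times> bool) list => (nat \<times> bool) list set" where
 "fg_class k w = fg_rel k `` {w}"

lemma fg_class_eq: "u \<in> fg_words k ==> v \<in> fg_words k ==> fg_class k u = fg_class k v \<longleftrightarrow> (u, v) \<in> fg_rel k"
 unfolding fg_class_def by (rule eq_equiv_class_iff[OF fg_rel_equiv])

lemma fg_class_mem: "w \<in> fg_class k v \<longleftrightarrow> (v, w) \<in> fg_rel k"
 by (simp add: fg_class_def)

lemma fg_self: "w \<in> fg_words k ==> w \<in> fg_class k w"
 using equiv_class_self[OF fg_rel_equiv] by (simp add: fg_class_def)

lemma free_group_carrier: "carrier (free_group k) = fg_class k ` fg_words k"
 by (auto simp: free_group_def quotient_def fg_class_def)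

lemma free_group_mult:
 assumes "u \<in> fg_words k" "v \<in> fg_words k"
 shows "fg_class k u \<otimes>\<^bsub>free_group k\<^esub> fg_class k v = fg_class k (u @ v)"
proof -
 have "fg_class k (u' @ v') = fg_class k (u @ v)" if "u' \<in> fg_class k u" "v' \<in> fg_class k v" for u' v'
  using fg_rel_append[of u u' k v v'] that fg_rel_words[of u u' k] fg_rel_words[of v v' k] assms
  by (subst eq_commute) (simp add: fg_class_eq fg_class_mem)
 hence "(\<Union>u'\<in>fg_class k u. \<Union>v'\<in>fg_class k v. fg_class k (u' @ v')) = fg_class k (u @ v)"
  using fg_self[OF assms(1)] fg_self[OF assms(2)] by blast
 thus ?thesis by (simp add: free_group_def fg_class_def)
qed

definition fg_rep :: "('a => (nat \<times> bool) list set) => 'a => (nat \<times> bool) list" where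
 "fg_rep f g = (SOME w. w \<in> f g)"

lemma fg_rep:
 assumes f: "f \<in> hom G (free_group k)" and g: "g \<in> carrier G"
 shows "fg_rep f g \<in> fg_words k" "f g = fg_class k (fg_rep f g)"
proof -
 have "f g \<in> fg_class k ` fg_words k" using hom_in_carrier[OF f g] by (simp add: free_group_carrier)
 then obtain w where w: "w \<in> fg_words k" "f g = fg_class k w" by blast
 hence "w \<in> f g" using fg_self by blast
 hence "fg_rep f g \<in> f g" unfolding fg_rep_def by (rule someI)
 hence r: "(w, fg_rep f g) \<in> fg_rel k" using w by (simp add: fg_class_mem)
 thus "fg_rep f g \<in> fg_words k" using fg_rel_words by blast
 thus "f g = fg_class k (fg_rep f g)" using r w fg_class_eq by blast
qed

lemma fg_eval_rep:
 assumes G: "group G" and f: "f \<in> hom G (free_group k)" and H: "group H" and s: "!!i. i < k ==> s i \<in> carrier H"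
 shows "g \<in> carrier G ==> h \<in> carrier G ==>
   fg_eval H s (fg_rep f (g \<otimes>\<^bsub>G\<^esub> h)) = fg_eval H s (fg_rep f g) \<otimes>\<^bsub>H\<^esub> fg_eval H s (fg_rep f h)"
  and "g \<in> carrier G ==> i < k ==> f g = fg_class k [(i, True)] ==> fg_eval H s (fg_rep f g) = s i"
proof -
 interpret H: group H by (rule H)
 interpret G: group G by (rule G)
 { assume gh: "g \<in> carrier G" "h \<in> carrier G"
  note r = fg_rep[OF f gh(1)] fg_rep[OF f gh(2)] fg_rep[OF f G.m_closed[OF gh]]
  have "f (g \<otimes>\<^bsub>G\<^esub> h) = fg_class k (fg_rep f g @ fg_rep f h)" using hom_mult[OF f gh] r free_group_mult by metis
  hence "(fg_rep f (g \<otimes>\<^bsub>G\<^esub> h), fg_rep f g @ fg_rep f h) \<in> fg_rel k" using r fg_class_eq by (metis fg_words_append)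
  thus "fg_eval H s (fg_rep f (g \<otimes>\<^bsub>G\<^esub> h)) = fg_eval H s (fg_rep f g) \<otimes>\<^bsub>H\<^esub> fg_eval H s (fg_rep f h)"
   using H.fg_eval_rel[of k s, OF s] H.fg_eval_append[of k s, OF s] r by metis }
 { assume g: "g \<in> carrier G" "i < k" "f g = fg_class k [(i, True)]"
  hence "(fg_rep f g, [(i, True)]) \<in> fg_rel k" using fg_rep[OF f g(1)] fg_class_eq[of "fg_rep f g" k "[(i, True)]"] by simp
  from H.fg_eval_rel[of k s, OF s this] show "fg_eval H s (fg_rep f g) = s i" using s[OF g(2)] by simp }
qed

lemma fg_epi_gen:
 assumes f: "f \<in> epi G (free_group k)" and "i < k"
 obtains x where "x \<in> carrier G" "f x = fg_class k [(i, True)]"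
proof -
 have "fg_class k [(i, True)] \<in> carrier (free_group k)" using assms(2) by (simp add: free_group_carrier)
 hence "fg_class k [(i, True)] \<in> f ` carrier G" using f by (simp add: epi_def)
 thus ?thesis using that by auto
qed

definition heis :: "(int \<times> int \<times> int) monoid" where
 "heis = \<lparr>carrier = UNIV, monoid.mult = (%(u, v, w) (u', v', w'). (u + u', v + v', w + w' + u * v')), one = (0, 0, 0)\<rparr>"

lemma group_heis: "group heis"
 unfolding heis_def
proof (rule groupI)
 fix x :: "int \<times> int \<times> int"
 obtain u v w where "x = (u, v, w)" by (cases x)
 thus "\<exists>y\<in>carrier \<lparr>carrier = UNIV, monoid.mult = (%(u, v, w) (u', v', w'). (u + u', v + v', w + w' + u * v')), one = (0, 0, 0)\<rparr>.
   y \<otimes>\<^bsub>\<lparr>carrier = UNIV, monoid.mult = (%(u, v, w) (u', v', w'). (u + u', v + v', w + w' + u * v')), one = (0, 0, 0)\<rparr>\<^esub> x =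
   \<one>\<^bsub>\<lparr>carrier = UNIV, monoid.mult = (%(u, v, w) (u', v', w'). (u + u', v + v', w + w' + u * v')), one = (0, 0, 0)\<rparr>\<^esub>"
  by (intro bexI[of _ "(- u, - v, u * v - w)"]) (auto simp: algebra_simps)
qed (auto simp: algebra_simps)

definition cyc_pow :: "int => int => int => int" where
 "cyc_pow c e n = c ^ nat (n mod e)"

lemma cyc_pow_add:
 assumes e: "e > 0" and c: "c ^ nat e mod p = 1 mod p"
 shows "cyc_pow c e (m + n) mod p = (cyc_pow c e m * cyc_pow c e n) mod p"
proof -
 have nn: "0 <= m mod e" "0 <= n mod e" "m mod e < e" "n mod e < e" using e by auto
 show ?thesis
 proof (cases "m mod e + n mod e < e")
  case True
  hence "(m + n) mod e = m mod e + n mod e" using nn by (metis mod_add_eq mod_pos_pos_trivial add_nonneg_nonneg)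
  thus ?thesis using nn by (simp add: cyc_pow_def nat_add_distrib power_add)
 next
  case False
  have "(m + n) mod e = (m mod e + n mod e - e) mod e" by (simp add: mod_add_eq)
  also have "... = m mod e + n mod e - e" using False nn by (intro mod_pos_pos_trivial) auto
  finally have "m mod e + n mod e = (m + n) mod e + e" by simp
  hence "nat (m mod e) + nat (n mod e) = nat ((m + n) mod e) + nat e" using nn e by (metis nat_add_distrib pos_mod_sign less_imp_le)
  hence "cyc_pow c e m * cyc_pow c e n = cyc_pow c e (m + n) * c ^ nat e" by (simp add: cyc_pow_def power_add[symmetric])
  thus ?thesis using c by (metis mod_mult_right_eq mult.right_neutral)
 qed
qed

definition affg :: "int => int => int => int => int => (int \<times> int \<times> int) monoid" where
 "affg p c e a b = \<lparr>carrier = {(u, v, t). 0 <= t & t < p},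
  monoid.mult = (%(u, v, t) (u', v', t'). (u + u', v + v', (t + cyc_pow c e (a * u + b * v) * t') mod p)),
  one = (0, 0, 0)\<rparr>"

lemma group_affg:
 assumes p: "p > 1" and e: "e > 0" and c: "c ^ nat e mod p = 1 mod p"
 shows "group (affg p c e a b)"
proof -
 let ?K = "cyc_pow c e"
 have K0: "?K 0 = 1" by (simp add: cyc_pow_def)
 have K: "(?K (m + n) * t) mod p = (?K m * (?K n * t)) mod p" for m n t using cyc_pow_add[OF e c, of m n] by (metis mod_mult_left_eq mult.assoc)
 show ?thesis unfolding affg_def
 proof (rule groupI, goal_cases)
  case (1 x y) thus ?case using p by auto
 next
  case 2 thus ?case using p by auto
 next
  case (3 x y z)
  obtain u v t u' v' t' u2 v2 t2 where *: "x = (u, v, t)" "y = (u', v', t')" "z = (u2, v2, t2)" by (cases x, cases y, cases z)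
  have "((t + ?K (a * u + b * v) * t') mod p + ?K (a * (u + u') + b * (v + v')) * t2) mod p
    = (t + ?K (a * u + b * v) * t' + ?K ((a * u + b * v) + (a * u' + b * v')) * t2) mod p" by (simp add: mod_add_left_eq algebra_simps)
  also have "... = (t + ?K (a * u + b * v) * t' + ?K (a * u + b * v) * (?K (a * u' + b * v') * t2)) mod p"
   using K[of "a * u + b * v" "a * u' + b * v'" t2] by (metis mod_add_right_eq)
  also have "... = (t + ?K (a * u + b * v) * (t' + ?K (a * u' + b * v') * t2)) mod p" by (simp add: algebra_simps)
  also have "... = (t + ?K (a * u + b * v) * ((t' + ?K (a * u' + b * v') * t2) mod p)) mod p" by (metis mod_add_right_eq mod_mult_right_eq)
  finally show ?case unfolding * by (simp add: add.assoc)
 next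
  case (4 x) thus ?case by (auto simp: K0)
 next
  case (5 x)
  then obtain u v t where x: "x = (u, v, t)" "0 <= t" "t < p" by auto
  define K' where "K' = ?K (a * (- u) + b * (- v))"
  have "((- K' * t) mod p + K' * t) mod p = 0" by (simp add: mod_add_left_eq)
  moreover have sw: "- (b * v) - a * u = - (a * u) - b * v" by simp
  ultimately show ?case using p x by (intro bexI[of _ "(- u, - v, (- K' * t) mod p)"]) (simp_all add: K'_def sw)
 qed
qed

definition pr2 :: "int \<times> int \<times> int => int \<times> int" where "pr2 x = (fst x, fst (snd x))"

lemma pr2_heis: "pr2 (x \<otimes>\<^bsub>heis\<^esub> y) = pr2 x + pr2 y"
 by (auto simp: pr2_def heis_def split: prod.splits)

lemma pr2_affg: "pr2 (x \<otimes>\<^bsub>affg p c e a b\<^esub> y) = pr2 x + pr2 y"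
 by (auto simp: pr2_def affg_def split: prod.splits)

lemma pr2_eval:
 assumes H: "group H" "!!x y. pr2 (x \<otimes>\<^bsub>H\<^esub> y) = pr2 x + pr2 y" "!!i. i < k ==> s i \<in> carrier H" "!!i. i < k ==> pr2 (s i) = q i"
  and w: "w \<in> fg_words k"
 shows "pr2 (fg_eval H s w) = foldr (%(i, b) h. (if b then q i else - q i) + h) w 0"
proof -
 interpret H: group H by (rule H)
 have one: "pr2 \<one>\<^bsub>H\<^esub> = 0" using H(2)[of "\<one>\<^bsub>H\<^esub>" "\<one>\<^bsub>H\<^esub>"] by simp
 have inv: "pr2 (inv\<^bsub>H\<^esub> x) = - pr2 x" if "x \<in> carrier H" for x
  using H(2)[of "inv\<^bsub>H\<^esub> x" x] that one by (simp add: eq_neg_iff_add_eq_0)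
 show ?thesis using w
 proof (induction w)
  case (Cons l w)
  obtain i b where l: "l = (i, b)" by (cases l)
  thus ?case using Cons H(2-4) inv by (auto simp: fun_eq_iff)
 qed (simp add: one)
qed

lemma free_quotient_data:
 assumes G: "group G" and f: "f \<in> epi G (free_group k)" and k: "k >= 2"
 obtains u v w :: "'a => int" and x y where "x \<in> carrier G" "y \<in> carrier G"
  "u x = 1" "v x = 0" "u y = 0" "v y = 1"
  "!!g h. g \<in> carrier G ==> h \<in> carrier G ==> u (g \<otimes>\<^bsub>G\<^esub> h) = u g + u h"
  "!!g h. g \<in> carrier G ==> h \<in> carrier G ==> v (g \<otimes>\<^bsub>G\<^esub> h) = v g + v h"
  "!!g h. g \<in> carrier G ==> h \<in> carrier G ==> w (g \<otimes>\<^bsub>G\<^esub> h) = w g + w h + u g * v h"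
  "!!p c e a b s t. p > 1 ==> e > 0 ==> c ^ nat e mod p = 1 mod p ==>
   \<exists>z. (\<forall>g\<in>carrier G. \<forall>h\<in>carrier G. z (g \<otimes>\<^bsub>G\<^esub> h) mod p = (z g + cyc_pow c e (a * u g + b * v g) * z h) mod p) &
    z x mod p = s mod p & z y mod p = t mod p"
proof -
 have fh: "f \<in> hom G (free_group k)" using f by (simp add: epi_def)
 define q :: "nat => int \<times> int" where "q i = (if i = 0 then (1, 0) else if i = 1 then (0, 1) else (0, 0))" for i
 define sh :: "nat => int \<times> int \<times> int" where "sh i = (fst (q i), snd (q i), 0)" for i
 define E where "E g = fg_eval heis sh (fg_rep f g)" for g
 define u where "u g = fst (E g)" for g
 define v where "v g = fst (snd (E g))" for g
 define w where "w g = snd (snd (E g))" for g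
 obtain x where x: "x \<in> carrier G" "f x = fg_class k [(0, True)]" using fg_epi_gen[OF f, of 0] k by auto
 obtain y where y: "y \<in> carrier G" "f y = fg_class k [(1, True)]" using fg_epi_gen[OF f, of 1] k by auto
 have sh: "!!i. i < k ==> sh i \<in> carrier heis" by (simp add: heis_def)
 note ev = fg_eval_rep[OF G fh group_heis, of sh]
 have E: "E (g \<otimes>\<^bsub>G\<^esub> h) = E g \<otimes>\<^bsub>heis\<^esub> E h" if "g \<in> carrier G" "h \<in> carrier G" for g h
  unfolding E_def by (rule ev(1)) (use sh that in auto)
 have Ex: "E x = sh 0" "E y = sh 1" unfolding E_def using ev(2)[of x 0] ev(2)[of y 1] x y sh k by auto
 show ?thesis
 proof (rule that[of x y u v w])
  show "u x = 1" "v x = 0" "u y = 0" "v y = 1" using Ex by (simp_all add: u_def v_def sh_def q_def)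
  fix g h assume gh: "g \<in> carrier G" "h \<in> carrier G"
  show "u (g \<otimes>\<^bsub>G\<^esub> h) = u g + u h" "v (g \<otimes>\<^bsub>G\<^esub> h) = v g + v h" "w (g \<otimes>\<^bsub>G\<^esub> h) = w g + w h + u g * v h"
   using E[OF gh] by (auto simp: u_def v_def w_def heis_def split: prod.splits)
 next
  fix p c e a b s t :: int
  assume pce: "p > 1" "e > 0" "c ^ nat e mod p = 1 mod p"
  let ?A = "affg p c e a b"
  define sa :: "nat => int \<times> int \<times> int" where
   "sa i = (fst (q i), snd (q i), (if i = 0 then s mod p else if i = 1 then t mod p else 0))" for i
  have gA: "group ?A" by (rule group_affg[OF pce])
  have sa: "!!i. i < k ==> sa i \<in> carrier ?A" using pce by (auto simp: affg_def sa_def)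
  define Z where "Z g = fg_eval ?A sa (fg_rep f g)" for g
  note eva = fg_eval_rep[OF G fh gA, of sa]
  have Z: "Z (g \<otimes>\<^bsub>G\<^esub> h) = Z g \<otimes>\<^bsub>?A\<^esub> Z h" if "g \<in> carrier G" "h \<in> carrier G" for g h
   unfolding Z_def by (rule eva(1)) (use sa that in auto)
  have Zx: "Z x = sa 0" "Z y = sa 1" unfolding Z_def using eva(2)[of x 0] eva(2)[of y 1] x y sa k by auto
  have pr: "pr2 (Z g) = (u g, v g)" if "g \<in> carrier G" for g
  proof -
   have wd: "fg_rep f g \<in> fg_words k" by (rule fg_rep(1)[OF fh that])
   have qa: "pr2 (sa i) = q i" and qh: "pr2 (sh i) = q i" for i by (simp_all add: pr2_def sa_def sh_def)
   have "pr2 (Z g) = pr2 (E g)" unfolding Z_def E_def using pr2_eval[of ?A k sa q "fg_rep f g"] pr2_eval[of heis k sh q "fg_rep f g"]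
     gA pr2_affg sa qa group_heis pr2_heis sh qh wd by simp
   thus ?thesis by (simp add: pr2_def u_def v_def)
  qed
  define z where "z g = snd (snd (Z g))" for g
  have "z (g \<otimes>\<^bsub>G\<^esub> h) mod p = (z g + cyc_pow c e (a * u g + b * v g) * z h) mod p" if gh: "g \<in> carrier G" "h \<in> carrier G" for g h
   using Z[OF gh] pr[OF gh(1)] by (auto simp: z_def affg_def pr2_def split: prod.splits)
  moreover have "z x mod p = s mod p" "z y mod p = t mod p" using Zx by (simp_all add: z_def sa_def)
  ultimately show "\<exists>z. (\<forall>g\<in>carrier G. \<forall>h\<in>carrier G. z (g \<otimes>\<^bsub>G\<^esub> h) mod p = (z g + cyc_pow c e (a * u g + b * v g) * z h) mod p) &
    z x mod p = s mod p & z y mod p = t mod p" by blast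
 qed (use x y in auto)
qed

definition zword :: "int => (nat \<times> bool) list" where
 "zword n = replicate (nat n) (0, True) @ replicate (nat (- n)) (0, False)"

lemma zword_in: "zword n \<in> fg_words 1"
 by (auto simp: zword_def fg_words_def)

lemma zword_Cons: "((0, b) # zword n, zword (if b then n + 1 else n - 1)) \<in> fg_rel 1"
proof -
 have rf: "(w, w) \<in> fg_rel 1" if "w \<in> fg_words 1" for w using fg_rel_equiv[of 1] that by (auto simp: equiv_def refl_on_def)
 have st: "((0, b) # (0, ~ b) # w, w) \<in> fg_rel 1" if "w \<in> fg_words 1" for w b
 proof -
  have "((0, b) # (0, ~ b) # w, w) \<in> fg_cancel 1" unfolding fg_cancel_def
   by (intro CollectI exI[of _ "[]"] exI[of _ w] exI[of _ 0] exI[of _ b]) (use that in auto)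
  thus ?thesis using that unfolding fg_rel_def by auto
 qed
 consider (1) "b" "n >= 0" | (2) "b" "n < 0" | (3) "~ b" "n <= 0" | (4) "~ b" "n > 0" by linarith
 thus ?thesis
 proof cases
  case 1
  hence "(0, b) # zword n = zword (n + 1)" by (simp add: zword_def nat_add_distrib)
  thus ?thesis using 1 rf zword_in by simp
 next
  case 2
  hence "nat (- n) = Suc (nat (- (n + 1)))" by simp
  hence "zword n = (0, False) # zword (n + 1)" using 2 by (simp add: zword_def)
  thus ?thesis using 2 st[of "zword (n + 1)" True] zword_in by simp
 next
  case 3
  hence "nat (- (n - 1)) = Suc (nat (- n))" by simp
  hence "(0, b) # zword n = zword (n - 1)" using 3 by (simp add: zword_def)
  thus ?thesis using 3 rf zword_in by simp
 next
  case 4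
  hence "nat n = Suc (nat (n - 1))" by simp
  hence "zword n = (0, True) # zword (n - 1)" using 4 by (simp add: zword_def)
  thus ?thesis using 4 st[of "zword (n - 1)" False] zword_in by simp
 qed
qed

lemma zword_append:
 assumes "w \<in> fg_words 1"
 shows "\<exists>m. \<forall>n. (w @ zword n, zword (m + n)) \<in> fg_rel 1" using assms
proof (induction w)
 case Nil
 have "(zword n, zword n) \<in> fg_rel 1" for n using fg_rel_equiv[of 1] zword_in by (auto simp: equiv_def refl_on_def)
 thus ?case by (intro exI[of _ 0]) simp
next
 case (Cons l w)
 obtain b where l: "l = (0, b)" using Cons.prems by (cases l) auto
 from Cons obtain m where m: "!!n. (w @ zword n, zword (m + n)) \<in> fg_rel 1" unfolding l by auto
 have tr: "trans (fg_rel 1)" using fg_rel_equiv by (auto simp: equiv_def)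
 have "((0, b) # w @ zword n, zword ((if b then m + 1 else m - 1) + n)) \<in> fg_rel 1" for n
 proof -
  have "([(0, b)], [(0, b)]) \<in> fg_rel 1" using fg_rel_equiv[of 1] by (auto simp: equiv_def refl_on_def)
  hence "([(0, b)] @ w @ zword n, [(0, b)] @ zword (m + n)) \<in> fg_rel 1" by (rule fg_rel_append[OF _ m])
  hence "((0, b) # w @ zword n, zword (if b then m + n + 1 else m + n - 1)) \<in> fg_rel 1"
   using transD[OF tr _ zword_Cons[of b "m + n"]] by simp
  thus ?thesis by (cases b) (simp_all add: algebra_simps)
 qed
 thus ?case unfolding l by (intro exI[of _ "if b then m + 1 else m - 1"]) simp
qed

lemma zword_add: "fg_class 1 (zword m @ zword n) = fg_class 1 (zword (m + n))"
proof -
 obtain a where a: "!!n. (zword m @ zword n, zword (a + n)) \<in> fg_rel 1" using zword_append[OF zword_in[of m]] by blast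
 have tI: "group \<lparr>carrier = UNIV, monoid.mult = (+), one = (0::int)\<rparr>" (is "group ?I")
  by (rule groupI) (auto intro: exI[of _ "- _"])
 interpret I: group ?I by (rule tI)
 have inv: "inv\<^bsub>?I\<^esub> x = - x" for x by (rule I.inv_equality) auto
 have ez: "fg_eval ?I (%_. 1) (zword n) = n" for n
 proof -
  have r: "fg_eval ?I (%_. 1) (replicate j (0, b) @ w) = (if b then int j else - int j) + fg_eval ?I (%_. 1) w" for j b w
   by (induction j) (auto simp: inv)
  show ?thesis unfolding zword_def r using r[of "nat (- n)" False "[]"] by simp
 qed
 have "zword m @ zword 0 = zword m" by (simp add: zword_def)
 hence "fg_eval ?I (%_. 1) (zword m) = fg_eval ?I (%_. 1) (zword (a + 0))"
  using I.fg_eval_rel[of 1 "%_. 1", OF _ a[of 0]] by simp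
 hence "a = m" by (simp add: ez)
 thus ?thesis using a[of n] fg_class_eq[of "zword m @ zword n" 1 "zword (m + n)"] zword_in by simp
qed

lemma corank_eq_1I:
 fixes f :: "'a => int"
 assumes hom: "!!x y. x \<in> carrier G ==> y \<in> carrier G ==> f (x \<otimes>\<^bsub>G\<^esub> y) = f x + f y"
  and onto: "!!n. \<exists>g\<in>carrier G. f g = n" and no: "!!k. k >= 2 ==> epi G (free_group k) = {}"
 shows "corank G = 1"
proof -
 have "(%g. fg_class 1 (zword (f g))) \<in> epi G (free_group 1)" unfolding epi_def
 proof (intro CollectI conjI)
  show "(%g. fg_class 1 (zword (f g))) \<in> hom G (free_group 1)"
   unfolding hom_def using hom zword_in zword_add free_group_mult[OF zword_in zword_in] by (auto simp: free_group_carrier)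
  show "(%g. fg_class 1 (zword (f g))) ` carrier G = carrier (free_group 1)"
  proof
   show "(%g. fg_class 1 (zword (f g))) ` carrier G \<subseteq> carrier (free_group 1)"
    using zword_in by (auto simp: free_group_carrier)
   show "carrier (free_group 1) \<subseteq> (%g. fg_class 1 (zword (f g))) ` carrier G"
   proof
    fix C assume "C \<in> carrier (free_group 1)"
    then obtain w where w: "w \<in> fg_words 1" "C = fg_class 1 w" by (auto simp: free_group_carrier)
    obtain m where "(w @ zword 0, zword (m + 0)) \<in> fg_rel 1" using zword_append[OF w(1)] by blast
    hence "(w, zword m) \<in> fg_rel 1" by (simp add: zword_def)
    hence C: "C = fg_class 1 (zword m)" using fg_class_eq[OF w(1) zword_in] w(2) by simp
    obtain g where "g \<in> carrier G" "f g = m" using onto by blast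
    thus "C \<in> (%g. fg_class 1 (zword (f g))) ` carrier G" unfolding C by blast
   qed
  qed
 qed
 hence one: "1 \<in> {k. epi G (free_group k) ~= {}}" by blast
 have le: "k <= 1" if "k \<in> {k. epi G (free_group k) ~= {}}" for k using no[of k] that by force
 have "corank G = enat 1" unfolding corank_def
 proof (rule antisym)
  show "(SUP k\<in>{k. epi G (free_group k) ~= {}}. enat k) <= enat 1" by (rule SUP_least) (use le in simp)
  show "enat 1 <= (SUP k\<in>{k. epi G (free_group k) ~= {}}. enat k)" by (rule SUP_upper[OF one])
 qed
 thus ?thesis by (simp add: one_enat_def)
qed

section \<open>Right-angled reflection groups\<close>

definition hs :: "real^3 => real" where "hs x = sqrt (1 + x \<bullet> x)"

lemma hs_pos: "hs x > 0" "hs x >= 1" and hs_sq: "hs x ^ 2 = 1 + x \<bullet> x"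
 by (simp_all add: hs_def add_pos_nonneg)

locale ra_system =
 fixes I :: "'i set" and n :: "'i => real^3" and p :: real
 assumes fin: "finite I" and p: "p > 0"
  and nn: "!!i. i \<in> I ==> n i \<bullet> n i = p^2 + 2"
  and nij: "!!i j. i \<in> I ==> j \<in> I ==> i ~= j ==> n i \<bullet> n j = p^2 \<or> n i \<bullet> n j <= p^2 - 2"
begin

definition adj :: "'i => 'i => bool" where
 "adj i j \<longleftrightarrow> i \<in> I & j \<in> I & i ~= j & n i \<bullet> n j = p^2"

definition L :: "'i => real^3 => real" where
 "L i x = n i \<bullet> x - p * hs x"

definition refl :: "'i => real^3 => real^3" where
 "refl i x = x - L i x *\<^sub>R n i"

definition P :: "(real^3) set" where "P = {x. \<forall>i\<in>I. L i x <= 0}"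

lemma adj_sym: "adj i j \<longleftrightarrow> adj j i"
 by (auto simp: adj_def inner_commute)

lemma hs_refl: "i \<in> I ==> hs (refl i x) = hs x - p * L i x"
proof -
 assume i: "i \<in> I"
 have sq: "1 + refl i x \<bullet> refl i x = (hs x - p * L i x)^2"
 proof -
  have "refl i x \<bullet> refl i x = x \<bullet> x - 2 * L i x * (n i \<bullet> x) + (L i x)^2 * (p^2 + 2)"
   unfolding refl_def nn[OF i, symmetric] by (simp add: inner_diff_left inner_diff_right inner_commute power2_eq_square algebra_simps)
  moreover have "n i \<bullet> x = L i x + p * hs x" by (simp add: L_def)
  ultimately show ?thesis using hs_sq[of x] by (simp add: power2_eq_square algebra_simps)
 qed
 have "p * (n i \<bullet> x) < (p^2 + 1) * hs x"
 proof -
  have "\<bar>n i \<bullet> x\<bar> <= norm (n i) * norm x" by (rule Cauchy_Schwarz_ineq2)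
  hence "(n i \<bullet> x)^2 <= (p^2 + 2) * (x \<bullet> x)" using Cauchy_Schwarz_ineq[of "n i" x] nn[OF i] by simp
  hence "p^2 * (n i \<bullet> x)^2 <= p^2 * ((p^2 + 2) * (x \<bullet> x))" by (rule mult_left_mono) simp
  also have "... <= (p^2 * (p^2 + 2)) * (1 + x \<bullet> x)" by (simp add: algebra_simps)
  also have "... < ((p^2 + 1)^2) * (1 + x \<bullet> x)"
   by (rule mult_strict_right_mono) (simp_all add: power2_eq_square algebra_simps add_pos_nonneg)
  finally have "(p * (n i \<bullet> x))^2 < ((p^2 + 1) * hs x)^2" by (simp add: power_mult_distrib hs_sq)
  thus ?thesis by (rule power_less_imp_less_base) (use hs_pos(1)[of x] in \<open>simp add: add_nonneg_nonneg\<close>)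
 qed
 hence "0 <= hs x - p * L i x" by (simp add: L_def power2_eq_square algebra_simps)
 thus ?thesis unfolding hs_def[of "refl i x"] sq by simp
qed

lemma L_refl:
 assumes "i \<in> I"
 shows "L j (refl i x) = L j x - (n i \<bullet> n j - p^2) * L i x" unfolding L_def[of j] hs_refl[OF assms]
 by (simp add: refl_def inner_diff_right inner_commute power2_eq_square algebra_simps)

lemma L_refl_self: "i \<in> I ==> L i (refl i x) = - L i x"
 using L_refl[of i i x] nn[of i] by simp

lemma L_refl_adj: "adj i j ==> L j (refl i x) = L j x"
 using L_refl[of i j x] by (simp add: adj_def)

lemma refl_refl: "i \<in> I ==> refl i (refl i x) = x"
 using L_refl_self[of i x] by (simp add: refl_def[of i "refl i x"]) (simp add: refl_def)

lemma refl_commute: "adj i j ==> refl i (refl j x) = refl j (refl i x)"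
 using L_refl_adj[of i j x] L_refl_adj[of j i x] adj_sym[of i j]
 by (simp add: refl_def[of i "refl j x"] refl_def[of j "refl i x"]) (simp add: refl_def algebra_simps)

lemma continuous_hs: "continuous_on S hs"
 unfolding hs_def by (intro continuous_intros)

lemma continuous_L: "continuous_on S (L i)"
 unfolding L_def by (intro continuous_intros continuous_hs)

lemma continuous_refl: "continuous_on S (refl i)"
 unfolding refl_def by (intro continuous_intros continuous_L)

lemma L_zero: "L i 0 < 0" using p by (simp add: L_def hs_def)

lemma L_nonadj:
 assumes ij: "i \<in> I" "j \<in> I" "i ~= j" "~ adj i j" "L i x >= 0"
 shows "L j x < 0"
proof (rule ccontr)
 assume "~ L j x < 0"
 hence s: "2 * p * hs x <= (n i + n j) \<bullet> x" using ij(5) by (simp add: L_def inner_add_left)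
 have "n i \<bullet> n j <= p^2 - 2" using ij nij[of i j] by (auto simp: adj_def)
 hence "(n i + n j) \<bullet> (n i + n j) <= 4 * p^2" using nn ij by (simp add: inner_add_left inner_add_right inner_commute)
 hence "((n i + n j) \<bullet> x)^2 <= (4 * p^2) * (x \<bullet> x)"
  using Cauchy_Schwarz_ineq[of "n i + n j" x] by (meson inner_ge_zero mult_right_mono order_trans)
 also have "... < (4 * p^2) * (1 + x \<bullet> x)" using p by simp
 also have "... = (2 * p * hs x)^2" by (simp add: power_mult_distrib hs_sq)
 finally have "((n i + n j) \<bullet> x)^2 < (2 * p * hs x)^2" .
 moreover have "0 <= 2 * p * hs x" using p hs_pos(1)[of x] by simp
 hence "(2 * p * hs x)^2 <= ((n i + n j) \<bullet> x)^2" by (rule power_mono[OF s])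
 ultimately show False by linarith
qed

definition ev :: "'i list => real^3 => real^3" where
 "ev w = foldr refl w"

lemma ev_simps [simp]: "ev [] x = x" "ev (i # w) x = refl i (ev w x)" "ev (u @ v) x = ev u (ev v x)"
 by (simp_all add: ev_def)

inductive weq :: "'i list => 'i list => bool" where
 weq_refl: "weq w w"
| weq_sym: "weq u v ==> weq v u"
| weq_trans: "weq u v ==> weq v w ==> weq u w"
| weq_Cons: "weq u v ==> weq (i # u) (i # v)"
| weq_cancel: "i \<in> I ==> weq (i # i # w) w"
| weq_swap: "adj i j ==> weq (i # j # w) (j # i # w)"

lemma weq_ev: "weq u v ==> ev u x = ev v x"
 by (induction rule: weq.induct) (auto simp: refl_refl intro: refl_commute)

lemma weq_parity: "weq u v ==> even (length u) = even (length v)"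
 by (induction rule: weq.induct) auto

lemma weq_set: "weq u v ==> (set u \<subseteq> I) = (set v \<subseteq> I)"
 by (induction rule: weq.induct) (auto simp: adj_def)

lemma weq_append: "weq u v ==> weq (w @ u) (w @ v)"
 by (induction w) (auto intro: weq_Cons)

lemma weq_append2: "weq u v ==> weq (u @ w) (v @ w)"
 by (induction rule: weq.induct) (auto intro: weq.intros)

lemma weq_rev: "set w \<subseteq> I ==> weq (rev w @ w) []"
proof (induction w)
 case (Cons i w)
 have "weq (rev w @ i # i # w) (rev w @ w)" by (rule weq_append, rule weq_cancel) (use Cons.prems in simp)
 thus ?case using Cons by (auto intro: weq_trans)
qed (simp add: weq_refl)

definition lw :: "'i list => nat" where
 "lw w = (LEAST l. \<exists>v. weq w v & length v = l)"

lemma lw_rep: obtains v where "weq w v" "length v = lw w"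
proof -
 have "\<exists>l v. weq w v & length v = l" using weq_refl by blast
 hence "\<exists>v. weq w v & length v = lw w" unfolding lw_def by (rule LeastI_ex)
 thus ?thesis using that by blast
qed

lemma lw_le: "weq w v ==> lw w <= length v"
 unfolding lw_def by (rule Least_le) blast

lemma lw_cong: "weq u v ==> lw u = lw v"
proof (rule antisym)
 assume uv: "weq u v"
 obtain a where "weq v a" "length a = lw v" by (rule lw_rep)
 thus "lw u <= lw v" using lw_le[of u a] weq_trans[OF uv] by simp
 obtain b where "weq u b" "length b = lw u" by (rule lw_rep)
 thus "lw v <= lw u" using lw_le[of v b] weq_trans[OF weq_sym[OF uv]] by simp
qed

lemma lw_Cons_le: "lw (i # w) <= Suc (lw w)"
proof -
 obtain v where "weq w v" "length v = lw w" by (rule lw_rep)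
 thus ?thesis using lw_le[of "i # w" "i # v"] weq_Cons by auto
qed

lemma lw_parity: "even (lw w) = even (length w)"
 using weq_parity lw_rep by metis

lemma lw_descent:
 assumes "i \<in> I" "~ lw (i # w) > lw w"
 obtains v where "weq w (i # v)" "Suc (lw v) = lw w" "lw (i # v) > lw v"
proof -
 obtain v where v: "weq (i # w) v" "length v = lw (i # w)" by (rule lw_rep)
 have wv: "weq w (i # v)" using weq_trans[OF weq_sym[OF weq_cancel[OF assms(1), of w]] weq_Cons[OF v(1)]] .
 have lv: "lw v = lw (i # w)" using lw_cong[OF v(1)] by simp
 have "lw (i # w) ~= lw w" using lw_parity[of "i # w"] lw_parity[of w] by auto
 hence "lw v < lw w" using assms(2) lv by simp
 moreover have "lw w = lw (i # v)" by (rule lw_cong[OF wv])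
 ultimately show ?thesis using that[OF wv] lw_Cons_le[of i v] by simp
qed

lemma lw_first:
 assumes "set w \<subseteq> I" "lw w ~= 0"
 obtains i v where "i \<in> I" "weq w (i # v)" "Suc (lw v) = lw w" "set v \<subseteq> I"
proof -
 obtain u where u: "weq w u" "length u = lw w" by (rule lw_rep)
 then obtain i v where iv: "u = i # v" using assms(2) by (cases u) auto
 have "set u \<subseteq> I" using weq_set[OF u(1)] assms(1) by simp
 moreover have "Suc (lw v) = lw w" using lw_le[OF weq_refl, of v] lw_Cons_le[of i v] lw_cong[OF u(1)] iv u(2) by simp
 ultimately show ?thesis using that[of i v] u(1) iv by auto
qed

text \<open>The root \<open>w\<inverse> e\<^sub>j\<close> is a nonnegative combination of simple roots if \<open>j\<close> lengthens \<open>w\<close>;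
 on points this says that \<open>L j \<circ> ev w\<close> is a nonnegative combination of the \<open>L k\<close>.\<close>

definition cone :: "(real^3 => real) set" where
 "cone = {f. \<exists>c. (\<forall>k\<in>I. c k >= 0) & (\<forall>x. f x = (\<Sum>k\<in>I. c k * L k x))}"

lemma cone_L: "j \<in> I ==> L j \<in> cone"
 unfolding cone_def
 by (intro CollectI exI[of _ "%k. if k = j then 1 else 0"]) (auto simp: fin if_distrib[of "%a. a * _"] cong: if_cong)

lemma cone_comb: "f \<in> cone ==> g \<in> cone ==> a >= 0 ==> b >= 0 ==> (%x. a * f x + b * g x) \<in> cone"
proof -
 assume fg: "f \<in> cone" "g \<in> cone" "a >= 0" "b >= 0"
 obtain c d where "\<forall>k\<in>I. c k >= 0" "!!x. f x = (\<Sum>k\<in>I. c k * L k x)" "\<forall>k\<in>I. d k >= 0" "!!x. g x = (\<Sum>k\<in>I. d k * L k x)"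
  using fg(1,2) unfolding cone_def by blast
 thus ?thesis unfolding cone_def using fg(3,4) by (intro CollectI exI[of _ "%k. a * c k + b * d k"])
   (auto simp: sum_distrib_left sum.distrib[symmetric] algebra_simps)
qed

lemma positivity:
 assumes "set w \<subseteq> I"
 shows "!!j. j \<in> I ==> lw (j # w) > lw w ==> (%x. L j (ev w x)) \<in> cone"
  and "!!i j a b. i \<in> I ==> j \<in> I ==> i ~= j ==> ~ adj i j ==> 0 <= a ==> a <= b ==> lw (j # w) > lw w ==>
   (%x. a * L i (ev w x) + b * L j (ev w x)) \<in> cone"
proof -
 have "(\<forall>j\<in>I. lw (j # w) > lw w --> (%x. L j (ev w x)) \<in> cone) &
  (\<forall>i\<in>I. \<forall>j\<in>I. \<forall>a b. i ~= j --> ~ adj i j --> 0 <= a --> a <= b --> lw (j # w) > lw w -->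
   (%x. a * L i (ev w x) + b * L j (ev w x)) \<in> cone)" using assms
 proof (induction "lw w" arbitrary: w rule: less_induct)
  case less
  have ih: "(%x. a * L i (ev v x) + b * L j (ev v x)) \<in> cone"
   if "lw v < lw w" "set v \<subseteq> I" "i \<in> I" "j \<in> I" "i ~= j" "~ adj i j" "0 <= a" "a <= b" "lw (j # v) > lw v"
   for v i j a b using less.hyps[OF that(1) that(2)] that(3-) by blast
  have pos: "(%x. L j (ev w x)) \<in> cone" if j: "j \<in> I" "lw (j # w) > lw w" for j
  proof (cases "lw w = 0")
   case True
   obtain v where "weq w v" "length v = lw w" by (rule lw_rep)
   hence "weq w []" using True by simp
   thus ?thesis using weq_ev[of w "[]"] cone_L[OF j(1)] by simp
  next
   case False
   then obtain k v where kv: "k \<in> I" "weq w (k # v)" "Suc (lw v) = lw w" "set v \<subseteq> I" using lw_first[OF less.prems] by metis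
   have "weq (k # w) v" using weq_trans[OF weq_Cons[OF kv(2)] weq_cancel[OF kv(1)]] .
   hence "j ~= k" using lw_cong[of "k # w" v] kv(3) j(2) by auto
   have lkv: "lw (k # v) > lw v" using lw_cong[OF kv(2)] kv(3) by simp
   have e: "L j (ev w x) = L j (refl k (ev v x))" for x using weq_ev[OF kv(2)] by simp
   show ?thesis
   proof (cases "adj k j")
    case True
    have "lw (j # v) > lw v"
    proof (rule ccontr)
     assume "~ lw (j # v) > lw v"
     then obtain u where u: "weq v (j # u)" "Suc (lw u) = lw v" by (rule lw_descent[OF j(1)])
     have "weq (j # w) (j # k # j # u)" using kv(2) u(1) by (meson weq_Cons weq_trans)
     moreover have "weq (j # k # j # u) (k # j # j # u)" using True adj_sym by (blast intro: weq_swap)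
     moreover have "weq (k # j # j # u) (k # u)" using j(1) by (blast intro: weq_Cons weq_cancel)
     ultimately have "weq (j # w) (k # u)" by (meson weq_trans)
     hence "lw (j # w) <= Suc (lw u)" using lw_cong lw_Cons_le by metis
     thus False using j(2) u(2) kv(3) by simp
    qed
    hence "(%x. L j (ev v x)) \<in> cone" using less.hyps[of v] kv j by auto
    thus ?thesis unfolding e using L_refl_adj[OF True] by simp
   next
    case False
    define b where "b = p^2 - n k \<bullet> n j"
    have b: "b >= 2" using nij[OF kv(1) j(1)] \<open>j ~= k\<close> False kv(1) j(1) by (auto simp: adj_def b_def)
    have "(%x. 1 * L j (ev v x) + b * L k (ev v x)) \<in> cone"
     by (rule ih) (use kv j lkv \<open>j ~= k\<close> False b adj_sym[of k j] in auto)
    moreover have "L j (ev w x) = 1 * L j (ev v x) + b * L k (ev v x)" for x unfolding e L_refl[OF kv(1)] by (simp add: b_def algebra_simps)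
    ultimately show ?thesis by simp
   qed
  qed
  have dih: "(%x. a * L i (ev w x) + b * L j (ev w x)) \<in> cone"
   if ij: "i \<in> I" "j \<in> I" "i ~= j" "~ adj i j" "0 <= a" "a <= b" "lw (j # w) > lw w" for i j a b
  proof (cases "lw (i # w) > lw w")
   case True
   show ?thesis by (rule cone_comb[OF pos[OF ij(1) True] pos[OF ij(2,7)]]) (use ij in auto)
  next
   case False
   then obtain v where v: "weq w (i # v)" "Suc (lw v) = lw w" "lw (i # v) > lw v" by (rule lw_descent[OF ij(1)])
   have vI: "set v \<subseteq> I" using weq_set[OF v(1)] less.prems by simp
   define c where "c = p^2 - n i \<bullet> n j"
   have c: "c >= 2" using nij[OF ij(1,2)] ij(1-4) by (auto simp: adj_def c_def)
   have "b * 2 <= b * c" using c ij(5,6) by (intro mult_left_mono) auto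
   hence bc: "b <= b * c - a" using ij(6) by simp
   have "(%x. b * L j (ev v x) + (b * c - a) * L i (ev v x)) \<in> cone" by (rule ih) (use v vI ij bc adj_sym[of i j] in auto)
   moreover have "a * L i (ev w x) + b * L j (ev w x) = b * L j (ev v x) + (b * c - a) * L i (ev v x)" for x
   proof -
    have "ev w x = refl i (ev v x)" using weq_ev[OF v(1)] by simp
    moreover have "L j (refl i y) = L j y + c * L i y" for y using L_refl[OF ij(1), of j y] by (simp add: c_def algebra_simps)
    ultimately show ?thesis using L_refl_self[OF ij(1)] by (simp add: algebra_simps)
   qed
   ultimately show ?thesis by simp
  qed
  show ?case using pos dih by blast
 qed
 thus "!!j. j \<in> I ==> lw (j # w) > lw w ==> (%x. L j (ev w x)) \<in> cone"
  and "!!i j a b. i \<in> I ==> j \<in> I ==> i ~= j ==> ~ adj i j ==> 0 <= a ==> a <= b ==> lw (j # w) > lw w ==>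
   (%x. a * L i (ev w x) + b * L j (ev w x)) \<in> cone" by blast+
qed

lemma cone_P: "f \<in> cone ==> x \<in> P ==> f x <= 0"
 unfolding cone_def P_def by (auto intro!: sum_nonpos mult_nonneg_nonpos)

lemma fundamental:
 assumes "set w \<subseteq> I" "x \<in> P" "ev w x \<in> P"
 obtains u where "weq w u" "!!i. i \<in> set u ==> i \<in> I & L i x = 0" "ev w x = x"
proof -
 have "\<exists>u. weq w u & (\<forall>i\<in>set u. i \<in> I & L i x = 0) & ev w x = x" using assms
 proof (induction "lw w" arbitrary: w rule: less_induct)
  case less
  show ?case
  proof (cases "lw w = 0")
   case True
   obtain v where "weq w v" "length v = lw w" by (rule lw_rep)
   hence "weq w []" using True by simp
   thus ?thesis using weq_ev[of w "[]"] by (intro exI[of _ "[]"]) simp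
  next
   case False
   then obtain i v where iv: "i \<in> I" "weq w (i # v)" "Suc (lw v) = lw w" "set v \<subseteq> I" using lw_first[OF less.prems(1)] by metis
   have e: "ev w x = refl i (ev v x)" using weq_ev[OF iv(2)] by simp
   have "lw (i # v) > lw v" using lw_cong[OF iv(2)] iv(3) by simp
   hence "L i (ev v x) <= 0" using cone_P[OF positivity(1)[OF iv(4,1)] less.prems(2)] by simp
   moreover have "L i (ev w x) <= 0" using less.prems(3) iv(1) by (simp add: P_def)
   ultimately have L0: "L i (ev v x) = 0" using e L_refl_self[OF iv(1)] by simp
   hence ev: "ev w x = ev v x" using e by (simp add: refl_def)
   obtain u where u: "weq v u" "\<forall>i\<in>set u. i \<in> I & L i x = 0" "ev v x = x" using less.hyps[of v] iv less.prems ev by auto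
   show ?thesis by (rule exI[of _ "i # u"]) (use u iv L0 ev in \<open>auto intro: weq_trans weq_Cons\<close>)
  qed
 qed
 thus ?thesis using that by blast
qed

lemma zero_P: "0 \<in> P" using L_zero by (auto simp: P_def less_imp_le)

end

context ra_system
begin

definition clique :: "'i set => bool" where
 "clique Z \<longleftrightarrow> Z \<subseteq> I & (\<forall>i\<in>Z. \<forall>j\<in>Z. i ~= j --> adj i j)"

definition walls :: "real^3 => 'i set" where "walls x = {i\<in>I. L i x = 0}"

lemma clique_walls: "clique (walls x)"
 using L_nonadj[of _ _ x] by (fastforce simp: clique_def walls_def)

lemma clique_subset: "clique Z ==> Y \<subseteq> Z ==> clique Y"
 by (auto simp: clique_def)

lemma L_ev_clique:
 assumes "clique Z" "distinct w" "set w \<subseteq> Z" "j \<in> Z"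
 shows "L j (ev w x) = (if j \<in> set w then - L j x else L j x)" using assms(2,3)
proof (induction w)
 case (Cons i w)
 show ?case
 proof (cases "i = j")
  case True
  thus ?thesis using Cons L_refl_self[of j] assms(1,4) by (auto simp: clique_def)
 next
  case False
  hence "adj i j" using Cons.prems assms(1,4) by (auto simp: clique_def)
  thus ?thesis using Cons False by (simp add: L_refl_adj)
 qed
qed simp

lemma ev_fixed: "(!!i. i \<in> set w ==> L i x = 0) ==> ev w x = x"
 by (induction w) (auto simp: refl_def)

lemma continuous_ev: "continuous_on S (ev w)"
proof (induction w)
 case (Cons i w)
 have "continuous_on S (refl i \<circ> ev w)" by (rule continuous_on_compose[OF Cons continuous_refl])
 thus ?case by (simp add: comp_def)
qed (simp add: continuous_on_id)

lemma weq_move: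
 "(!!k. k \<in> set a ==> adj i k) ==> weq (i # a @ b) (a @ i # b)"
proof (induction a)
 case (Cons k a)
 have "weq (i # k # a @ b) (k # i # a @ b)" using Cons.prems by (intro weq_swap) simp
 moreover have "weq (k # i # a @ b) (k # a @ i # b)" using Cons by (intro weq_Cons) simp
 ultimately show ?case using weq_trans by simp
qed (simp add: weq_refl)

lemma clique_weq_distinct:
 assumes "clique (set w)"
 obtains v where "weq w v" "distinct v" "set v \<subseteq> set w"
proof -
 have "\<exists>v. weq w v & distinct v & set v \<subseteq> set w" using assms
 proof (induction w)
  case (Cons i w)
  have "clique (set w)" by (rule clique_subset[OF Cons.prems]) auto
  then obtain v where v: "weq w v" "distinct v" "set v \<subseteq> set w" using Cons.IH by blast
  have iw: "weq (i # w) (i # v)" by (rule weq_Cons[OF v(1)])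
  show ?case
  proof (cases "i \<in> set v")
   case False
   thus ?thesis using iw v by (intro exI[of _ "i # v"]) auto
  next
   case True
   then obtain a b where ab: "v = a @ i # b" by (meson split_list)
   have "adj i k" if "k \<in> set a" for k using that ab v Cons.prems by (auto simp: clique_def)
   hence "weq (i # a @ i # b) (a @ i # i # b)" by (rule weq_move)
   moreover have "weq (a @ i # i # b) (a @ b)" by (rule weq_append, rule weq_cancel) (use Cons.prems in \<open>auto simp: clique_def\<close>)
   ultimately have "weq (i # w) (a @ b)" using iw ab weq_trans by blast
   thus ?thesis using ab v by (intro exI[of _ "a @ b"]) auto
  qed
 qed (use weq_refl in auto)
 thus ?thesis using that by blast
qed

lemma ev_rev: "set w \<subseteq> I ==> ev (rev w) (ev w x) = x"
 using weq_ev[OF weq_rev, of w x] by simp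

lemma local_cover:
 assumes "y \<in> P"
 obtains U where "open U" "y \<in> U"
  "!!x. x \<in> U ==> \<exists>w. distinct w & set w \<subseteq> I & ev w x \<in> P"
proof -
 define Z where "Z = walls y"
 have Z: "clique Z" "Z \<subseteq> I" "finite Z" using clique_walls fin finite_subset[of Z I] by (auto simp: Z_def walls_def)
 define D where "D = {w. distinct w & set w \<subseteq> Z}"
 have D: "finite D" using finite_subset_distinct[OF Z(3)] by (simp add: D_def conj_commute)
 define N where "N = {x. \<forall>j\<in>I - Z. L j x < 0}"
 have N: "open N"
 proof -
  have "N = (\<Inter>j\<in>I - Z. {x. L j x < 0})" by (auto simp: N_def)
  moreover have "open {x. L j x < 0}" for j by (rule open_Collect_less) (auto intro: continuous_L continuous_intros)
  ultimately show ?thesis using fin by auto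
 qed
 have "y \<in> N" using assms by (fastforce simp: N_def Z_def walls_def P_def)
 define U where "U = (\<Inter>w\<in>D. ev w -` N)"
 have "open U" unfolding U_def using D by (intro open_INT) (auto intro: open_vimage[OF N] continuous_ev)
 moreover have "y \<in> U" using ev_fixed[of _ y] \<open>y \<in> N\<close> by (auto simp: U_def D_def Z_def walls_def subset_iff)
 moreover have "\<exists>w. distinct w & set w \<subseteq> I & ev w x \<in> P" if x: "x \<in> U" for x
 proof -
  obtain w where w: "set w = {i\<in>Z. L i x > 0}" "distinct w" using finite_distinct_list[of "{i\<in>Z. L i x > 0}"] Z(3) by auto
  have "ev w x \<in> N" using x w by (auto simp: U_def D_def)
  moreover have "L j (ev w x) <= 0" if "j \<in> Z" for j using L_ev_clique[OF Z(1) w(2) _ that, of x] w(1) that by auto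
  ultimately have "ev w x \<in> P" using less_imp_le by (auto simp: P_def N_def)
  thus ?thesis using w Z(2) by blast
 qed
 ultimately show ?thesis using that by blast
qed

lemma norm_less_hs: "norm x <= hs x"
 by (simp add: hs_def norm_eq_sqrt_inner)

text \<open>A point of the orbit almost closest to the origin nearly lies in \<open>P\<close>; the almost closest
 points accumulate at a point of \<open>P\<close>.\<close>

lemma tiling: obtains w where "set w \<subseteq> I" "ev w x \<in> P"
proof -
 define A where "A = {ev w x | w. set w \<subseteq> I}"
 define m where "m = Inf (hs ` A)"
 have xA: "x \<in> A" unfolding A_def by (intro CollectI exI[of _ "[]"]) simp
 have bdd: "bdd_below (hs ` A)" using hs_pos(2) by (intro bdd_belowI[of _ 1]) auto
 have "\<exists>y\<in>A. hs y < m + 1 / Suc k" for k :: nat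
 proof -
  have "Inf (hs ` A) < m + 1 / Suc k" by (simp add: m_def)
  thus ?thesis using cInf_less_iff[OF _ bdd] xA by auto
 qed
 then obtain z where z: "!!k. z k \<in> A" "!!k. hs (z k) < m + 1 / Suc k" by metis
 have "z k \<in> cball 0 (m + 1)" for k
 proof -
  have "hs (z k) < m + 1" using z(2)[of k] by (rule order_less_le_trans) simp
  thus ?thesis using norm_less_hs[of "z k"] by simp
 qed
 then obtain y r where yr: "strict_mono r" "(z \<circ> r) \<longlonglongrightarrow> y"
  using compact_cball[of "0::real^3" "m + 1"] unfolding compact_eq_seq_compact_metric seq_compact_def by meson
 have "y \<in> P" unfolding P_def
 proof safe
  fix i assume i: "i \<in> I"
  have le: "p * L i (z k) <= 1 / Suc k" for k
  proof -
   obtain w where w: "z k = ev w x" "set w \<subseteq> I" using z(1)[of k] by (auto simp: A_def)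
   have "refl i (z k) \<in> A" unfolding A_def using w i by (intro CollectI exI[of _ "i # w"]) simp
   hence "m <= hs (refl i (z k))" unfolding m_def by (intro cInf_lower bdd imageI)
   thus ?thesis using z(2)[of k] by (simp add: hs_refl[OF i])
  qed
  have "isCont (L i) y" using continuous_L[of UNIV i] by (simp add: continuous_on_eq_continuous_at)
  hence "(%k. p * L i ((z \<circ> r) k)) \<longlonglongrightarrow> p * L i y"
   by (intro tendsto_intros isCont_tendsto_compose[OF _ yr(2)])
  moreover have "(%k. 1 / real (Suc (r k))) \<longlonglongrightarrow> 0"
   using LIMSEQ_subseq_LIMSEQ[OF LIMSEQ_inverse_real_of_nat yr(1)] by (simp add: comp_def inverse_eq_divide)
  ultimately have "p * L i y <= 0" by (rule LIMSEQ_le) (use le in auto)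
  thus "L i y <= 0" using p by (simp add: mult_le_0_iff)
 qed
 then obtain U where U: "open U" "y \<in> U" "!!x. x \<in> U ==> \<exists>w. distinct w & set w \<subseteq> I & ev w x \<in> P"
  using local_cover by blast
 have "eventually (%k. (z \<circ> r) k \<in> U) sequentially" using topological_tendstoD[OF yr(2) U(1,2)] .
 then obtain k where k: "(z \<circ> r) k \<in> U" using eventually_happens' by force
 obtain v where v: "set v \<subseteq> I" "ev v ((z \<circ> r) k) \<in> P" using U(3)[OF k] by blast
 obtain w where w: "(z \<circ> r) k = ev w x" "set w \<subseteq> I" using z(1)[of "r k"] by (auto simp: A_def)
 show ?thesis by (rule that[of "v @ w"]) (use v w in auto)
qed

end

abbreviation finv :: "('a => 'b) => 'b => 'a" where "finv \<equiv> inv_into UNIV"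

section \<open>Spaces glued from copies of a right-angled polyhedron\<close>

text \<open>The \<^emph>\<open>symmetries\<close> of the polyhedron. They act on points by \<open>ri h\<close>, which moves the wall of
 \<open>h i\<close> to the wall of \<open>i\<close>, hence contravariantly.\<close>

definition (in ra_system) symm :: "('i => 'i) set" where
 "symm = {h. \<exists>R. orthogonal_transformation R & (\<forall>i. R (n (h i)) = n i)}"

text \<open>The cells are copies of \<open>P\<close>. The face \<open>i\<close> of the cell \<open>c\<close> is glued to a face of the cell
 \<open>nb c i\<close>, and the symmetry \<open>gl c i\<close> maps the names of the faces of \<open>c\<close> to those of \<open>nb c i\<close> in such a
 way that it is compatible with the reflection in \<open>i\<close>. The last two axioms say that four cells
 meet around every edge and that the result of the gluing is a manifold.\<close>

locale ra_cells = ra_system UNIV n p for n :: "'i::finite => real^3" and p +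
 fixes nb :: "'c => 'i => 'c" and gl :: "'c => 'i => 'i => 'i"
 assumes n_inj: "inj n" and n_span: "span (range n) = UNIV"
  and gl_symm: "!!c i. gl c i \<in> symm"
  and nb_back: "!!c i. nb (nb c i) (gl c i i) = c"
  and gl_back: "!!c i. gl (nb c i) (gl c i i) \<circ> gl c i = id"
  and nb_square: "!!c i j. adj i j ==> nb (nb c i) (gl c i j) = nb (nb c j) (gl c j i)"
  and gl_square: "!!c i j. adj i j ==>
   gl (nb c i) (gl c i j) \<circ> gl c i = gl (nb c j) (gl c j i) \<circ> gl c j"
  and no_fix: "!!c h w Z. clique Z ==> distinct w ==> w ~= [] ==> set w \<subseteq> Z ==>
   foldl (%(c, h) i. (nb c (h i), gl c (h i) \<circ> h)) (c, id) w = (c, h) ==> h ` Z ~= Z"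
begin

definition ri :: "('i => 'i) => real^3 => real^3" where
 "ri h = (SOME R. orthogonal_transformation R & (\<forall>i. R (n (h i)) = n i))"

lemma ri: assumes "h \<in> symm" shows ri_orth: "orthogonal_transformation (ri h)" and ri_n: "ri h (n (h i)) = n i"
proof -
 have "\<exists>R. orthogonal_transformation R & (\<forall>i. R (n (h i)) = n i)" using assms by (simp add: symm_def)
 from someI_ex[OF this] have "orthogonal_transformation (ri h) & (\<forall>i. ri h (n (h i)) = n i)" unfolding ri_def .
 thus "orthogonal_transformation (ri h)" "ri h (n (h i)) = n i" by auto
qed

lemma symm_inj: "h \<in> symm ==> inj h"
proof (rule injI)
 fix i j assume "h \<in> symm" "h i = h j"
 hence "n i = n j" by (metis ri_n)
 thus "i = j" using n_inj by (simp add: inj_eq)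
qed

lemma symm_bij: "h \<in> symm ==> bij h"
 using symm_inj finite_UNIV_inj_surj[of h] by (auto simp: bij_def)

lemma symm_id: "id \<in> symm"
 unfolding symm_def by (intro CollectI exI[of _ id]) (simp add: orthogonal_transformation_id[unfolded id_def] id_def)

lemma symm_comp: "h \<in> symm ==> k \<in> symm ==> h \<circ> k \<in> symm"
 unfolding symm_def
proof (safe)
 fix R S assume R: "orthogonal_transformation R" "\<forall>i. R (n (h i)) = n i"
  and S: "orthogonal_transformation S" "\<forall>i. S (n (k i)) = n i"
 show "\<exists>R. orthogonal_transformation R & (\<forall>i. R (n ((h \<circ> k) i)) = n i)"
  by (rule exI[of _ "S \<circ> R"]) (use R S in \<open>auto intro: orthogonal_transformation_compose\<close>)
qed

lemma finite_symm: "finite symm" by (rule finite)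

lemma n_ext:
 assumes "linear f" "linear g" "!!i. f (n i) = g (n i)"
 shows "f = g"
proof
 fix x show "f x = g x" by (rule linear_eq_on_span[OF assms(1,2), of "range n"]) (use assms(3) n_span in auto)
qed

lemma ri_comp: assumes "h \<in> symm" "k \<in> symm" shows "ri (h \<circ> k) = ri k \<circ> ri h"
proof (rule n_ext)
 show "linear (ri (h \<circ> k))" using ri_orth[OF symm_comp[OF assms]] orthogonal_transformation_linear by blast
 show "linear (ri k \<circ> ri h)" using ri_orth[OF assms(1)] ri_orth[OF assms(2)] by (intro linear_compose orthogonal_transformation_linear)
 fix j
 obtain i where j: "j = (h \<circ> k) i" using symm_bij[OF symm_comp[OF assms]] by (metis bij_pointE)
 have "ri (h \<circ> k) (n j) = n i" unfolding j by (rule ri_n[OF symm_comp[OF assms]])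
 moreover have "(ri k \<circ> ri h) (n j) = n i" unfolding j using ri_n[OF assms(1)] ri_n[OF assms(2)] by simp
 ultimately show "ri (h \<circ> k) (n j) = (ri k \<circ> ri h) (n j)" by simp
qed

lemma ri_id: "ri id = id"
proof (rule n_ext)
 show "linear (ri id)" using ri_orth[OF symm_id] orthogonal_transformation_linear by blast
 show "linear (id :: real^3 => real^3)" by (simp add: linear_id)
 show "ri id (n i) = id (n i)" for i using ri_n[OF symm_id, of i] by simp
qed

lemma ri_inner: "h \<in> symm ==> ri h x \<bullet> ri h y = x \<bullet> y"
 using ri_orth by (simp add: orthogonal_transformation_def)

lemma ri_inj: "h \<in> symm ==> inj (ri h)"
 using ri_orth orthogonal_transformation_inj by blast

lemma hs_ri: "h \<in> symm ==> hs (ri h x) = hs x"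
 by (simp add: hs_def ri_inner)

lemma L_ri: "h \<in> symm ==> L i (ri h x) = L (h i) x"
 using ri_inner[of h "n (h i)" x] by (simp add: L_def hs_ri ri_n)

lemma ri_diff: "h \<in> symm ==> ri h (x - a *\<^sub>R y) = ri h x - a *\<^sub>R ri h y"
 using orthogonal_transformation_linear[OF ri_orth] by (simp add: linear_diff linear_scale)

lemma refl_ri: "h \<in> symm ==> refl i (ri h x) = ri h (refl (h i) x)"
 by (simp add: refl_def L_ri ri_diff ri_n)

lemma ev_ri: "h \<in> symm ==> ev w (ri h x) = ri h (ev (map h w) x)"
 by (induction w) (auto simp: refl_ri)

lemma ri_P: "h \<in> symm ==> ri h x \<in> P \<longleftrightarrow> x \<in> P"
proof -
 assume h: "h \<in> symm"
 have "(\<forall>i. L (h i) x <= 0) \<longleftrightarrow> (\<forall>i. L i x <= 0)" using symm_bij[OF h] by (metis bij_pointE)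
 thus ?thesis by (simp add: P_def L_ri[OF h])
qed

lemma ri_zero: "h \<in> symm ==> ri h 0 = 0"
 using orthogonal_transformation_linear[OF ri_orth] linear_0 by blast

lemma continuous_ri: "h \<in> symm ==> continuous_on S (ri h)"
 using orthogonal_transformation_linear[OF ri_orth] linear_continuous_on linear_conv_bounded_linear by blast

lemma adj_symm: "h \<in> symm ==> adj (h i) (h j) \<longleftrightarrow> adj i j"
proof -
 assume h: "h \<in> symm"
 have "n (h i) \<bullet> n (h j) = n i \<bullet> n j" using ri_inner[OF h, of "n (h i)" "n (h j)"] ri_n[OF h] by simp
 thus ?thesis using symm_inj[OF h] by (simp add: adj_def inj_eq)
qed

definition step :: "'c \<times> ('i => 'i) => 'i => 'c \<times> ('i => 'i)" where
 "step = (%(c, h) i. (nb c (h i), gl c (h i) \<circ> h))"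

definition run :: "'c \<times> ('i => 'i) => 'i list => 'c \<times> ('i => 'i)" where
 "run = foldl step"

lemma run_simps [simp]: "run s [] = s" "run s (i # w) = run (step s i) w" "run s (u @ v) = run (run s u) v"
 by (simp_all add: run_def)

lemma step_simp: "step (c, h) i = (nb c (h i), gl c (h i) \<circ> h)" by (simp add: step_def)

lemma run_comp: "run (c, h \<circ> k) w = (fst (run (c, h) (map k w)), snd (run (c, h) (map k w)) \<circ> k)"
proof (induction w arbitrary: c h)
 case (Cons i w)
 have "run (c, h \<circ> k) (i # w) = run (nb c (h (k i)), (gl c (h (k i)) \<circ> h) \<circ> k) w" by (simp add: step_simp comp_assoc)
 also note Cons
 finally show ?case unfolding list.map run_simps step_simp .
qed simp

lemma run_base: "run (c, h) w = (fst (run (c, id) (map h w)), snd (run (c, id) (map h w)) \<circ> h)"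
 using run_comp[of c id h w] by simp

lemma run_symm: "h \<in> symm ==> snd (run (c, h) w) \<in> symm"
proof (induction w arbitrary: c h)
 case (Cons i w)
 show ?case unfolding run_simps step_simp by (rule Cons.IH[OF symm_comp[OF gl_symm Cons.prems]])
qed simp

lemma step_back: "step (step (c, h) i) i = (c, h)"
 using nb_back[of c "h i"] gl_back[of c "h i"] by (simp add: step_simp comp_assoc[symmetric])

lemma step_square: "h \<in> symm ==> adj i j ==> step (step (c, h) i) j = step (step (c, h) j) i"
 using nb_square[of "h i" "h j" c] gl_square[of "h i" "h j" c] adj_symm[of h i j] by (simp add: step_simp comp_assoc[symmetric])

lemma run_weq: "weq u v ==> h \<in> symm ==> run (c, h) u = run (c, h) v"
proof (induction arbitrary: c h rule: weq.induct)
 case (weq_Cons u v i)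
 show ?case unfolding run_simps step_simp by (rule weq_Cons.IH[OF symm_comp[OF gl_symm weq_Cons.prems]])
next
 case (weq_cancel i w) show ?case using step_back[of c h i] by simp
next
 case (weq_swap i j w) show ?case using step_square[OF weq_swap.prems weq_swap.hyps] by simp
qed auto

definition Mor :: "'c => 'c => (real^3 => real^3) set" where
 "Mor c d = {ev w \<circ> ri h | w h. run (c, id) w = (d, h)}"

lemma MorE:
 assumes "f \<in> Mor c d"
 obtains w h where "f = ev w \<circ> ri h" "run (c, id) w = (d, h)" "h \<in> symm"
 using assms run_symm[OF symm_id] unfolding Mor_def by (smt (verit) mem_Collect_eq snd_conv)

lemma MorI: "run (c, id) w = (d, h) ==> ev w \<circ> ri h \<in> Mor c d"
 by (auto simp: Mor_def)

lemma ev_ri_unique: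
 assumes "h \<in> symm" "k \<in> symm" "ev u \<circ> ri h = ev v \<circ> ri k"
 shows "h = k" "weq u v"
proof -
 have "ev u (ri h 0) = ev v (ri k 0)" using fun_cong[OF assms(3), of 0] by simp
 hence e: "ev u 0 = ev v 0" by (simp add: ri_zero[OF assms(1)] ri_zero[OF assms(2)])
 have "ev (rev v @ u) 0 = 0" using e ev_rev[of v 0] by simp
 hence inP: "ev (rev v @ u) 0 \<in> P" using zero_P by simp
 obtain w where w: "weq (rev v @ u) w" "!!i. i \<in> set w ==> i \<in> UNIV & L i 0 = 0" "ev (rev v @ u) 0 = 0"
  by (rule fundamental[OF _ zero_P inP], simp, blast)
 have "w = []"
 proof (rule ccontr)
  assume "w ~= []"
  hence "L (hd w) 0 = 0" using w(2)[of "hd w"] by simp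
  thus False using L_zero[of "hd w"] by simp
 qed
 hence a: "weq (v @ rev v @ u) v" using weq_append[OF w(1), of v] by simp
 have b: "weq (v @ rev v @ u) u" using weq_append2[OF weq_rev[of "rev v"], of u] by simp
 show uv: "weq u v" by (rule weq_trans[OF weq_sym[OF b] a])
 have "ri h x = ri k x" for x
 proof -
  have "ev v (ri h x) = ev v (ri k x)" using assms(3) weq_ev[OF uv] by (auto simp: fun_eq_iff)
  thus ?thesis using ev_rev[of v] by (metis subset_UNIV)
 qed
 hence rhk: "ri h = ri k" by auto
 have "n (h i) = n (k i)" for i using ri_n[OF assms(1), of i] ri_n[OF assms(2), of i] ri_inj[OF assms(1)] rhk by (metis injD)
 thus "h = k" using n_inj by (auto simp: inj_eq)
qed

lemma Mor_id: "id \<in> Mor c c"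
proof -
 have "ev [] \<circ> ri id = id" by (simp add: ri_id fun_eq_iff)
 thus ?thesis using MorI[of c "[]" c id] by simp
qed

lemma Mor_comp:
 assumes "f \<in> Mor c d" "g \<in> Mor d e"
 shows "f \<circ> g \<in> Mor c e"
proof -
 obtain w h where f: "f = ev w \<circ> ri h" "run (c, id) w = (d, h)" "h \<in> symm" using MorE[OF assms(1)] .
 obtain u k where g: "g = ev u \<circ> ri k" "run (d, id) u = (e, k)" "k \<in> symm" using MorE[OF assms(2)] .
 define v where "v = map (finv h) u"
 have v: "map h v = u" using symm_bij[OF f(3)] by (simp add: v_def bij_is_surj surj_f_inv_f o_def)
 have "f \<circ> g = ev (w @ v) \<circ> ri (k \<circ> h)"
  using ev_ri[OF f(3), of v] ri_comp[OF g(3) f(3)] by (auto simp: f(1) g(1) v fun_eq_iff)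
 moreover have "run (c, id) (w @ v) = (e, k \<circ> h)" using run_base[of d h v] f(2) g(2) v by simp
 ultimately show ?thesis using MorI[of c "w @ v" e "k \<circ> h"] by simp
qed

lemma ev_inj: "inj (ev w)"
 by (rule injI) (metis ev_rev subset_UNIV)

lemma Mor_inv:
 assumes "f \<in> Mor c d"
 shows "bij f" "finv f \<in> Mor d c"
proof -
 obtain w h where f: "f = ev w \<circ> ri h" "run (c, id) w = (d, h)" "h \<in> symm" using MorE[OF assms] .
 define v where "v = map h (rev w)"
 have "run (c, id) (w @ rev w) = run (c, id) []" using weq_rev[of "rev w"] by (intro run_weq symm_id) simp
 hence "run (d, h) (rev w) = (c, id)" using f(2) by simp
 then obtain k where k: "run (d, id) v = (c, k)" "k \<circ> h = id" using run_base[of d h "rev w"] by (cases "run (d, id) v") (auto simp: v_def)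
 have ks: "k \<in> symm" using run_symm[OF symm_id, of d v] k(1) by simp
 define g where "g = ev v \<circ> ri k"
 have fg: "f (g x) = x" for x
 proof -
  have "f (g x) = ev w (ev (rev w) (ri h (ri k x)))" by (simp add: f(1) g_def v_def ev_ri[OF f(3)])
  also have "... = ri (k \<circ> h) x" using ev_rev[of "rev w"] ri_comp[OF ks f(3)] by simp
  finally show ?thesis using k(2) by (simp add: ri_id)
 qed
 have "inj f" unfolding f(1) by (rule inj_compose[OF ev_inj ri_inj[OF f(3)]])
 moreover have "surj f" using fg by (metis surj_def)
 ultimately show b: "bij f" by (simp add: bij_def)
 have "finv f = g" using fg \<open>inj f\<close> by (intro inv_equality) (auto intro: injD)
 thus "finv f \<in> Mor d c" using MorI[OF k(1)] g_def by simp
qed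

definition gen :: "'c => 'i => real^3 => real^3" where "gen c i = refl i \<circ> ri (gl c i)"

lemma gen_Mor: "gen c i \<in> Mor c (nb c i)"
 using MorI[of c "[i]" "nb c i" "gl c i"] by (simp add: gen_def step_simp comp_def)

lemma Mor_induct [consumes 1, case_names id gen]:
 assumes "f \<in> Mor c d"
  and "!!c. Q c c id"
  and "!!c d i g. g \<in> Mor (nb c i) d ==> Q (nb c i) d g ==> Q c d (gen c i \<circ> g)"
 shows "Q c d f"
proof -
 have "Q c d (ev w \<circ> ri h)" if "run (c, id) w = (d, h)" for w h using that
 proof (induction "length w" arbitrary: w c h)
  case 0
  thus ?case using assms(2)[of c] ri_id by (simp add: comp_def id_def)
 next
  case (Suc l)
  then obtain i v where w: "w = i # v" "length v = l" by (cases w) auto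
  define k where "k = gl c i"
  have k: "k \<in> symm" by (simp add: k_def gl_symm)
  obtain m where m: "run (nb c i, id) (map k v) = (d, m)" "h = m \<circ> k"
   using Suc.prems run_base[of "nb c i" k v] w(1) by (cases "run (nb c i, id) (map k v)") (auto simp: step_simp k_def)
  have ms: "m \<in> symm" using run_symm[OF symm_id, of "nb c i" "map k v"] m(1) by simp
  have "Q c d (gen c i \<circ> (ev (map k v) \<circ> ri m))" by (rule assms(3)[OF MorI[OF m(1)] Suc.hyps(1)[OF _ m(1)]]) (use w in simp)
  moreover have "gen c i \<circ> (ev (map k v) \<circ> ri m) = ev w \<circ> ri h"
   by (simp add: gen_def w(1) m(2) ri_comp[OF ms k] ev_ri[OF k] refl_ri[OF k] k_def[symmetric] fun_eq_iff)
  ultimately show ?case by simp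
 qed
 thus ?thesis using assms(1) unfolding Mor_def by blast
qed

lemma gen_back: "gen c i \<circ> gen (nb c i) (gl c i i) = id"
proof -
 have "gen c i (gen (nb c i) (gl c i i) x) = x" for x
 proof -
  have "ri (gl c i) (refl (gl c i i) y) = refl i (ri (gl c i) y)" for y by (simp add: refl_ri gl_symm)
  hence "gen c i (gen (nb c i) (gl c i i) x) = ri (gl c i) (ri (gl (nb c i) (gl c i i)) x)" by (simp add: gen_def refl_refl)
  also have "... = x" using ri_comp[OF gl_symm gl_symm, of "nb c i" "gl c i i" c i] gl_back[of c i] ri_id by (metis comp_apply id_apply)
  finally show ?thesis .
 qed
 thus ?thesis by (simp add: fun_eq_iff)
qed

lemma gen_gen: "gen c i (gen (nb c i) (gl c i j) x) = refl i (refl j (ri (gl (nb c i) (gl c i j) \<circ> gl c i) x))"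
 by (simp add: gen_def ri_comp gl_symm refl_ri)

lemma gen_square: "adj i j ==>
 gen c i \<circ> gen (nb c i) (gl c i j) = gen c j \<circ> gen (nb c j) (gl c j i)"
proof
 fix x assume a: "adj i j"
 show "(gen c i \<circ> gen (nb c i) (gl c i j)) x = (gen c j \<circ> gen (nb c j) (gl c j i)) x"
  unfolding comp_apply gen_gen gl_square[OF a] by (rule refl_commute[OF a])
qed

lemma Mor_continuous: "f \<in> Mor c d ==> continuous_on S f"
proof -
 assume "f \<in> Mor c d"
 then obtain w h where f: "f = ev w \<circ> ri h" "h \<in> symm" by (rule MorE)
 show ?thesis unfolding f(1) by (rule continuous_on_compose[OF continuous_ri[OF f(2)] continuous_ev])
qed

lemma Mor_cover:
 obtains d f y where "f \<in> Mor c d" "y \<in> P" "x = f y"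
proof -
 obtain w where w: "ev w x \<in> P" by (rule tiling)
 obtain d h where dh: "run (c, id) (rev w) = (d, h)" by fastforce
 have h: "h \<in> symm" using run_symm[OF symm_id, of c "rev w"] dh by simp
 obtain y where y: "ri h y = ev w x" using orthogonal_transformation_surj[OF ri_orth[OF h]] by (metis surjD)
 show ?thesis
 proof (rule that[OF MorI[OF dh]])
  show "y \<in> P" using w y ri_P[OF h] by metis
  show "x = (ev (rev w) \<circ> ri h) y" using y ev_rev[of w x] by simp
 qed
qed

lemma Mor_free:
 assumes "f \<in> Mor c c" "f x = x"
 shows "f = id"
proof -
 obtain d e y where e: "e \<in> Mor c d" "y \<in> P" "x = e y" by (rule Mor_cover)
 define g where "g = finv e \<circ> f \<circ> e"
 have gM: "g \<in> Mor d d" unfolding g_def using Mor_comp Mor_inv[OF e(1)] e(1) assms(1) by blast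
 have gy: "g y = y" using assms(2) e(3) Mor_inv(1)[OF e(1)] by (simp add: g_def bij_is_inj)
 obtain w h where g: "g = ev w \<circ> ri h" "run (d, id) w = (d, h)" "h \<in> symm" using MorE[OF gM] .
 have hyP: "ri h y \<in> P" using e(2) ri_P[OF g(3)] by simp
 have "ev w (ri h y) \<in> P" using gy g(1) e(2) by simp
 then obtain u where u: "weq w u" "!!i. i \<in> set u ==> i \<in> UNIV & L i (ri h y) = 0" "ev w (ri h y) = ri h y"
  by (rule fundamental[OF _ hyP, rotated], simp, blast)
 have hy: "ri h y = y" using u(3) gy g(1) by simp
 have "clique (set u)" by (rule clique_subset[OF clique_walls[of y]]) (use u(2) hy in \<open>auto simp: walls_def\<close>)
 then obtain v where v: "weq u v" "distinct v" "set v \<subseteq> set u" using clique_weq_distinct by blast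
 have wv: "weq w v" by (rule weq_trans[OF u(1) v(1)])
 have rv: "run (d, id) v = (d, h)" using run_weq[OF wv symm_id] g(2) by simp
 have hZ: "h ` walls y = walls y"
 proof -
  have iff: "i \<in> walls y \<longleftrightarrow> h i \<in> walls y" for i using L_ri[OF g(3), of i y] hy by (simp add: walls_def)
  show ?thesis
  proof (rule subset_antisym)
   show "h ` walls y \<subseteq> walls y" using iff by blast
   show "walls y \<subseteq> h ` walls y"
   proof
    fix j assume j: "j \<in> walls y"
    obtain i where "j = h i" using symm_bij[OF g(3)] by (metis bij_pointE)
    thus "j \<in> h ` walls y" using iff[of i] j by blast
   qed
  qed
 qed
 have vZ: "set v \<subseteq> walls y" using v(3) u(2) hy by (auto simp: walls_def)
 have "v = []" using no_fix[OF clique_walls[of y] v(2) _ vZ, of d h] rv hZ by (auto simp: run_def step_def)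
 hence h: "h = id" and ew: "ev w z = z" for z using rv weq_ev[OF wv, of z] by auto
 have "g z = z" for z unfolding g(1) comp_apply ew unfolding h ri_id by simp
 hence fe: "f (e z) = e z" for z using Mor_inv(1)[OF e(1)] by (metis g_def comp_apply bij_inv_eq_iff)
 show "f = id"
 proof
  fix z
  obtain y where "z = e y" using Mor_inv(1)[OF e(1)] by (metis bij_pointE)
  thus "f z = id z" using fe by simp
 qed
qed

definition whole :: "(real^3 => real^3) set" where "whole = {ev w \<circ> ri h | w h. h \<in> symm}"

lemma Mor_whole: "Mor c d \<subseteq> whole"
 unfolding whole_def using MorE by blast

lemma whole_comp:
 assumes "f \<in> whole" "g \<in> whole" shows "f \<circ> g \<in> whole"
proof -
 obtain w h where f: "f = ev w \<circ> ri h" "h \<in> symm" using assms(1) unfolding whole_def by blast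
 obtain u k where g: "g = ev u \<circ> ri k" "k \<in> symm" using assms(2) unfolding whole_def by blast
 define v where "v = map (finv h) u"
 have v: "map h v = u" using symm_bij[OF f(2)] by (simp add: v_def bij_is_surj surj_f_inv_f o_def)
 have "f \<circ> g = ev (w @ v) \<circ> ri (k \<circ> h)"
  using ev_ri[OF f(2), of v] ri_comp[OF g(2) f(2)] by (auto simp: f(1) g(1) v fun_eq_iff)
 thus ?thesis unfolding whole_def using symm_comp[OF g(2) f(2)] by blast
qed

lemma whole_ev: "ev w \<in> whole"
 unfolding whole_def by (intro CollectI exI[of _ w] exI[of _ id]) (simp add: symm_id ri_id)

lemma finite_overlap: "finite {g \<in> whole. \<exists>y\<in>P. g y \<in> P}"
proof (rule finite_subset)
 show "{g \<in> whole. \<exists>y\<in>P. g y \<in> P} \<subseteq> (%(v, h). ev v \<circ> ri h) ` ({v. set v \<subseteq> UNIV & distinct v} \<times> symm)"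
 proof (rule subsetI, safe)
  fix g y assume g: "g \<in> whole" "y \<in> P" "g y \<in> P"
  obtain w h where wh: "g = ev w \<circ> ri h" "h \<in> symm" using g(1) unfolding whole_def by blast
  have hyP: "ri h y \<in> P" using g(2) ri_P[OF wh(2)] by simp
  have "ev w (ri h y) \<in> P" using g(3) wh by simp
  then obtain u where u: "weq w u" "!!i. i \<in> set u ==> i \<in> UNIV & L i (ri h y) = 0" "ev w (ri h y) = ri h y"
   by (rule fundamental[OF _ hyP, rotated], simp, blast)
  have "clique (set u)" by (rule clique_subset[OF clique_walls[of "ri h y"]]) (use u(2) in \<open>auto simp: walls_def\<close>)
  then obtain v where v: "weq u v" "distinct v" "set v \<subseteq> set u" using clique_weq_distinct by blast
  have "ev w = ev v" using weq_ev[OF weq_trans[OF u(1) v(1)]] by auto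
  thus "g \<in> (%(v, h). ev v \<circ> ri h) ` ({v. set v \<subseteq> UNIV & distinct v} \<times> symm)"
   using wh v(2) by (intro image_eqI[of _ _ "(v, h)"]) auto
 qed
 show "finite ((%(v, h). ev v \<circ> ri h) ` ({v. set v \<subseteq> UNIV & distinct v} \<times> symm))"
  using finite_subset_distinct[of "UNIV :: 'i set"] finite_symm by (intro finite_imageI finite_cartesian_product) auto
qed

lemma whole_inv:
 assumes "f \<in> whole" shows "bij f" "finv f \<in> whole"
proof -
 obtain w h where f: "f = ev w \<circ> ri h" "h \<in> symm" using assms unfolding whole_def by blast
 have "surj (ev w)" using ev_rev[of "rev w"] by (metis subset_UNIV rev_rev_ident surjI)
 moreover have "surj (ri h)" using orthogonal_transformation_surj[OF ri_orth[OF f(2)]] .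
 ultimately have "surj (ev w \<circ> ri h)" by (intro comp_surj)
 moreover have "inj (ev w \<circ> ri h)" by (rule inj_compose[OF ev_inj ri_inj[OF f(2)]])
 ultimately show b: "bij f" unfolding f(1) bij_def by simp
 define k where "k = finv h"
 have "bij k" unfolding k_def by (rule bij_imp_bij_inv[OF symm_bij[OF f(2)]])
 have kh: "k \<circ> h = id" "h \<circ> k = id" using symm_bij[OF f(2)] by (auto simp: k_def fun_eq_iff bij_is_inj bij_is_surj surj_f_inv_f)
 have ks: "k \<in> symm"
 proof -
  have "orthogonal_transformation (finv (ri h))" by (rule orthogonal_transformation_inv[OF ri_orth[OF f(2)]])
  moreover have "finv (ri h) (n (k i)) = n i" for i
  proof (rule inv_f_eq[OF ri_inj[OF f(2)]])
   have "h (k i) = i" using kh(2) by (metis comp_apply id_apply)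
   thus "ri h (n i) = n (k i)" using ri_n[OF f(2), of "k i"] by simp
  qed
  ultimately show ?thesis unfolding symm_def by blast
 qed
 define g where "g = ri k \<circ> ev (rev w)"
 have "f (g x) = x" for x
 proof -
  have "f (g x) = ev w (ri (k \<circ> h) (ev (rev w) x))" by (simp add: f(1) g_def ri_comp[OF ks f(2)])
  thus ?thesis using ev_rev[of "rev w" x] by (simp add: kh ri_id)
 qed
 hence "finv f = g" using b by (intro inv_equality) (metis bij_inv_eq_iff)+
 moreover have "g = ri k \<circ> ev []  \<circ> ev (rev w)" by (simp add: g_def fun_eq_iff)
 moreover have "ri k \<in> whole" unfolding whole_def using ks by (intro CollectI exI[of _ "[]"] exI[of _ k]) (simp add: fun_eq_iff)
 ultimately show "finv f \<in> whole" using whole_comp[OF _ whole_ev, of "ri k" "rev w"] g_def by simp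
qed

lemma finite_cover_nbhd:
 obtains U E where "open U" "x \<in> U" "finite E" "E \<subseteq> whole" "!!z. z \<in> U ==> \<exists>e\<in>E. e z \<in> P"
proof -
 obtain v where v: "ev v x \<in> P" by (rule tiling)
 obtain V where V: "open V" "ev v x \<in> V" "!!z. z \<in> V ==> \<exists>w. distinct w & set w \<subseteq> UNIV & ev w z \<in> P"
  using local_cover[OF v] by metis
 define U where "U = ev v -` V"
 define E where "E = (%w. ev (w @ v)) ` {w. set w \<subseteq> (UNIV::'i set) & distinct w}"
 show ?thesis
 proof (rule that[of U E])
  show "open U" unfolding U_def by (rule open_vimage[OF V(1) continuous_ev])
  show "x \<in> U" using V(2) by (simp add: U_def)
  show "finite E" unfolding E_def by (intro finite_imageI finite_subset_distinct) simp
  show "E \<subseteq> whole" using whole_ev by (auto simp: E_def)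
  show "\<exists>e\<in>E. e z \<in> P" if "z \<in> U" for z using V(3)[of "ev v z"] that by (force simp: E_def U_def)
 qed
qed

lemma locally_finite:
 obtains U V where "open U" "x \<in> U" "open V" "y \<in> V" "finite {g \<in> whole. g ` U \<inter> V ~= {}}"
proof -
 obtain U E where U: "open U" "x \<in> U" "finite E" "E \<subseteq> whole" "!!z. z \<in> U ==> \<exists>e\<in>E. e z \<in> P"
  using finite_cover_nbhd[of x] by metis
 obtain V D where V: "open V" "y \<in> V" "finite D" "D \<subseteq> whole" "!!z. z \<in> V ==> \<exists>e\<in>D. e z \<in> P"
  using finite_cover_nbhd[of y] by metis
 define F where "F = {g \<in> whole. \<exists>y\<in>P. g y \<in> P}"
 have "{g \<in> whole. g ` U \<inter> V ~= {}} \<subseteq> (%(d, f, e). finv d \<circ> f \<circ> e) ` (D \<times> F \<times> E)"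
 proof (rule subsetI)
  fix g assume "g \<in> {g \<in> whole. g ` U \<inter> V ~= {}}"
  then obtain z where g: "g \<in> whole" and z: "z \<in> U" "g z \<in> V" by blast
  obtain e where e: "e \<in> E" "e z \<in> P" using U(5)[OF z(1)] by blast
  obtain d where d: "d \<in> D" "d (g z) \<in> P" using V(5)[OF z(2)] by blast
  define f where "f = d \<circ> g \<circ> finv e"
  have w: "e \<in> whole" "d \<in> whole" using U(4) V(4) e d by auto
  have be: "bij e" "bij d" using whole_inv(1) w by auto
  have "f \<in> whole" unfolding f_def using whole_comp whole_inv(2) w g by blast
  moreover have "f (e z) \<in> P" using d(2) be by (simp add: f_def bij_is_inj)
  ultimately have "f \<in> F" using e(2) by (auto simp: F_def)
  moreover have "g = finv d \<circ> f \<circ> e" using be by (simp add: f_def fun_eq_iff bij_is_inj)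
  ultimately show "g \<in> (%(d, f, e). finv d \<circ> f \<circ> e) ` (D \<times> F \<times> E)"
   using e d by (intro image_eqI[of _ _ "(d, f, e)"]) auto
 qed
 moreover have "finite ((%(d, f, e). finv d \<circ> f \<circ> e) ` (D \<times> F \<times> E))"
  using U(3) V(3) finite_overlap unfolding F_def by (intro finite_imageI finite_cartesian_product)
 ultimately have "finite {g \<in> whole. g ` U \<inter> V ~= {}}" by (rule finite_subset)
 thus ?thesis using that U(1,2) V(1,2) by blast
qed

lemma Mor_separate:
 assumes "D \<subseteq> Mor c c" "!!g. g \<in> D ==> g x ~= y"
 obtains U V where "open U" "open V" "x \<in> U" "y \<in> V" "!!g. g \<in> D ==> g ` U \<inter> V = {}"
proof -
 obtain U V where UV: "open U" "x \<in> U" "open V" "y \<in> V" "finite {g \<in> whole. g ` U \<inter> V ~= {}}" by (rule locally_finite)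
 define E where "E = {g \<in> D. g ` U \<inter> V ~= {}}"
 have E: "finite E" by (rule finite_subset[OF _ UV(5)]) (use Mor_whole assms(1) in \<open>auto simp: E_def\<close>)
 have "\<exists>A B. open A & x \<in> A & open B & y \<in> B & g ` A \<inter> B = {}" if g: "g \<in> E" for g
 proof -
  have gD: "g \<in> D" "g \<in> Mor c c" using g assms(1) by (auto simp: E_def)
  obtain A B where AB: "open A" "open B" "g x \<in> A" "y \<in> B" "A \<inter> B = {}" using hausdorff[OF assms(2)[OF gD(1)]] by blast
  have "open (g -` A)" by (rule open_vimage[OF AB(1) Mor_continuous[OF gD(2)]])
  thus ?thesis using AB by (intro exI[of _ "g -` A"] exI[of _ B]) auto
 qed
 then obtain A B where AB: "!!g. g \<in> E ==> open (A g) & x \<in> A g & open (B g) & y \<in> B g & g ` A g \<inter> B g = {}" by metis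
 define U' where "U' = U \<inter> (\<Inter>g\<in>E. A g)"
 define V' where "V' = V \<inter> (\<Inter>g\<in>E. B g)"
 show ?thesis
 proof (rule that[of U' V'])
  show "open U'" "open V'" unfolding U'_def V'_def using UV AB E by (auto intro!: open_Int open_INT)
  show "x \<in> U'" "y \<in> V'" using UV AB by (auto simp: U'_def V'_def)
  show "g ` U' \<inter> V' = {}" if g: "g \<in> D" for g
  proof (cases "g \<in> E")
   case True
   have "U' \<subseteq> A g" "V' \<subseteq> B g" using True by (auto simp: U'_def V'_def)
   thus ?thesis using AB[OF True] by blast
  next
   case False
   hence "g ` U \<inter> V = {}" using g by (auto simp: E_def)
   thus ?thesis unfolding U'_def V'_def by blast
  qed
 qed
qed

lemma deck_action_Mor: "deck_action UNIV (Mor c c)"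
proof (unfold_locales)
 show "id \<in> Mor c c" by (rule Mor_id)
 show "!!g h. g \<in> Mor c c ==> h \<in> Mor c c ==> g \<circ> h \<in> Mor c c" by (rule Mor_comp)
 show "\<exists>h\<in>Mor c c. h \<circ> g = id & g \<circ> h = id" if "g \<in> Mor c c" for g
  using Mor_inv[OF that] by (intro bexI[of _ "finv g"]) (auto simp: fun_eq_iff bij_is_inj bij_is_surj surj_f_inv_f)
 show "continuous_on UNIV g" if "g \<in> Mor c c" for g using Mor_continuous[OF that] .
 fix x :: "real^3"
 have fr: "g x ~= x" if "g \<in> Mor c c - {id}" for g using that Mor_free by blast
 obtain U V where "open U" "open V" "x \<in> U" "x \<in> V" "!!g. g \<in> Mor c c - {id} ==> g ` U \<inter> V = {}"
  by (rule Mor_separate[of "Mor c c - {id}" c x x]) (rule Diff_subset, erule fr, rule that)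
 thus "\<exists>U. openin (top_of_set UNIV) U & x \<in> U & (\<forall>g\<in>Mor c c. g ~= id --> g ` U \<inter> U = {})"
  by (intro exI[of _ "U \<inter> V"]) auto
qed simp

end

context ra_cells
begin

text \<open>Cocycles with values in \<open>\<int>/q\<close>, or in \<open>\<int>\<close> for \<open>q = 0\<close>, twisted by the character \<open>K\<close>.\<close>

definition flat :: "int => ('c => 'i => int) => ('c => 'i => int) => bool" where
 "flat q K x \<longleftrightarrow> (\<forall>c i. [x c i + K c i * x (nb c i) (gl c i i) = 0] (mod q)) &
  (\<forall>c i j. adj i j -->
   [x c i + K c i * x (nb c i) (gl c i j) = x c j + K c j * x (nb c j) (gl c j i)] (mod q))"

fun wsum :: "('c => 'i => int) => 'c \<times> ('i => 'i) => 'i list => int" where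
 "wsum x s [] = 0"
| "wsum x s (i # w) = x (fst s) (snd s i) + wsum x (step s i) w"

lemma wsum_append: "wsum x s (u @ v) = wsum x s u + wsum x (run s u) v"
 by (induction u arbitrary: s) auto

lemma wsum_comp: "wsum x (c, h \<circ> k) w = wsum x (c, h) (map k w)"
proof (induction w arbitrary: c h)
 case (Cons i w)
 have "wsum x (c, h \<circ> k) (i # w) = x c (h (k i)) + wsum x (nb c (h (k i)), (gl c (h (k i)) \<circ> h) \<circ> k) w"
  by (simp add: step_simp comp_assoc)
 also note Cons
 finally show ?case unfolding list.map wsum.simps step_simp fst_conv snd_conv .
qed simp

lemma wsum_base: "wsum x (c, h) w = wsum x (c, id) (map h w)"
 using wsum_comp[of x c id h w] by simp

lemma wsum_weq:
 assumes x: "flat 0 (%_ _. 1) x"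
 shows "weq u v ==> h \<in> symm ==> wsum x (c, h) u = wsum x (c, h) v"
proof (induction arbitrary: c h rule: weq.induct)
 case (weq_Cons u v i)
 have "wsum x (step (c, h) i) u = wsum x (step (c, h) i) v" unfolding step_simp by (rule weq_Cons.IH[OF symm_comp[OF gl_symm weq_Cons.prems]])
 thus ?case by simp
next
 case (weq_cancel i w)
 have "x c (h i) + x (nb c (h i)) (gl c (h i) (h i)) = 0" using x by (simp add: flat_def cong_def)
 thus ?case using step_back[of c h i] by (simp add: step_simp)
next
 case (weq_swap i j w)
 have "adj (h i) (h j)" using adj_symm[OF weq_swap.prems] weq_swap.hyps by simp
 hence "[x c (h i) + 1 * x (nb c (h i)) (gl c (h i) (h j)) = x c (h j) + 1 * x (nb c (h j)) (gl c (h j) (h i))] (mod 0)"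
  using x unfolding flat_def by blast
 hence "x c (h i) + x (nb c (h i)) (gl c (h i) (h j)) = x c (h j) + x (nb c (h j)) (gl c (h j) (h i))" by (simp add: cong_def)
 thus ?case using step_square[OF weq_swap.prems weq_swap.hyps, of c] by (simp add: step_simp)
qed auto

definition lab_hom :: "('c => 'i => int) => 'c => (real^3 => real^3) => int" where
 "lab_hom x c f = wsum x (c, id) (SOME w. \<exists>h\<in>symm. f = ev w \<circ> ri h)"

lemma lab_hom_eq:
 assumes x: "flat 0 (%_ _. 1) x" and h: "h \<in> symm"
 shows "lab_hom x c (ev w \<circ> ri h) = wsum x (c, id) w"
proof -
 define v where "v = (SOME v. \<exists>k\<in>symm. ev w \<circ> ri h = ev v \<circ> ri k)"
 have "\<exists>v. \<exists>k\<in>symm. ev w \<circ> ri h = ev v \<circ> ri k" using h by blast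
 from someI_ex[OF this] obtain k where k: "k \<in> symm" "ev w \<circ> ri h = ev v \<circ> ri k" unfolding v_def by blast
 have "weq w v" by (rule ev_ri_unique(2)[OF h k])
 hence "wsum x (c, id) w = wsum x (c, id) v" by (rule wsum_weq[OF x _ symm_id])
 thus ?thesis by (simp add: lab_hom_def v_def)
qed

lemma lab_hom_comp:
 assumes x: "flat 0 (%_ _. 1) x" and fg: "f \<in> Mor c d" "g \<in> Mor d e"
 shows "lab_hom x c (f \<circ> g) = lab_hom x c f + lab_hom x d g"
proof -
 obtain w h where f: "f = ev w \<circ> ri h" "run (c, id) w = (d, h)" "h \<in> symm" using MorE[OF fg(1)] .
 obtain u k where g: "g = ev u \<circ> ri k" "run (d, id) u = (e, k)" "k \<in> symm" using MorE[OF fg(2)] .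
 define v where "v = map (finv h) u"
 have v: "map h v = u" using symm_bij[OF f(3)] by (simp add: v_def bij_is_surj surj_f_inv_f o_def)
 have "f \<circ> g = ev (w @ v) \<circ> ri (k \<circ> h)" by (simp add: f(1) g(1) v[symmetric] fun_eq_iff ev_ri[OF f(3)] ri_comp[OF g(3) f(3)])
 hence "lab_hom x c (f \<circ> g) = wsum x (c, id) (w @ v)" using lab_hom_eq[OF x symm_comp[OF g(3) f(3)]] by simp
 also have "... = wsum x (c, id) w + wsum x (d, id) u" using wsum_base[of x d h v] by (simp add: wsum_append f(2) v)
 finally show ?thesis using lab_hom_eq[OF x f(3)] lab_hom_eq[OF x g(3)] f(1) g(1) by simp
qed

lemma lab_hom_gen: "flat 0 (%_ _. 1) x ==> lab_hom x c (gen c i) = x c i"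
 using lab_hom_eq[of x "gl c i" c "[i]"] by (simp add: gen_def gl_symm comp_def)

fun tree_ok :: "'c set => ('c \<times> 'i) list => bool" where
 "tree_ok V [] \<longleftrightarrow> V = UNIV"
| "tree_ok V (e # ts) \<longleftrightarrow> fst e \<in> V & nb (fst e) (snd e) \<notin> V & tree_ok (insert (nb (fst e) (snd e)) V) ts"

lemma tree_paths:
 assumes "tree_ok V ts" "\<forall>c\<in>V. m0 c \<in> Mor c0 c"
 shows "\<exists>m. (\<forall>c. m c \<in> Mor c0 c) & (\<forall>c\<in>V. m c = m0 c) &
  (\<forall>(d, i)\<in>set ts. m (nb d i) = m d \<circ> gen d i)" using assms
proof (induction ts arbitrary: V m0)
 case (Cons e ts)
 obtain d i where e: "e = (d, i)" by fastforce
 define b where "b = nb d i"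
 have V: "d \<in> V" "b \<notin> V" "tree_ok (insert b V) ts" using Cons.prems(1) by (auto simp: e b_def)
 define m1 where "m1 = m0(b := m0 d \<circ> gen d i)"
 have "m0 d \<circ> gen d i \<in> Mor c0 b" unfolding b_def using Cons.prems(2) V(1) by (intro Mor_comp[OF _ gen_Mor]) auto
 hence "\<forall>c\<in>insert b V. m1 c \<in> Mor c0 c" using Cons.prems(2) by (auto simp: m1_def)
 then obtain m where m: "\<forall>c. m c \<in> Mor c0 c" "\<forall>c\<in>insert b V. m c = m1 c"
  "\<forall>(d, i)\<in>set ts. m (nb d i) = m d \<circ> gen d i" using Cons.IH[OF V(3)] by blast
 have eq: "m c = m0 c" if "c \<in> V" for c using m(2) that V(2) by (auto simp: m1_def)
 have "m b = m d \<circ> gen d i" using m(2) eq[OF V(1)] by (simp add: m1_def)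
 hence "\<forall>(d, i)\<in>set (e # ts). m (nb d i) = m d \<circ> gen d i" using m(3) unfolding e b_def list.set by blast
 thus ?case using m(1) eq by blast
qed auto

lemma tree_zero:
 assumes "tree_ok V ts" "\<forall>c\<in>V. F c = (0::int)" "\<forall>(d, i)\<in>set ts. F (nb d i) = F d"
 shows "F c = 0" using assms by (induction ts arbitrary: V) auto

end

locale ra_tree = ra_cells n p nb gl
 for n :: "'i::finite => real^3" and p and nb :: "'c => 'i => 'c" and gl +
 fixes c0 :: 'c and ts :: "('c \<times> 'i) list"
 assumes tree: "tree_ok {c0} ts"
begin

definition m :: "'c => real^3 => real^3" where
 "m = (SOME m. (\<forall>c. m c \<in> Mor c0 c) & m c0 = id & (\<forall>(d, i)\<in>set ts. m (nb d i) = m d \<circ> gen d i))"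

lemma m: "m c \<in> Mor c0 c" "m c0 = id" "(d, i) \<in> set ts ==> m (nb d i) = m d \<circ> gen d i"
proof -
 have "\<exists>m. (\<forall>c. m c \<in> Mor c0 c) & m c0 = id & (\<forall>(d, i)\<in>set ts. m (nb d i) = m d \<circ> gen d i)"
  using tree_paths[OF tree, of "%_. id" c0] Mor_id by auto
 from someI_ex[OF this] have "(\<forall>c. m c \<in> Mor c0 c) & m c0 = id & (\<forall>(d, i)\<in>set ts. m (nb d i) = m d \<circ> gen d i)"
  unfolding m_def .
 thus "m c \<in> Mor c0 c" "m c0 = id" "(d, i) \<in> set ts ==> m (nb d i) = m d \<circ> gen d i" by auto
qed

abbreviation Gam :: "(real^3 => real^3) set" where "Gam \<equiv> Mor c0 c0"

lemma m_bij: "bij (m c)" using Mor_inv(1)[OF m(1)] .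

lemma m_inv: "finv (m c) (m c x) = x" "m c (finv (m c) x) = x"
 using m_bij by (auto simp: bij_is_inj bij_is_surj surj_f_inv_f)

definition t :: "'c => 'i => real^3 => real^3" where
 "t c i = m c \<circ> gen c i \<circ> finv (m (nb c i))"

lemma t_in: "t c i \<in> Gam"
 unfolding t_def using Mor_comp[OF Mor_comp[OF m(1) gen_Mor] Mor_inv(2)[OF m(1)]] .

lemma t_back: "t c i \<circ> t (nb c i) (gl c i i) = id"
proof
 fix x
 have "gen c i (gen (nb c i) (gl c i i) y) = y" for y using fun_cong[OF gen_back, of c i y] by simp
 thus "(t c i \<circ> t (nb c i) (gl c i i)) x = id x" by (simp add: t_def m_inv nb_back)
qed

lemma t_square: "adj i j ==> t c i \<circ> t (nb c i) (gl c i j) = t c j \<circ> t (nb c j) (gl c j i)"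
proof
 fix x assume a: "adj i j"
 have "gen c i (gen (nb c i) (gl c i j) y) = gen c j (gen (nb c j) (gl c j i) y)" for y using fun_cong[OF gen_square[OF a], of c y] by simp
 thus "(t c i \<circ> t (nb c i) (gl c i j)) x = (t c j \<circ> t (nb c j) (gl c j i)) x" by (simp add: t_def m_inv nb_square[OF a])
qed

lemma t_tree: "(c, i) \<in> set ts ==> t c i = id"
 using m(3)[of c i] m_inv(2)[of "nb c i"] by (simp add: t_def fun_eq_iff)

lemma Gam_induct [consumes 1, case_names id t]:
 assumes "g \<in> Gam" "Q id" "!!c i g. g \<in> Gam ==> Q g ==> Q (t c i \<circ> g)"
 shows "Q g"
proof -
 have "Q (m c \<circ> f \<circ> finv (m d))" if "f \<in> Mor c d" for c d f using that
 proof (induction rule: Mor_induct)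
  case (id c)
  have "m c \<circ> id \<circ> finv (m c) = id" by (simp add: fun_eq_iff m_inv)
  thus ?case using assms(2) by metis
 next
  case (gen c d i g)
  have "m (nb c i) \<circ> g \<circ> finv (m d) \<in> Gam" by (rule Mor_comp[OF Mor_comp[OF m(1) gen.hyps] Mor_inv(2)[OF m(1)]])
  hence "Q (t c i \<circ> (m (nb c i) \<circ> g \<circ> finv (m d)))" using gen.IH by (rule assms(3))
  moreover have "t c i \<circ> (m (nb c i) \<circ> g \<circ> finv (m d)) = m c \<circ> (gen c i \<circ> g) \<circ> finv (m d)"
   by (simp add: t_def fun_eq_iff m_inv)
  ultimately show ?case by (simp only:)
 qed
 from this[OF assms(1)] show ?thesis by (simp only: m(2) inv_id comp_id id_comp)
qed

lemma lab_hom_t: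
 assumes x: "flat 0 (%_ _. 1) x" and x0: "!!d i. (d, i) \<in> set ts ==> x d i = 0"
 shows "lab_hom x c0 (t c i) = x c i"
proof -
 have 0: "lab_hom x c0 id = 0" using lab_hom_comp[OF x Mor_id Mor_id, of c0] by simp
 have m0: "lab_hom x c0 (m c) = 0" for c
 proof (rule tree_zero[OF tree])
  show "\<forall>c\<in>{c0}. lab_hom x c0 (m c) = 0" using 0 by (simp add: m(2))
  show "\<forall>(d, i)\<in>set ts. lab_hom x c0 (m (nb d i)) = lab_hom x c0 (m d)"
   using lab_hom_comp[OF x m(1) gen_Mor] lab_hom_gen[OF x] x0 by (auto simp: m(3))
 qed
 have "t c i \<circ> m (nb c i) = m c \<circ> gen c i" by (simp add: t_def fun_eq_iff m_inv)
 hence "lab_hom x c0 (t c i) + lab_hom x c0 (m (nb c i)) = lab_hom x c0 (m c) + lab_hom x c (gen c i)"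
  using lab_hom_comp[OF x t_in m(1)] lab_hom_comp[OF x m(1) gen_Mor] by metis
 thus ?thesis using m0 lab_hom_gen[OF x] by simp
qed

interpretation D: deck_action UNIV Gam by (rule deck_action_Mor)

abbreviation dg :: "(real^3 => real^3) monoid" where "dg \<equiv> D.deck_group"

lemma dg_simps: "carrier dg = Gam" "monoid.mult dg = (\<circ>)" "one dg = id"
 by (simp_all add: D.deck_group_def)

lemma cocycle_flat:
 assumes z: "!!g h. g \<in> Gam ==> h \<in> Gam ==> [z (g \<circ> h) = z g + K g * z h] (mod q)" and K: "K id = 1"
 shows "flat q (%c i. K (t c i)) (%c i. z (t c i))"
  and "[z id = 0] (mod q)"
proof -
 have "[z id = z id + z id] (mod q)" using z[OF Mor_id Mor_id] K by simp
 thus 0: "[z id = 0] (mod q)" by (metis add_0_right cong_add_lcancel cong_sym)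
 have "[z (t c i) + K (t c i) * z (t (nb c i) (gl c i i)) = 0] (mod q)" for c i
  using cong_trans[OF cong_sym[OF z[OF t_in t_in]], of c i "nb c i" "gl c i i"] 0 by (simp add: t_back)
 moreover have "[z (t c i) + K (t c i) * z (t (nb c i) (gl c i j)) =
   z (t c j) + K (t c j) * z (t (nb c j) (gl c j i))] (mod q)" if "adj i j" for c i j
  using cong_trans[OF cong_sym[OF z[OF t_in t_in]], of c i "nb c i" "gl c i j"] z[OF t_in t_in, of c j "nb c j" "gl c j i"]
  by (simp add: t_square[OF that])
 ultimately show "flat q (%c i. K (t c i)) (%c i. z (t c i))" unfolding flat_def by blast
qed

end

section \<open>Certificates for vanishing of twisted cohomology\<close>

datatype 'a trie = Tip | Nd "'a option" "'a trie" "'a trie"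

fun tget :: "'a trie => bool list => 'a option" where
 "tget Tip ks = None"
| "tget (Nd v l r) [] = v"
| "tget (Nd v l r) (True # ks) = tget r ks"
| "tget (Nd v l r) (False # ks) = tget l ks"

fun tput :: "bool list => 'a => 'a trie => 'a trie" where
 "tput [] a Tip = Nd (Some a) Tip Tip"
| "tput [] a (Nd v l r) = Nd (Some a) l r"
| "tput (True # ks) a Tip = Nd None Tip (tput ks a Tip)"
| "tput (True # ks) a (Nd v l r) = Nd v l (tput ks a r)"
| "tput (False # ks) a Tip = Nd None (tput ks a Tip) Tip"
| "tput (False # ks) a (Nd v l r) = Nd v (tput ks a l) r"

lemma tget_tput: "tget (tput ks a t) js = (if js = ks then Some a else tget t js)"
proof (induction ks a t arbitrary: js rule: tput.induct)
 case (1 a) show ?case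
 proof (cases js)
  case (Cons b bs) thus ?thesis by (cases b) auto
 qed simp
next
 case (2 a v l r) show ?case
 proof (cases js)
  case (Cons b bs) thus ?thesis by (cases b) auto
 qed simp
next
 case (3 ks a) show ?case
 proof (cases js)
  case (Cons b bs) thus ?thesis using 3 by (cases b) auto
 qed simp
next
 case (4 ks a v l r) show ?case
 proof (cases js)
  case (Cons b bs) thus ?thesis using 4 by (cases b) auto
 qed simp
next
 case (5 ks a) show ?case
 proof (cases js)
  case (Cons b bs) thus ?thesis using 5 by (cases b) auto
 qed simp
next
 case (6 ks a v l r) show ?case
 proof (cases js)
  case (Cons b bs) thus ?thesis using 6 by (cases b) auto
 qed simp
qed

fun dot :: "int list => int list => int" where
 "dot (a # as) (y # ys) = a * y + dot as ys"
| "dot _ _ = 0"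

definition vcomb :: "int => int => int list => int => int list => int list" where
 "vcomb q k as l bs = map2 (%a b. (k * a + l * b) mod q) as bs"

fun elim :: "int => nat => int list list => bool" where
 "elim q 0 R \<longleftrightarrow> True"
| "elim q (Suc k) R \<longleftrightarrow> (case find (%r. hd r ~= 0) R of None => False
  | Some r => elim q k (map (%s. vcomb q (hd r) (tl s) (- hd s) (tl r)) R))"

definition reduced :: "int => nat => int list => bool" where
 "reduced q k r \<longleftrightarrow> length r = k & (\<forall>a\<in>set r. 0 <= a & a < q)"

lemma reduced_vcomb: "q > 0 ==> length as = k ==> length bs = k ==> reduced q k (vcomb q a as b bs)"
 by (auto simp: reduced_def vcomb_def)

lemma reduced_length: "reduced q k r ==> length r = k"
 by (simp add: reduced_def)

lemma dot_vcomb: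
 assumes "length as = length ys" "length bs = length ys"
 shows "[dot (vcomb q k as l bs) ys = k * dot as ys + l * dot bs ys] (mod q)" using assms
proof (induction ys arbitrary: as bs)
 case (Cons y ys)
 obtain a as' b bs' where ab: "as = a # as'" "bs = b # bs'" using Cons.prems by (cases as; cases bs) auto
 have "[dot (vcomb q k as' l bs') ys = k * dot as' ys + l * dot bs' ys] (mod q)" by (rule Cons.IH) (use Cons.prems ab in auto)
 moreover have "[((k * a + l * b) mod q) * y = (k * a + l * b) * y] (mod q)" by (intro cong_mult) (auto simp: cong_def)
 ultimately have "[((k * a + l * b) mod q) * y + dot (vcomb q k as' l bs') ys =
   (k * a + l * b) * y + (k * dot as' ys + l * dot bs' ys)] (mod q)" by (intro cong_add)
 thus ?case by (simp add: ab vcomb_def algebra_simps)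
qed (simp add: vcomb_def)

lemma dot_zero: "\<forall>y\<in>set ys. [y = 0] (mod q) ==> [dot v ys = 0] (mod q)"
 by (induction v ys rule: dot.induct) (auto simp: cong_0_iff)

lemma elim_sound:
 assumes "prime q" "elim q k R" "length ys = k" "!!r. r \<in> set R ==> reduced q k r & [dot r ys = 0] (mod q)"
 shows "\<forall>y\<in>set ys. [y = 0] (mod q)" using assms(2-)
proof (induction k arbitrary: R ys)
 case (Suc k)
 have q0: "q > 0" using assms(1) prime_gt_0_int by blast
 obtain y zs where ys: "ys = y # zs" "length zs = k" using Suc.prems(2) by (cases ys) auto
 obtain r where r: "find (%r. hd r ~= 0) R = Some r"
  "elim q k (map (%s. vcomb q (hd r) (tl s) (- hd s) (tl r)) R)" using Suc.prems(1) by (auto split: option.splits)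
 have rR: "r \<in> set R" "hd r ~= 0" using r(1) by (auto simp: find_Some_iff)
 have split: "length (tl s) = k & [hd s * y + dot (tl s) zs = 0] (mod q)" if s: "s \<in> set R" for s
 proof -
  have "length s = Suc k" using Suc.prems(3)[OF s] by (simp add: reduced_def)
  then obtain a s' where "s = a # s'" "length s' = k" by (cases s) auto
  thus ?thesis using Suc.prems(3)[OF s] ys by simp
 qed
 have zs: "\<forall>z\<in>set zs. [z = 0] (mod q)"
 proof (rule Suc.IH[OF r(2) ys(2)])
  fix u assume "u \<in> set (map (%s. vcomb q (hd r) (tl s) (- hd s) (tl r)) R)"
  then obtain s where s: "s \<in> set R" "u = vcomb q (hd r) (tl s) (- hd s) (tl r)" by auto
  have "[dot u zs = hd r * dot (tl s) zs + (- hd s) * dot (tl r) zs] (mod q)"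
   unfolding s(2) by (rule dot_vcomb) (use split[OF s(1)] split[OF rR(1)] ys in auto)
  also have "hd r * dot (tl s) zs + (- hd s) * dot (tl r) zs =
    hd r * (hd s * y + dot (tl s) zs) - hd s * (hd r * y + dot (tl r) zs)" by (simp add: algebra_simps)
  also have "[... = hd r * 0 - hd s * 0] (mod q)" using split[OF s(1)] split[OF rR(1)] by (intro cong_diff cong_mult) auto
  finally have "[dot u zs = 0] (mod q)" by simp
  moreover have "reduced q k u" unfolding s(2) by (rule reduced_vcomb[OF q0]) (use split[OF s(1)] split[OF rR(1)] in auto)
  ultimately show "reduced q k u & [dot u zs = 0] (mod q)" by blast
 qed
 have "[hd r * y + dot (tl r) zs - dot (tl r) zs = 0 - 0] (mod q)" by (rule cong_diff) (use split[OF rR(1)] dot_zero[OF zs] in auto)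
 hence "q dvd hd r * y" by (simp add: cong_0_iff)
 moreover have "~ q dvd hd r"
 proof -
  have "hd r \<in> set r" using Suc.prems(3)[OF rR(1)] by (cases r) (auto simp: reduced_def)
  hence "0 < hd r" "hd r < q" using Suc.prems(3)[OF rR(1)] rR(2) by (force simp: reduced_def)+
  thus ?thesis using zdvd_not_zless by blast
 qed
 ultimately have "q dvd y" using assms(1) prime_dvd_mult_iff by blast
 thus ?case using zs ys by (simp add: cong_0_iff)
qed simp

context
 fixes nb :: "'c => 'i => 'c" and gl :: "'c => 'i => 'i => 'i" and key :: "'c => 'i => bool list"
  and q :: int and K :: "'c => 'i => int"
begin

definition solve :: "int list trie => 'c => 'i => 'i => int list option" where
 "solve env c i j =
  (case tget env (key (nb c i) (gl c i j)) of None => None | Some v2 =>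
   (case tget env (key c j) of None => None | Some v3 =>
   (case tget env (key (nb c j) (gl c j i)) of None => None | Some v4 =>
    Some (vcomb q 1 (vcomb q 1 v3 (K c j) v4) (- K c i) v2))))"

definition put2 :: "'c => 'i => int list => int list trie => int list trie" where
 "put2 c i v env = tput (key (nb c i) (gl c i i)) (vcomb q (- K (nb c i) (gl c i i)) v 0 v) (tput (key c i) v env)"

fun exec :: "int list trie => ('c \<times> 'i \<times> 'i) list => int list trie option" where
 "exec env [] = Some env"
| "exec env ((c, i, j) # ps) = (case solve env c i j of None => None | Some v => exec (put2 c i v env) ps)"

fun inits :: "int list trie => (('c \<times> 'i) \<times> int list) list => int list trie" where
 "inits env [] = env"
| "inits env (((c, i), v) # es) = inits (put2 c i v env) es"

fun rel_rows :: "int list trie => ('c \<times> 'i \<times> 'i) list => int list list" where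
 "rel_rows env [] = []"
| "rel_rows env ((c, i, j) # rs) = (case solve env c i j of None => rel_rows env rs | Some v =>
  (case tget env (key c i) of None => rel_rows env rs | Some u => vcomb q 1 v (- 1) u # rel_rows env rs))"

fun zero_rows :: "int list trie => ('c \<times> 'i) list => int list list" where
 "zero_rows env [] = []"
| "zero_rows env ((c, i) # es) = (case tget env (key c i) of None => zero_rows env es | Some u => u # zero_rows env es)"

definition units :: "nat => int list list" where
 "units k = map (%j. map (%i. if i = j then 1 else 0) [0..<k]) [0..<k]"

definition certify :: "('c \<times> 'i) list => ('c \<times> 'i) list => ('c \<times> 'i) list => ('c \<times> 'i \<times> 'i) list =>
  ('c \<times> 'i \<times> 'i) list => 'c list => 'i list => bool" where
 "certify ts Z ps prog rels cs fs =
  (case exec (inits Tip (map (%e. (e, replicate (length ps) 0)) ts @ zip ps (units (length ps)))) prog of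
    None => False
   | Some env => list_all (%c. list_all (%i. tget env (key c i) ~= None) fs) cs &
     elim q (length ps) (zero_rows env Z @ rel_rows env rels))"

end

context ra_cells
begin

lemma certify_sound:
 assumes q: "prime q" and key: "!!c i d j. key c i = key d j ==> c = d & i = j"
  and cert: "certify nb gl key q K ts Z ps prog rels cs fs" and all: "set cs = UNIV" "set fs = UNIV"
  and adj: "list_all (%(c, i, j). adj i j) (prog @ rels)"
  and x: "flat q K x" and x0: "!!c i. (c, i) \<in> set ts \<union> set Z ==> [x c i = 0] (mod q)"
 shows "[x c i = 0] (mod q)"
proof -
 define k where "k = length ps"
 define ys where "ys = map (%(c, i). x c i) ps"
 have ys: "length ys = k" by (simp add: ys_def k_def)
 have q0: "q > 0" "q > 1" using q prime_gt_0_int prime_gt_1_int by auto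
 define Inv where "Inv env \<longleftrightarrow> (\<forall>c i v. tget env (key c i) = Some v --> reduced q k v & [x c i = dot v ys] (mod q))" for env
 have solve: "reduced q k v & [x c i = dot v ys] (mod q)"
  if env: "Inv env" and ij: "adj i j" and s: "solve nb gl key q K env c i j = Some v" for env c i j v
 proof -
  obtain v2 v3 v4 where g: "tget env (key (nb c i) (gl c i j)) = Some v2" "tget env (key c j) = Some v3"
    "tget env (key (nb c j) (gl c j i)) = Some v4"
   and v: "v = vcomb q 1 (vcomb q 1 v3 (K c j) v4) (- K c i) v2" using s by (auto simp: solve_def split: option.splits)
  define v34 where "v34 = vcomb q 1 v3 (K c j) v4"
  note h = g[THEN env[unfolded Inv_def, rule_format]]
  have l: "length v2 = k" "length v3 = k" "length v4 = k" using h by (auto simp: reduced_def)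
  have r34: "reduced q k v34" unfolding v34_def by (rule reduced_vcomb[OF q0(1)]) (use l in auto)
  have "[x c i + K c i * x (nb c i) (gl c i j) = x c j + K c j * x (nb c j) (gl c j i)] (mod q)" using x ij unfolding flat_def by blast
  hence "[x c i + K c i * x (nb c i) (gl c i j) - K c i * x (nb c i) (gl c i j) =
    x c j + K c j * x (nb c j) (gl c j i) - K c i * x (nb c i) (gl c i j)] (mod q)" by (intro cong_diff) auto
  hence "[x c i = x c j + K c j * x (nb c j) (gl c j i) - K c i * x (nb c i) (gl c i j)] (mod q)" by simp
  also have "[x c j + K c j * x (nb c j) (gl c j i) - K c i * x (nb c i) (gl c i j) =
    dot v3 ys + K c j * dot v4 ys - K c i * dot v2 ys] (mod q)" using h by (intro cong_diff cong_add cong_mult) auto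
  also have "[dot v3 ys + K c j * dot v4 ys - K c i * dot v2 ys = dot v34 ys - K c i * dot v2 ys] (mod q)"
   using cong_sym[OF dot_vcomb[of v3 ys v4 q 1 "K c j"]] l ys unfolding v34_def by (intro cong_diff) auto
  also have "[dot v34 ys - K c i * dot v2 ys = dot v ys] (mod q)"
   using cong_sym[OF dot_vcomb[of v34 ys v2 q 1 "- K c i"]] l ys reduced_length[OF r34] unfolding v v34_def[symmetric] by simp
  finally have "[x c i = dot v ys] (mod q)" .
  moreover have "reduced q k v" unfolding v v34_def[symmetric] by (rule reduced_vcomb[OF q0(1)]) (use l reduced_length[OF r34] in auto)
  ultimately show ?thesis by blast
 qed
 have put2: "Inv (put2 nb gl key q K c i v env)"
  if env: "Inv env" and v: "reduced q k v" "[x c i = dot v ys] (mod q)" for env c i v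
 proof -
  define d where "d = nb c i"
  define j where "j = gl c i i"
  define w where "w = vcomb q (- K d j) v 0 v"
  have lv: "length v = k" using v(1) by (simp add: reduced_def)
  have dj: "nb d j = c" "gl d j j = i" using nb_back[of c i] fun_cong[OF gl_back[of c i], of i] by (simp_all add: d_def j_def)
  have "[x d j + K d j * x c i = 0] (mod q)" using x dj unfolding flat_def by metis
  hence "[x d j + K d j * x c i - K d j * x c i = 0 - K d j * dot v ys] (mod q)" using v(2) by (intro cong_diff cong_mult) auto
  hence "[x d j = - K d j * dot v ys + 0 * dot v ys] (mod q)" by simp
  also have "[- K d j * dot v ys + 0 * dot v ys = dot w ys] (mod q)" unfolding w_def by (rule cong_sym, rule dot_vcomb) (use lv ys in auto)
  finally have xd: "[x d j = dot w ys] (mod q)" .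
  have rw: "reduced q k w" unfolding w_def by (rule reduced_vcomb[OF q0(1) lv lv])
  show ?thesis unfolding Inv_def
  proof (intro allI impI)
   fix c' i' u assume "tget (put2 nb gl key q K c i v env) (key c' i') = Some u"
   hence u: "(if key c' i' = key d j then Some w else if key c' i' = key c i then Some v else tget env (key c' i')) = Some u"
    unfolding put2_def tget_tput d_def j_def w_def .
   show "reduced q k u & [x c' i' = dot u ys] (mod q)"
   proof (cases "key c' i' = key d j")
    case True
    hence "c' = d" "i' = j" using key[OF True] by blast+
    moreover have "u = w" using u True by simp
    ultimately show ?thesis using xd rw by simp
   next
    case f1: False
    show ?thesis
    proof (cases "key c' i' = key c i")
     case True
     hence "c' = c" "i' = i" using key[OF True] by blast+
     moreover have "u = v" using u True f1 by simp
     ultimately show ?thesis using v by simp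
    next
     case False
     hence "tget env (key c' i') = Some u" using u f1 by simp
     thus ?thesis using env unfolding Inv_def by blast
    qed
   qed
  qed
 qed
 have inits: "Inv (inits nb gl key q K env es)"
  if "Inv env" "!!c i v. ((c, i), v) \<in> set es ==> reduced q k v & [x c i = dot v ys] (mod q)" for env es using that
 proof (induction es arbitrary: env)
  case (Cons e es)
  obtain c i v where e: "e = ((c, i), v)" by (metis surj_pair)
  have "Inv (put2 nb gl key q K c i v env)" using Cons.prems e by (intro put2) auto
  hence "Inv (inits nb gl key q K (put2 nb gl key q K c i v env) es)" by (rule Cons.IH) (rule Cons.prems(2), simp)
  thus ?case by (simp add: e)
 qed simp
 have exec: "Inv env'" if "Inv env" "list_all (%(c, i, j). adj i j) prog" "exec nb gl key q K env prog = Some env'" for env env' prog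
  using that
 proof (induction prog arbitrary: env)
  case (Cons e es)
  obtain c i j where e: "e = (c, i, j)" by (metis surj_pair)
  obtain v where v: "solve nb gl key q K env c i j = Some v" "exec nb gl key q K (put2 nb gl key q K c i v env) es = Some env'"
   using Cons.prems(3) e by (auto split: option.splits)
  have "Inv (put2 nb gl key q K c i v env)" using put2[OF Cons.prems(1)] solve[OF Cons.prems(1) _ v(1)] Cons.prems(2) e by auto
  thus ?case using Cons.IH v(2) Cons.prems(2) by simp
 qed simp
 define es where "es = map (%e. (e, replicate k (0::int))) ts @ zip ps (units k)"
 have dot0: "dot (replicate l 0) zs = 0" for l zs by (induction zs arbitrary: l) (case_tac l, auto)+
 have es: "reduced q k v & [x c i = dot v ys] (mod q)" if "((c, i), v) \<in> set es" for c i v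
 proof -
  consider "(c, i) \<in> set ts" "v = replicate k 0" | j where "j < k" "ps ! j = (c, i)" "v = units k ! j"
  proof (cases "((c, i), v) \<in> set (zip ps (units k))")
   case True
   then obtain j where "j < k" "(c, i) = ps ! j" "v = units k ! j" by (auto simp: in_set_zip k_def units_def)
   thus ?thesis using that(2)[of j] by simp
  next
   case False
   hence "(c, i) \<in> set ts" "v = replicate k 0" using \<open>((c, i), v) \<in> set es\<close> by (auto simp: es_def)
   thus ?thesis using that(1) by blast
  qed
  thus ?thesis
  proof cases
   case 1
   thus ?thesis using x0[of c i] q0 dot0 by (auto simp: reduced_def)
  next
   case 2
   have "dot (map (%i. if i = j then 1 else 0) [a..<a + length zs]) zs = (if a <= j & j < a + length zs then zs ! (j - a) else 0)" for a zs
   proof (induction zs arbitrary: a)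
    case (Cons z zs)
    show ?case using Cons.IH[of "Suc a"] by (auto simp: upt_conv_Cons nth_Cons' split: if_splits simp del: upt_Suc)
   qed simp
   from this[of 0 ys] have "dot v ys = ys ! j" using 2 ys by (simp add: units_def)
   moreover have "ys ! j = x c i" using 2 by (simp add: ys_def k_def)
   ultimately show ?thesis using 2 q0 by (auto simp: reduced_def units_def)
  qed
 qed
 obtain env where env: "exec nb gl key q K (inits nb gl key q K Tip es) prog = Some env"
  "!!c i. tget env (key c i) ~= None" "elim q k (zero_rows key env Z @ rel_rows nb gl key q K env rels)"
  using cert all unfolding certify_def es_def k_def by (auto split: option.splits simp: list_all_iff)
 have "Inv Tip" by (simp add: Inv_def)
 hence I: "Inv env" using exec[OF inits[OF _ es] _ env(1)] adj by simp
 have zr: "reduced q k r & [dot r ys = 0] (mod q)" if r: "r \<in> set (zero_rows key env Z)" for r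
 proof -
  have "\<exists>c i. (c, i) \<in> set W & tget env (key c i) = Some r" if "r \<in> set (zero_rows key env W)" for W
   using that by (induction W) (auto split: option.splits, blast+)
  then obtain c i where ci: "(c, i) \<in> set Z" "tget env (key c i) = Some r" using r by blast
  have "reduced q k r" "[x c i = dot r ys] (mod q)" using I ci(2) unfolding Inv_def by auto
  thus ?thesis using x0[of c i] ci(1) cong_trans[OF cong_sym] by blast
 qed
 have rr: "reduced q k r & [dot r ys = 0] (mod q)" if r: "r \<in> set (rel_rows nb gl key q K env rels)" for r
 proof -
  have "\<exists>c i j v u. (c, i, j) \<in> set W & solve nb gl key q K env c i j = Some v & tget env (key c i) = Some u & r = vcomb q 1 v (- 1) u"
   if "r \<in> set (rel_rows nb gl key q K env W)" for W using that by (induction W) (auto split: option.splits, blast+)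
  then obtain c i j v u where *: "(c, i, j) \<in> set rels" "solve nb gl key q K env c i j = Some v"
   "tget env (key c i) = Some u" "r = vcomb q 1 v (- 1) u" using r by blast
  have "adj i j" using adj *(1) by (fastforce simp: list_all_iff)
  note v = solve[OF I this *(2)]
  have u: "reduced q k u" "[x c i = dot u ys] (mod q)" using I *(3) unfolding Inv_def by auto
  have "[dot r ys = 1 * dot v ys + (- 1) * dot u ys] (mod q)"
   unfolding *(4) by (rule dot_vcomb) (use v u ys in \<open>auto simp: reduced_def\<close>)
  also have "[1 * dot v ys + (- 1) * dot u ys = 1 * x c i + (- 1) * x c i] (mod q)"
   by (intro cong_add cong_mult cong_refl) (use v u cong_sym in auto)
  finally have "[dot r ys = 0] (mod q)" by simp
  moreover have "reduced q k r" unfolding *(4) by (rule reduced_vcomb[OF q0(1)]) (use v u(1) in \<open>auto simp: reduced_def\<close>)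
  ultimately show ?thesis by blast
 qed
 have "\<forall>y\<in>set ys. [y = 0] (mod q)" by (rule elim_sound[OF q env(3) ys]) (use zr rr in auto)
 moreover obtain v where "tget env (key c i) = Some v" using env(2) by auto
 ultimately show ?thesis using I dot_zero unfolding Inv_def by (meson cong_trans)
qed

end

locale ra_classes = ra_tree n p nb gl c0 ts
 for n :: "'i::finite => real^3" and p and nb :: "'c::finite => 'i => 'c" and gl c0 ts +
 fixes k :: nat and phi :: "nat => 'c => 'i => int" and es :: "nat => 'c \<times> 'i" and q :: int
 assumes k: "k > 0"
  and phi_flat: "!!j. j < k ==> flat 0 (%_ _. 1) (phi j)"
  and phi_tree: "!!j c i. j < k ==> (c, i) \<in> set ts ==> phi j c i = 0"
  and phi_es: "!!j l. j < k ==> l < k ==> phi l (fst (es j)) (snd (es j)) = (if l = j then 1 else 0)"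
  and q: "prime q"
  and rigid: "!!x c i. flat q (%_ _. 1) x ==>
   (!!c i. (c, i) \<in> set ts \<union> es ` {..<k} ==> [x c i = 0] (mod q)) ==> [x c i = 0] (mod q)"
begin

definition g :: "nat => real^3 => real^3" where "g j = t (fst (es j)) (snd (es j))"
definition f :: "nat => (real^3 => real^3) => int" where "f j = lab_hom (phi j) c0"

lemma g_in: "g j \<in> Gam" by (simp add: g_def t_in)

lemma f_comp: "j < k ==> x \<in> Gam ==> y \<in> Gam ==> f j (x \<circ> y) = f j x + f j y"
 unfolding f_def by (rule lab_hom_comp[OF phi_flat])

lemma f_t: "j < k ==> f j (t c i) = phi j c i"
 unfolding f_def by (rule lab_hom_t[OF phi_flat phi_tree])

lemma fg: "j < k ==> l < k ==> f l (g j) = (if l = j then 1 else 0)"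
 by (simp add: g_def f_t phi_es)

text \<open>Infinite descent: an integral label system vanishing on the tree and on the chosen faces is
 divisible by every power of \<open>q\<close>.\<close>

lemma flat_zero:
 assumes "flat 0 (%_ _. 1) x" "!!c i. (c, i) \<in> set ts \<union> es ` {..<k} ==> x c i = 0"
 shows "x c i = 0"
proof -
 have q1: "q > 1" using q prime_gt_1_int by blast
 have d: "q ^ N dvd x c i" for N using assms
 proof (induction N arbitrary: x)
  case (Suc N)
  have "[a = b] (mod q)" if "[a = b] (mod 0)" for a b :: int using that by simp
  hence fx: "flat q (%_ _. 1) x" using Suc.prems(1) unfolding flat_def by blast
  have "\<forall>c i. q dvd x c i" using rigid[OF fx] Suc.prems(2) by (simp add: cong_0_iff)
  then obtain y where y: "!!c i. x c i = q * y c i" unfolding dvd_def by metis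
  have q0: "q ~= 0" using q1 by simp
  have "flat 0 (%_ _. 1) y" unfolding flat_def
  proof (intro conjI allI impI)
   fix c i
   have "[x c i + 1 * x (nb c i) (gl c i i) = 0] (mod 0)" using Suc.prems(1) unfolding flat_def by blast
   hence "q * (y c i + y (nb c i) (gl c i i)) = 0" by (simp add: y algebra_simps)
   thus "[y c i + 1 * y (nb c i) (gl c i i) = 0] (mod 0)" using q0 by simp
  next
   fix c i j assume "adj i j"
   hence "[x c i + 1 * x (nb c i) (gl c i j) = x c j + 1 * x (nb c j) (gl c j i)] (mod 0)" using Suc.prems(1) unfolding flat_def by blast
   hence "q * (y c i + y (nb c i) (gl c i j)) = q * (y c j + y (nb c j) (gl c j i))" by (simp add: y algebra_simps)
   thus "[y c i + 1 * y (nb c i) (gl c i j) = y c j + 1 * y (nb c j) (gl c j i)] (mod 0)" using q0 by simp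
  qed
  moreover have "y c i = 0" if "(c, i) \<in> set ts \<union> es ` {..<k}" for c i using Suc.prems(2)[OF that] y[of c i] q0 by simp
  ultimately have "q ^ N dvd y c i" by (rule Suc.IH)
  thus ?case by (simp add: y mult_dvd_mono)
 qed simp
 have "\<bar>x c i\<bar> < q ^ nat \<bar>x c i\<bar>"
 proof -
  have "int (nat \<bar>x c i\<bar>) < 2 ^ nat \<bar>x c i\<bar>" using of_nat_less_two_power by blast
  also have "... <= q ^ nat \<bar>x c i\<bar>" using q1 by (intro power_mono) auto
  finally show ?thesis by simp
 qed
 thus ?thesis using dvd_imp_le_int[OF _ d, of "nat \<bar>x c i\<bar>"] by fastforce
qed

lemma additive_zero:
 fixes h :: "(real^3 => real^3) => rat"
 assumes h: "!!x y. x \<in> Gam ==> y \<in> Gam ==> h (x \<circ> y) = h x + h y"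
  and h0: "!!j. j < k ==> h (g j) = 0" and x: "x \<in> Gam"
 shows "h x = 0"
proof -
 define D where "D = (\<Prod>ci\<in>UNIV. snd (quotient_of (h (t (fst ci) (snd ci)))) :: int)"
 have D0: "D > 0" unfolding D_def by (intro prod_pos) (simp add: quotient_of_denom_pos')
 have "\<exists>y. of_int D * h (t c i) = of_int y" for c i
 proof -
  obtain a b where ab: "quotient_of (h (t c i)) = (a, b)" by fastforce
  have "b > 0" "h (t c i) = of_int a / of_int b" using quotient_of_denom_pos[OF ab] quotient_of_div[OF ab] by auto
  moreover have "b dvd D" unfolding D_def
   using dvd_prodI[of "UNIV :: ('c \<times> 'i) set" "(c, i)" "%ci. snd (quotient_of (h (t (fst ci) (snd ci))))"] ab by simp
  then obtain e where "D = b * e" by (auto simp: dvd_def)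
  ultimately show ?thesis by (intro exI[of _ "a * e"]) simp
 qed
 then obtain y where y: "!!c i. of_int D * h (t c i) = of_int (y c i)" by metis
 have h1: "h id = 0" using h[OF Mor_id Mor_id] by simp
 have "flat 0 (%_ _. 1) y" unfolding flat_def
 proof (intro conjI allI impI)
  fix c i
  have "h (t c i) + h (t (nb c i) (gl c i i)) = 0" using h[OF t_in t_in, of c i] t_back[of c i] h1 by metis
  hence "of_int D * h (t c i) + of_int D * h (t (nb c i) (gl c i i)) = 0" by (simp add: distrib_left[symmetric])
  hence "of_int (y c i + y (nb c i) (gl c i i)) = (0 :: rat)" by (simp add: y)
  thus "[y c i + 1 * y (nb c i) (gl c i i) = 0] (mod 0)" by (simp del: of_int_add)
 next
  fix c i j assume a: "adj i j"
  have "h (t c i) + h (t (nb c i) (gl c i j)) = h (t c j) + h (t (nb c j) (gl c j i))"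
   using h[OF t_in t_in, of c i "nb c i" "gl c i j"] h[OF t_in t_in, of c j "nb c j" "gl c j i"] t_square[OF a, of c] by metis
  hence "of_int D * h (t c i) + of_int D * h (t (nb c i) (gl c i j)) = of_int D * h (t c j) + of_int D * h (t (nb c j) (gl c j i))"
   by (simp add: distrib_left[symmetric])
  hence "of_int (y c i + y (nb c i) (gl c i j)) = (of_int (y c j + y (nb c j) (gl c j i)) :: rat)" by (simp add: y)
  thus "[y c i + 1 * y (nb c i) (gl c i j) = y c j + 1 * y (nb c j) (gl c j i)] (mod 0)" by (simp del: of_int_add)
 qed
 moreover have "y c i = 0" if "(c, i) \<in> set ts \<union> es ` {..<k}" for c i
 proof -
  have "h (t c i) = 0"
  proof (cases "(c, i) \<in> set ts")
   case True thus ?thesis using t_tree h1 by metis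
  next
   case False
   hence "(c, i) \<in> es ` {..<k}" using that by blast
   then obtain j where "j < k" "es j = (c, i)" by (metis imageE lessThan_iff)
   thus ?thesis using h0[of j] by (simp add: g_def)
  qed
  thus ?thesis using y[of c i] by simp
 qed
 ultimately have "y c i = 0" for c i by (rule flat_zero)
 hence ht: "h (t c i) = 0" for c i using y[of c i] D0 by simp
 show ?thesis using x
 proof (induction rule: Gam_induct)
  case (t c i g)
  have "h (t c i \<circ> g) = 0" using h[OF t_in t.hyps, of c i] ht[of c i] t.IH by simp
  thus ?case .
 qed (rule h1)
qed

lemma group_dg: "group dg"
proof (rule groupI)
 show "\<exists>y\<in>carrier dg. y \<otimes>\<^bsub>dg\<^esub> x = \<one>\<^bsub>dg\<^esub>" if "x \<in> carrier dg" for x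
  using that Mor_inv[of x] unfolding dg_simps by (intro bexI[of _ "finv x"]) (auto simp: fun_eq_iff bij_is_inj)
qed (auto simp: dg_simps Mor_id Mor_comp comp_assoc)

lemma additive_int:
 assumes u: "!!x y. x \<in> Gam ==> y \<in> Gam ==> u (x \<circ> y) = u x + (u y :: int)" and x: "x \<in> Gam"
 shows "u x = (\<Sum>j<k. u (g j) * f j x)"
proof -
 define h where "h x = (of_int (u x - (\<Sum>j<k. u (g j) * f j x)) :: rat)" for x
 have "h x = 0"
 proof (rule additive_zero[OF _ _ x])
  show "h (x \<circ> y) = h x + h y" if "x \<in> Gam" "y \<in> Gam" for x y using that by (simp add: h_def u f_comp sum.distrib algebra_simps)
  show "h (g j) = 0" if "j < k" for j using that by (simp add: h_def fg if_distrib[of "%a. _ * a"] cong: if_cong)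
 qed
 thus ?thesis unfolding h_def of_int_eq_0_iff by simp
qed

text \<open>Labels of the coordinate \<open>w\<close> of a homomorphism \<open>(u, v, w)\<close> to the Heisenberg group: they
 witness that the cup product of \<open>u\<close> and \<open>v\<close> vanishes.\<close>

definition cup_zero :: "(nat => int) => (nat => int) => bool" where
 "cup_zero U V \<longleftrightarrow> (\<exists>w u v. (\<forall>c i. u c i = (\<Sum>j<k. U j * phi j c i)) & (\<forall>c i. v c i = (\<Sum>j<k. V j * phi j c i)) &
  (\<forall>(c, i)\<in>set ts. w c i = 0) &
  (\<forall>c i. w c i + w (nb c i) (gl c i i) + u c i * v (nb c i) (gl c i i) = 0) &
  (\<forall>c i j. adj i j --> w c i + w (nb c i) (gl c i j) + u c i * v (nb c i) (gl c i j) =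
    w c j + w (nb c j) (gl c j i) + u c j * v (nb c j) (gl c j i :: 'i) + (0::int)))"

definition chi :: "int => int => (nat => int) => 'c => 'i => int" where
 "chi e b A c i = cyc_pow b e (\<Sum>j<k. A j * phi j c i)"

definition chi_rigid :: "int => int => int => (nat => int) => bool" where
 "chi_rigid r e b A \<longleftrightarrow> (\<exists>c' i'. chi e b A c' i' mod r ~= 1 &
  (\<forall>x. flat r (chi e b A) x --> (\<forall>(c, i)\<in>set ts. [x c i = 0] (mod r)) --> [x c' i' = 0] (mod r) -->
    (\<forall>c i. [x c i = 0] (mod r))))"

lemma cyc_pow_cong: "a mod e = a' mod e ==> cyc_pow b e a = cyc_pow b e a'"
 by (simp add: cyc_pow_def)

lemma chi_cong: "(!!j. j < k ==> A j mod e = B j mod e) ==> chi e b A = chi e b B"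
proof (intro ext)
 fix c i assume *: "!!j. j < k ==> A j mod e = B j mod e"
 have "(\<Sum>j<k. A j * phi j c i) mod e = (\<Sum>j<k. (A j * phi j c i) mod e) mod e" by (rule mod_sum_eq[symmetric])
 also have "(\<Sum>j<k. (A j * phi j c i) mod e) = (\<Sum>j<k. (B j * phi j c i) mod e)" using * by (intro sum.cong) (auto intro: mod_mult_cong)
 also have "... mod e = (\<Sum>j<k. B j * phi j c i) mod e" by (rule mod_sum_eq)
 finally show "chi e b A c i = chi e b B c i" unfolding chi_def by (rule cyc_pow_cong)
qed

lemma unit_mod: "prime r ==> a mod r ~= 1 ==> \<exists>s. [(1 - a) * s = (1::int)] (mod r)"
proof -
 assume r: "prime r" and a: "a mod r ~= 1"
 have "r > 1" using r prime_gt_1_int by blast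
 have "~ r dvd 1 - a"
 proof
  assume "r dvd 1 - a"
  hence "[1 = a] (mod r)" by (simp add: cong_iff_dvd_diff)
  thus False using a \<open>r > 1\<close> by (simp add: cong_def)
 qed
 hence "coprime (1 - a) r" using r prime_imp_coprime_int coprime_commute by blast
 thus ?thesis using cong_solve_coprime_int by blast
qed

theorem no_free_quotient:
 fixes r e b :: int
 assumes r: "prime r" and e: "e > 0" and b: "b ^ nat e mod r = 1"
  and prim: "!!m. 0 < m ==> m < e ==> b ^ nat m mod r ~= 1"
  and good: "!!U V. cup_zero U V ==>
   (!!s s'. s mod e ~= 0 \<or> s' mod e ~= 0 ==> \<exists>j<k. (s * U j + s' * V j) mod e ~= 0) ==>
   \<exists>s s'. (s mod e ~= 0 \<or> s' mod e ~= 0) & chi_rigid r e b (%j. s * U j + s' * V j)"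
  and l: "l >= 2"
 shows "epi dg (free_group l) = {}"
proof (rule ccontr)
 assume "epi dg (free_group l) ~= {}"
 then obtain ff where ff: "ff \<in> epi dg (free_group l)" by blast
 obtain u v w x y where *: "x \<in> carrier dg" "y \<in> carrier dg"
  "u x = 1" "v x = 0" "u y = 0" "v y = (1::int)"
  "!!g h. g \<in> carrier dg ==> h \<in> carrier dg ==> u (g \<otimes>\<^bsub>dg\<^esub> h) = u g + (u h :: int)"
  "!!g h. g \<in> carrier dg ==> h \<in> carrier dg ==> v (g \<otimes>\<^bsub>dg\<^esub> h) = v g + v h"
  "!!g h. g \<in> carrier dg ==> h \<in> carrier dg ==> w (g \<otimes>\<^bsub>dg\<^esub> h) = w g + (w h :: int) + u g * v h"
  and tw: "!!p c e a b s t. p > 1 ==> e > 0 ==> c ^ nat e mod p = 1 mod p ==>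
   \<exists>z. (\<forall>g\<in>carrier dg. \<forall>h\<in>carrier dg. z (g \<otimes>\<^bsub>dg\<^esub> h) mod p = (z g + cyc_pow c e (a * u g + b * v g) * z h) mod p) &
    z x mod p = s mod p & z y mod p = t mod p" by (rule free_quotient_data[OF group_dg ff l]) blast
 note * = *[unfolded dg_simps]
 have r1: "r > 1" using r prime_gt_1_int by blast
 define U where "U j = u (g j)" for j
 define V where "V j = v (g j)" for j
 have uU: "u z = (\<Sum>j<k. U j * f j z)" if "z \<in> Gam" for z unfolding U_def by (rule additive_int[OF *(7) that])
 have vV: "v z = (\<Sum>j<k. V j * f j z)" if "z \<in> Gam" for z unfolding V_def by (rule additive_int[OF *(8) that])
 have ut: "u (t c i) = (\<Sum>j<k. U j * phi j c i)" and vt: "v (t c i) = (\<Sum>j<k. V j * phi j c i)" for c i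
  using uU[OF t_in] vV[OF t_in] by (simp_all add: f_t)
 have cup: "cup_zero U V" unfolding cup_zero_def
 proof (intro exI conjI allI impI ballI)
  have "w id = w id + w id + u id * v id" using *(9)[OF Mor_id Mor_id] by simp
  moreover have u1: "u id = 0" using *(7)[OF Mor_id Mor_id] by simp
  ultimately have w1: "w id = 0" by simp
  show "u (t c i) = (\<Sum>j<k. U j * phi j c i)" "v (t c i) = (\<Sum>j<k. V j * phi j c i)" for c i by (rule ut vt)+
  show "case z of (c, i) => w (t c i) = 0" if "z \<in> set ts" for z using that w1 t_tree by (cases z) auto
  show "w (t c i) + w (t (nb c i) (gl c i i)) + u (t c i) * v (t (nb c i) (gl c i i)) = 0" for c i
   using *(9)[OF t_in t_in, of c i] t_back[of c i] w1 by metis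
  show "w (t c i) + w (t (nb c i) (gl c i j)) + u (t c i) * v (t (nb c i) (gl c i j)) =
    w (t c j) + w (t (nb c j) (gl c j i)) + u (t c j) * v (t (nb c j) (gl c j i)) + 0" if "adj i j" for c i j
   using *(9)[OF t_in t_in, of c i "nb c i" "gl c i j"] *(9)[OF t_in t_in, of c j "nb c j" "gl c j i"] t_square[OF that, of c] by simp
 qed
 have indep: "\<exists>j<k. (s * U j + s' * V j) mod e ~= 0" if s: "s mod e ~= 0 \<or> s' mod e ~= 0" for s s'
 proof (rule ccontr)
  assume "~ (\<exists>j<k. (s * U j + s' * V j) mod e ~= 0)"
  hence d: "e dvd s * U j + s' * V j" if "j < k" for j using that by auto
  have "e dvd s * u z + s' * v z" if "z \<in> Gam" for z
  proof -
   have "s * u z + s' * v z = (\<Sum>j<k. (s * U j + s' * V j) * f j z)"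
    by (simp add: uU[OF that] vV[OF that] sum_distrib_left sum.distrib[symmetric] algebra_simps)
   also have "e dvd ..." using d by (intro dvd_sum) auto
   finally show ?thesis .
  qed
  from this[OF *(1)] this[OF *(2)] show False using s *(3-6) by auto
 qed
 obtain s s' where ss: "s mod e ~= 0 \<or> s' mod e ~= 0" "chi_rigid r e b (%j. s * U j + s' * V j)"
  using good[OF cup indep] by blast
 define A where "A j = s * U j + s' * V j" for j
 define K where "K z = cyc_pow b e (s * u z + s' * v z)" for z
 have b': "b ^ nat e mod r = 1 mod r" using b r1 by simp
 have Kt: "K (t c i) = chi e b A c i" for c i by (simp add: K_def chi_def A_def ut vt sum_distrib_left sum.distrib[symmetric] algebra_simps)
 have K1: "K id = 1" using *(7)[OF Mor_id Mor_id] *(8)[OF Mor_id Mor_id] by (simp add: K_def cyc_pow_def)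
 have Kcomp: "[K (z \<circ> z') = K z * K z'] (mod r)" if "z \<in> Gam" "z' \<in> Gam" for z z'
  using cyc_pow_add[OF e b', of "s * u z + s' * v z" "s * u z' + s' * v z'"] *(7)[OF that] *(8)[OF that]
  by (simp add: K_def cong_def algebra_simps)
 have kne: "cyc_pow b e m mod r ~= 1" if "m mod e ~= 0" for m
 proof -
  have "0 < m mod e" "m mod e < e" using that e pos_mod_sign[of e m] pos_mod_bound[of e m] by linarith+
  thus ?thesis unfolding cyc_pow_def by (rule prim)
 qed
 obtain c' i' where ci: "chi e b A c' i' mod r ~= 1"
  "!!x. flat r (chi e b A) x ==> (\<forall>(c, i)\<in>set ts. [x c i = 0] (mod r)) ==> [x c' i' = 0] (mod r) ==>
    (\<forall>c i. [x c i = 0] (mod r))" using ss(2) unfolding chi_rigid_def A_def[symmetric] by blast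
 obtain a where a: "[(1 - chi e b A c' i') * a = 1] (mod r)" using unit_mod[OF r ci(1)] by blast
 have main: "\<exists>\<tau>. \<forall>m\<in>Gam. [z m = (1 - K m) * \<tau>] (mod r)"
  if z: "!!m m'. m \<in> Gam ==> m' \<in> Gam ==> [z (m \<circ> m') = z m + K m * z m'] (mod r)" for z
 proof -
  define \<tau> where "\<tau> = a * z (t c' i')"
  define z' where "z' m = z m - (1 - K m) * \<tau>" for m
  have z'c: "[z' (m \<circ> m') = z' m + K m * z' m'] (mod r)" if "m \<in> Gam" "m' \<in> Gam" for m m'
  proof -
   have "[z (m \<circ> m') - (1 - K (m \<circ> m')) * \<tau> = z m + K m * z m' - (1 - K m * K m') * \<tau>] (mod r)"
    by (intro cong_diff cong_mult cong_refl z[OF that] Kcomp[OF that])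
   moreover have "z m + K m * z m' - (1 - K m * K m') * \<tau> = z' m + K m * z' m'" by (simp add: z'_def algebra_simps)
   ultimately show ?thesis by (simp add: z'_def)
  qed
  have "(%c i. K (t c i)) = chi e b A" by (intro ext) (rule Kt)
  moreover have "flat r (%c i. K (t c i)) (%c i. z' (t c i))" by (rule cocycle_flat(1)[OF z'c K1])
  ultimately have fl: "flat r (chi e b A) (%c i. z' (t c i))" by (simp only:)
  have z'1: "[z' id = 0] (mod r)" by (rule cocycle_flat(2)[OF z'c K1])
  have "[(1 - chi e b A c' i') * a * z (t c' i') = 1 * z (t c' i')] (mod r)" by (intro cong_mult a cong_refl)
  hence "[z (t c' i') - (1 - chi e b A c' i') * a * z (t c' i') = z (t c' i') - 1 * z (t c' i')] (mod r)" by (intro cong_diff cong_refl)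
  hence "[z' (t c' i') = 0] (mod r)" by (simp add: z'_def \<tau>_def Kt mult.assoc)
  moreover have "\<forall>(c, i)\<in>set ts. [z' (t c i) = 0] (mod r)" using z'1 t_tree by auto
  ultimately have z't: "[z' (t c i) = 0] (mod r)" for c i using ci(2)[OF fl] by blast
  have "[z' m = 0] (mod r)" if "m \<in> Gam" for m using that
  proof (induction rule: Gam_induct)
   case (t c i m)
   have "[z' (t c i) + K (t c i) * z' m = 0 + K (t c i) * 0] (mod r)" by (intro cong_add cong_mult cong_refl z't t.IH)
   hence "[z' (t c i \<circ> m) = 0] (mod r)" using cong_trans[OF z'c[OF t_in t.hyps, of c i]] by simp
   thus ?case .
  qed (rule z'1)
  hence "[z m = (1 - K m) * \<tau>] (mod r)" if "m \<in> Gam" for m using that by (simp add: z'_def cong_iff_dvd_diff)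
  thus ?thesis by blast
 qed
 have contra: False if k1: "K m mod r ~= 1" and m: "m \<in> Gam" "m' \<in> Gam" and z: "z m mod r = 0" "z m' mod r = 1"
  "!!m m'. m \<in> Gam ==> m' \<in> Gam ==> [z (m \<circ> m') = z m + K m * z m'] (mod r)" for z m m'
 proof -
  obtain \<tau> where \<tau>: "!!m. m \<in> Gam ==> [z m = (1 - K m) * \<tau>] (mod r)" using main[OF z(3)] by blast
  obtain s where s: "[(1 - K m) * s = 1] (mod r)" using unit_mod[OF r k1] by blast
  have "[(1 - K m) * s * \<tau> = 1 * \<tau>] (mod r)" by (intro cong_mult s cong_refl)
  moreover have "[s * ((1 - K m) * \<tau>) = s * 0] (mod r)" using \<tau>[OF m(1)] z(1) by (intro cong_mult cong_refl) (simp add: cong_def)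
  ultimately have "[\<tau> = 0] (mod r)" by (simp add: ac_simps) (meson cong_sym cong_trans)
  hence "[(1 - K m') * \<tau> = (1 - K m') * 0] (mod r)" by (intro cong_mult cong_refl)
  hence "[z m' = 0] (mod r)" using \<tau>[OF m(2)] cong_trans by fastforce
  thus False using z(2) by (simp add: cong_def)
 qed
 show False
 proof (cases "s mod e = 0")
  case False
  obtain z where z: "\<forall>m\<in>Gam. \<forall>h\<in>Gam. z (m \<circ> h) mod r = (z m + cyc_pow b e (s * u m + s' * v m) * z h) mod r"
   "z x mod r = 0 mod r" "z y mod r = 1 mod r" using tw[OF r1 e b', of s s' 0 1] unfolding dg_simps by blast
  have "K x mod r ~= 1" unfolding K_def *(3,4) using kne[OF False] by simp
  thus False using contra[OF _ *(1,2), of z] z r1 by (simp add: K_def cong_def)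
 next
  case True
  hence F: "s' mod e ~= 0" using ss(1) by simp
  obtain z where z: "\<forall>m\<in>Gam. \<forall>h\<in>Gam. z (m \<circ> h) mod r = (z m + cyc_pow b e (s * u m + s' * v m) * z h) mod r"
   "z x mod r = 1 mod r" "z y mod r = 0 mod r" using tw[OF r1 e b', of s s' 1 0] unfolding dg_simps by blast
  have "K y mod r ~= 1" unfolding K_def *(5,6) using kne[OF F] by simp
  thus False using contra[OF _ *(2,1), of z] z r1 by (simp add: K_def cong_def)
 qed
qed

lemma f_onto: "\<exists>x\<in>Gam. f 0 x = N"
proof -
 have f1: "f 0 id = 0" using f_comp[OF k Mor_id Mor_id] by simp
 have pow: "\<exists>x\<in>Gam. f 0 x = int M" for M
 proof (induction M)
  case (Suc M)
  then obtain x where "x \<in> Gam" "f 0 x = int M" by blast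
  hence "f 0 (x \<circ> g 0) = int (Suc M)" "x \<circ> g 0 \<in> Gam" using f_comp[OF k, of x "g 0"] g_in fg[OF k k] Mor_comp by simp_all
  thus ?case by blast
 qed (use f1 Mor_id in auto)
 show ?thesis
 proof (cases "N >= 0")
  case True thus ?thesis using pow[of "nat N"] by simp
 next
  case False
  then obtain x where x: "x \<in> Gam" "f 0 x = - N" using pow[of "nat (- N)"] by auto
  have "x \<circ> finv x = id" using Mor_inv(1)[OF x(1)] by (simp add: fun_eq_iff bij_is_surj surj_f_inv_f)
  hence "f 0 x + f 0 (finv x) = 0" using f_comp[OF k x(1) Mor_inv(2)[OF x(1)]] f1 by simp
  thus ?thesis using x Mor_inv(2)[OF x(1)] by (intro bexI[of _ "finv x"]) auto
 qed
qed

end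

section \<open>Transfer along isomorphisms\<close>

lemma epi_iso_empty:
 assumes "group G" "\<phi> \<in> iso G H" "epi G F = {}"
 shows "epi H F = {}"
proof (rule ccontr)
 assume "epi H F ~= {}"
 then obtain h where h: "h \<in> epi H F" by blast
 have "(h \<circ> \<phi>) ` carrier G = h ` (\<phi> ` carrier G)" by (rule image_comp[symmetric])
 also have "... = carrier F" using h assms(2) by (simp add: epi_def iso_def bij_betw_def)
 finally have "h \<circ> \<phi> \<in> epi G F" using h assms(2) hom_compose[of \<phi> G H h F] by (simp add: epi_def iso_def)
 thus False using assms(3) by blast
qed

lemma corank_iso_eq_1:
 fixes f :: "'a => int"
 assumes G: "group G" and \<phi>: "\<phi> \<in> iso G H"
  and hom: "!!x y. x \<in> carrier G ==> y \<in> carrier G ==> f (x \<otimes>\<^bsub>G\<^esub> y) = f x + f y"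
  and onto: "!!n. \<exists>g\<in>carrier G. f g = n" and no: "!!k. k >= 2 ==> epi G (free_group k) = {}"
 shows "corank H = 1"
proof -
 obtain \<psi> where \<psi>: "\<psi> \<in> iso H G" "!!x. x \<in> carrier G ==> \<psi> (\<phi> x) = x" using iso_inv[OF G \<phi>] by metis
 have h: "\<psi> \<in> hom H G" using \<psi>(1) by (simp add: iso_def)
 show ?thesis
 proof (rule corank_eq_1I[where f = "f \<circ> \<psi>"])
  show "(f \<circ> \<psi>) (x \<otimes>\<^bsub>H\<^esub> y) = (f \<circ> \<psi>) x + (f \<circ> \<psi>) y" if "x \<in> carrier H" "y \<in> carrier H" for x y
   using hom[OF hom_in_carrier[OF h that(1)] hom_in_carrier[OF h that(2)]] hom_mult[OF h that] by simp
  show "\<exists>g\<in>carrier H. (f \<circ> \<psi>) g = n" for n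
  proof -
   obtain g where g: "g \<in> carrier G" "f g = n" using onto by blast
   have "\<phi> g \<in> carrier H" using \<phi> g(1) by (auto simp: iso_def hom_def)
   thus ?thesis using g \<psi>(2) by (intro bexI[of _ "\<phi> g"]) auto
  qed
  show "epi H (free_group k) = {}" if "k >= 2" for k by (rule epi_iso_empty[OF G \<phi> no[OF that]])
 qed
qed

section \<open>Quotient manifolds\<close>

context deck_action
begin

lemma second_countable_quot:
 assumes "second_countable (top_of_set X)"
 shows "second_countable quot" by (rule second_countable_open_map_image[OF continuous_map_orb open_map_orb _ assms]) (simp add: topspace_quot)

lemma connected_quot: "connected X ==> connected_space quot"
 using connectedin_continuous_map_image[OF continuous_map_orb, of X] connectedin_topspace[of quot]
 by (simp add: connectedin_subtopology topspace_quot)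

lemma compact_quot:
 assumes "compact C" "C \<subseteq> X" "!!x. x \<in> X ==> \<exists>y\<in>C. orb y = orb x"
 shows "compact_space quot"
proof -
 have "compactin quot (orb ` C)"
  by (rule image_compactin[OF _ continuous_map_orb]) (use assms(1,2) in \<open>simp add: compactin_subtopology\<close>)
 moreover have "orb ` C = topspace quot" unfolding topspace_quot
 proof (rule subset_antisym[OF image_mono[OF assms(2)]], rule subsetI)
  fix a assume "a \<in> orb ` X"
  then obtain x where x: "x \<in> X" "a = orb x" by blast
  then obtain y where "y \<in> C" "orb y = a" using assms(3)[OF x(1)] by metis
  thus "a \<in> orb ` C" by blast
 qed
 ultimately show ?thesis by (simp add: compact_space_def)
qed

lemma Hausdorff_quot:
 assumes "!!x y. x \<in> X ==> y \<in> X ==> orb x ~= orb y ==>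
  \<exists>U V. openin (top_of_set X) U & openin (top_of_set X) V & x \<in> U & y \<in> V & (\<forall>g\<in>G. g ` U \<inter> V = {})"
 shows "Hausdorff_space quot" unfolding Hausdorff_space_def
proof (intro allI impI, elim conjE)
 fix a b assume ab: "a \<in> topspace quot" "b \<in> topspace quot" "a ~= b"
 obtain x y where xy: "x \<in> X" "y \<in> X" "a = orb x" "b = orb y" using ab(1,2) unfolding topspace_quot by (elim imageE)
 have ne: "orb x ~= orb y" using ab(3) xy(3,4) by simp
 obtain U V where UV0: "openin (top_of_set X) U & openin (top_of_set X) V & x \<in> U & y \<in> V & (\<forall>g\<in>G. g ` U \<inter> V = {})"
  using assms[OF xy(1,2) ne] by (elim exE)
 hence UV: "openin (top_of_set X) U" "openin (top_of_set X) V" "x \<in> U" "y \<in> V" "!!g. g \<in> G ==> g ` U \<inter> V = {}"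
  by simp_all
 have "disjnt (orb ` U) (orb ` V)" unfolding disjnt_def
 proof (rule ccontr)
  assume "orb ` U \<inter> orb ` V ~= {}"
  then obtain c where "c \<in> orb ` U" "c \<in> orb ` V" by blast
  then obtain u v where uv: "u \<in> U" "v \<in> V" "orb u = orb v" by (elim imageE) simp
  obtain g where g: "g \<in> G" "v = g u" using orb_eqD[OF uv(3)] by blast
  have "v \<in> g ` U \<inter> V" using g(2) uv(1,2) by simp
  thus False using UV(5)[OF g(1)] by simp
 qed
 thus "\<exists>U V. openin quot U & openin quot V & a \<in> U & b \<in> V & disjnt U V"
  using open_orb_image[OF UV(1)] open_orb_image[OF UV(2)] UV(3,4) xy by (intro exI[of _ "orb ` U"] exI[of _ "orb ` V"]) simp
qed

lemma openin_even_subset: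
 assumes "openin (top_of_set X) U" "!!g. g \<in> G ==> g ~= id ==> g ` U \<inter> U = {}"
 shows "inj_on orb U" "homeomorphic_map (top_of_set U) (subtopology quot (orb ` U)) orb"
proof -
 have UX: "U \<subseteq> X" using assms(1) openin_imp_subset by blast
 show inj: "inj_on orb U"
 proof
  fix a b assume ab: "a \<in> U" "b \<in> U" "orb a = orb b"
  then obtain g where g: "g \<in> G" "b = g a" using orb_eqD by blast
  show "a = b"
  proof (cases "g = id")
   case False
   hence "g ` U \<inter> U = {}" using assms(2) g by blast
   thus ?thesis using ab g by blast
  qed (use g in simp)
 qed
 have om: "open_map (top_of_set U) (subtopology quot (orb ` U)) orb" unfolding open_map_def
 proof (intro allI impI)
  fix V assume V: "openin (top_of_set U) V"
  hence "openin (top_of_set X) V" using assms(1) openin_trans by blast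
  hence "openin quot (orb ` V)" by (rule open_orb_image)
  moreover have "orb ` V = orb ` V \<inter> orb ` U" using V openin_imp_subset by blast
  ultimately show "openin (subtopology quot (orb ` U)) (orb ` V)" by (metis openin_subtopology)
 qed
 have cm: "continuous_map (top_of_set U) (subtopology quot (orb ` U)) orb" unfolding continuous_map_in_subtopology
  using continuous_map_from_subtopology_mono[OF continuous_map_orb UX] by simp
 have im: "orb ` topspace (top_of_set U) = topspace (subtopology quot (orb ` U))" by (simp add: topspace_quot image_mono[OF UX] inf_absorb2)
 show "homeomorphic_map (top_of_set U) (subtopology quot (orb ` U)) orb"
  unfolding homeomorphic_map_def using continuous_open_imp_quotient_map[OF cm om im] inj by simp
qed

end

section \<open>The hyperboloid model\<close>

definition hB :: "real^3 => real^3 => real" where "hB x y = hs x * hs y - x \<bullet> y"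

definition psi :: "real^3 => real^3" where
 "psi x = (\<chi> i. (if i = 3 then 1 else x$i) / (hs x - x$3))"

definition psi_inv :: "real^3 => real^3" where
 "psi_inv v = (\<chi> i. if i = 3 then (((v$1 / v$3)^2 + (v$2 / v$3)^2 + 1) * v$3 - 1 / v$3) / 2 else v$i / v$3)"

lemma inner3: "(x :: real^3) \<bullet> y = x$1 * y$1 + x$2 * y$2 + x$3 * y$3"
 by (simp add: inner_vec_def sum_3)

lemma hs_minus: "hs x - x$3 > 0" "(hs x - x$3) * (hs x + x$3) = 1 + (x$1)^2 + (x$2)^2"
proof -
 have e: "hs x ^ 2 = 1 + (x$1)^2 + (x$2)^2 + (x$3)^2" unfolding hs_sq inner3 by (simp add: power2_eq_square)
 hence "(x$3)^2 < hs x ^ 2" by (simp add: add_pos_nonneg)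
 hence "x$3 < hs x" using power2_less_imp_less[of "x$3" "hs x"] hs_pos(1)[of x] by simp
 thus "hs x - x$3 > 0" by simp
 show "(hs x - x$3) * (hs x + x$3) = 1 + (x$1)^2 + (x$2)^2" using e by (simp add: algebra_simps power2_eq_square)
qed

lemma psi_nth: "psi x $ 1 = x$1 / (hs x - x$3)" "psi x $ 2 = x$2 / (hs x - x$3)" "psi x $ 3 = 1 / (hs x - x$3)"
 by (simp_all add: psi_def)

lemma psi_inv_nth: "psi_inv v $ 1 = v$1 / v$3" "psi_inv v $ 2 = v$2 / v$3"
 "psi_inv v $ 3 = (((v$1 / v$3)^2 + (v$2 / v$3)^2 + 1) * v$3 - 1 / v$3) / 2" by (simp_all add: psi_inv_def)

lemma psi_hyp3: "psi x \<in> hyp3" using hs_minus(1)[of x] by (simp add: psi_nth hyp3_def)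

lemma psi_inv_psi: "psi_inv (psi x) = x"
proof -
 define a where "a = hs x - x$3"
 have a: "a > 0" using hs_minus(1) by (simp add: a_def)
 have "(1 + (x$1)^2 + (x$2)^2) / a = hs x + x$3" using hs_minus(2)[of x] a by (simp add: a_def[symmetric] field_simps)
 hence "((x$1)^2 + (x$2)^2 + 1) * (1 / a) - a = 2 * x$3" by (simp add: a_def add.commute add.assoc)
 thus ?thesis using a by (simp add: vec_eq_iff forall_3 psi_nth psi_inv_nth a_def[symmetric])
qed

lemma psi_psi_inv: "v \<in> hyp3 ==> psi (psi_inv v) = v"
proof -
 assume "v \<in> hyp3"
 hence h: "v$3 > 0" by (simp add: hyp3_def)
 define x where "x = psi_inv v"
 define c where "c = 1 / v$3"
 define Q where "Q = (v$1 / v$3)^2 + (v$2 / v$3)^2 + 1"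
 define r where "r = Q * v$3"
 have Q: "Q > 0" unfolding Q_def by (intro add_nonneg_pos) auto
 have rc: "r > 0" "c > 0" "Q = r * c" using Q h by (simp_all add: r_def c_def)
 have x: "x$1 = v$1 / v$3" "x$2 = v$2 / v$3" "x$3 = (r - c) / 2" by (simp_all add: x_def psi_inv_nth r_def Q_def c_def)
 have "1 + x \<bullet> x = Q + ((r - c) / 2)^2" unfolding inner3 x Q_def by (simp add: power2_eq_square)
 also have "... = ((r + c) / 2)^2" unfolding rc(3) by (simp add: power2_eq_square field_simps)
 finally have "hs x = (r + c) / 2" using rc by (simp add: hs_def)
 hence "hs x - x$3 = c" unfolding x by (simp add: field_simps)
 thus ?thesis using h unfolding x_def[symmetric] by (simp add: vec_eq_iff forall_3 psi_nth x c_def)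
qed

lemma hyp3_dist_psi: "hyp3_dist (psi x) (psi y) = arcosh (hB x y)"
proof -
 define a b p q where "a = hs x - x$3" and "b = hs y - y$3" and "p = hs x + x$3" and "q = hs y + y$3"
 note d = this
 define \<alpha> \<beta> where "\<alpha> = 1 / a" and "\<beta> = 1 / b"
 define S where "S = x$1 * y$1 + x$2 * y$2 + 1"
 have ab: "a > 0" "b > 0" using hs_minus(1) by (simp_all add: d)
 hence \<alpha>: "\<alpha> > 0" "\<beta> > 0" "\<alpha> * a = 1" "\<beta> * b = 1" by (simp_all add: \<alpha>_def \<beta>_def)
 have A: "(x$1)^2 + (x$2)^2 + 1 = a * p" and B: "(y$1)^2 + (y$2)^2 + 1 = b * q" using hs_minus(2)[of x] hs_minus(2)[of y] by (simp_all add: d)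
 have ps: "psi x $ 1 = x$1 * \<alpha>" "psi x $ 2 = x$2 * \<alpha>" "psi x $ 3 = \<alpha>" "psi y $ 1 = y$1 * \<beta>" "psi y $ 2 = y$2 * \<beta>" "psi y $ 3 = \<beta>"
  by (simp_all add: psi_nth d \<alpha>_def \<beta>_def)
 have "(dist (psi x) (psi y))^2 = (x$1 * \<alpha> - y$1 * \<beta>)^2 + (x$2 * \<alpha> - y$2 * \<beta>)^2 + (\<alpha> - \<beta>)^2"
  unfolding dist_norm power2_norm_eq_inner inner3 by (simp add: ps power2_eq_square)
 also have "... = \<alpha>^2 * ((x$1)^2 + (x$2)^2 + 1) + \<beta>^2 * ((y$1)^2 + (y$2)^2 + 1) - 2 * \<alpha> * \<beta> * S"
  by (simp add: S_def power2_eq_square algebra_simps)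
 also have "... = \<alpha> * p * (\<alpha> * a) + \<beta> * q * (\<beta> * b) - 2 * \<alpha> * \<beta> * S"
  unfolding A B by (simp add: power2_eq_square)
 also have "... = \<alpha> * p * (\<beta> * b) + \<beta> * q * (\<alpha> * a) - 2 * \<alpha> * \<beta> * S" by (simp add: \<alpha>)
 also have "... = 2 * \<alpha> * \<beta> * ((p * b + q * a) / 2 - S)" by (simp add: algebra_simps)
 also have "(p * b + q * a) / 2 - S = hB x y - 1" by (simp add: hB_def inner3 d S_def field_simps)
 finally have "(dist (psi x) (psi y))\<^sup>2 / (2 * psi x $ 3 * psi y $ 3) = hB x y - 1" using \<alpha> by (simp add: ps)
 thus ?thesis by (simp add: hyp3_dist_def)
qed

lemma continuous_psi: "continuous_on S psi"
 unfolding psi_def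
proof (rule continuous_on_vec_lambda)
 fix i :: 3
 have ne: "\<forall>x\<in>S. hs x - x$3 ~= 0" using hs_minus(1) by (metis less_irrefl)
 have "continuous_on S hs" unfolding hs_def by (intro continuous_intros)
 thus "continuous_on S (%x. (if i = 3 then 1 else x$i) / (hs x - x$3))"
  by (cases "i = 3") (simp_all, (intro continuous_intros ne; assumption)+)
qed

lemma continuous_psi_inv: "S \<subseteq> hyp3 ==> continuous_on S psi_inv"
 unfolding psi_inv_def
proof (rule continuous_on_vec_lambda)
 fix i :: 3
 assume "S \<subseteq> hyp3"
 hence ne: "\<forall>v\<in>S. v$3 ~= 0" by (auto simp: hyp3_def)
 show "continuous_on S (%v. if i = 3 then (((v$1 / v$3)^2 + (v$2 / v$3)^2 + 1) * v$3 - 1 / v$3) / 2 else v$i / v$3)"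
 proof (cases "i = 3")
  case True
  have "continuous_on S (%v. (((v$1 / v$3)^2 + (v$2 / v$3)^2 + 1) * v$3 - 1 / v$3) / 2)" by (intro continuous_intros ne) simp
  thus ?thesis using True by simp
 next
  case False
  have "continuous_on S (%v. v$i / v$3)" by (intro continuous_intros ne)
  thus ?thesis using False by simp
 qed
qed

lemma open_hyp3: "open hyp3"
 unfolding hyp3_def by (intro open_Collect_less continuous_intros)

lemma open_psi_image: "open U ==> open (psi ` U)"
proof -
 assume U: "open U"
 have "psi ` U = hyp3 \<inter> psi_inv -` U" using psi_hyp3 psi_inv_psi psi_psi_inv by (auto intro!: image_eqI[of _ psi "psi_inv _"])
 moreover have "open (hyp3 \<inter> psi_inv -` U)" by (rule continuous_open_preimage[OF continuous_psi_inv open_hyp3 U]) simp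
 ultimately show ?thesis by simp
qed

lemma hyp3_isometry_conj:
 assumes "bij \<gamma>" "!!x y. hB (\<gamma> x) (\<gamma> y) = hB x y"
 shows "hyp3_isometry (psi \<circ> \<gamma> \<circ> psi_inv)" unfolding hyp3_isometry_def
proof (intro conjI ballI)
 show "bij_betw (psi \<circ> \<gamma> \<circ> psi_inv) hyp3 hyp3"
 proof (rule bij_betwI[where g = "psi \<circ> inv_into UNIV \<gamma> \<circ> psi_inv"])
  show "(psi \<circ> inv_into UNIV \<gamma> \<circ> psi_inv) ((psi \<circ> \<gamma> \<circ> psi_inv) x) = x" if "x \<in> hyp3" for x
   using assms(1) psi_psi_inv[OF that] by (simp add: psi_inv_psi bij_is_inj)
  show "(psi \<circ> \<gamma> \<circ> psi_inv) ((psi \<circ> inv_into UNIV \<gamma> \<circ> psi_inv) x) = x" if "x \<in> hyp3" for x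
   using assms(1) psi_psi_inv[OF that] by (simp add: psi_inv_psi bij_is_surj surj_f_inv_f)
 qed (auto simp: psi_hyp3)
 fix v w assume "v \<in> hyp3" "w \<in> hyp3"
 hence "v = psi (psi_inv v)" "w = psi (psi_inv w)" by (simp_all add: psi_psi_inv)
 moreover have "hyp3_dist ((psi \<circ> \<gamma> \<circ> psi_inv) v) ((psi \<circ> \<gamma> \<circ> psi_inv) w) = hyp3_dist (psi (psi_inv v)) (psi (psi_inv w))"
  by (simp add: hyp3_dist_psi assms(2))
 ultimately show "hyp3_dist ((psi \<circ> \<gamma> \<circ> psi_inv) v) ((psi \<circ> \<gamma> \<circ> psi_inv) w) = hyp3_dist v w" by simp
qed

lemma homeomorphism_imp_space:
 assumes "homeomorphism S T f g"
 shows "top_of_set S homeomorphic_space top_of_set T" unfolding homeomorphic_space_def homeomorphic_maps_def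
 using assms by (intro exI[of _ f] exI[of _ g]) (auto simp: homeomorphism_def continuous_map_subtopology_eu)

lemma second_countable_subset: "second_countable (top_of_set (S :: 'a::second_countable_topology set))"
proof (rule second_countable_subtopology)
 obtain \<B> :: "'a set set" where B: "countable \<B>" "!!C. C \<in> \<B> ==> open C" "!!S. open S ==> \<exists>U. U \<subseteq> \<B> & S = \<Union>U"
  using univ_second_countable by blast
 show "second_countable (euclidean :: 'a topology)" unfolding second_countable_def
 proof (intro exI[of _ \<B>] conjI ballI allI impI B(1))
  fix U and x :: 'a assume "openin euclidean U & x \<in> U"
  moreover then obtain V where "V \<subseteq> \<B>" "U = \<Union>V" using B(3)[of U] by (metis open_openin)
  ultimately show "\<exists>V\<in>\<B>. x \<in> V & V \<subseteq> U" by blast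
 qed (use B(2) in simp)
qed

lemma homeomorphic_half_space:
 assumes "bounded (B :: (real^3) set)" "open B"
 obtains V where "open V" "V \<subseteq> half_space3" "top_of_set B homeomorphic_space top_of_set V"
proof -
 obtain b where b: "!!x. x \<in> B ==> norm x <= b" using assms(1) by (auto simp: bounded_iff)
 define V where "V = (+) (b *\<^sub>R axis 3 1) ` B"
 have "open V" unfolding V_def by (rule open_translation[OF assms(2)])
 moreover have "V \<subseteq> half_space3"
 proof
  fix v assume "v \<in> V"
  then obtain x where x: "x \<in> B" "v = b *\<^sub>R axis 3 1 + x" by (auto simp: V_def)
  have "\<bar>x$3\<bar> <= b" using component_le_norm_cart[of x 3] b[OF x(1)] by linarith
  thus "v \<in> half_space3" by (simp add: half_space3_def x axis_def)
 qed
 moreover have "top_of_set B homeomorphic_space top_of_set V"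
  using homeomorphic_translation[of B "b *\<^sub>R axis 3 1"] homeomorphism_imp_space unfolding V_def homeomorphic_def by blast
 ultimately show ?thesis by (rule that)
qed

context ra_system
begin

lemma hB_refl: "i \<in> I ==> hB (refl i x) (refl i y) = hB x y"
proof -
 assume i: "i \<in> I"
 define a where "a = L i x"
 define b where "b = L i y"
 have nx: "n i \<bullet> x = a + p * hs x" "n i \<bullet> y = b + p * hs y" by (simp_all add: L_def a_def b_def)
 have "refl i x \<bullet> refl i y = x \<bullet> y - b * (n i \<bullet> x) - a * (n i \<bullet> y) + a * b * (n i \<bullet> n i)"
  by (simp add: refl_def inner_diff_left inner_diff_right inner_commute a_def b_def algebra_simps)
 thus ?thesis unfolding hB_def hs_refl[OF i] nx nn[OF i] by (simp add: a_def[symmetric] b_def[symmetric] algebra_simps power2_eq_square)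
qed

end

context ra_cells
begin

lemma hB_ev: "hB (ev w x) (ev w y) = hB x y"
 by (induction w) (auto simp: hB_refl)

lemma hB_Mor: "f \<in> Mor c d ==> hB (f x) (f y) = hB x y"
proof -
 assume "f \<in> Mor c d"
 then obtain w h where f: "f = ev w \<circ> ri h" "h \<in> symm" by (rule MorE)
 show ?thesis unfolding f(1) comp_apply hB_ev by (simp add: hB_def hs_ri[OF f(2)] ri_inner[OF f(2)])
qed

end

context ra_tree
begin

interpretation D: deck_action UNIV Gam by (rule deck_action_Mor)

lemma orb_cell: "\<exists>d. \<exists>y\<in>P. D.orb (m d y) = D.orb x"
proof -
 obtain d f y where f: "f \<in> Mor c0 d" "y \<in> P" "x = f y" by (rule Mor_cover)
 have "m d \<circ> finv f \<in> Gam" by (rule Mor_comp[OF m(1) Mor_inv(2)[OF f(1)]])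
 hence "D.orb ((m d \<circ> finv f) x) = D.orb x" by (rule D.orb_apply)
 moreover have "(m d \<circ> finv f) x = m d y" using Mor_inv(1)[OF f(1)] by (simp add: f(3) bij_is_inj)
 ultimately show ?thesis using f(2) by metis
qed

lemma Hausdorff_quot: "Hausdorff_space D.quot"
proof (rule D.Hausdorff_quot)
 fix x y assume "D.orb x ~= D.orb y"
 hence "g x ~= y" if "g \<in> Gam" for g using D.orb_apply[OF that, of x] by auto
 then obtain U V where "open U" "open V" "x \<in> U" "y \<in> V" "!!g. g \<in> Gam ==> g ` U \<inter> V = {}"
  using Mor_separate[of "Mor c0 c0" c0 x y] by (metis order_refl)
 thus "\<exists>U V. openin (top_of_set UNIV) U & openin (top_of_set UNIV) V & x \<in> U & y \<in> V & (\<forall>g\<in>Gam. g ` U \<inter> V = {})"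
  by (intro exI[of _ U] exI[of _ V]) simp
qed

lemma chart_quot:
 assumes "x \<in> topspace D.quot"
 obtains U B where "openin D.quot U" "x \<in> U" "open B" "bounded B"
  "subtopology D.quot U homeomorphic_space top_of_set (B :: (real^3) set)"
proof -
 obtain y where y: "x = D.orb y" using assms by (auto simp: D.topspace_quot)
 obtain W where W: "openin (top_of_set UNIV) W" "y \<in> W" "\<forall>g\<in>Gam. g ~= id --> g ` W \<inter> W = {}"
  using D.even_nbhd[of y] by auto
 obtain r where r: "r > 0" "ball y r \<subseteq> W" using W(1,2) open_contains_ball by (metis openin_open_eq open_UNIV subtopology_UNIV open_openin)
 have b: "g ` ball y r \<inter> ball y r = {}" if "g \<in> Gam" "g ~= id" for g
 proof -
  have "g ` ball y r \<inter> ball y r \<subseteq> g ` W \<inter> W" using r(2) by blast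
  thus ?thesis using W(3) that by blast
 qed
 have o: "openin (top_of_set UNIV) (ball y r)" by simp
 have "top_of_set (ball y r) homeomorphic_space subtopology D.quot (D.orb ` ball y r)"
  by (rule homeomorphic_map_imp_homeomorphic_space[OF D.openin_even_subset(2)[OF o b]])
 hence "subtopology D.quot (D.orb ` ball y r) homeomorphic_space top_of_set (ball y r)" by (rule homeomorphic_space_sym[THEN iffD1])
 moreover have "openin D.quot (D.orb ` ball y r)" by (rule D.open_orb_image[OF o])
 ultimately show ?thesis using that[of "D.orb ` ball y r" "ball y r"] r(1) y by simp
qed

lemma closed_manifold_quot:
 assumes "compact P" "finite (UNIV :: 'c set)"
 shows "closed_manifold3 D.quot"
proof -
 have 1: "connected_space D.quot" by (rule D.connected_quot) (rule convex_connected[OF convex_UNIV])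
 have 2: "second_countable D.quot" by (rule D.second_countable_quot[OF second_countable_subset])
 have 3: "\<exists>U V. openin D.quot U & x \<in> U & openin (top_of_set half_space3) V &
   subtopology D.quot U homeomorphic_space top_of_set V" if x: "x \<in> topspace D.quot" for x
 proof -
  obtain U B where UB: "openin D.quot U" "x \<in> U" "open B" "bounded B"
   "subtopology D.quot U homeomorphic_space top_of_set (B :: (real^3) set)" using chart_quot[OF x] .
  obtain V where V: "open V" "V \<subseteq> half_space3" "top_of_set B homeomorphic_space top_of_set V"
   using homeomorphic_half_space[OF UB(4,3)] .
  have "openin (top_of_set half_space3) V" by (rule open_subset[OF V(2,1)])
  thus ?thesis using UB(1,2) homeomorphic_space_trans[OF UB(5) V(3)] by blast
 qed
 have 4: "compact_space D.quot"
 proof (rule D.compact_quot[where C = "\<Union>d\<in>UNIV. m d ` P"])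
  show "compact (\<Union>d\<in>UNIV. m d ` P)" by (intro compact_UN assms(2) compact_continuous_image Mor_continuous[OF m(1)] assms(1))
  show "\<exists>y\<in>\<Union>d\<in>UNIV. m d ` P. D.orb y = D.orb x" for x using orb_cell[of x] by blast
 qed simp
 have "x \<in> manifold3_interior D.quot" if x: "x \<in> topspace D.quot" for x
 proof -
  obtain U B where UB: "openin D.quot U" "x \<in> U" "open B" "bounded B"
   "subtopology D.quot U homeomorphic_space top_of_set (B :: (real^3) set)" using chart_quot[OF x] .
  show ?thesis unfolding manifold3_interior_def by (rule CollectI, intro conjI x exI[of _ U] exI[of _ B] UB)
 qed
 hence 5: "manifold3_boundary D.quot = {}" unfolding manifold3_boundary_def by blast
 have 6: "topspace D.quot ~= {}" by (simp add: D.topspace_quot)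
 show ?thesis unfolding closed_manifold3_def manifold3_def by (intro conjI ballI 1 2 3 4 5 6 Hausdorff_quot)
qed

lemma hyperbolic_quot: "\<exists>A. hyperbolic_atlas3 D.quot A"
proof -
 define ev_set where "ev_set U \<longleftrightarrow> open U & (\<forall>g\<in>Gam. g ~= id --> g ` U \<inter> U = {})" for U :: "(real^3) set"
 define ch where "ch U = psi \<circ> inv_into U D.orb" for U
 have inj: "inj_on D.orb U" and hm: "homeomorphic_map (top_of_set U) (subtopology D.quot (D.orb ` U)) D.orb"
  and op: "openin D.quot (D.orb ` U)" if "ev_set U" for U
 proof -
  have o: "openin (top_of_set UNIV) U" using that by (simp add: ev_set_def)
  show "inj_on D.orb U" "homeomorphic_map (top_of_set U) (subtopology D.quot (D.orb ` U)) D.orb"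
   using D.openin_even_subset[OF o] that unfolding ev_set_def by blast+
  show "openin D.quot (D.orb ` U)" by (rule D.open_orb_image[OF o])
 qed
 have ch: "ch U (D.orb x) = psi x" if "ev_set U" "x \<in> U" for U x using inv_into_f_f[OF inj[OF that(1)] that(2)] by (simp add: ch_def)
 have im: "ch U ` D.orb ` U = psi ` U" if "ev_set U" for U using ch[OF that] by (force simp: image_iff)
 define A where "A = {(D.orb ` U, ch U) | U. ev_set U}"
 have cov: "(\<Union>(U, f)\<in>A. U) = topspace D.quot"
 proof (rule subset_antisym)
  show "(\<Union>(U, f)\<in>A. U) \<subseteq> topspace D.quot" unfolding A_def D.topspace_quot by blast
  show "topspace D.quot \<subseteq> (\<Union>(U, f)\<in>A. U)"
  proof
   fix a assume "a \<in> topspace D.quot"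
   then obtain x where x: "a = D.orb x" by (auto simp: D.topspace_quot)
   obtain U where "openin (top_of_set UNIV) U" "x \<in> U" "\<forall>g\<in>Gam. g ~= id --> g ` U \<inter> U = {}"
    using D.even_nbhd[of x] by auto
   hence "ev_set U" "a \<in> D.orb ` U" using x by (auto simp: ev_set_def)
   thus "a \<in> (\<Union>(U, f)\<in>A. U)" unfolding A_def by blast
  qed
 qed
 have charts: "openin D.quot W & open (f ` W) & f ` W \<subseteq> hyp3 &
   homeomorphic_map (subtopology D.quot W) (top_of_set (f ` W)) f" if Wf: "(W, f) \<in> A" for W f
 proof -
  obtain U where U: "ev_set U" "W = D.orb ` U" "f = ch U" using Wf by (auto simp: A_def)
  have fW: "f ` W = psi ` U" unfolding U(2,3) by (rule im[OF U(1)])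
  have oU: "open U" using U(1) by (simp add: ev_set_def)
  obtain g where g: "homeomorphic_maps (top_of_set U) (subtopology D.quot W) D.orb g"
   using hm[OF U(1)] unfolding U(2) homeomorphic_map_maps by blast
  have gi: "g a = inv_into U D.orb a" if a: "a \<in> W" for a
  proof -
   obtain x where x: "x \<in> U" "a = D.orb x" using a unfolding U(2) by (elim imageE)
   have "g (D.orb x) = x" using g x(1) by (simp add: homeomorphic_maps_def)
   thus ?thesis using inv_into_f_f[OF inj[OF U(1)] x(1)] x(2) by simp
  qed
  have gm: "homeomorphic_map (subtopology D.quot W) (top_of_set U) g" using g homeomorphic_maps_sym homeomorphic_map_maps by blast
  have pm: "homeomorphic_map (top_of_set U) (top_of_set (psi ` U)) psi" unfolding homeomorphic_map_maps homeomorphic_maps_def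
   by (rule exI[of _ psi_inv]) (auto simp: continuous_map_subtopology_eu continuous_psi psi_inv_psi psi_hyp3 intro!: continuous_psi_inv)
  have tW: "topspace (subtopology D.quot W) = W" using openin_subset[OF op[OF U(1)]] U(2) by (simp add: inf_absorb2)
  have "homeomorphic_map (subtopology D.quot W) (top_of_set (psi ` U)) (psi \<circ> g)" by (rule homeomorphic_map_compose[OF gm pm])
  hence "homeomorphic_map (subtopology D.quot W) (top_of_set (psi ` U)) f"
   by (rule homeomorphic_map_eq) (use gi U(3) tW in \<open>auto simp: ch_def\<close>)
  thus ?thesis using fW op[OF U(1)] U(2) open_psi_image[OF oU] psi_hyp3 by auto
 qed
 have trans: "\<exists>Z \<gamma>. openin D.quot Z & a \<in> Z & Z \<subseteq> W \<inter> W' & hyp3_isometry \<gamma> & (\<forall>w\<in>Z. f' w = \<gamma> (f w))"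
  if Wf: "(W, f) \<in> A" "(W', f') \<in> A" "a \<in> W \<inter> W'" for W f W' f' a
 proof -
  obtain U where U: "ev_set U" "W = D.orb ` U" "f = ch U" using Wf(1) by (auto simp: A_def)
  obtain V where V: "ev_set V" "W' = D.orb ` V" "f' = ch V" using Wf(2) by (auto simp: A_def)
  obtain x y where xy: "x \<in> U" "y \<in> V" "a = D.orb x" "a = D.orb y" using Wf(3) U(2) V(2) by blast
  obtain g where g: "g \<in> Gam" "y = g x" using D.orb_eqD[of x y] xy(3,4) by auto
  define Z where "Z = U \<inter> g -` V"
  have "open Z" unfolding Z_def using U(1) V(1) open_vimage[OF _ Mor_continuous[OF g(1)]] by (intro open_Int) (auto simp: ev_set_def)
  hence oZ: "openin D.quot (D.orb ` Z)" by (intro D.open_orb_image) simp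
  have "f' w = (psi \<circ> g \<circ> psi_inv) (f w)" if w: "w \<in> D.orb ` Z" for w
  proof -
   obtain z where z: "z \<in> U" "g z \<in> V" "w = D.orb z" using w by (auto simp: Z_def)
   have "w = D.orb (g z)" using D.orb_apply[OF g(1)] z(3) by simp
   hence "f' w = psi (g z)" using ch[OF V(1) z(2)] V(3) by simp
   moreover have "f w = psi z" using ch[OF U(1) z(1)] z(3) U(3) by simp
   ultimately show ?thesis by (simp add: psi_inv_psi)
  qed
  moreover have "hyp3_isometry (psi \<circ> g \<circ> psi_inv)" by (rule hyp3_isometry_conj[OF Mor_inv(1)[OF g(1)] hB_Mor[OF g(1)]])
  moreover have "D.orb ` Z \<subseteq> W \<inter> W'"
  proof
   fix w assume "w \<in> D.orb ` Z"
   then obtain z where z: "z \<in> U" "g z \<in> V" "w = D.orb z" by (auto simp: Z_def)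
   have "w = D.orb (g z)" using D.orb_apply[OF g(1)] z(3) by simp
   thus "w \<in> W \<inter> W'" using z U(2) V(2) by blast
  qed
  moreover have "a \<in> D.orb ` Z" using xy g by (auto simp: Z_def)
  ultimately show ?thesis using oZ by blast
 qed
 have "hyperbolic_atlas3 D.quot A" unfolding hyperbolic_atlas3_def
 proof (intro conjI cov ballI)
  fix z assume z: "z \<in> A"
  obtain W f where zz: "z = (W, f)" by fastforce
  show "case z of (U, f) => openin D.quot U & open (f ` U) & f ` U \<subseteq> hyp3 &
    homeomorphic_map (subtopology D.quot U) (top_of_set (f ` U)) f" using z unfolding zz prod.case by (rule charts)
  show "case z of (U, f) => \<forall>(V, g)\<in>A. \<forall>p\<in>U \<inter> V. \<exists>W \<gamma>. openin D.quot W & p \<in> W & W \<subseteq> U \<inter> V &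
    hyp3_isometry \<gamma> & (\<forall>w\<in>W. g w = \<gamma> (f w))" unfolding zz prod.case
  proof (rule ballI)
   fix z' assume z': "z' \<in> A"
   obtain W' f' where zz': "z' = (W', f')" by fastforce
   show "case z' of (V, g) => \<forall>p\<in>W \<inter> V. \<exists>Z \<gamma>. openin D.quot Z & p \<in> Z & Z \<subseteq> W \<inter> V &
     hyp3_isometry \<gamma> & (\<forall>w\<in>Z. g w = \<gamma> (f w))"
    unfolding zz' prod.case using trans[OF z[unfolded zz] z'[unfolded zz']] by (rule ballI)
  qed
 qed
 thus ?thesis ..
qed

theorem closed_hyperbolic_quot:
 "compact P ==> finite (UNIV :: 'c set) ==> closed_hyperbolic_manifold3 D.quot"
 unfolding closed_hyperbolic_manifold3_def using closed_manifold_quot hyperbolic_quot by blast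

end

context sc_deck_action
begin

lemma one_fundamental_group: "\<one>\<^bsub>fundamental_group quot (orb x0)\<^esub> = loop_class id"
proof -
 have "orb x0 \<in> topspace quot" using x0 by (simp add: topspace_quot)
 hence c: "(%_. orb x0) \<in> loops_at quot (orb x0)" by (simp add: loops_at_def pathin_def)
 have "dk (%_. orb x0) = id" by (rule dk_eqI[of _ "%_. x0"]) (use x0 G_id in \<open>auto simp: is_lift_def\<close>)
 thus ?thesis using loop_homotopy_image[OF c] by (simp add: fundamental_group_def)
qed

lemma group_fundamental_group: "group deck_group ==> group (fundamental_group quot (orb x0))"
proof -
 assume G: "group deck_group"
 have "group ((fundamental_group quot (orb x0)) \<lparr>one := loop_class \<one>\<^bsub>deck_group\<^esub>\<rparr>)"
  by (rule group.iso_imp_img_group[OF G fundamental_group_iso])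
 moreover have "loop_class \<one>\<^bsub>deck_group\<^esub> = \<one>\<^bsub>fundamental_group quot (orb x0)\<^esub>"
  unfolding one_fundamental_group by (simp add: deck_group_def)
 ultimately show ?thesis by simp
qed

end

context ra_classes
begin

theorem manifold_invariants:
 assumes X: "deck_action X Gam" "simply_connected X"
  and no: "!!l. l >= 2 ==> epi dg (free_group l) = {}"
  and x: "x \<in> topspace (deck_action.quot X Gam)"
 shows "manifold_betti1 (deck_action.quot X Gam) x = enat k" "manifold_corank (deck_action.quot X Gam) x = 1"
proof -
 interpret D: deck_action X Gam by (rule X(1))
 obtain x0 where x0: "x0 \<in> X" "x = D.orb x0" using x by (auto simp: D.topspace_quot)
 interpret S: sc_deck_action X Gam x0 by unfold_locales (use X(2) x0 in auto)
 let ?H = "fundamental_group D.quot x"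
 have iso: "S.loop_class \<in> iso dg ?H" using S.fundamental_group_iso x0(2) by simp
 have H: "group ?H" using S.group_fundamental_group[OF group_dg] x0(2) by simp
 show "manifold_betti1 D.quot x = enat k" unfolding manifold_betti1_def
 proof (rule betti1_iso_eqI[OF group_dg H iso, where f = f and g = g])
  show "f i (x \<otimes>\<^bsub>dg\<^esub> y) = f i x + f i y" if "i < k" "x \<in> carrier dg" "y \<in> carrier dg" for i x y
   using f_comp that by (simp add: dg_simps)
  show "g i \<in> carrier dg" for i by (simp add: dg_simps g_in)
  show "f i (g j) = (if i = j then 1 else 0)" if "i < k" "j < k" for i j using fg[OF that(2,1)] .
  fix h :: "(real^3 => real^3) => rat" and x
  assume "!!x y. x \<in> carrier dg ==> y \<in> carrier dg ==> h (x \<otimes>\<^bsub>dg\<^esub> y) = h x + h y"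
   "!!j. j < k ==> h (g j) = 0" "x \<in> carrier dg"
  thus "h x = 0" using additive_zero[of h x] by (simp add: dg_simps)
 qed
 show "manifold_corank D.quot x = 1" unfolding manifold_corank_def
 proof (rule corank_iso_eq_1[OF group_dg iso, where f = "f 0"])
  show "f 0 (x \<otimes>\<^bsub>dg\<^esub> y) = f 0 x + f 0 y" if "x \<in> carrier dg" "y \<in> carrier dg" for x y
   using f_comp[OF k] that by (simp add: dg_simps)
  show "\<exists>g\<in>carrier dg. f 0 g = n" for n using f_onto by (simp add: dg_simps)
 qed (rule no)
qed

end

section \<open>Checking the combinatorial axioms by evaluation\<close>

definition gluing_ok :: "('c => 'i => 'c) => ('c => 'i => 'i => 'i) => ('i => 'i list) => 'c list => 'i list => bool" where
 "gluing_ok nb gl nbrs cs fs = list_all (%c. list_all (%i.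
  (let d = nb c i; h = gl c i; d' = nb d (h i); h' = gl d (h i) in
    d' = c & list_all (%k. h' (h k) = k) fs &
    list_all (%j. nb d (h j) = nb (nb c j) (gl c j i) &
     list_all (%k. gl d (h j) (h k) = gl (nb c j) (gl c j i) (gl c j k)) fs) (nbrs i))) fs) cs"

fun cliques :: "('i => 'i list) => 'i list => 'i list list" where
 "cliques nbrs [] = [[]]"
| "cliques nbrs (i # is) = (let C = cliques nbrs is in map ((#) i) (filter (list_all (%j. j \<in> set (nbrs i))) C) @ C)"

definition words :: "'i list => 'i list list" where
 "words Z = concat (map (%l. filter distinct (List.n_lists (Suc l) Z)) [0..<length Z])"

fun walk :: "('c => 'i => 'c) => ('c => 'i => 'i => 'i) => 'c => ('i => 'i) => 'i list => 'c \<times> ('i => 'i)" where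
 "walk nb gl c h [] = (c, h)"
| "walk nb gl c h (i # w) = walk nb gl (nb c (h i)) (gl c (h i) \<circ> h) w"

definition free_ok :: "('c => 'i => 'c) => ('c => 'i => 'i => 'i) => ('i => 'i list) => 'c list => 'i list => bool" where
 "free_ok nb gl nbrs cs fs = list_all (%Z. list_all (%w. list_all (%c.
  (case walk nb gl c id w of (d, h) => d ~= c \<or> ~ list_all (%z. h z \<in> set Z) Z)) cs) (words Z))
  (cliques nbrs fs)"

lemma walk_foldl: "foldl (%(c, h) i. (nb c (h i), gl c (h i) \<circ> h)) (c, h) w = walk nb gl c h w"
 by (induction w arbitrary: c h) auto

lemma cliques_mem:
 assumes "!!i j. i \<in> Z ==> j \<in> Z ==> i ~= j ==> j \<in> set (nbrs i)" "distinct fs"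
 shows "filter (%i. i \<in> Z) fs \<in> set (cliques nbrs fs)" using assms(2)
proof (induction fs)
 case (Cons i fs)
 have "list_all (%j. j \<in> set (nbrs i)) (filter (%i. i \<in> Z) fs)" if "i \<in> Z"
  using assms(1)[OF that] Cons.prems by (auto simp: list_all_iff)
 thus ?case using Cons by (auto simp: Let_def)
qed simp

lemma words_mem: "distinct w ==> w ~= [] ==> set w \<subseteq> set Z ==> w \<in> set (words Z)"
proof -
 assume w: "distinct w" "w ~= []" "set w \<subseteq> set Z"
 have "length w <= length Z" using w distinct_card[OF w(1)] card_mono[OF _ w(3)] card_length[of Z] by simp
 moreover obtain l where "length w = Suc l" using w(2) by (cases w) auto
 moreover from this have "w \<in> set (List.n_lists (Suc l) Z)" unfolding set_n_lists using w(3) by simp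
 ultimately show ?thesis using w(1) by (auto simp: words_def simp del: List.n_lists.simps intro!: bexI[of _ l])
qed

lemma ra_cellsI:
 fixes nb :: "'c => 'i::finite => 'c"
 assumes sys: "ra_system UNIV n p" and span: "span (range n) = UNIV" and gl: "!!c i. gl c i \<in> ra_system.symm n"
  and nbrs: "!!i j. ra_system.adj UNIV n p i j \<longleftrightarrow> j \<in> set (nbrs i)"
  and cs: "set cs = UNIV" and fs: "set fs = UNIV" "distinct fs"
  and ok: "gluing_ok nb gl nbrs cs fs" "free_ok nb gl nbrs cs fs"
 shows "ra_cells n p nb gl"
proof -
 interpret U: ra_system UNIV n p by (rule sys)
 have ok1: "nb (nb c i) (gl c i i) = c" "gl (nb c i) (gl c i i) (gl c i k) = k"
  "j \<in> set (nbrs i) ==> nb (nb c i) (gl c i j) = nb (nb c j) (gl c j i)"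
  "j \<in> set (nbrs i) ==> gl (nb c i) (gl c i j) (gl c i k) = gl (nb c j) (gl c j i) (gl c j k)" for c i j k
  using ok(1) unfolding gluing_ok_def Let_def list_all_iff cs fs(1) by blast+
 have inj: "inj n"
 proof (rule injI, rule ccontr)
  fix i j assume "n i = n j" "i ~= j"
  thus False using U.nij[of i j] U.nn[of i] by auto
 qed
 show ?thesis
 proof (intro ra_cells.intro ra_cells_axioms.intro)
  show "ra_system UNIV n p" by (rule U.ra_system_axioms)
  show "inj n" "span (range n) = UNIV" by (fact inj, fact span)
  show "gl c i \<in> ra_system.symm n" for c i by (rule gl)
  show "nb (nb c i) (gl c i i) = c" for c i by (rule ok1)
  show "gl (nb c i) (gl c i i) \<circ> gl c i = id" for c i using ok1(2) by (simp add: fun_eq_iff)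
  fix c :: 'c and i j
  assume "ra_system.adj UNIV n p i j"
  hence a: "j \<in> set (nbrs i)" using nbrs by simp
  show "nb (nb c i) (gl c i j) = nb (nb c j) (gl c j i)" by (rule ok1(3)[OF a])
  show "gl (nb c i) (gl c i j) \<circ> gl c i = gl (nb c j) (gl c j i) \<circ> gl c j" using ok1(4)[OF a] by (simp add: fun_eq_iff)
 next
  fix c :: 'c and h w Z
  assume Z: "ra_system.clique UNIV n p Z" and w: "distinct w" "w ~= []" "set w \<subseteq> Z"
   and f: "foldl (%(c, h) i. (nb c (h i), gl c (h i) \<circ> h)) (c, id) w = (c, h)"
  define zl where "zl = filter (%i. i \<in> Z) fs"
  have zl: "set zl = Z" using fs by (auto simp: zl_def)
  have zm: "zl \<in> set (cliques nbrs fs)" unfolding zl_def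
   by (rule cliques_mem[OF _ fs(2)]) (use Z nbrs in \<open>auto simp: U.clique_def\<close>)
  have wm: "w \<in> set (words zl)" by (rule words_mem) (use w zl in auto)
  have cm: "c \<in> set cs" using cs by simp
  define T where "T Z w c = (case walk nb gl c id w of (d, h) => d ~= c \<or> ~ list_all (%z. h z \<in> set Z) Z)" for Z w c
  have "\<forall>Z\<in>set (cliques nbrs fs). \<forall>w\<in>set (words Z). \<forall>c\<in>set cs. T Z w c"
   using ok(2) unfolding free_ok_def T_def list_all_iff .
  hence "T zl w c" using zm wm cm by blast
  hence "~ (\<forall>z\<in>set zl. h z \<in> set zl)" using f unfolding walk_foldl T_def by (simp add: list_all_iff)
  thus "h ` Z ~= Z" using zl by auto
 qed
qed

definition lab_ok :: "('c => 'i => 'c) => ('c => 'i => 'i => 'i) => ('i => 'i list) => 'c list => 'i list =>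
  ('c => 'i => int list) => nat => bool" where
 "lab_ok nb gl nbrs cs fs lab k = list_all (%c. list_all (%i. length (lab c i) = k &
  map2 (+) (lab c i) (lab (nb c i) (gl c i i)) = replicate k 0 &
  list_all (%j. map2 (+) (lab c i) (lab (nb c i) (gl c i j)) = map2 (+) (lab c j) (lab (nb c j) (gl c j i))) (nbrs i)) fs) cs"

fun tree_list :: "('c => 'i => 'c) => 'c list => 'c list => ('c \<times> 'i) list => bool" where
 "tree_list nb cs V [] \<longleftrightarrow> list_all (%c. c \<in> set V) cs"
| "tree_list nb cs V (e # ts) \<longleftrightarrow> fst e \<in> set V & nb (fst e) (snd e) \<notin> set V & tree_list nb cs (nb (fst e) (snd e) # V) ts"

lemma dot_eq_sum: "length as = length bs ==> dot as bs = (\<Sum>j<length bs. as ! j * bs ! j)"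
proof (induction as arbitrary: bs)
 case (Cons a as)
 then obtain b bs' where "bs = b # bs'" by (cases bs) auto
 thus ?case using Cons by (simp add: sum.lessThan_Suc_shift del: sum.lessThan_Suc)
qed simp

context ra_cells
begin

lemma tree_list_ok: "tree_list nb cs V ts ==> set cs = UNIV ==> tree_ok (set V) ts"
proof (induction ts arbitrary: V)
 case (Cons e ts)
 have "tree_list nb cs (nb (fst e) (snd e) # V) ts" using Cons.prems(1) by simp
 from Cons.IH[OF this Cons.prems(2)] show ?case using Cons.prems by simp
qed (auto simp: list_all_iff)

end

lemma ra_classesI:
 fixes nb :: "'c::finite => 'i::finite => 'c"
 assumes "ra_cells n p nb gl" and nbrs: "!!i j. ra_system.adj UNIV n p i j \<longleftrightarrow> j \<in> set (nbrs i)" and cs: "set cs = UNIV" and fs: "set fs = UNIV"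
  and tree: "tree_list nb cs [c0] ts" and lab: "lab_ok nb gl nbrs cs fs lab k"
  and tl: "list_all (%e. lab (fst e) (snd e) = replicate k 0) ts"
  and es: "length es = k" "map (%e. lab (fst e) (snd e)) es = units k" "k > 0"
  and q: "prime q" and key: "!!c i d j. key c i = key d j ==> c = d & i = j"
  and cert: "certify nb gl key q (%_ _. 1) ts es ps prog rels cs fs" and adj: "list_all (%(c, i, j). j \<in> set (nbrs i)) (prog @ rels)"
 shows "ra_classes n p nb gl c0 ts k (%j c i. lab c i ! j) (%j. es ! j) q"
proof -
 interpret ra_cells n p nb gl by fact
 have tree': "tree_ok {c0} ts" using tree_list_ok[OF tree cs] by simp
 have len: "length (lab c i) = k" for c i using lab unfolding lab_ok_def list_all_iff cs fs by blast
 have bk: "map2 (+) (lab c i) (lab (nb c i) (gl c i i)) = replicate k 0" for c i using lab unfolding lab_ok_def list_all_iff cs fs by blast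
 have sq: "map2 (+) (lab c i) (lab (nb c i) (gl c i j)) = map2 (+) (lab c j) (lab (nb c j) (gl c j i))" if "adj i j" for c i j
  using lab that nbrs unfolding lab_ok_def list_all_iff cs fs by blast
 have nth: "map2 (+) (lab c i) (lab d j) ! l = lab c i ! l + lab d j ! l" if "l < k" for c i d j l using that len by simp
 have adj': "list_all (%(c, i, j). adj i j) (prog @ rels)" using adj by (simp add: nbrs)
 show ?thesis
 proof (intro ra_classes.intro ra_classes_axioms.intro ra_tree.intro ra_tree_axioms.intro)
  show "ra_cells n p nb gl" by (rule ra_cells_axioms)
  show "tree_ok {c0} ts" by (rule tree')
  show "k > 0" "prime q" by fact+
  show "flat 0 (%_ _. 1) (%c i. lab c i ! j)" if "j < k" for j unfolding flat_def
  proof (intro conjI allI impI)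
   show "[lab c i ! j + 1 * lab (nb c i) (gl c i i) ! j = 0] (mod 0)" for c i
    using arg_cong[OF bk[of c i], of "%v. v ! j"] nth[OF that, of c i] that by simp
   show "[lab c i ! j + 1 * lab (nb c i) (gl c i l) ! j = lab c l ! j + 1 * lab (nb c l) (gl c l i) ! j] (mod 0)" if a: "adj i l" for c i l
    using arg_cong[OF sq[OF a, of c], of "%v. v ! j"] nth[OF \<open>j < k\<close>] by simp
  qed
  show "lab c i ! j = 0" if "j < k" "(c, i) \<in> set ts" for j c i using tl that by (auto simp: list_all_iff)
  show "lab (fst (es ! j)) (snd (es ! j)) ! l = (if l = j then 1 else 0)" if "j < k" "l < k" for j l
  proof -
   have "map (%e. lab (fst e) (snd e)) es ! j = units k ! j" using es(2) by simp
   thus ?thesis using that es(1) by (simp add: units_def)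
  qed
  show "[x c i = 0] (mod q)" if "flat q (%_ _. 1) x"
   "!!c i. (c, i) \<in> set ts \<union> (!) es ` {..<k} ==> [x c i = 0] (mod q)" for x c i
  proof (rule certify_sound[OF q key cert cs fs adj' that(1)])
   fix c i assume "(c, i) \<in> set ts \<union> set es"
   moreover have "set es = (!) es ` {..<k}" using nth_image[of k es] es(1) by (simp add: lessThan_atLeast0)
   ultimately have "(c, i) \<in> set ts \<union> (!) es ` {..<k}" by simp
   thus "[x c i = 0] (mod q)" by (rule that(2))
  qed
 qed
qed

lemma (in ra_classes) chi_rigidI:
 assumes phi: "!!j c i. j < k ==> phi j c i = lab c i ! j" and lab: "!!c i. length (lab c i) = k"
  and r: "prime r" and al: "length al = k" "!!j. j < k ==> A j mod e = al ! j mod e"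
  and key: "!!c i d j. key c i = key d j ==> c = d & i = j" and cs: "set cs = UNIV" and fs: "set fs = UNIV"
  and cert: "certify nb gl key r (%c i. cyc_pow b e (dot al (lab c i))) ts [z] ps prog rels cs fs"
  and adj: "list_all (%(c, i, j). adj i j) (prog @ rels)"
  and ne: "cyc_pow b e (dot al (lab (fst z) (snd z))) mod r ~= 1"
 shows "chi_rigid r e b A"
proof -
 have "chi e b A = chi e b (%j. al ! j)" by (rule chi_cong[OF al(2)])
 also have "... = (%c i. cyc_pow b e (dot al (lab c i)))"
 proof (intro ext)
  fix c i
  have "dot al (lab c i) = (\<Sum>j<k. al ! j * phi j c i)" using dot_eq_sum[of al "lab c i"] al(1) lab phi by simp
  thus "chi e b (%j. al ! j) c i = cyc_pow b e (dot al (lab c i))" by (simp add: chi_def)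
 qed
 finally have K: "chi e b A = (%c i. cyc_pow b e (dot al (lab c i)))" .
 show ?thesis unfolding chi_rigid_def K
 proof (intro exI[of _ "fst z"] exI[of _ "snd z"] conjI ne allI impI)
  fix x c i
  assume x: "flat r (%c i. cyc_pow b e (dot al (lab c i))) x" "\<forall>(c, i)\<in>set ts. [x c i = 0] (mod r)" "[x (fst z) (snd z) = 0] (mod r)"
  show "[x c i = 0] (mod r)" by (rule certify_sound[OF r key cert cs fs adj x(1)]) (use x(2,3) in \<open>auto\<close>)
 qed
qed

section \<open>A closed hyperbolic manifold\<close>

 datatype cellA = A0 | A1 | A2 | A3 | A4 | A5 | A6 | A7 | A8 | A9 | A10 | A11 | A12 | A13 | A14 | A15
 | A16 | A17 | A18 | A19 | A20 | A21 | A22 | A23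
 datatype faceA = D0 | D1 | D2 | D3 | D4 | D5 | D6 | D7 | D8 | D9 | D10 | D11
 datatype symA = S0 | S1 | S2 | S3 | S4 | S5

primrec row :: "'a => 'a => 'a => 'a => 'a => 'a => 'a => 'a => 'a => 'a => 'a => 'a => faceA => 'a" where

 "row x0 x1 x2 x3 x4 x5 x6 x7 x8 x9 x10 x11 D0 = x0" |
 "row x0 x1 x2 x3 x4 x5 x6 x7 x8 x9 x10 x11 D1 = x1" |
 "row x0 x1 x2 x3 x4 x5 x6 x7 x8 x9 x10 x11 D2 = x2" |
 "row x0 x1 x2 x3 x4 x5 x6 x7 x8 x9 x10 x11 D3 = x3" |
 "row x0 x1 x2 x3 x4 x5 x6 x7 x8 x9 x10 x11 D4 = x4" |
 "row x0 x1 x2 x3 x4 x5 x6 x7 x8 x9 x10 x11 D5 = x5" |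
 "row x0 x1 x2 x3 x4 x5 x6 x7 x8 x9 x10 x11 D6 = x6" |
 "row x0 x1 x2 x3 x4 x5 x6 x7 x8 x9 x10 x11 D7 = x7" |
 "row x0 x1 x2 x3 x4 x5 x6 x7 x8 x9 x10 x11 D8 = x8" |
 "row x0 x1 x2 x3 x4 x5 x6 x7 x8 x9 x10 x11 D9 = x9" |
 "row x0 x1 x2 x3 x4 x5 x6 x7 x8 x9 x10 x11 D10 = x10" |
 "row x0 x1 x2 x3 x4 x5 x6 x7 x8 x9 x10 x11 D11 = x11"

primrec nbA :: "cellA => faceA => cellA" where
 "nbA A0 = row A12 A6 A18 A9 A21 A15 A11 A23 A17 A20 A14 A8"
| "nbA A1 = row A13 A7 A19 A10 A22 A16 A9 A21 A15 A18 A12 A6"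
| "nbA A2 = row A14 A8 A20 A11 A23 A17 A10 A22 A16 A19 A13 A7"
| "nbA A3 = row A15 A9 A21 A7 A19 A13 A8 A20 A14 A21 A15 A9"
| "nbA A4 = row A16 A10 A22 A8 A20 A14 A6 A18 A12 A22 A16 A10"
| "nbA A5 = row A17 A11 A23 A6 A18 A12 A7 A19 A13 A23 A17 A11"
| "nbA A6 = row A1 A12 A18 A5 A10 A10 A4 A23 A17 A0 A12 A18"
| "nbA A7 = row A2 A13 A19 A3 A11 A11 A5 A21 A15 A1 A13 A19"
| "nbA A8 = row A0 A14 A20 A4 A9 A9 A3 A22 A16 A2 A14 A20"
| "nbA A9 = row A3 A17 A23 A0 A8 A8 A1 A19 A13 A3 A16 A22"
| "nbA A10 = row A4 A15 A21 A1 A6 A6 A2 A20 A14 A4 A17 A23"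
| "nbA A11 = row A5 A16 A22 A2 A7 A7 A0 A18 A12 A5 A15 A21"
| "nbA A12 = row A1 A18 A6 A5 A16 A16 A4 A11 A23 A0 A18 A6"
| "nbA A13 = row A2 A19 A7 A3 A17 A17 A5 A9 A21 A1 A19 A7"
| "nbA A14 = row A0 A20 A8 A4 A15 A15 A3 A10 A22 A2 A20 A8"
| "nbA A15 = row A3 A23 A11 A0 A14 A14 A1 A7 A19 A3 A22 A10"
| "nbA A16 = row A4 A21 A9 A1 A12 A12 A2 A8 A20 A4 A23 A11"
| "nbA A17 = row A5 A22 A10 A2 A13 A13 A0 A6 A18 A5 A21 A9"
| "nbA A18 = row A12 A1 A6 A22 A5 A22 A11 A4 A17 A12 A0 A6"
| "nbA A19 = row A13 A2 A7 A23 A3 A23 A9 A5 A15 A13 A1 A7"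
| "nbA A20 = row A14 A0 A8 A21 A4 A21 A10 A3 A16 A14 A2 A8"
| "nbA A21 = row A17 A3 A11 A20 A0 A20 A7 A1 A13 A16 A3 A10"
| "nbA A22 = row A15 A4 A9 A18 A1 A18 A8 A2 A14 A17 A4 A11"
| "nbA A23 = row A16 A5 A10 A19 A2 A19 A6 A0 A12 A15 A5 A9"

primrec actA :: "symA => faceA => faceA" where
 "actA S0 = row D0 D1 D2 D3 D4 D5 D6 D7 D8 D9 D10 D11"
| "actA S1 = row D1 D2 D0 D4 D5 D3 D7 D8 D6 D10 D11 D9"
| "actA S2 = row D2 D0 D1 D5 D3 D4 D8 D6 D7 D11 D9 D10"
| "actA S3 = row D9 D10 D11 D6 D7 D8 D3 D4 D5 D0 D1 D2"
| "actA S4 = row D10 D11 D9 D7 D8 D6 D4 D5 D3 D1 D2 D0"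
| "actA S5 = row D11 D9 D10 D8 D6 D7 D5 D3 D4 D2 D0 D1"

primrec sA :: "cellA => faceA => symA" where
 "sA A0 = row S3 S5 S5 S0 S0 S1 S0 S0 S1 S4 S5 S4"
| "sA A1 = row S3 S5 S5 S0 S0 S1 S0 S0 S1 S4 S5 S4"
| "sA A2 = row S3 S5 S5 S0 S0 S1 S0 S0 S1 S4 S5 S4"
| "sA A3 = row S3 S5 S5 S0 S0 S1 S0 S0 S1 S4 S5 S4"
| "sA A4 = row S3 S5 S5 S0 S0 S1 S0 S0 S1 S4 S5 S4"
| "sA A5 = row S3 S5 S5 S0 S0 S1 S0 S0 S1 S4 S5 S4"
| "sA A6 = row S5 S4 S3 S0 S1 S2 S0 S2 S2 S4 S4 S3"
| "sA A7 = row S5 S4 S3 S0 S1 S2 S0 S2 S2 S4 S4 S3"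
| "sA A8 = row S5 S4 S3 S0 S1 S2 S0 S2 S2 S4 S4 S3"
| "sA A9 = row S5 S4 S3 S0 S1 S2 S0 S2 S2 S4 S4 S3"
| "sA A10 = row S5 S4 S3 S0 S1 S2 S0 S2 S2 S4 S4 S3"
| "sA A11 = row S5 S4 S3 S0 S1 S2 S0 S2 S2 S4 S4 S3"
| "sA A12 = row S4 S5 S5 S2 S1 S2 S2 S1 S0 S3 S5 S5"
| "sA A13 = row S4 S5 S5 S2 S1 S2 S2 S1 S0 S3 S5 S5"
| "sA A14 = row S4 S5 S5 S2 S1 S2 S2 S1 S0 S3 S5 S5"
| "sA A15 = row S4 S5 S5 S2 S1 S2 S2 S1 S0 S3 S5 S5"
| "sA A16 = row S4 S5 S5 S2 S1 S2 S2 S1 S0 S3 S5 S5"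
| "sA A17 = row S4 S5 S5 S2 S1 S2 S2 S1 S0 S3 S5 S5"
| "sA A18 = row S4 S5 S3 S2 S0 S1 S1 S0 S0 S4 S4 S3"
| "sA A19 = row S4 S5 S3 S2 S0 S1 S1 S0 S0 S4 S4 S3"
| "sA A20 = row S4 S5 S3 S2 S0 S1 S1 S0 S0 S4 S4 S3"
| "sA A21 = row S4 S5 S3 S2 S0 S1 S1 S0 S0 S4 S4 S3"
| "sA A22 = row S4 S5 S3 S2 S0 S1 S1 S0 S0 S4 S4 S3"
| "sA A23 = row S4 S5 S3 S2 S0 S1 S1 S0 S0 S4 S4 S3"

definition glA where "glA c i = actA (sA c i)"

primrec keyc :: "cellA => bool list" where
 "keyc A0 = [False,False,False,False,False]"
| "keyc A1 = [True,False,False,False,False]"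
| "keyc A2 = [False,True,False,False,False]"
| "keyc A3 = [True,True,False,False,False]"
| "keyc A4 = [False,False,True,False,False]"
| "keyc A5 = [True,False,True,False,False]"
| "keyc A6 = [False,True,True,False,False]"
| "keyc A7 = [True,True,True,False,False]"
| "keyc A8 = [False,False,False,True,False]"
| "keyc A9 = [True,False,False,True,False]"
| "keyc A10 = [False,True,False,True,False]"
| "keyc A11 = [True,True,False,True,False]"
| "keyc A12 = [False,False,True,True,False]"
| "keyc A13 = [True,False,True,True,False]"
| "keyc A14 = [False,True,True,True,False]"
| "keyc A15 = [True,True,True,True,False]"
| "keyc A16 = [False,False,False,False,True]"
| "keyc A17 = [True,False,False,False,True]"
| "keyc A18 = [False,True,False,False,True]"
| "keyc A19 = [True,True,False,False,True]"
| "keyc A20 = [False,False,True,False,True]"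
| "keyc A21 = [True,False,True,False,True]"
| "keyc A22 = [False,True,True,False,True]"
| "keyc A23 = [True,True,True,False,True]"

primrec keyf :: "faceA => bool list" where
 "keyf D0 = [False,False,False,False]"
| "keyf D1 = [True,False,False,False]"
| "keyf D2 = [False,True,False,False]"
| "keyf D3 = [True,True,False,False]"
| "keyf D4 = [False,False,True,False]"
| "keyf D5 = [True,False,True,False]"
| "keyf D6 = [False,True,True,False]"
| "keyf D7 = [True,True,True,False]"
| "keyf D8 = [False,False,False,True]"
| "keyf D9 = [True,False,False,True]"
| "keyf D10 = [False,True,False,True]"
| "keyf D11 = [True,True,False,True]"

definition keyA where "keyA c i = keyc c @ keyf i"

primrec labA :: "cellA => faceA => int list" where
 "labA A0 = row [0,0,0,0,0] [0,0,0,0,0] [0,0,0,0,0] [0,0,0,0,0] [0,0,0,0,0] [0,0,0,0,0] [0,0,0,0,0] [0,0,0,0,0] [0,0,0,0,0] [0,0,0,0,0] [0,0,0,0,0] [0,0,0,0,0]"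
| "labA A1 = row [0,1,0,1,0] [0,0,-1,0,0] [0,0,-1,1,-1] [1,0,0,-1,0] [0,0,0,0,-1] [1,1,1,0,0] [0,0,0,0,0] [0,-1,-1,0,-1] [0,0,0,1,-1] [1,-1,0,-1,-1] [1,0,1,0,-1] [1,0,1,-1,0]"
| "labA A2 = row [-1,0,-1,2,-1] [-1,1,0,2,0] [-1,0,-1,1,0] [0,1,1,1,0] [0,0,0,0,0] [0,0,0,1,-1] [0,0,0,1,0] [-1,0,0,1,0] [0,0,0,1,0] [0,0,0,1,0] [0,0,0,1,0] [0,0,0,1,0]"
| "labA A3 = row [0,0,0,0,0] [0,0,0,-1,1] [0,-1,-1,-1,0] [0,-1,-1,-1,1] [0,-1,-1,0,0] [0,0,0,0,1] [0,0,0,0,0] [0,0,0,-1,1] [0,-1,-1,-1,0] [0,-2,-1,-1,0] [0,-1,0,0,0] [0,-1,0,-1,1]"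
| "labA A4 = row [1,0,0,-1,0] [1,0,0,-1,0] [0,0,0,-1,0] [0,0,0,0,0] [0,-1,-1,-1,0] [0,-1,-1,0,-1] [1,-1,0,-2,0] [1,-1,0,-1,-1] [1,0,1,-1,0] [0,-1,0,-1,0] [1,-1,0,-1,0] [1,-1,0,-1,0]"
| "labA A5 = row [0,0,0,0,0] [0,0,0,0,0] [0,0,0,0,0] [0,-1,0,0,0] [0,-1,0,0,0] [0,-1,0,0,0] [0,0,0,0,1] [0,-1,-1,0,0] [0,0,0,1,0] [0,-1,0,0,0] [0,-1,0,0,0] [0,-1,0,0,0]"
| "labA A6 = row [-1,0,-1,1,0] [0,0,0,0,-1] [0,0,0,0,-1] [0,1,0,0,0] [0,0,0,0,0] [0,0,-1,1,0] [-1,1,0,2,0] [0,0,-1,0,0] [0,0,0,0,-1] [0,0,0,0,0] [0,0,0,1,0] [0,-1,-1,0,0]"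
| "labA A7 = row [0,0,0,-1,0] [0,1,1,0,0] [0,0,0,0,-1] [0,1,1,1,-1] [0,0,1,0,-1] [0,0,0,0,0] [0,0,0,0,-1] [0,0,0,0,0] [0,0,1,0,-1] [0,0,1,0,0] [0,0,0,1,0] [0,0,0,1,0]"
| "labA A8 = row [0,0,0,0,0] [0,0,0,0,-1] [0,0,0,-1,0] [0,0,0,0,0] [0,-1,0,-1,0] [0,0,0,0,1] [0,0,0,0,0] [0,0,0,0,0] [1,0,1,-1,0] [1,-1,0,-2,0] [0,-1,-1,0,0] [0,-1,-1,0,0]"
| "labA A9 = row [0,1,0,1,-1] [0,0,0,0,-1] [0,0,0,0,-1] [0,0,0,0,0] [0,0,0,0,-1] [0,1,0,1,0] [0,0,0,0,0] [0,0,-1,1,0] [0,0,0,0,0] [0,0,0,1,-1] [1,0,0,0,0] [0,0,0,0,0]"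
| "labA A10 = row [-1,1,0,1,0] [-1,0,0,1,-1] [-1,-1,-1,0,-1] [-1,0,0,1,0] [0,0,1,-1,0] [0,0,0,0,0] [0,0,0,-1,0] [-1,0,-1,1,0] [-1,0,0,1,-1] [-1,0,0,1,0] [0,0,0,0,0] [0,0,0,0,0]"
| "labA A11 = row [0,1,0,0,0] [0,0,0,0,0] [-1,0,0,0,0] [0,-1,-1,-1,0] [0,0,0,0,0] [0,0,-1,0,1] [0,0,0,0,0] [0,-1,-1,0,0] [0,-1,0,0,-1] [0,0,0,0,0] [0,0,0,1,0] [0,-1,-1,0,0]"
| "labA A12 = row [-1,0,-1,0,1] [0,0,0,-1,0] [0,0,0,-1,0] [0,1,0,0,0] [0,0,0,0,0] [0,0,-1,0,1] [-1,0,-1,1,0] [0,1,0,0,1] [0,0,0,-1,0] [0,0,0,0,0] [0,-1,-1,0,0] [0,0,0,0,1]"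
| "labA A13 = row [0,0,0,-1,0] [0,0,0,0,-1] [0,0,0,-1,0] [0,0,0,0,-1] [0,-1,0,-1,-1] [0,0,0,0,0] [0,0,0,-1,0] [0,0,0,0,0] [0,-1,0,-1,-1] [0,-1,0,-1,0] [0,-1,-1,0,0] [0,-1,-1,0,0]"
| "labA A14 = row [0,0,0,0,0] [0,0,0,-1,0] [0,1,1,0,0] [0,1,1,0,1] [0,0,1,0,0] [0,0,0,1,0] [0,1,1,1,0] [1,0,0,-1,1] [0,0,1,-1,0] [1,0,1,-2,1] [0,0,0,0,1] [0,0,0,0,1]"
| "labA A15 = row [0,1,0,0,0] [0,0,0,-1,0] [0,0,0,-1,0] [0,0,0,0,0] [0,0,0,-1,0] [0,0,-1,0,0] [0,0,0,-1,1] [0,0,-1,0,1] [0,0,0,0,0] [0,0,0,0,0] [0,0,0,-1,1] [1,0,0,-1,1]"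
| "labA A16 = row [-1,1,0,1,0] [-1,-1,-1,0,-1] [-1,0,0,0,0] [-1,-1,-1,0,0] [0,0,1,0,-1] [0,0,0,0,0] [0,0,0,-1,0] [-1,0,-1,1,0] [-1,-1,-1,0,-1] [-1,0,0,1,0] [0,0,0,0,0] [0,0,0,0,0]"
| "labA A17 = row [0,1,0,0,0] [-1,0,0,0,0] [0,0,0,0,0] [0,0,0,-1,1] [0,0,0,0,0] [0,1,0,1,1] [0,0,0,0,0] [0,0,0,0,1] [0,-1,0,-1,0] [0,0,0,0,0] [0,-1,-1,0,0] [0,0,0,0,1]"
| "labA A18 = row [0,1,1,0,0] [-1,1,0,1,1] [0,1,1,0,0] [-1,1,0,1,1] [0,1,0,0,0] [-1,0,0,0,0] [0,1,1,0,0] [-1,1,0,1,1] [0,1,0,1,0] [0,0,0,1,0] [0,0,0,0,0] [0,0,0,0,1]"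
| "labA A19 = row [0,1,1,0,0] [0,0,0,-1,0] [0,0,0,-1,0] [0,0,0,0,0] [0,1,1,0,0] [0,0,1,-1,0] [0,0,1,-1,0] [0,1,1,0,0] [0,0,0,0,0] [0,0,0,0,1] [0,0,1,-1,1] [0,0,0,0,1]"
| "labA A20 = row [0,0,0,0,-1] [0,0,0,0,0] [0,1,1,0,0] [0,-1,-1,0,0] [0,1,1,1,0] [0,-1,0,0,-1] [1,0,1,-1,0] [0,0,0,1,-1] [1,1,1,0,1] [0,0,0,1,0] [1,0,1,-1,0] [0,0,0,1,0]"
| "labA A21 = row [0,1,1,0,0] [0,2,1,1,0] [0,1,1,0,0] [0,1,0,0,1] [0,0,0,0,0] [0,1,1,0,0] [0,0,0,0,0] [0,1,1,0,1] [0,1,0,1,1] [1,1,1,0,1] [0,1,1,1,0] [1,1,1,0,1]"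
| "labA A22 = row [0,0,0,1,-1] [0,1,0,1,0] [0,0,0,0,0] [1,0,0,0,0] [0,0,0,0,1] [1,-1,0,-1,-1] [0,0,0,0,0] [1,0,0,-1,0] [0,0,-1,1,0] [1,0,0,0,0] [0,0,0,1,0] [1,0,0,0,0]"
| "labA A23 = row [0,0,0,0,0] [0,1,0,0,0] [0,0,0,0,0] [0,0,-1,1,0] [0,0,0,0,0] [0,0,0,0,0] [0,0,1,0,0] [0,0,0,0,0] [0,0,0,1,0] [0,0,0,1,0] [0,0,0,0,0] [0,0,0,0,1]"

primrec nbrsA :: "faceA => faceA list" where
 "nbrsA D0 = [D1,D2,D5,D6,D7]"
| "nbrsA D1 = [D0,D2,D3,D7,D8]"
| "nbrsA D2 = [D0,D1,D4,D6,D8]"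
| "nbrsA D3 = [D1,D7,D8,D9,D11]"
| "nbrsA D4 = [D2,D6,D8,D9,D10]"
| "nbrsA D5 = [D0,D6,D7,D10,D11]"
| "nbrsA D6 = [D0,D2,D4,D5,D10]"
| "nbrsA D7 = [D0,D1,D3,D5,D11]"
| "nbrsA D8 = [D1,D2,D3,D4,D9]"
| "nbrsA D9 = [D3,D4,D8,D10,D11]"
| "nbrsA D10 = [D4,D5,D6,D9,D11]"
| "nbrsA D11 = [D3,D5,D7,D9,D10]"

definition tsA :: "(cellA \<times> faceA) list" where
 "tsA = [(A0,D7),(A0,D11),(A0,D3),(A0,D10),(A0,D8),(A0,D4),(A0,D9),(A0,D1),(A0,D0),
 (A0,D6),(A0,D2),(A0,D5),(A23,D4),(A23,D2),(A23,D5),(A23,D10),(A23,D0),(A8,D7),(A8,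
 D6),(A8,D3),(A9,D6),(A9,D8),(A21,D6)]"

definition esA :: "(cellA \<times> faceA) list" where
 "esA = [(A22,D11),(A23,D1),(A23,D6),(A23,D9),(A23,D11)]"

definition paramsA :: "(cellA \<times> faceA) list" where
 "paramsA = [(A15,D1),(A3,D5),(A15,D2),(A20,D0),(A8,D11),(A9,D7),(A13,D9),(A11,D2)]"

definition progA :: "(cellA \<times> faceA \<times> faceA) list" where
 "progA = [(A15,D8,D3),(A11,D4,D6),(A12,D4,D9),(A9,D11,D3),(A17,D4,D6),(A3,D0,D6),
 (A23,D8,D9),(A19,D1,D8),(A16,D6,D10),(A8,D5,D6),(A23,D11,D7),(A13,D1,D3),(A22,D4,
 D6),(A14,D5,D0),(A11,D9,D10),(A19,D2,D8),(A14,D11,D10),(A3,D7,D0),(A9,D9,D3),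
 (A15,D10,D9),(A8,D10,D11),(A3,D8,D1),(A21,D10,D4),(A19,D4,D2),(A8,D4,D6),(A1,D2,
 D4),(A19,D5,D6),(A14,D8,D2),(A3,D11,D5),(A3,D3,D11),(A21,D5,D6),(A3,D10,D11),
 (A15,D6,D0),(A15,D5,D6),(A15,D7,D5),(A19,D11,D5),(A13,D11,D9),(A20,D11,D7),(A20,
 D9,D11),(A21,D0,D6),(A7,D6,D2),(A11,D5,D6),(A7,D9,D4),(A13,D10,D9),(A2,D11,D9),
 (A13,D0,D1),(A13,D6,D0),(A23,D1,D3),(A6,D3,D9),(A13,D2,D6),(A2,D7,D11),(A18,D5,
 D10),(A14,D9,D4),(A20,D10,D11),(A8,D9,D10),(A22,D1,D7),(A20,D4,D9),(A22,D10,D6),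
 (A16,D0,D6),(A10,D7,D11),(A15,D11,D5),(A21,D11,D10),(A14,D7,D1),(A10,D9,D8),(A9,
 D10,D5),(A21,D9,D10),(A20,D8,D1),(A4,D11,D10),(A16,D9,D10),(A14,D3,D1),(A18,D7,
 D5),(A22,D5,D6),(A1,D3,D1),(A18,D1,D7),(A16,D7,D0),(A20,D5,D11),(A21,D8,D3),(A17,
 D5,D6),(A1,D7,D0),(A21,D1,D7),(A9,D1,D0),(A17,D9,D11),(A19,D7,D0),(A12,D3,D8),
 (A11,D0,D6),(A16,D11,D10),(A11,D3,D1),(A21,D2,D6),(A18,D6,D10),(A18,D4,D6),(A2,
 D6,D0),(A17,D2,D4),(A10,D5,D10),(A18,D11,D7),(A1,D5,D6),(A12,D11,D9),(A12,D7,
 D11),(A18,D9,D3),(A12,D6,D4),(A18,D0,D5),(A16,D4,D9),(A12,D0,D5),(A6,D0,D2),(A23,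
 D6,D2),(A18,D2,D4),(A12,D2,D0),(A10,D4,D9),(A18,D8,D2),(A22,D9,D4),(A17,D7,D1),
 (A17,D3,D7),(A17,D0,D7),(A6,D6,D5)]"

definition relsA :: "(cellA \<times> faceA \<times> faceA) list" where
 "relsA = [(A12,D9,D10),(A7,D10,D6),(A12,D1,D8),(A1,D11,D5),(A16,D11,D3),(A5,D10,
 D9),(A11,D5,D11),(A5,D3,D8)]"

definition cellsA where
 "cellsA = [A0, A1, A2, A3, A4, A5, A6, A7, A8, A9, A10, A11, A12, A13, A14, A15, A16, A17, A18, A19,
 A20, A21, A22, A23]"

definition facesA where "facesA = [D0, D1, D2, D3, D4, D5, D6, D7, D8, D9, D10, D11]"

definition gold :: real where "gold = (1 + sqrt 5) / 2"

primrec nA :: "faceA => real^3" where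
 "nA D0 = (vector [0, 1, gold])"
| "nA D1 = (vector [1, gold, 0])"
| "nA D2 = (vector [gold, 0, 1])"
| "nA D3 = (vector [0, 1, - gold])"
| "nA D4 = (vector [1, - gold, 0])"
| "nA D5 = (vector [- gold, 0, 1])"
| "nA D6 = (vector [0, - 1, gold])"
| "nA D7 = (vector [- 1, gold, 0])"
| "nA D8 = (vector [gold, 0, - 1])"
| "nA D9 = (vector [0, - 1, - gold])"
| "nA D10 = (vector [- 1, - gold, 0])"
| "nA D11 = (vector [- gold, 0, - 1])"

primrec RA :: "symA => real^3 => real^3" where
 "RA S0 x = vector [x$1, x$2, x$3]"
| "RA S1 x = vector [x$3, x$1, x$2]"
| "RA S2 x = vector [x$2, x$3, x$1]"
| "RA S3 x = vector [- x$1, - x$2, - x$3]"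
| "RA S4 x = vector [- x$3, - x$1, - x$2]"
| "RA S5 x = vector [- x$2, - x$3, - x$1]"

instance cellA :: finite
proof
 have "UNIV = set cellsA" unfolding cellsA_def by (auto intro: cellA.exhaust)
 thus "finite (UNIV :: cellA set)" by (metis List.finite_set)
qed

instance faceA :: finite
proof
 have "UNIV = set facesA" unfolding facesA_def by (auto intro: faceA.exhaust)
 thus "finite (UNIV :: faceA set)" by (metis List.finite_set)
qed

lemma cellsA: "set cellsA = UNIV" unfolding cellsA_def by (auto intro: cellA.exhaust)
lemma facesA: "set facesA = UNIV" "distinct facesA" unfolding facesA_def by (auto intro: faceA.exhaust)

lemma keyA_inj: "keyA c i = keyA d j ==> c = d & i = j"
proof -
 assume k: "keyA c i = keyA d j"
 have "length (keyc a) = 5" for a by (cases a) simp_all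
 hence e: "keyc c = keyc d" "keyf i = keyf j" using k by (simp_all add: keyA_def)
 have "list_all (%a. list_all (%b. keyc a = keyc b --> a = b) cellsA) cellsA" by code_simp
 hence "keyc a = keyc b --> a = b" for a b unfolding list_all_iff cellsA by blast
 moreover have "list_all (%a. list_all (%b. keyf a = keyf b --> a = b) facesA) facesA" by code_simp
 hence "keyf a = keyf b --> a = b" for a b unfolding list_all_iff facesA by blast
 ultimately show ?thesis using e by blast
qed

lemma gold: "gold * gold = gold + 1" "gold * (gold * x) = gold * x + x" "3 / 2 < gold" "gold < 13 / 8"
proof -
 have s: "sqrt 5 * sqrt 5 = 5" by simp
 show g: "gold * gold = gold + 1" unfolding gold_def using s by (simp add: field_simps)
 show "gold * (gold * x) = gold * x + x" using arg_cong[OF g, of "%a. a * x"] by (simp add: algebra_simps)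
 have "2 < sqrt 5" by (rule real_less_rsqrt) simp
 thus "3 / 2 < gold" by (simp add: gold_def)
 have "sqrt 5 < 9 / 4" by (rule real_less_lsqrt) (simp_all add: power2_eq_square)
 thus "gold < 13 / 8" by (simp add: gold_def)
qed

lemma gram: "nA i \<bullet> nA j = (if i = j then gold + 2 else if j \<in> set (nbrsA i) then gold else nA i \<bullet> nA j)"
  "i ~= j ==> j \<notin> set (nbrsA i) ==> nA i \<bullet> nA j <= gold - 2"
 using gold(3,4) by (cases i; cases j; simp add: inner3 gold)+

interpretation A: ra_system UNIV nA "sqrt gold"
proof
 have s: "(sqrt gold)\<^sup>2 = gold" using gold(3) by simp
 show "sqrt gold > 0" using gold(3) by simp
 show "nA i \<bullet> nA i = (sqrt gold)\<^sup>2 + 2" for i unfolding s using gram(1)[of i i] by simp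
 show "nA i \<bullet> nA j = (sqrt gold)\<^sup>2 \<or> nA i \<bullet> nA j <= (sqrt gold)\<^sup>2 - 2" if "i ~= j" for i j
  unfolding s using gram[of i j] that by (auto split: if_splits)
qed simp

lemma adjA: "A.adj i j \<longleftrightarrow> j \<in> set (nbrsA i)"
proof -
 have "i \<notin> set (nbrsA i)" by (cases i) simp_all
 thus ?thesis unfolding A.adj_def using gram[of i j] gold(3) by (auto split: if_splits)
qed

lemma spanA: "span (range nA) = UNIV"
proof -
 have "x \<in> span (range nA)" for x
 proof -
  have "x = (x$2 / 2) *\<^sub>R (nA D0 + nA D3) + (x$1 / 2) *\<^sub>R (nA D1 + nA D4) + (x$3 / 2) *\<^sub>R (nA D2 + nA D5)"
   by (simp add: vec_eq_iff forall_3)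
  also have "... \<in> span (range nA)" by (intro span_add span_scale span_base rangeI)
  finally show ?thesis .
 qed
 thus ?thesis by blast
qed

lemma glA_symm: "glA c i \<in> A.symm"
proof -
 have "RA s (nA (actA s j)) = nA j" for s j by (cases s; cases j; simp add: vec_eq_iff forall_3)
 moreover have "orthogonal_transformation (RA s)" for s unfolding orthogonal_transformation_def
  by (cases s; simp add: inner3 algebra_simps; intro linearI; simp add: vec_eq_iff forall_3)
 ultimately show ?thesis unfolding A.symm_def glA_def by blast
qed

lemma gluingA: "gluing_ok nbA glA nbrsA cellsA facesA" by code_simp
lemma freeA: "free_ok nbA glA nbrsA cellsA facesA" by code_simp

interpretation A: ra_cells nA "sqrt gold" nbA glA by (rule ra_cellsI[OF A.ra_system_axioms spanA glA_symm adjA cellsA facesA gluingA freeA])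

lemma progA_adj: "list_all (%(c, i, j). j \<in> set (nbrsA i)) (progA @ relsA)" by code_simp

interpretation A: ra_classes nA "sqrt gold" nbA glA A0 tsA 5 "%j c i. labA c i ! j" "%j. esA ! j" 11
proof (rule ra_classesI[OF A.ra_cells_axioms adjA cellsA facesA(1) _ _ _ _ _ _ _ keyA_inj _ progA_adj])
 show "tree_list nbA cellsA [A0] tsA" by code_simp
 show "lab_ok nbA glA nbrsA cellsA facesA labA 5" by code_simp
 show "list_all (%e. labA (fst e) (snd e) = replicate 5 0) tsA" by code_simp
 show "length esA = 5" by code_simp
 show "map (%e. labA (fst e) (snd e)) esA = units 5" by code_simp
 show "prime (11::int)" by simp
 show "certify nbA glA keyA 11 (%_ _. 1) tsA esA paramsA progA relsA cellsA facesA" by code_simp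
qed simp

definition pivotA :: "int list => cellA \<times> faceA" where
 "pivotA al = (case find (%j. al ! j ~= 0) [0..<5] of None => (A0,D0) | Some j => esA ! j)"

definition chiA :: "int list => bool" where
 "chiA al \<longleftrightarrow> cyc_pow 10 2 (dot al (labA (fst (pivotA al)) (snd (pivotA al)))) mod 11 ~= 1 &
  certify nbA glA keyA 11 (%c i. cyc_pow 10 2 (dot al (labA c i))) tsA [pivotA al] paramsA progA relsA cellsA facesA"

lemma chiA: "list_all (%al. chiA (0 # 0 # al)) (tl (List.n_lists 3 [0, 1]))"
  "list_all (%al. chiA (0 # 1 # al)) (List.n_lists 3 [0, 1])" by code_simp+

lemma chi_rigidA:
 assumes "A 0 mod 2 = 0" "\<exists>j<5. A j mod 2 ~= 0"
 shows "A.chi_rigid 11 2 10 A"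
proof -
 define bs where "bs = [A 2 mod 2, A 3 mod 2, A 4 mod 2]"
 define al where "al = 0 # A 1 mod 2 # bs"
 have b: "A j mod 2 = 0 \<or> A j mod 2 = 1" for j by presburger
 have al: "length al = 5" "!!j. j < 5 ==> A j mod 2 = al ! j mod 2"
  using assms(1) by (auto simp: al_def bs_def less_Suc_eq numeral_eq_Suc)
 have bs: "bs \<in> set (List.n_lists 3 [0, 1])" using b by (auto simp: bs_def set_n_lists)
 have "chiA al"
 proof (cases "A 1 mod 2 = 0")
  case True
  have "n_lists3": "List.n_lists 3 [0, 1 :: int] = [0, 0, 0] # tl (List.n_lists 3 [0, 1])" by code_simp
  have "bs ~= [0, 0, 0]" using assms True by (auto simp: bs_def less_Suc_eq numeral_eq_Suc)
  hence "bs \<in> set (tl (List.n_lists 3 [0, 1]))" using bs by (subst (asm) n_lists3) simp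
  thus ?thesis using chiA(1) True unfolding al_def by (auto simp: list_all_iff)
 next
  case False
  hence "A 1 mod 2 = 1" using b by blast
  thus ?thesis using chiA(2) bs unfolding al_def by (auto simp: list_all_iff)
 qed
 hence "cyc_pow 10 2 (dot al (labA (fst (pivotA al)) (snd (pivotA al)))) mod 11 ~= 1"
  "certify nbA glA keyA 11 (%c i. cyc_pow 10 2 (dot al (labA c i))) tsA [pivotA al] paramsA progA relsA cellsA facesA"
  by (simp_all add: chiA_def)
 note c = this
 have len: "length (labA c i) = 5" for c i
 proof -
  have "list_all (%c. list_all (%i. length (labA c i) = 5) facesA) cellsA" by code_simp
  thus ?thesis unfolding list_all_iff cellsA facesA by blast
 qed
 have "prime (11::int)" by simp
 moreover have "list_all (%(c, i, j). A.adj i j) (progA @ relsA)" using progA_adj by (simp only: adjA)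
 ultimately show ?thesis by (intro A.chi_rigidI[OF refl len _ al(1) al(2) keyA_inj cellsA facesA(1) c(2) _ c(1)])
qed

lemma no_free_quotientA: "l >= 2 ==> epi A.dg (free_group l) = {}"
proof (rule A.no_free_quotient[where r = 11 and e = 2 and b = 10])
 fix U V :: "nat => int"
 assume i: "!!s s'. s mod 2 ~= 0 \<or> s' mod 2 ~= 0 ==> \<exists>j<5. (s * U j + s' * V j) mod 2 ~= 0"
 have ch: "A.chi_rigid 11 2 10 (%j. s * U j + s' * V j)"
  if "s mod 2 ~= 0 \<or> s' mod 2 ~= 0" "(s * U 0 + s' * V 0) mod 2 = 0" for s s' by (rule chi_rigidA[OF that(2) i[OF that(1)]])
 have "a mod 2 = 0 \<or> b mod 2 = 0 \<or> (a + b) mod 2 = 0" for a b :: int by presburger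
 then consider "U 0 mod 2 = 0" | "V 0 mod 2 = 0" | "(U 0 + V 0) mod 2 = 0" by blast
 thus "\<exists>s s'. (s mod 2 ~= 0 \<or> s' mod 2 ~= 0) & A.chi_rigid 11 2 10 (%j. s * U j + s' * V j)"
 proof cases
  case 1 thus ?thesis using ch[of 1 0] by (intro exI[of _ 1] exI[of _ 0]) simp
 next
  case 2 thus ?thesis using ch[of 0 1] by (intro exI[of _ 0] exI[of _ 1]) simp
 next
  case 3 thus ?thesis using ch[of 1 1] by (intro exI[of _ 1] exI[of _ 1]) simp
 qed
next
 fix m' :: int assume "0 < m'" "m' < 2"
 hence "m' = 1" by simp
 thus "10 ^ nat m' mod 11 ~= (1::int)" by simp
qed simp_all

lemma dodecahedron_bound:
 fixes X Y Z :: real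
 assumes "0 <= X" "0 <= Y" "X <= Z" "Y <= Z"
  and "(Y + gold * Z)^2 <= gold * (1 + X^2 + Y^2 + Z^2)" "(gold * X + Z)^2 <= gold * (1 + X^2 + Y^2 + Z^2)"
 shows "X^2 + Y^2 + Z^2 <= 20"
proof -
 have "Y * Y <= Y * Z" "X * X <= X * Z" using assms by (auto intro: mult_left_mono)
 hence yz: "gold * (Y * Y) <= gold * (Y * Z)" "gold * (X * X) <= gold * (X * Z)" using gold(3) by (auto intro: mult_left_mono)
 have g: "gold * X * (gold * X) = gold * (X * X) + X * X" "gold * Z * (gold * Z) = gold * (Z * Z) + Z * Z"
  using gold(2)[of "X * X"] gold(2)[of "Z * Z"] by (simp_all add: algebra_simps)
 have 1: "Y * Y + 2 * (gold * (Y * Z)) + gold * (Z * Z) + Z * Z <= gold + gold * (X * X) + gold * (Y * Y) + gold * (Z * Z)"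
  using assms(5) g(2) by (simp add: power2_eq_square algebra_simps)
 have 2: "gold * (X * X) + X * X + 2 * (gold * (X * Z)) + Z * Z <= gold + gold * (X * X) + gold * (Y * Y) + gold * (Z * Z)"
  using assms(6) g(1) by (simp add: power2_eq_square algebra_simps)
 have "Y * Y + X * X + gold * (X * X) + (2 * (Z * Z) - gold * (Z * Z)) <= 2 * gold" using 1 2 yz by linarith
 moreover have "gold * (Z * Z) <= 13 / 8 * (Z * Z)" using gold(4) by (intro mult_right_mono) auto
 moreover have "0 <= gold * (X * X)" using gold(3) by simp
 ultimately have "Y * Y + X * X + 3 / 8 * (Z * Z) <= 13 / 4" using gold(4) by linarith
 moreover have "0 <= X * X" "0 <= Y * Y" by simp_all
 ultimately show ?thesis unfolding power2_eq_square by linarith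
qed

lemma compactA: "compact A.P"
proof -
 have "A.P = (\<Inter>i. {x. A.L i x <= 0})" by (auto simp: A.P_def)
 moreover have "closed {x. A.L i x <= 0}" for i by (rule closed_Collect_le) (auto intro: A.continuous_L continuous_intros)
 ultimately have "closed A.P" by auto
 moreover have "norm x <= 5" if x: "x \<in> A.P" for x
 proof -
  define s where "s = sqrt gold * hs x"
  have s0: "s >= 0" using gold(3) hs_pos(1)[of x] by (simp add: s_def)
  have s2: "s^2 = gold * (1 + \<bar>x$1\<bar>^2 + \<bar>x$2\<bar>^2 + \<bar>x$3\<bar>^2)"
   using gold(3) unfolding s_def power_mult_distrib hs_sq inner3 by (simp add: power2_eq_square algebra_simps)
  have le: "nA i \<bullet> x <= s" for i using x by (simp add: A.P_def A.L_def s_def)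
  have h: "\<bar>x$2\<bar> + gold * \<bar>x$3\<bar> <= s" "\<bar>x$1\<bar> + gold * \<bar>x$2\<bar> <= s" "gold * \<bar>x$1\<bar> + \<bar>x$3\<bar> <= s"
   using le[of D0] le[of D1] le[of D2] le[of D3] le[of D4] le[of D5] le[of D6] le[of D7] le[of D8] le[of D9] le[of D10] le[of D11]
   by (simp_all add: inner3 abs_if split: if_splits)
  have h2: "(\<bar>x$2\<bar> + gold * \<bar>x$3\<bar>)^2 <= s^2" "(\<bar>x$1\<bar> + gold * \<bar>x$2\<bar>)^2 <= s^2" "(gold * \<bar>x$1\<bar> + \<bar>x$3\<bar>)^2 <= s^2"
   using h gold(3) by (auto intro!: power_mono)
  consider "\<bar>x$1\<bar> <= \<bar>x$3\<bar>" "\<bar>x$2\<bar> <= \<bar>x$3\<bar>" | "\<bar>x$1\<bar> <= \<bar>x$2\<bar>" "\<bar>x$3\<bar> <= \<bar>x$2\<bar>" | "\<bar>x$2\<bar> <= \<bar>x$1\<bar>" "\<bar>x$3\<bar> <= \<bar>x$1\<bar>"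
   by linarith
  hence "\<bar>x$1\<bar>^2 + \<bar>x$2\<bar>^2 + \<bar>x$3\<bar>^2 <= 20"
  proof cases
   case 1 thus ?thesis using dodecahedron_bound[of "\<bar>x$1\<bar>" "\<bar>x$2\<bar>" "\<bar>x$3\<bar>"] h2 s2 by (simp add: ac_simps)
  next
   case 2 thus ?thesis using dodecahedron_bound[of "\<bar>x$3\<bar>" "\<bar>x$1\<bar>" "\<bar>x$2\<bar>"] h2 s2 by (simp add: ac_simps)
  next
   case 3 thus ?thesis using dodecahedron_bound[of "\<bar>x$2\<bar>" "\<bar>x$3\<bar>" "\<bar>x$1\<bar>"] h2 s2 by (simp add: ac_simps)
  qed
  hence "(norm x)^2 <= 5^2" unfolding power2_norm_eq_inner inner3 by (simp add: power2_eq_square)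
  thus ?thesis by (rule power2_le_imp_le) simp
 qed
 ultimately show ?thesis using bounded_iff compact_eq_bounded_closed by blast
qed

theorem closed_example:
 "\<exists>M :: (real^3) set topology. closed_hyperbolic_manifold3 M &
  (\<forall>x\<in>topspace M. manifold_betti1 M x = 5 & manifold_corank M x = 1)"
proof (intro exI conjI ballI)
 let ?M = "deck_action.quot UNIV A.Gam"
 show "closed_hyperbolic_manifold3 ?M" by (rule A.closed_hyperbolic_quot[OF compactA finite])
 have sc: "simply_connected (UNIV :: (real^3) set)" by (rule convex_imp_simply_connected) simp
 fix x assume x: "x \<in> topspace ?M"
 note inv = A.manifold_invariants[OF A.deck_action_Mor sc no_free_quotientA x]
 show "manifold_betti1 ?M x = 5" using inv(1) by (simp add: numeral_eq_enat)
 show "manifold_corank ?M x = 1" by (rule inv(2))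
qed

section \<open>Truncated cusps\<close>

definition lam :: "real^3 => real" where "lam y = hs y - y$3"

text \<open>The right-angled ideal octahedron. The cusp at its ideal vertex above the third axis is described
 by \<open>lam\<close>, whose sublevel sets are horoballs.\<close>

locale octahedron = ra_cells n 1 nb gl
 for n :: "'i::finite => real^3" and nb :: "'c::finite => 'i => 'c" and gl +
 assumes n_signs: "n i $ k = 1 \<or> n i $ k = - 1"
  and n_ex: "(\<forall>k. v $ k = 1 \<or> v $ k = - 1) ==> \<exists>i. n i = v"
begin

lemma n_sq: "n i $ k * n i $ k = 1"
 using n_signs[of i k] by auto

lemma continuous_lam: "continuous_on S lam"
 unfolding lam_def by (intro continuous_intros continuous_hs)

lemma lam_refl_top: "n i $ 3 = 1 ==> lam (refl i x) = lam x"
 by (simp add: lam_def hs_refl) (simp add: refl_def)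

lemma lam_far:
 assumes "n i $ 3 ~= 1" "L i z >= 0"
 shows "lam z > 1"
proof -
 define A B where "A = hs z - z$3" and "B = hs z + z$3"
 have n3: "n i $ 3 = - 1" using n_signs[of i 3] assms(1) by auto
 have AB: "A * B = 1 + (z$1)^2 + (z$2)^2" using hs_minus(2)[of z] by (simp add: A_def B_def)
 have A0: "A > 0" using hs_minus(1)[of z] by (simp add: A_def)
 moreover have "A * B > 0" unfolding AB by (simp add: add_pos_nonneg)
 ultimately have B0: "B > 0" by (simp add: zero_less_mult_iff)
 define q where "q = n i $ 1 * z$1 + n i $ 2 * z$2"
 have "q >= B" using assms(2) by (simp add: L_def inner3 n3 q_def B_def)
 hence "B^2 <= q^2" using B0 by (intro power_mono) auto
 moreover have "q^2 <= 2 * ((z$1)^2 + (z$2)^2)"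
 proof -
  have "q^2 = 2 * ((n i $ 1 * n i $ 1) * (z$1)^2 + (n i $ 2 * n i $ 2) * (z$2)^2) - (n i $ 1 * z$1 - n i $ 2 * z$2)^2"
   by (simp add: q_def power2_eq_square algebra_simps)
  thus ?thesis unfolding n_sq by simp
 qed
 ultimately have "B^2 <= 2 * (A * B - 1)" unfolding AB by simp
 moreover have "2 * B <= B^2 + 1" using zero_le_power2[of "B - 1"] by (simp add: power2_eq_square algebra_simps)
 ultimately have "2 * B < 2 * A * B" by simp
 hence "1 * B < A * B" by simp
 hence "1 < A" using B0 by (simp only: mult_less_cancel_right_pos)
 thus ?thesis by (simp add: lam_def A_def)
qed

lemma lam_dichotomy:
 "(\<forall>x\<in>P. lam (ev w x) > 1) \<or> ((\<forall>x. lam (ev w x) = lam x) & (\<exists>v. weq w v & (\<forall>i\<in>set v. n i $ 3 = 1)))"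
proof (induction "lw w" arbitrary: w rule: less_induct)
 case less
 show ?case
 proof (cases "lw w = 0")
  case True
  obtain v where "weq w v" "length v = lw w" by (rule lw_rep)
  hence "weq w []" using True by simp
  moreover from this have "lam (ev w x) = lam x" for x using weq_ev[of w "[]" x] by simp
  ultimately show ?thesis by (intro disjI2 conjI exI[of _ "[]"]) auto
 next
  case False
  then obtain i v where iv: "weq w (i # v)" "Suc (lw v) = lw w" using lw_first[of w] by auto
  have e: "ev w x = refl i (ev v x)" for x using weq_ev[OF iv(1)] by simp
  show ?thesis
  proof (cases "n i $ 3 = 1")
   case True
   hence l: "lam (ev w x) = lam (ev v x)" for x by (simp add: e lam_refl_top)
   have "(\<forall>x\<in>P. lam (ev v x) > 1) \<or> ((\<forall>x. lam (ev v x) = lam x) & (\<exists>u. weq v u & (\<forall>i\<in>set u. n i $ 3 = 1)))"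
    by (rule less.hyps) (use iv(2) in simp)
   thus ?thesis
   proof (elim disjE conjE exE)
    fix u assume u: "\<forall>x. lam (ev v x) = lam x" "weq v u" "\<forall>i\<in>set u. n i $ 3 = 1"
    have "weq w (i # u)" by (rule weq_trans[OF iv(1) weq_Cons[OF u(2)]])
    thus ?thesis using u l True by (intro disjI2 conjI exI[of _ "i # u"]) auto
   qed (simp add: l)
  next
   case False
   have lt: "lw (i # v) > lw v" using lw_cong[OF iv(1)] iv(2) by simp
   have "lam (ev w x) > 1" if x: "x \<in> P" for x
   proof (rule lam_far[OF False])
    have "L i (ev v x) <= 0" using cone_P[OF positivity(1)[OF _ _ lt] x] by simp
    thus "0 <= L i (ev w x)" by (simp add: e L_refl_self)
   qed
   thus ?thesis by blast
  qed
 qed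
qed

lemma wholeE:
 assumes "g \<in> whole" obtains w h where "g = ev w \<circ> ri h" "h \<in> symm" using assms unfolding whole_def by blast

lemma ri_whole: "h \<in> symm ==> ri h \<in> whole"
 unfolding whole_def by (intro CollectI exI[of _ "[]"] exI[of _ h]) (simp add: fun_eq_iff)

lemma lam_whole:
 assumes "g \<in> whole" "x \<in> P" "lam (g x) <= 1"
 obtains h where "h \<in> symm" "!!y. lam (g y) = lam (ri h y)"
proof -
 obtain w h where g: "g = ev w \<circ> ri h" "h \<in> symm" using assms(1) by (rule wholeE)
 have "ri h x \<in> P" using assms(2) ri_P[OF g(2)] by simp
 hence "~ (\<forall>x\<in>P. lam (ev w x) > 1)" using assms(3) g(1) by force
 hence "\<forall>x. lam (ev w x) = lam x" using lam_dichotomy[of w] by blast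
 thus ?thesis using that[OF g(2)] by (simp add: g(1))
qed

lemma whole_continuous: "g \<in> whole ==> continuous_on S g"
proof -
 assume "g \<in> whole"
 then obtain w h where f: "g = ev w \<circ> ri h" "h \<in> symm" by (rule wholeE)
 show ?thesis unfolding f(1) by (rule continuous_on_compose[OF continuous_ri[OF f(2)] continuous_ev])
qed

lemma whole_id: "id \<in> whole" using ri_whole[OF symm_id] by (simp add: ri_id)

lemma ri_vertex:
 assumes h: "h \<in> symm"
 obtains k s where "s = 1 \<or> s = - 1" "!!x. (ri h x) $ 3 = s * x $ k"
proof -
 define c where "c = adjoint (ri h) (axis 3 1)"
 have lin: "linear (ri h)" using ri_orth[OF h] orthogonal_transformation_linear by blast
 have cx: "(ri h x) $ 3 = c \<bullet> x" for x using adjoint_works[OF lin, of x "axis 3 1"] by (simp add: c_def inner_axis inner_commute)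
 have cn: "c \<bullet> n j = 1 \<or> c \<bullet> n j = - 1" for j
 proof -
  obtain i where "j = h i" using symm_bij[OF h] by (metis bij_pointE)
  thus ?thesis using cx[of "n j"] ri_n[OF h, of i] n_signs[of i 3] by simp
 qed
 have s: "a * c$1 + b * c$2 + d * c$3 = 1 \<or> a * c$1 + b * c$2 + d * c$3 = - 1"
  if "a = 1 \<or> a = - 1" "b = 1 \<or> b = - 1" "d = 1 \<or> d = - 1" for a b d
 proof -
  have "\<forall>k. (vector [a, b, d] :: real^3) $ k = 1 \<or> (vector [a, b, d] :: real^3) $ k = - 1" using that by (simp add: forall_3)
  then obtain i where "n i = vector [a, b, d]" using n_ex by blast
  thus ?thesis using cn[of i] by (simp add: inner3 mult.commute)
 qed
 have "c$1 + c$2 + c$3 = 1 \<or> c$1 + c$2 + c$3 = - 1" "c$1 + c$2 - c$3 = 1 \<or> c$1 + c$2 - c$3 = - 1"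
  "c$1 - c$2 + c$3 = 1 \<or> c$1 - c$2 + c$3 = - 1" "c$1 - c$2 - c$3 = 1 \<or> c$1 - c$2 - c$3 = - 1"
  using s[of 1 1 1] s[of 1 1 "-1"] s[of 1 "-1" 1] s[of 1 "-1" "-1"] by simp_all
 then consider "c$2 = 0 & c$3 = 0 & (c$1 = 1 \<or> c$1 = - 1)" | "c$1 = 0 & c$3 = 0 & (c$2 = 1 \<or> c$2 = - 1)"
  | "c$1 = 0 & c$2 = 0 & (c$3 = 1 \<or> c$3 = - 1)" by (smt (verit))
 thus ?thesis
 proof cases
  case 1
  thus ?thesis using cx that[of "c$1" 1] by (simp add: inner3)
 next
  case 2
  thus ?thesis using cx that[of "c$2" 2] by (simp add: inner3)
 next
  case 3
  thus ?thesis using cx that[of "c$3" 3] by (simp add: inner3)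
 qed
qed

lemma lam_pair:
 assumes h: "h \<in> symm" "k \<in> symm" and ne: "\<exists>y. lam (ri h y) ~= lam (ri k y)"
 shows "lam (ri h x) + lam (ri k x) > 1"
proof -
 obtain a s where a: "s = 1 \<or> s = - 1" "!!x. (ri h x) $ 3 = s * x $ a" using ri_vertex[OF h(1)] by metis
 obtain b t where b: "t = 1 \<or> t = - 1" "!!x. (ri k x) $ 3 = t * x $ b" using ri_vertex[OF h(2)] by metis
 have l: "lam (ri h x) + lam (ri k x) = 2 * hs x - (s * x$a + t * x$b)" for x by (simp add: lam_def hs_ri[OF h(1)] hs_ri[OF h(2)] a b)
 have sq: "(hs x)^2 = 1 + (x$1)^2 + (x$2)^2 + (x$3)^2" unfolding hs_sq inner3 by (simp add: power2_eq_square)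
 define m where "m = s * x$a + t * x$b"
 have ab: "~ (a = b & s = t)" using ne a b by (auto simp: lam_def hs_ri[OF h(1)] hs_ri[OF h(2)])
 have "m^2 <= 2 * ((x$1)^2 + (x$2)^2 + (x$3)^2)"
 proof (cases "a = b")
  case True
  hence "t = - s" using ab a(1) b(1) by auto
  thus ?thesis using True by (simp add: m_def)
 next
  case False
  have "m^2 <= 2 * ((s * x$a)^2 + (t * x$b)^2)"
   using zero_le_power2[of "s * x$a - t * x$b"] by (simp add: m_def power2_eq_square algebra_simps)
  also have "(s * x$a)^2 = (x$a)^2" "(t * x$b)^2 = (x$b)^2" using a(1) b(1) by auto
  moreover have "(x$a)^2 + (x$b)^2 <= (x$1)^2 + (x$2)^2 + (x$3)^2" using False exhaust_3[of a] exhaust_3[of b] by auto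
  ultimately show ?thesis by simp
 qed
 hence m: "m^2 <= 2 * ((hs x)^2 - 1)" using sq by simp
 have "m < 2 * hs x - 1"
 proof (rule power2_less_imp_less)
  have "(2 * hs x - 1)^2 - 2 * ((hs x)^2 - 1) = 2 * (hs x - 1)^2 + 1" by (simp add: power2_eq_square algebra_simps)
  thus "m^2 < (2 * hs x - 1)^2" using m zero_le_power2[of "hs x - 1"] by linarith
  show "0 <= 2 * hs x - 1" using hs_pos(2)[of x] by simp
 qed
 thus ?thesis using l[of x] m_def by simp
qed

lemma lam_unique:
 assumes "g \<in> whole" "g' \<in> whole" "lam (g x) <= 1/2" "lam (g' x) <= 1/2"
 shows "lam (g y) = lam (g' y)"
proof -
 obtain w where w: "ev w x \<in> P" by (rule tiling)
 define e where "e = ev (rev w)"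
 have e: "e \<in> whole" "e (ev w x) = x" using whole_ev ev_rev[of w] by (auto simp: e_def)
 have "g \<circ> e \<in> whole" "lam ((g \<circ> e) (ev w x)) <= 1" using whole_comp assms e by auto
 then obtain h where h: "h \<in> symm" "!!y. lam ((g \<circ> e) y) = lam (ri h y)" using lam_whole[OF _ w] by metis
 have "g' \<circ> e \<in> whole" "lam ((g' \<circ> e) (ev w x)) <= 1" using whole_comp assms e by auto
 then obtain k where k: "k \<in> symm" "!!y. lam ((g' \<circ> e) y) = lam (ri k y)" using lam_whole[OF _ w] by metis
 have "lam (ri h (ev w x)) + lam (ri k (ev w x)) <= 1" using h(2)[of "ev w x"] k(2)[of "ev w x"] assms(3,4) e(2) by simp
 hence eq: "lam (ri h z) = lam (ri k z)" for z using lam_pair[OF h(1) k(1), of "ev w x"] by force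
 have "lam (g y) = lam ((g \<circ> e) (ev w y))" using ev_rev[of w y] by (simp add: e_def)
 also have "... = lam ((g' \<circ> e) (ev w y))" using h(2) k(2) eq by simp
 also have "... = lam (g' y)" using ev_rev[of w y] by (simp add: e_def)
 finally show ?thesis .
qed

lemma lam_locally_finite:
 obtains U Fn where "open U" "x \<in> U" "finite Fn" "Fn \<subseteq> {lam \<circ> g | g. g \<in> whole}"
  "!!z g. z \<in> U ==> g \<in> whole ==> lam (g z) <= 1 ==> lam \<circ> g \<in> Fn"
proof -
 obtain U E where U: "open U" "x \<in> U" "finite E" "E \<subseteq> whole" "!!z. z \<in> U ==> \<exists>e\<in>E. e z \<in> P"
  using finite_cover_nbhd[of x] by metis
 define Fn where "Fn = (%(h, e). lam \<circ> (ri h \<circ> e)) ` (symm \<times> E)"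
 have "finite Fn" unfolding Fn_def using U(3) finite_symm by simp
 moreover have "Fn \<subseteq> {lam \<circ> g | g. g \<in> whole}" unfolding Fn_def using U(4) whole_comp ri_whole by fast
 moreover have "lam \<circ> g \<in> Fn" if z: "z \<in> U" "g \<in> whole" "lam (g z) <= 1" for z g
 proof -
  obtain e where e: "e \<in> E" "e z \<in> P" using U(5)[OF z(1)] by blast
  have ew: "e \<in> whole" using e(1) U(4) by blast
  have be: "finv e (e y) = y" for y using whole_inv(1)[OF ew] by (simp add: bij_is_inj)
  have "g \<circ> finv e \<in> whole" "lam ((g \<circ> finv e) (e z)) <= 1" using whole_comp whole_inv(2)[OF ew] z be by auto
  then obtain h where h: "h \<in> symm" "!!y. lam ((g \<circ> finv e) y) = lam (ri h y)" using lam_whole[OF _ e(2)] by metis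
  have "lam \<circ> g = lam \<circ> (ri h \<circ> e)"
  proof
   fix y show "(lam \<circ> g) y = (lam \<circ> (ri h \<circ> e)) y" using h(2)[of "e y"] be by simp
  qed
  thus ?thesis unfolding Fn_def using h(1) e(1) by (intro image_eqI[of _ _ "(h, e)"]) auto
 qed
 ultimately show ?thesis using that U(1,2) by blast
qed

definition X :: "(real^3) set" where "X = {x. \<forall>g\<in>whole. lam (g x) >= 1/2}"

lemma one_horoball:
 obtains U g where "open U" "x \<in> U" "g \<in> whole" "!!z g'. z \<in> U ==> g' \<in> whole ==> lam (g' z) <= 1/2 ==> lam \<circ> g' = lam \<circ> g"
proof -
 obtain U Fn where U: "open U" "x \<in> U" "finite Fn" "Fn \<subseteq> {lam \<circ> g | g. g \<in> whole}"
  "!!z g. z \<in> U ==> g \<in> whole ==> lam (g z) <= 1 ==> lam \<circ> g \<in> Fn" using lam_locally_finite[of x] by blast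
 define D where "D = {f \<in> Fn. f x > 1/2}"
 define V where "V = U \<inter> (\<Inter>f\<in>D. {z. f z > 1/2})"
 have cont: "continuous_on UNIV f" if f: "f \<in> Fn" for f
 proof -
  obtain g where g: "g \<in> whole" "f = lam \<circ> g" using f U(4) by blast
  show ?thesis unfolding g(2) by (rule continuous_on_compose[OF whole_continuous[OF g(1)] continuous_lam])
 qed
 have "open V" unfolding V_def
 proof (intro open_Int U(1) open_INT ballI)
  show "finite D" using U(3) by (simp add: D_def)
  show "open {z. f z > 1/2}" if "f \<in> D" for f using that by (intro open_Collect_less cont continuous_on_const) (simp add: D_def)
 qed
 moreover have "x \<in> V" using U(2) by (simp add: V_def D_def)
 moreover obtain g where g: "g \<in> whole" "!!g'. g' \<in> whole ==> lam (g' x) <= 1/2 ==> lam \<circ> g' = lam \<circ> g"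
 proof (cases "\<exists>g\<in>whole. lam (g x) <= 1/2")
  case True
  then obtain g where g: "g \<in> whole" "lam (g x) <= 1/2" by blast
  show ?thesis using that[OF g(1)] lam_unique[OF _ g(1) _ g(2)] by (simp add: fun_eq_iff)
 next
  case False thus ?thesis using that[OF whole_id] by blast
 qed
 moreover have "lam \<circ> g' = lam \<circ> g" if z: "z \<in> V" "g' \<in> whole" "lam (g' z) <= 1/2" for z g'
 proof -
  have "lam \<circ> g' \<in> Fn" using U(5)[of z g'] z by (simp add: V_def)
  hence "lam (g' x) <= 1/2" using z by (force simp: V_def D_def)
  thus ?thesis by (rule g(2)[OF z(2)])
 qed
 ultimately show ?thesis using that by blast
qed

end

lemma deck_action_subset:
 assumes "deck_action UNIV G" "!!g x. g \<in> G ==> x \<in> X ==> g x \<in> X"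
 shows "deck_action X G"
proof -
 interpret deck_action UNIV G by fact
 show ?thesis
 proof (unfold_locales, goal_cases)
  case (1) show ?case by (rule G_id)
 next
  case (2 g h) thus ?case by (rule G_comp)
 next
  case (3 g) thus ?case by (rule G_inv)
 next
  case (4 g) thus ?case using continuous_on_subset[OF G_cont] by blast
 next
  case (5 g x) thus ?case by (rule assms(2))
 next
  case (6 x)
  obtain U where U: "open U" "x \<in> U" "\<forall>g\<in>G. g ~= id --> g ` U \<inter> U = {}" using even_nbhd[of x] by auto
  have "g ` (X \<inter> U) \<inter> (X \<inter> U) = {}" if "g \<in> G" "g ~= id" for g using U(3) that by blast
  thus ?case using U 6 by (intro exI[of _ "X \<inter> U"]) (simp add: openin_open_Int)
 qed
qed

lemma lam_psi: "lam y = 1 / psi y $ 3" by (simp add: lam_def psi_nth)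

lemma lam_psi_inv: "v \<in> hyp3 ==> lam (psi_inv v) = 1 / v $ 3"
 by (simp add: lam_psi psi_psi_inv)

lemma lam_half: "lam y >= 1/2 \<longleftrightarrow> psi y $ 3 <= 2"
 using psi_hyp3[of y] by (simp add: lam_psi hyp3_def divide_simps)

lemma truncated_octahedron_bound:
 fixes a b c s :: real
 assumes nn: "0 <= a" "0 <= b" "0 <= c" and sum: "a + b + c <= s" and sq: "s^2 = 1 + a^2 + b^2 + c^2"
  and le: "a + 1/2 <= s" "b + 1/2 <= s" "c + 1/2 <= s"
 shows "a^2 + b^2 + c^2 <= 3^2"
proof -
 have "(a + b + c)^2 <= s^2" using sum nn by (intro power_mono) auto
 hence prod: "2 * (a * b) + 2 * (a * c) + 2 * (b * c) <= 1" unfolding sq by (simp add: power2_eq_square algebra_simps)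
 have pp: "0 <= a * b" "0 <= a * c" "0 <= b * c" using nn by auto
 have sqk: "(a + 1/2)^2 <= s^2" "(b + 1/2)^2 <= s^2" "(c + 1/2)^2 <= s^2" using le nn by (auto intro!: power_mono)
 have key: "z <= 2 & x <= 2 & y <= 2" if "0 <= x" "0 <= y" "x <= z" "y <= z" "2 * (x * z) <= 1" "2 * (y * z) <= 1"
  "(z + 1/2)^2 <= 1 + x^2 + y^2 + z^2" for x y z :: real
 proof -
  have "x * x <= x * z" "y * y <= y * z" using that by (auto intro: mult_left_mono)
  thus ?thesis using that by (simp add: power2_eq_square algebra_simps)
 qed
 consider "a <= c" "b <= c" | "a <= b" "c <= b" | "b <= a" "c <= a" by linarith
 hence 2: "a <= 2 & b <= 2 & c <= 2"
 proof cases
  case 1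
  have "2 * (a * c) <= 1" "2 * (b * c) <= 1" "(c + 1/2)^2 <= 1 + a^2 + b^2 + c^2" using prod pp sqk(3) sq by linarith+
  thus ?thesis using key[of a b c] nn 1 by blast
 next
  case 2
  have "2 * (a * b) <= 1" "2 * (c * b) <= 1" "(b + 1/2)^2 <= 1 + a^2 + c^2 + b^2"
   using prod pp sqk(2) sq by (simp_all add: mult.commute)
  thus ?thesis using key[of a c b] nn 2 by blast
 next
  case 3
  have "2 * (b * a) <= 1" "2 * (c * a) <= 1" "(a + 1/2)^2 <= 1 + b^2 + c^2 + a^2"
   using prod pp sqk(1) sq by (simp_all add: mult.commute)
  thus ?thesis using key[of b c a] nn 3 by blast
 qed
 hence q: "a * a <= 2 * 2" "b * b <= 2 * 2" "c * c <= 2 * 2" using nn by (intro mult_mono; simp)+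
 have "s^2 <= 4^2" using q sq by (simp add: power2_eq_square)
 hence "s <= 4" by (rule power2_le_imp_le) simp
 moreover have "a * a <= a * 2" "b * b <= b * 2" "c * c <= c * 2" using 2 nn by (auto intro: mult_left_mono)
 ultimately show ?thesis using sum by (simp add: power2_eq_square)
qed

context octahedron
begin

lemma X_whole: "g \<in> whole ==> x \<in> X ==> g x \<in> X"
proof -
 assume g: "g \<in> whole" "x \<in> X"
 have "lam (k (g x)) >= 1/2" if "k \<in> whole" for k using g(2) whole_comp[OF that g(1)] by (auto simp: X_def)
 thus "g x \<in> X" by (simp add: X_def)
qed

lemma deck_action_X: "deck_action X (Mor c c)"
proof (rule deck_action_subset[OF deck_action_Mor])
 fix g x assume "g \<in> Mor c c" "x \<in> X"
 thus "g x \<in> X" using Mor_whole X_whole by blast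
qed

definition clamp :: "real^3 => real^3" where "clamp v = (\<chi> i. if i = 3 then min (v$3) 2 else v$i)"

definition rho :: "(real^3 => real^3) => real^3 => real^3" where
 "rho g x = finv g (psi_inv (clamp (psi (g x))))"

lemma clamp_hyp3: "v \<in> hyp3 ==> clamp v \<in> hyp3" by (simp add: clamp_def hyp3_def)

lemma continuous_clamp: "continuous_on S clamp"
 unfolding clamp_def
proof (rule continuous_on_vec_lambda)
 show "continuous_on S (%v. if i = 3 then min (v$3) 2 else v$i)" for i :: 3
  by (cases "i = 3") (simp_all add: continuous_on_min continuous_on_component continuous_on_id)
qed

lemma continuous_rho:
 assumes "g \<in> whole" shows "continuous_on S (rho g)"
proof -
 have 1: "continuous_on S (%x. psi (g x))" by (rule continuous_on_compose2[OF continuous_psi[of UNIV] whole_continuous[OF assms]]) simp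
 have 2: "continuous_on S (%x. clamp (psi (g x)))" by (rule continuous_on_compose2[OF continuous_clamp[of UNIV] 1]) simp
 have 3: "continuous_on S (%x. psi_inv (clamp (psi (g x))))"
  by (rule continuous_on_compose2[OF continuous_psi_inv[OF order_refl] 2]) (auto simp: clamp_hyp3 psi_hyp3)
 show ?thesis unfolding rho_def by (rule continuous_on_compose2[OF whole_continuous[OF whole_inv(2)[OF assms], of UNIV] 3]) simp
qed

lemma rho_eq: "g \<in> whole ==> lam (g x) >= 1/2 ==> rho g x = x"
proof -
 assume g: "g \<in> whole" "lam (g x) >= 1/2"
 have "psi (g x) $ 3 <= 2" using g(2) lam_half by blast
 hence "clamp (psi (g x)) = psi (g x)" by (auto simp: clamp_def vec_eq_iff)
 thus ?thesis using whole_inv(1)[OF g(1)] by (simp add: rho_def psi_inv_psi bij_is_inj)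
qed

lemma rho_lam_le: "g \<in> whole ==> lam (g x) <= 1/2 ==> lam (g (rho g x)) = 1/2"
proof -
 assume g: "g \<in> whole" and le: "lam (g x) <= 1/2"
 have e: "g (rho g x) = psi_inv (clamp (psi (g x)))" using whole_inv(1)[OF g] by (simp add: rho_def bij_is_surj surj_f_inv_f)
 have "psi (g x) $ 3 >= 2" using le psi_hyp3[of "g x"] by (simp add: lam_psi hyp3_def divide_simps)
 hence "(clamp (psi (g x))) $ 3 = 2" by (simp add: clamp_def)
 thus ?thesis unfolding e by (simp add: lam_psi_inv clamp_hyp3 psi_hyp3)
qed

definition horo :: "real^3 => real^3 => real" where
 "horo x = lam \<circ> (SOME g. g \<in> whole & lam (g x) <= 1/2)"

definition rep :: "(real^3 => real) => real^3 => real^3" where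
 "rep f = (SOME g. g \<in> whole & lam \<circ> g = f)"

definition retr :: "real^3 => real^3" where
 "retr x = (if \<exists>g\<in>whole. lam (g x) <= 1/2 then rho (rep (horo x)) x else x)"

lemma rep: "g \<in> whole ==> rep (lam \<circ> g) \<in> whole & lam \<circ> rep (lam \<circ> g) = lam \<circ> g"
 unfolding rep_def by (rule someI[of "%h. h \<in> whole & lam \<circ> h = lam \<circ> g" g]) simp

lemma horo: "g \<in> whole ==> lam (g x) <= 1/2 ==> horo x = lam \<circ> g"
proof -
 assume g: "g \<in> whole" "lam (g x) <= 1/2"
 define k where "k = (SOME g. g \<in> whole & lam (g x) <= 1/2)"
 have "k \<in> whole & lam (k x) <= 1/2" unfolding k_def by (rule someI[of _ g]) (use g in simp)
 hence "lam (k y) = lam (g y)" for y using lam_unique[OF _ g(1) _ g(2)] by blast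
 thus ?thesis unfolding horo_def k_def[symmetric] by (simp add: fun_eq_iff)
qed

lemma retr_X: "x \<in> X ==> retr x = x"
proof (cases "\<exists>g\<in>whole. lam (g x) <= 1/2")
 case True
 assume x: "x \<in> X"
 obtain g where g: "g \<in> whole" "lam (g x) <= 1/2" using True by blast
 have r: "rep (lam \<circ> g) \<in> whole" using rep[OF g(1)] by blast
 have "rho (rep (lam \<circ> g)) x = x" by (rule rho_eq[OF r]) (use x r in \<open>auto simp: X_def\<close>)
 thus ?thesis using True horo[OF g] by (simp add: retr_def)
qed (simp add: retr_def)

lemma retr_in: "retr x \<in> X"
proof (cases "\<exists>g\<in>whole. lam (g x) <= 1/2")
 case True
 obtain g where g: "g \<in> whole" "lam (g x) <= 1/2" using True by blast
 define k where "k = rep (lam \<circ> g)"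
 have k: "k \<in> whole" "lam \<circ> k = lam \<circ> g" using rep[OF g(1)] by (auto simp: k_def)
 have kx: "lam (k x) <= 1/2" using fun_cong[OF k(2), of x] g(2) by simp
 have e: "retr x = rho k x" using True horo[OF g] by (simp add: retr_def k_def)
 have ky: "lam (k (rho k x)) = 1/2" by (rule rho_lam_le[OF k(1) kx])
 have "lam (g' (rho k x)) >= 1/2" if g': "g' \<in> whole" for g'
 proof (rule ccontr)
  assume "~ 1/2 <= lam (g' (rho k x))"
  moreover from this have "lam (g' (rho k x)) = lam (k (rho k x))" using lam_unique[OF g' k(1), of "rho k x"] ky by simp
  ultimately show False using ky by simp
 qed
 thus ?thesis by (simp add: e X_def)
next
 case False thus ?thesis by (auto simp: retr_def X_def)
qed

lemma continuous_retr: "continuous_on UNIV retr"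
proof (subst continuous_on_eq_continuous_at, simp, intro ballI)
 fix x
 obtain V g where V: "open V" "x \<in> V" "g \<in> whole"
  "!!z g'. z \<in> V ==> g' \<in> whole ==> lam (g' z) <= 1/2 ==> lam \<circ> g' = lam \<circ> g" using one_horoball[of x] by blast
 define k where "k = rep (lam \<circ> g)"
 have k: "k \<in> whole" using rep[OF V(3)] by (simp add: k_def)
 have "retr z = rho k z" if z: "z \<in> V" for z
 proof (cases "\<exists>g\<in>whole. lam (g z) <= 1/2")
  case True
  then obtain g' where g': "g' \<in> whole" "lam (g' z) <= 1/2" by blast
  have "horo z = lam \<circ> g" using horo[OF g'] V(4)[OF z g'] by simp
  thus ?thesis using True by (simp add: retr_def k_def)
 next
  case False
  hence "lam (k z) >= 1/2" using k by (meson le_cases)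
  thus ?thesis using False rho_eq[OF k] by (simp add: retr_def)
 qed
 hence "continuous_on V retr" using continuous_rho[OF k, of V] continuous_on_cong[of V V retr "rho k"] by simp
 thus "isCont retr x" using V(1,2) by (simp add: continuous_on_eq_continuous_at)
qed

lemma simply_connected_X: "simply_connected X"
proof (rule retract_of_simply_connected)
 show "simply_connected (UNIV :: (real^3) set)" by (rule convex_imp_simply_connected) simp
 show "X retract_of UNIV" unfolding retract_of_def retraction_def by (intro exI[of _ retr]) (use continuous_retr retr_in retr_X in auto)
qed

lemma closed_X: "closed X"
proof -
 have "X = (\<Inter>g\<in>whole. {x. 1/2 <= lam (g x)})" by (auto simp: X_def)
 moreover have "closed {x. 1/2 <= lam (g x)}" if "g \<in> whole" for g
  by (intro closed_Collect_le continuous_on_const continuous_on_compose2[OF continuous_lam[of UNIV] whole_continuous[OF that]]) simp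
 ultimately show ?thesis by auto
qed

lemma symmI:
 assumes "orthogonal_transformation R" "!!x. R (R x) = x" "!!x. \<forall>k. \<bar>x $ k\<bar> = 1 ==> \<forall>k. \<bar>R x $ k\<bar> = 1"
 obtains h where "h \<in> symm" "ri h = R" "!!i. R (n i) = n (h i)"
proof -
 have abs1: "\<bar>a\<bar> = 1 \<longleftrightarrow> a = 1 \<or> a = - 1" for a :: real by auto
 have "\<exists>j. n j = R (n i)" for i by (rule n_ex) (use assms(3)[of "n i"] n_signs[of i] in \<open>auto simp: abs1\<close>)
 then obtain h where h: "!!i. n (h i) = R (n i)" by metis
 have "R (n (h i)) = n i" for i by (simp add: h assms(2))
 hence hs: "h \<in> symm" unfolding symm_def using assms(1) by blast
 have "ri h = R"
 proof (rule n_ext)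
  show "linear (ri h)" using ri_orth[OF hs] orthogonal_transformation_linear by blast
  show "linear R" using assms(1) orthogonal_transformation_linear by blast
  fix j
  obtain i where "j = h i" using symm_bij[OF hs] by (metis bij_pointE)
  thus "ri h (n j) = R (n j)" using ri_n[OF hs] by (simp add: h assms(2))
 qed
 thus ?thesis using that[OF hs] h by simp
qed

lemma vertex_symm:
 assumes "s = 1 \<or> s = - 1"
 obtains h where "h \<in> symm" "!!x. (ri h x) $ 3 = s * x $ k"
proof -
 define R :: "real^3 => real^3" where "R x = (\<chi> j. if j = 3 then s * x $ k else if j = k then s * x $ 3 else x $ j)" for x
 have ss: "s * s = 1" "\<bar>s\<bar> = 1" "s * (s * a) = a" for a using assms by auto
 have lin: "linear R" by (rule linearI) (auto simp: R_def vec_eq_iff algebra_simps)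
 have "R x \<bullet> R y = x \<bullet> y" for x y
 proof -
  show ?thesis using assms exhaust_3[of k] by (elim disjE) (simp_all add: inner3 R_def)
 qed
 hence "orthogonal_transformation R" using lin by (simp add: orthogonal_transformation_def)
 moreover have "R (R x) = x" for x using ss(3) by (auto simp: R_def vec_eq_iff)
 moreover have "\<forall>k. \<bar>R x $ k\<bar> = 1" if "\<forall>k. \<bar>x $ k\<bar> = 1" for x using that ss by (auto simp: R_def abs_mult)
 ultimately obtain h where "h \<in> symm" "ri h = R" by (rule symmI)
 thus ?thesis using that[of h] by (simp add: R_def)
qed

lemma bounded_PX: "bounded (P \<inter> X)"
 unfolding bounded_iff
proof (intro exI[of _ 3] ballI)
 fix x assume x: "x \<in> P \<inter> X"
 have le: "\<bar>x $ k\<bar> + 1/2 <= hs x" for k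
 proof -
  define s :: real where "s = (if x $ k >= 0 then 1 else - 1)"
  obtain h where h: "h \<in> symm" "!!x. (ri h x) $ 3 = s * x $ k" by (rule vertex_symm[of s k]) (auto simp: s_def)
  have "lam (ri h x) >= 1/2" using x ri_whole[OF h(1)] by (auto simp: X_def)
  thus ?thesis by (auto simp: lam_def hs_ri[OF h(1)] h(2) s_def split: if_splits)
 qed
 have sum: "\<bar>x$1\<bar> + \<bar>x$2\<bar> + \<bar>x$3\<bar> <= hs x"
 proof -
  define v :: "real^3" where "v = (\<chi> k. if x $ k >= 0 then 1 else - 1)"
  have "\<forall>k. v $ k = 1 \<or> v $ k = - 1" by (simp add: v_def)
  then obtain i where i: "n i = v" using n_ex by blast
  have "n i \<bullet> x <= hs x" using x by (simp add: P_def L_def)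
  moreover have "v $ k * x $ k = \<bar>x $ k\<bar>" for k by (simp add: v_def)
  ultimately show ?thesis unfolding i inner3 by simp
 qed
 have sq: "(hs x)^2 = 1 + \<bar>x$1\<bar>^2 + \<bar>x$2\<bar>^2 + \<bar>x$3\<bar>^2" unfolding hs_sq inner3 by (simp add: power2_eq_square)
 have "\<bar>x$1\<bar>^2 + \<bar>x$2\<bar>^2 + \<bar>x$3\<bar>^2 <= 3^2" by (rule truncated_octahedron_bound[OF _ _ _ sum sq le le le]) auto
 hence "(norm x)^2 <= 3^2" unfolding power2_norm_eq_inner inner3 by (simp add: power2_eq_square)
 thus "norm x <= 3" by (rule power2_le_imp_le) simp
qed

lemma compact_PX: "compact (P \<inter> X)"
proof -
 have "P = (\<Inter>i. {x. L i x <= 0})" by (auto simp: P_def)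
 moreover have "closed {x. L i x <= 0}" for i by (rule closed_Collect_le) (auto intro: continuous_L continuous_intros)
 ultimately have "closed P" by auto
 thus ?thesis using bounded_PX closed_X by (simp add: compact_eq_bounded_closed closed_Int)
qed

end

lemma half_space_not_interior:
 assumes U: "openin T U" "p \<in> U" and f: "homeomorphic_map (subtopology T U) (top_of_set Q) f"
  and Q: "Q \<subseteq> half_space3" and p0: "f p $ 3 = 0"
 shows "p \<notin> manifold3_interior T"
proof
 assume "p \<in> manifold3_interior T"
 then obtain U1 and V1 :: "(real^3) set" where U1: "openin T U1" "p \<in> U1" "open V1"
  "subtopology T U1 homeomorphic_space top_of_set V1" unfolding manifold3_interior_def by (elim CollectE conjE exE)
 then obtain k k' where k: "homeomorphic_maps (subtopology T U1) (top_of_set V1) k k'" by (auto simp: homeomorphic_space_def)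
 have tU: "topspace (subtopology T U) = U" "topspace (subtopology T U1) = U1"
  using openin_subset[OF U(1)] openin_subset[OF U1(1)] by (auto simp: inf_absorb2)
 define N where "N = U \<inter> U1"
 define A where "A = k ` N"
 have kk: "k' (k x) = x" if "x \<in> U1" for x using k that tU(2) unfolding homeomorphic_maps_def by auto
 have kV: "k x \<in> V1" if "x \<in> U1" for x using k that tU(2) unfolding homeomorphic_maps_def continuous_map_def by auto
 have kh: "homeomorphic_map (subtopology T U1) (top_of_set V1) k" using k homeomorphic_maps_map by blast
 have "openin (subtopology T U1) N" unfolding N_def using U(1) by (metis Int_commute openin_subtopology_Int)
 hence "openin (top_of_set V1) A" unfolding A_def using homeomorphic_imp_open_map[OF kh] by (simp add: open_map_def)
 hence oA: "open A" using U1(3) openin_open_trans by blast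
 have AV: "A \<subseteq> V1" unfolding A_def N_def using kV by auto
 have k'A: "k' ` A = N" unfolding A_def image_image using kk by (auto simp: N_def)
 have "continuous_map (top_of_set V1) (subtopology T U1) k'" using k by (simp add: homeomorphic_maps_def)
 hence "continuous_map (top_of_set V1) T k'" by (simp add: continuous_map_in_subtopology)
 hence "continuous_map (top_of_set A) T k'" by (rule continuous_map_from_subtopology_mono[OF _ AV])
 hence "continuous_map (top_of_set A) (subtopology T U) k'" using k'A by (auto simp: continuous_map_in_subtopology N_def)
 moreover have "continuous_map (subtopology T U) (top_of_set Q) f" using f by (rule homeomorphic_imp_continuous_map)
 ultimately have "continuous_map (top_of_set A) (top_of_set Q) (f \<circ> k')" by (rule continuous_map_compose)
 hence c: "continuous_on A (f \<circ> k')" "(f \<circ> k') ` A \<subseteq> Q" by auto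
 have "inj_on (f \<circ> k') A"
 proof (rule comp_inj_on)
  show "inj_on k' A" unfolding A_def using kk by (auto simp: inj_on_def N_def)
  have "inj_on f U" using homeomorphic_imp_injective_map[OF f] tU by simp
  thus "inj_on f (k' ` A)" unfolding k'A by (rule inj_on_subset) (simp add: N_def)
 qed
 hence o: "open ((f \<circ> k') ` A)" by (rule invariance_of_domain[OF c(1) oA])
 have "(f \<circ> k') ` A = f ` N" unfolding image_comp[symmetric] k'A ..
 hence "f p \<in> (f \<circ> k') ` A" using U(2) U1(2) by (simp add: N_def)
 then obtain e where e: "e > 0" "ball (f p) e \<subseteq> (f \<circ> k') ` A" using o open_contains_ball by blast
 define v where "v = f p - (e / 2) *\<^sub>R axis 3 1"
 have "dist (f p) v < e" using e(1) by (simp add: v_def dist_norm norm_axis_1)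
 hence "v \<in> half_space3" using e(2) c(2) Q by (metis mem_ball subsetD)
 thus False using e(1) p0 by (simp add: v_def half_space3_def axis_def)
qed

definition flip3 :: "real^3 => real^3" where "flip3 v = (\<chi> i. if i = 3 then 2 - v$3 else v$i)"

lemma flip3_flip3: "flip3 (flip3 v) = v" by (simp add: flip3_def vec_eq_iff)

lemma continuous_flip3: "continuous_on S flip3"
 unfolding flip3_def
proof (rule continuous_on_vec_lambda)
 show "continuous_on S (%v. if i = 3 then 2 - v$3 else v$i)" for i :: 3
  by (cases "i = 3") (simp_all add: continuous_on_diff continuous_on_component continuous_on_id)
qed

lemma open_flip3: "open S ==> open (flip3 ` S)"
proof -
 assume S: "open S"
 have "flip3 ` S = flip3 -` S"
 proof (rule subset_antisym; rule subsetI)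
  fix v assume "v \<in> flip3 ` S" thus "v \<in> flip3 -` S" by (auto simp: flip3_flip3)
 next
  fix v assume "v \<in> flip3 -` S" thus "v \<in> flip3 ` S" by (intro image_eqI[of _ _ "flip3 v"]) (simp_all add: flip3_flip3)
 qed
 thus ?thesis using open_vimage[OF S continuous_flip3] by simp
qed

context octahedron
begin

definition bd :: "(real^3) set" where "bd = {x \<in> X. \<exists>g\<in>whole. lam (g x) = 1/2}"

lemma interior_ball:
 assumes "x \<in> X" "x \<notin> bd" obtains r where "r > 0" "ball x r \<subseteq> X"
proof -
 obtain V g where V: "open V" "x \<in> V" "g \<in> whole"
  "!!z g'. z \<in> V ==> g' \<in> whole ==> lam (g' z) <= 1/2 ==> lam \<circ> g' = lam \<circ> g" using one_horoball[of x] by blast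
 define W where "W = V \<inter> {z. 1/2 < lam (g z)}"
 have "open {z. 1/2 < lam (g z)}"
  by (intro open_Collect_less continuous_on_const continuous_on_compose2[OF continuous_lam[of UNIV] whole_continuous[OF V(3)]]) simp
 hence "open W" unfolding W_def using V(1) by auto
 moreover have "lam (g x) >= 1/2" "lam (g x) ~= 1/2" using assms V(3) unfolding bd_def X_def by blast+
 hence "x \<in> W" using V(2) unfolding W_def by auto
 moreover have "z \<in> X" if z: "z \<in> W" for z unfolding X_def
 proof (intro CollectI ballI, rule ccontr)
  fix g' assume g': "g' \<in> whole" "~ 1/2 <= lam (g' z)"
  hence "lam \<circ> g' = lam \<circ> g" using V(4)[of z g'] z unfolding W_def by auto
  hence "lam (g' z) = lam (g z)" by (metis comp_apply)
  thus False using g'(2) z unfolding W_def by auto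
 qed
 ultimately show ?thesis using that open_contains_ball by (metis subset_iff)
qed

lemma bd_nbhd:
 assumes "g \<in> whole" "lam (g x) = 1/2"
 obtains V where "open V" "x \<in> V" "!!z. z \<in> V ==> z \<in> X \<longleftrightarrow> lam (g z) >= 1/2"
  "!!z g'. z \<in> V ==> g' \<in> whole ==> lam (g' z) <= 1/2 ==> lam \<circ> g' = lam \<circ> g"
proof -
 obtain V g0 where V: "open V" "x \<in> V" "g0 \<in> whole"
  "!!z g'. z \<in> V ==> g' \<in> whole ==> lam (g' z) <= 1/2 ==> lam \<circ> g' = lam \<circ> g0" using one_horoball[of x] by blast
 have "lam \<circ> g = lam \<circ> g0" using V(4)[OF V(2) assms(1)] assms(2) by simp
 hence u: "lam \<circ> g' = lam \<circ> g" if "z \<in> V" "g' \<in> whole" "lam (g' z) <= 1/2" for z g' using V(4)[OF that] by simp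
 have "z \<in> X \<longleftrightarrow> lam (g z) >= 1/2" if z: "z \<in> V" for z
 proof
  show "z \<in> X ==> lam (g z) >= 1/2" using assms(1) unfolding X_def by blast
  assume *: "lam (g z) >= 1/2"
  show "z \<in> X" unfolding X_def
  proof (intro CollectI ballI, rule ccontr)
   fix g' assume g': "g' \<in> whole" "~ 1/2 <= lam (g' z)"
   hence "lam (g' z) = lam (g z)" using u[OF z g'(1)] by (metis comp_apply le_cases)
   thus False using g'(2) * by simp
  qed
 qed
 thus ?thesis using that[OF V(1,2)] u by blast
qed

definition tau :: "(real^3 => real^3) => real^3 => real^3" where "tau g x = flip3 (psi (g x))"

lemma tau_homeo:
 assumes g: "g \<in> whole"
 shows "homeomorphism S (tau g ` S) (tau g) (%v. finv g (psi_inv (flip3 v)))" and "open S ==> open (tau g ` S)"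
proof -
 have inv: "finv g (psi_inv (flip3 (tau g x))) = x" for x using whole_inv(1)[OF g] by (simp add: tau_def flip3_flip3 psi_inv_psi bij_is_inj)
 have c1: "continuous_on S (tau g)" unfolding tau_def
  by (rule continuous_on_compose2[OF continuous_flip3[of UNIV]], rule continuous_on_compose2[OF continuous_psi[of UNIV] whole_continuous[OF g]]) auto
 have "flip3 v \<in> hyp3" if "v \<in> tau g ` S" for v using that psi_hyp3 by (auto simp: tau_def flip3_flip3)
 hence c2: "continuous_on (tau g ` S) (%v. finv g (psi_inv (flip3 v)))"
  by (intro continuous_on_compose2[OF whole_continuous[OF whole_inv(2)[OF g], of UNIV]]
    continuous_on_compose2[OF continuous_psi_inv[OF order_refl]] continuous_flip3) auto
 show "homeomorphism S (tau g ` S) (tau g) (%v. finv g (psi_inv (flip3 v)))"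
  unfolding homeomorphism_def using c1 c2 inv by (auto simp: image_image)
 assume S: "open S"
 have "g ` S = finv g -` S" using whole_inv(1)[OF g] by (force simp: image_iff bij_is_inj bij_is_surj surj_f_inv_f)
 hence "open (g ` S)" using open_vimage[OF S whole_continuous[OF whole_inv(2)[OF g]]] by simp
 moreover have "tau g ` S = flip3 ` psi ` g ` S" by (simp add: tau_def image_image)
 ultimately show "open (tau g ` S)" by (simp add: open_flip3 open_psi_image)
qed

lemma tau_X:
 "lam (g z) >= 1/2 \<longleftrightarrow> tau g z \<in> half_space3" "lam (g z) = 1/2 \<longleftrightarrow> tau g z $ 3 = 0"
proof -
 have "tau g z $ 3 = 2 - psi (g z) $ 3" by (simp add: tau_def flip3_def)
 moreover have "psi (g z) $ 3 > 0" using psi_hyp3[of "g z"] by (simp add: hyp3_def)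
 ultimately show "lam (g z) >= 1/2 \<longleftrightarrow> tau g z \<in> half_space3" "lam (g z) = 1/2 \<longleftrightarrow> tau g z $ 3 = 0"
  unfolding lam_psi by (auto simp: half_space3_def divide_simps)
qed

context
 fixes c0 :: 'c
begin

interpretation D: deck_action X "Mor c0 c0" by (rule deck_action_X)

lemma chart_bd:
 assumes x: "x \<in> X" and g: "g \<in> whole" "lam (g x) = 1/2"
 obtains U Q f where "openin D.quot U" "D.orb x \<in> U" "openin (top_of_set half_space3) Q"
  "homeomorphic_map (subtopology D.quot U) (top_of_set Q) f" "f (D.orb x) $ 3 = 0"
proof -
 obtain V where V: "open V" "x \<in> V" "!!z. z \<in> V ==> z \<in> X \<longleftrightarrow> lam (g z) >= 1/2" using bd_nbhd[OF g] by metis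
 obtain W where W: "openin (top_of_set X) W" "x \<in> W" "\<forall>g\<in>Mor c0 c0. g ~= id --> g ` W \<inter> W = {}"
  using D.even_nbhd[OF x] by blast
 obtain W0 where W0: "open W0" "W = X \<inter> W0" using W(1) by (auto simp: openin_open)
 define S where "S = X \<inter> (W0 \<inter> V)"
 have oS: "openin (top_of_set X) S" unfolding S_def using W0(1) V(1) by (intro openin_open_Int open_Int)
 have eS: "g ` S \<inter> S = {}" if "g \<in> Mor c0 c0" "g ~= id" for g
 proof -
  have "g ` S \<inter> S \<subseteq> g ` W \<inter> W" unfolding S_def W0(2) by blast
  thus ?thesis using W(3) that by blast
 qed
 note hm = D.openin_even_subset(2)[OF oS eS]
 then obtain k where k: "homeomorphic_maps (top_of_set S) (subtopology D.quot (D.orb ` S)) D.orb k" unfolding homeomorphic_map_maps by blast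
 have km: "homeomorphic_map (subtopology D.quot (D.orb ` S)) (top_of_set S) k" using k homeomorphic_maps_sym homeomorphic_map_maps by blast
 define Q where "Q = tau g ` S"
 have "homeomorphic_maps (top_of_set S) (top_of_set Q) (tau g) (%v. finv g (psi_inv (flip3 v)))"
  unfolding homeomorphic_maps_def Q_def using tau_homeo(1)[OF g(1), of S] by (auto simp: homeomorphism_def continuous_map_subtopology_eu)
 hence tm: "homeomorphic_map (top_of_set S) (top_of_set Q) (tau g)" using homeomorphic_map_maps by blast
 have Qe: "Q = half_space3 \<inter> tau g ` (W0 \<inter> V)" unfolding Q_def S_def using V(3) tau_X(1) by blast
 have xS: "x \<in> S" using x W(2) V(2) W0(2) unfolding S_def by blast
 have "k (D.orb x) = x" using k xS unfolding homeomorphic_maps_def by simp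
 show ?thesis
 proof (rule that[of "D.orb ` S" Q "tau g \<circ> k"])
  show "openin D.quot (D.orb ` S)" by (rule D.open_orb_image[OF oS])
  show "D.orb x \<in> D.orb ` S" using xS by (rule imageI)
  show "openin (top_of_set half_space3) Q" unfolding Qe using tau_homeo(2)[OF g(1)] W0(1) V(1) by (intro openin_open_Int) auto
  show "homeomorphic_map (subtopology D.quot (D.orb ` S)) (top_of_set Q) (tau g \<circ> k)" by (rule homeomorphic_map_compose[OF km tm])
  show "(tau g \<circ> k) (D.orb x) $ 3 = 0" using \<open>k (D.orb x) = x\<close> tau_X(2) g(2) by (metis comp_apply)
 qed
qed

lemma chart_int:
 assumes x: "x \<in> X" "x \<notin> bd"
 obtains U B where "openin D.quot U" "D.orb x \<in> U" "open B" "bounded B"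
  "subtopology D.quot U homeomorphic_space top_of_set (B :: (real^3) set)"
proof -
 obtain W where W: "openin (top_of_set X) W" "x \<in> W" "\<forall>g\<in>Mor c0 c0. g ~= id --> g ` W \<inter> W = {}"
  using D.even_nbhd[OF x(1)] by blast
 obtain W0 where W0: "open W0" "W = X \<inter> W0" using W(1) by (auto simp: openin_open)
 obtain r where r: "r > 0" "ball x r \<subseteq> X" using interior_ball[OF x] by blast
 obtain s where s: "s > 0" "ball x s \<subseteq> W0" using W0 W(2) open_contains_ball by (metis IntD2)
 define B where "B = ball x (min r s)"
 have BX: "B \<subseteq> X" "B \<subseteq> W" using r s unfolding B_def W0(2) by auto
 have oB: "openin (top_of_set X) B" by (rule open_subset[OF BX(1)]) (simp add: B_def)
 have eB: "g ` B \<inter> B = {}" if "g \<in> Mor c0 c0" "g ~= id" for g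
 proof -
  have "g ` B \<inter> B \<subseteq> g ` W \<inter> W" using BX(2) by blast
  thus ?thesis using W(3) that by blast
 qed
 have "top_of_set B homeomorphic_space subtopology D.quot (D.orb ` B)"
  by (rule homeomorphic_map_imp_homeomorphic_space[OF D.openin_even_subset(2)[OF oB eB]])
 hence "subtopology D.quot (D.orb ` B) homeomorphic_space top_of_set B" by (rule homeomorphic_space_sym[THEN iffD1])
 moreover have "openin D.quot (D.orb ` B)" by (rule D.open_orb_image[OF oB])
 moreover have "x \<in> B" using r(1) s(1) by (simp add: B_def)
 ultimately show ?thesis using that[of "D.orb ` B" B] by (simp add: B_def)
qed

lemma bd_whole: "f \<in> whole ==> x \<in> bd ==> f x \<in> bd"
proof -
 assume f: "f \<in> whole" and x: "x \<in> bd"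
 then obtain g where g: "g \<in> whole" "lam (g x) = 1/2" by (auto simp: bd_def)
 have "g \<circ> finv f \<in> whole" by (rule whole_comp[OF g(1) whole_inv(2)[OF f]])
 moreover have "(g \<circ> finv f) (f x) = g x" using whole_inv(1)[OF f] by (simp add: bij_is_inj)
 ultimately show ?thesis using g(2) X_whole[OF f] x unfolding bd_def by (metis (mono_tags, lifting) mem_Collect_eq)
qed

lemma boundary_quot: "manifold3_boundary D.quot = D.orb ` bd"
proof (rule subset_antisym; rule subsetI)
 fix a assume a: "a \<in> manifold3_boundary D.quot"
 then obtain x where x: "x \<in> X" "a = D.orb x" unfolding manifold3_boundary_def D.topspace_quot by blast
 have "x \<in> bd"
 proof (rule ccontr)
  assume nb: "x \<notin> bd"
  obtain U B where UB: "openin D.quot U" "D.orb x \<in> U" "open B" "bounded B"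
   "subtopology D.quot U homeomorphic_space top_of_set (B :: (real^3) set)" using chart_int[OF x(1) nb] .
  have "D.orb x \<in> topspace D.quot" using x(1) by (simp add: D.topspace_quot)
  hence "a \<in> manifold3_interior D.quot" unfolding manifold3_interior_def x(2) by (intro CollectI conjI exI[of _ U] exI[of _ B] UB)
  thus False using a by (simp add: manifold3_boundary_def)
 qed
 thus "a \<in> D.orb ` bd" using x(2) by (rule image_eqI[rotated])
next
 fix a assume "a \<in> D.orb ` bd"
 then obtain x where x: "x \<in> bd" "a = D.orb x" by blast
 then obtain g where g: "x \<in> X" "g \<in> whole" "lam (g x) = 1/2" by (auto simp: bd_def)
 obtain U Q f where U: "openin D.quot U" "D.orb x \<in> U" "openin (top_of_set half_space3) Q"
  "homeomorphic_map (subtopology D.quot U) (top_of_set Q) f" "f (D.orb x) $ 3 = 0" using chart_bd[OF g] .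
 have "D.orb x \<notin> manifold3_interior D.quot" by (rule half_space_not_interior[OF U(1,2,4) openin_imp_subset[OF U(3)] U(5)])
 moreover have "D.orb x \<in> topspace D.quot" using g(1) by (simp add: D.topspace_quot)
 ultimately show "a \<in> manifold3_boundary D.quot" by (simp add: manifold3_boundary_def x(2))
qed

lemma Hausdorff_X: "Hausdorff_space D.quot"
proof (rule D.Hausdorff_quot)
 fix x y assume xy: "x \<in> X" "y \<in> X" "D.orb x ~= D.orb y"
 hence "g x ~= y" if "g \<in> Mor c0 c0" for g using D.orb_apply[OF that, of x] by auto
 then obtain U V where UV: "open U" "open V" "x \<in> U" "y \<in> V" "!!g. g \<in> Mor c0 c0 ==> g ` U \<inter> V = {}"
  using Mor_separate[of "Mor c0 c0" c0 x y] by (metis order_refl)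
 have "g ` (X \<inter> U) \<inter> (X \<inter> V) = {}" if "g \<in> Mor c0 c0" for g using UV(5)[OF that] by blast
 thus "\<exists>U V. openin (top_of_set X) U & openin (top_of_set X) V & x \<in> U & y \<in> V & (\<forall>g\<in>Mor c0 c0. g ` U \<inter> V = {})"
  using UV(1-4) xy(1,2) by (intro exI[of _ "X \<inter> U"] exI[of _ "X \<inter> V"] conjI openin_open_Int IntI ballI)
qed

lemma compact_X: "compact_space D.quot"
proof -
 define md where "md d = (SOME f. f \<in> Mor c0 d)" for d
 define C where "C = (\<Union>d\<in>{d. Mor c0 d ~= {}}. md d ` (P \<inter> X))"
 have md: "md d \<in> Mor c0 d" if "Mor c0 d ~= {}" for d unfolding md_def using that by (metis ex_in_conv someI_ex)
 show ?thesis
 proof (rule D.compact_quot[where C = C])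
  show "compact C" unfolding C_def by (intro compact_UN finite compact_continuous_image compact_PX) (use md Mor_continuous in blast)
  show "C \<subseteq> X" unfolding C_def using md Mor_whole X_whole by blast
  fix x assume x: "x \<in> X"
  obtain d f y where f: "f \<in> Mor c0 d" "y \<in> P" "x = f y" by (rule Mor_cover)
  have m: "md d \<in> Mor c0 d" using md f(1) by blast
  have "md d \<circ> finv f \<in> Mor c0 c0" by (rule Mor_comp[OF m Mor_inv(2)[OF f(1)]])
  hence "D.orb ((md d \<circ> finv f) x) = D.orb x" by (rule D.orb_apply)
  moreover have fx: "finv f x = y" using Mor_inv(1)[OF f(1)] by (simp add: f(3) bij_is_inj)
  moreover have "y \<in> X" using X_whole[of "finv f" x] Mor_whole Mor_inv(2)[OF f(1)] x fx by auto
  ultimately show "\<exists>y\<in>C. D.orb y = D.orb x" unfolding C_def using f by (intro bexI[of _ "md d y"]) auto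
 qed
qed

lemma manifold_X: "manifold3 D.quot"
proof -
 have 0: "0 \<in> X"
 proof -
  have "lam (g 0) >= 1/2" if g: "g \<in> whole" for g
  proof (cases "lam (g 0) <= 1")
   case True
   obtain h where h: "h \<in> symm" "!!y. lam (g y) = lam (ri h y)" using lam_whole[OF g zero_P True] by blast
   show ?thesis unfolding h(2) by (simp add: ri_zero[OF h(1)] lam_def hs_def)
  qed simp
  thus ?thesis by (simp add: X_def)
 qed
 have 1: "connected_space D.quot" by (rule D.connected_quot[OF simply_connected_imp_connected[OF simply_connected_X]])
 have 2: "second_countable D.quot" by (rule D.second_countable_quot[OF second_countable_subset])
 have 3: "\<exists>U V. openin D.quot U & x \<in> U & openin (top_of_set half_space3) V &
   subtopology D.quot U homeomorphic_space top_of_set V" if x: "x \<in> topspace D.quot" for x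
 proof -
  obtain y where y: "y \<in> X" "x = D.orb y" using x unfolding D.topspace_quot by blast
  show ?thesis
  proof (cases "y \<in> bd")
   case True
   then obtain g where g: "g \<in> whole" "lam (g y) = 1/2" by (auto simp: bd_def)
   obtain U Q f where U: "openin D.quot U" "D.orb y \<in> U" "openin (top_of_set half_space3) Q"
    "homeomorphic_map (subtopology D.quot U) (top_of_set Q) f" "f (D.orb y) $ 3 = 0" using chart_bd[OF y(1) g] .
   show ?thesis using U(1-3) homeomorphic_map_imp_homeomorphic_space[OF U(4)] y(2) by blast
  next
   case False
   obtain U B where UB: "openin D.quot U" "D.orb y \<in> U" "open B" "bounded B"
    "subtopology D.quot U homeomorphic_space top_of_set (B :: (real^3) set)" using chart_int[OF y(1) False] .
   obtain V where V: "open V" "V \<subseteq> half_space3" "top_of_set B homeomorphic_space top_of_set V"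
    using homeomorphic_half_space[OF UB(4,3)] .
   have "openin (top_of_set half_space3) V" by (rule open_subset[OF V(2,1)])
   thus ?thesis using UB(1,2) y(2) homeomorphic_space_trans[OF UB(5) V(3)] by blast
  qed
 qed
 have 4: "topspace D.quot ~= {}" using 0 by (auto simp: D.topspace_quot)
 show ?thesis unfolding manifold3_def by (intro conjI ballI 1 2 3 4 Hausdorff_X)
qed

end

lemma cusp_point: "\<exists>x\<in>P. lam x = 1/2 & x \<in> bd"
proof -
 define y :: "real^3" where "y = (3/4) *\<^sub>R axis 3 1"
 have yn: "y$1 = 0" "y$2 = 0" "y$3 = 3/4" by (simp_all add: y_def axis_def)
 have "1 + y \<bullet> y = (5/4)^2" by (simp add: inner3 yn power2_eq_square)
 hence hsy: "hs y = 5/4" by (simp add: hs_def)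
 have yP: "y \<in> P" unfolding P_def L_def
 proof (intro CollectI ballI)
  fix i show "n i \<bullet> y - 1 * hs y <= 0" using n_signs[of i 3] by (auto simp: inner3 yn hsy)
 qed
 have l: "lam y = 1/2" by (simp add: lam_def hsy yn)
 have "lam (g y) >= 1/2" if g: "g \<in> whole" for g
 proof (cases "lam (g y) <= 1")
  case True
  obtain h where h: "h \<in> symm" "!!z. lam (g z) = lam (ri h z)" using lam_whole[OF g yP True] by blast
  obtain k s where k: "s = 1 \<or> s = - 1" "!!x. (ri h x) $ 3 = s * x $ k" using ri_vertex[OF h(1)] by metis
  have "s * y $ k <= 3/4" using k(1) exhaust_3[of k] yn by auto
  thus ?thesis unfolding h(2) by (simp add: lam_def hs_ri[OF h(1)] k(2) hsy)
 qed simp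
 hence "y \<in> bd" unfolding bd_def X_def by (intro CollectI conjI ballI bexI[of _ id] whole_id) (simp_all add: l)
 thus ?thesis using yP l by blast
qed

end

section \<open>Tori\<close>

lemma cis_eq_Ints: "cis (2 * pi * a) = cis (2 * pi * b) \<longleftrightarrow> a - b \<in> \<int>"
proof -
 have "cis (2 * pi * a) = cis (2 * pi * b) \<longleftrightarrow> (\<exists>m::int. 2 * pi * a = 2 * pi * b + 2 * pi * m)"
  using sin_cos_eq_iff[of "2 * pi * a" "2 * pi * b"] by (auto simp: complex_eq_iff)
 also have "... \<longleftrightarrow> (\<exists>m::int. a - b = m)"
 proof -
  have "2 * pi * a = 2 * pi * b + 2 * pi * m \<longleftrightarrow> a - b = m" for m :: real
  proof -
   have "2 * pi * a = 2 * pi * b + 2 * pi * m \<longleftrightarrow> 2 * pi * a = 2 * pi * (b + m)" by (simp add: algebra_simps)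
   also have "... \<longleftrightarrow> a = b + m" by simp
   finally show ?thesis by auto
  qed
  thus ?thesis by simp
 qed
 also have "... \<longleftrightarrow> a - b \<in> \<int>" by (auto simp: Ints_def)
 finally show ?thesis .
qed

lemma torus_quotient:
 fixes q :: "real \<times> real => 'b"
 assumes c: "continuous_map euclidean T q" and H: "Hausdorff_space T" and im: "range q = topspace T"
  and eq: "!!a b a' b'. q (a, b) = q (a', b') \<longleftrightarrow> a - a' \<in> \<int> & b - b' \<in> \<int>"
 shows "T homeomorphic_space torus"
proof -
 define K where "K = {0..1::real} \<times> {0..1::real}"
 define e where "e = (%(a, b). (cis (2 * pi * a), cis (2 * pi * b)))"
 have K: "compact_space (top_of_set K)" by (simp add: K_def compact_space_subtopology compact_Times)
 have qK: "continuous_map (top_of_set K) T q" by (rule continuous_map_from_subtopology[OF c])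
 have frac: "(frac a, frac b) \<in> K" "a - frac a \<in> \<int>" "b - frac b \<in> \<int>" for a b :: real
  using frac_ge_0 frac_lt_1[THEN less_imp_le] by (auto simp: K_def frac_def)
 have qi: "q ` topspace (top_of_set K) = topspace T"
 proof -
  have "q (a, b) \<in> q ` K" for a b
  proof -
   have "q (a, b) = q (frac a, frac b)" using frac(2,3) eq by blast
   thus ?thesis using frac(1) by (metis image_eqI)
  qed
  hence "range q \<subseteq> q ` K" by auto
  thus ?thesis using im by auto
 qed
 have qq: "quotient_map (top_of_set K) T q" by (rule continuous_imp_quotient_map[OF qK K H qi])
 have torus_sub: "torus = top_of_set (sphere 0 1 \<times> sphere (0::complex) 1)"
  unfolding torus_def by (simp add: prod_topology_subtopology_eu)
 have "continuous_on K (%x. (cis (2 * pi * fst x), cis (2 * pi * snd x)))" by (intro continuous_intros continuous_on_cis)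
 hence ce: "continuous_map (top_of_set K) torus e" unfolding torus_sub by (auto simp: e_def case_prod_unfold)
 have ee: "e (a, b) = e (a', b') \<longleftrightarrow> a - a' \<in> \<int> & b - b' \<in> \<int>" for a b a' b'
  by (simp add: e_def cis_eq_Ints)
 have wd: "!!x y. x \<in> topspace (top_of_set K) ==> y \<in> topspace (top_of_set K) ==> q x = q y ==> e x = e y"
  and qe: "!!x y. e x = e y ==> q x = q y"
 proof -
  show "e x = e y" if "q x = q y" for x y using that by (cases x; cases y) (simp only: eq ee)
  show "q x = q y" if "e x = e y" for x y using that by (cases x; cases y) (simp only: eq ee)
 qed
 obtain h where h: "continuous_map T torus h" "h ` topspace T = e ` topspace (top_of_set K)"
  "!!x. x \<in> topspace (top_of_set K) ==> h (q x) = e x" using quotient_map_lift_exists[OF qq ce wd] by blast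
 have "compactin T (q ` K)" by (rule image_compactin[OF _ qK]) (use K in \<open>simp add: compact_space_def compactin_subtopology\<close>)
 hence cT: "compact_space T" using qi by (simp add: compact_space_def)
 have surj: "e ` K = topspace torus"
 proof (rule subset_antisym)
  show "e ` K \<subseteq> topspace torus" using ce by (auto simp: continuous_map_def)
  show "topspace torus \<subseteq> e ` K"
  proof
   fix z assume "z \<in> topspace torus"
   then obtain u v where z: "z = (u, v)" "norm u = 1" "norm v = 1" by (auto simp: torus_sub)
   obtain s where s: "u = cis s" using z(2) by (metis complex_norm_eq_1_exp cis_conv_exp)
   obtain t where t: "v = cis t" using z(3) by (metis complex_norm_eq_1_exp cis_conv_exp)
   have "z = e (s / (2 * pi), t / (2 * pi))" by (simp add: e_def z(1) s t)
   also have "... = e (frac (s / (2 * pi)), frac (t / (2 * pi)))" using frac(2,3) ee by blast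
   finally show "z \<in> e ` K" using frac(1) by (metis image_eqI)
  qed
 qed
 have inj: "inj_on h (topspace T)"
 proof (rule inj_onI)
  fix x y assume xy: "x \<in> topspace T" "y \<in> topspace T" "h x = h y"
  then obtain u v where uv: "u \<in> K" "v \<in> K" "x = q u" "y = q v" using qi by (metis imageE topspace_euclidean_subtopology)
  hence "e u = e v" using h(3) xy(3) by simp
  hence "q u = q v" by (rule qe)
  thus "x = y" using uv(3,4) by simp
 qed
 have "Hausdorff_space torus" unfolding torus_sub by (simp add: Hausdorff_space_subtopology)
 moreover have "h ` topspace T = topspace torus" unfolding h(2) topspace_euclidean_subtopology by (rule surj)
 ultimately have "homeomorphic_map T torus h" by (intro continuous_imp_homeomorphic_map[OF h(1) cT _ _ inj])
 thus ?thesis by (rule homeomorphic_map_imp_homeomorphic_space)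
qed

lemma lattice_basis:
 fixes D :: "int => int => bool"
 assumes add: "!!a b c d. D a b ==> D c d ==> D (a + c) (b + d)" and neg: "!!a b. D a b ==> D (- a) (- b)"
  and N: "N > 0" "D N 0" "M > 0" "D 0 M"
 obtains \<alpha> \<beta> d where "\<alpha> > 0" "d > 0" "!!x y. D x y \<longleftrightarrow> (\<exists>i j. x = i * \<alpha> + j * \<beta> & y = j * d)"
proof -
 have D0: "D 0 0" using add[OF N(2) neg[OF N(2)]] by simp
 have natmul: "D (int m * a) (int m * b)" if "D a b" for m a b
 proof (induction m)
  case (Suc m) thus ?case using add[OF Suc that] by (simp add: algebra_simps)
 qed (simp add: D0)
 have mul: "D (k * a) (k * b)" if "D a b" for k a b
 proof (cases "k >= 0")
  case True thus ?thesis using natmul[OF that, of "nat k"] by simp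
 next
  case False thus ?thesis using neg[OF natmul[OF that, of "nat (- k)"]] by simp
 qed
 define A where "A m \<longleftrightarrow> m > 0 & D (int m) 0" for m
 define B where "B m \<longleftrightarrow> m > 0 & (\<exists>b. D b (int m))" for m
 define a where "a = (LEAST m. A m)"
 define d where "d = (LEAST m. B m)"
 have ab: "A (nat N)" "B (nat M)" using N by (auto simp: A_def B_def)
 have AB: "A a" "B d" unfolding a_def d_def by (rule LeastI[of A, OF ab(1)], rule LeastI[of B, OF ab(2)])
 then obtain \<beta> where \<beta>: "D \<beta> (int d)" by (auto simp: B_def)
 have a: "a > 0" "D (int a) 0" "d > 0" using AB by (auto simp: A_def B_def)
 have "D x y \<longleftrightarrow> (\<exists>i j. x = i * int a + j * \<beta> & y = j * int d)" for x y
 proof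
  assume xy: "D x y"
  define j where "j = y div int d"
  have r: "D (x - j * \<beta>) (y mod int d)" using add[OF xy neg[OF mul[OF \<beta>, of j]]] by (simp add: j_def minus_div_mult_eq_mod)
  have "y mod int d = 0"
  proof (rule ccontr)
   assume "y mod int d ~= 0"
   moreover have "0 <= y mod int d" "y mod int d < int d" using a(3) by simp_all
   ultimately have "B (nat (y mod int d))" "nat (y mod int d) < d" using r by (auto simp: B_def)
   thus False using not_less_Least[of _ B] d_def by blast
  qed
  hence y: "y = j * int d" "D (x - j * \<beta>) 0" using r by (auto simp: j_def)
  define i where "i = (x - j * \<beta>) div int a"
  have r2: "D ((x - j * \<beta>) mod int a) 0" using add[OF y(2) neg[OF mul[OF a(2), of i]]] by (simp add: i_def minus_div_mult_eq_mod)
  have "(x - j * \<beta>) mod int a = 0"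
  proof (rule ccontr)
   assume "(x - j * \<beta>) mod int a ~= 0"
   moreover have "0 <= (x - j * \<beta>) mod int a" "(x - j * \<beta>) mod int a < int a" using a(1) by simp_all
   ultimately have "A (nat ((x - j * \<beta>) mod int a))" "nat ((x - j * \<beta>) mod int a) < a" using r2 by (auto simp: A_def)
   thus False using not_less_Least[of _ A] a_def by blast
  qed
  hence "x - j * \<beta> = i * int a" by (auto simp: i_def)
  thus "\<exists>i j. x = i * int a + j * \<beta> & y = j * int d" using y(1) by (intro exI[of _ i] exI[of _ j]) simp
 next
  assume "\<exists>i j. x = i * int a + j * \<beta> & y = j * int d"
  then obtain i j where "x = i * int a + j * \<beta>" "y = j * int d" by blast
  thus "D x y" using add[OF mul[OF a(2), of i] mul[OF \<beta>, of j]] by simp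
 qed
 thus ?thesis using that[of "int a" "int d" \<beta>] a by simp
qed

section \<open>Cusp cross-sections\<close>

definition hv :: "real => real => real^3" where "hv a b = vector [a + b, a - b, 0]"

definition tr :: "real => real => real^3 => real^3" where "tr a b y = psi_inv (psi y + hv a b)"

lemma hv_nth: "hv a b $ 1 = a + b" "hv a b $ 2 = a - b" "hv a b $ 3 = 0" by (simp_all add: hv_def)

lemma psi_tr: "psi (tr a b y) = psi y + hv a b"
 using psi_hyp3[of y] by (simp add: tr_def psi_psi_inv hyp3_def hv_nth)

lemma psi_eqI: "psi x = psi y ==> x = y" by (metis psi_inv_psi)

lemma psi_eqI3: "psi x $ 1 = psi y $ 1 ==> psi x $ 2 = psi y $ 2 ==> psi x $ 3 = psi y $ 3 ==> x = y"
 by (rule psi_eqI) (simp add: vec_eq_iff forall_3)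

lemma tr_tr: "tr a b (tr c d y) = tr (a + c) (b + d) y"
 by (rule psi_eqI3) (simp_all add: psi_tr hv_nth)

lemma tr_0: "tr 0 0 y = y" by (rule psi_eqI3) (simp_all add: psi_tr hv_nth)

lemma lam_tr: "lam (tr a b y) = lam y" by (simp add: lam_psi psi_tr hv_nth)

text \<open>A framing \<open>(c, k)\<close> of a cell \<open>c\<close> moves one of its ideal vertices to the standard position; the
 framings in \<open>Fr\<close> are parallel along the squares in which the cusp cross-sections meet the cells.\<close>

locale framed = octahedron n nb gl for n :: "'i::finite => real^3" and nb :: "'c::finite => 'i => 'c" and gl +
 fixes pp pm qp qm :: 'i and sp sq :: "'i => 'i" and Fr :: "('c \<times> ('i => 'i)) set"
 assumes n_tops: "n pp = vector [1, 1, 1]" "n pm = vector [- 1, - 1, 1]" "n qp = vector [1, - 1, 1]" "n qm = vector [- 1, 1, 1]"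
  and n_flip: "!!i. n (sp i) = vector [- (n i $ 2), - (n i $ 1), n i $ 3]"
  and n_swap: "!!i. n (sq i) = vector [n i $ 2, n i $ 1, n i $ 3]"
  and Fr_symm: "!!c k. (c, k) \<in> Fr ==> k \<in> symm"
  and Fr_closed: "!!c k i s. (c, k) \<in> Fr ==> (i, s) \<in> {(pp, sp), (pm, sp), (qp, sq), (qm, sq)} ==>
   (nb c (k i), gl c (k i) \<circ> k \<circ> s) \<in> Fr"
  and Fr_unique: "!!c k k'. (c, k) \<in> Fr ==> (c, k') \<in> Fr ==> k ` {pp, pm, qp, qm} \<subseteq> k' ` {pp, pm, qp, qm} ==> k = k'"
  and Fr_cover: "!!c v s. s = 1 \<or> s = - 1 ==> \<exists>k. (c, k) \<in> Fr & (\<forall>i\<in>{pp, pm, qp, qm}. n (k i) $ v = s)"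
begin

lemma vec3_eqI: "(x::real^3) $ 1 = y $ 1 ==> x $ 2 = y $ 2 ==> x $ 3 = y $ 3 ==> x = y"
 by (simp add: vec_eq_iff forall_3)

lemma tops: "n i $ 3 = 1 \<longleftrightarrow> i \<in> {pp, pm, qp, qm}"
proof
 assume t: "n i $ 3 = 1"
 have "n i = n pp \<or> n i = n pm \<or> n i = n qp \<or> n i = n qm"
  using n_signs[of i 1] n_signs[of i 2] t unfolding n_tops by (auto intro: vec3_eqI)
 thus "i \<in> {pp, pm, qp, qm}" using n_inj by (auto simp: inj_eq)
qed (auto simp: n_tops)

lemma reflection_symm:
 assumes R: "orthogonal_transformation R" "!!i. R (n (s i)) = n i"
 shows "s \<in> symm" "ri s = R"
proof -
 show s: "s \<in> symm" unfolding symm_def using R by blast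
 show "ri s = R"
 proof (rule n_ext)
  show "linear (ri s)" using ri_orth[OF s] orthogonal_transformation_linear by blast
  show "linear R" using R(1) orthogonal_transformation_linear by blast
  fix j obtain i where "j = s i" using symm_bij[OF s] by (metis bij_pointE)
  thus "ri s (n j) = R (n j)" using ri_n[OF s] R(2) by simp
 qed
qed

lemma sp: "sp \<in> symm" "ri sp x = vector [- (x$2), - (x$1), x$3]"
proof -
 have "orthogonal_transformation (%x::real^3. vector [- (x$2), - (x$1), x$3] :: real^3)"
  unfolding orthogonal_transformation_def by (auto intro!: linearI vec3_eqI simp: inner3)
 note r = reflection_symm[OF this, of sp]
 show "sp \<in> symm" by (rule r(1)) (auto simp: n_flip intro!: vec3_eqI)
 have "ri sp = (%x. vector [- (x$2), - (x$1), x$3])" by (rule r(2)) (auto simp: n_flip intro!: vec3_eqI)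
 thus "ri sp x = vector [- (x$2), - (x$1), x$3]" by (rule fun_cong)
qed

lemma sq: "sq \<in> symm" "ri sq x = vector [x$2, x$1, x$3]"
proof -
 have "orthogonal_transformation (%x::real^3. vector [x$2, x$1, x$3] :: real^3)"
  unfolding orthogonal_transformation_def by (auto intro!: linearI vec3_eqI simp: inner3)
 note r = reflection_symm[OF this, of sq]
 show "sq \<in> symm" by (rule r(1)) (auto simp: n_swap intro!: vec3_eqI)
 have "ri sq = (%x. vector [x$2, x$1, x$3])" by (rule r(2)) (auto simp: n_swap intro!: vec3_eqI)
 thus "ri sq x = vector [x$2, x$1, x$3]" by (rule fun_cong)
qed

lemma psi_sp: "psi (ri sp x) $ 1 = - (psi x $ 2)" "psi (ri sp x) $ 2 = - (psi x $ 1)" "psi (ri sp x) $ 3 = psi x $ 3"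
 using hs_ri[OF sp(1), of x] by (simp_all add: psi_nth sp(2))

lemma psi_sq: "psi (ri sq x) $ 1 = psi x $ 2" "psi (ri sq x) $ 2 = psi x $ 1" "psi (ri sq x) $ 3 = psi x $ 3"
 using hs_ri[OF sq(1), of x] by (simp_all add: psi_nth sq(2))

lemma ri_sp_tr: "ri sp (tr a b y) = tr (- a) b (ri sp y)"
 by (rule psi_eqI3) (simp_all add: psi_sp psi_tr hv_nth)

lemma ri_sq_tr: "ri sq (tr a b y) = tr a (- b) (ri sq y)"
 by (rule psi_eqI3) (simp_all add: psi_sq psi_tr hv_nth)

lemma ri_sp_sp: "ri sp (ri sp y) = y" by (rule psi_eqI3) (simp_all add: psi_sp)
lemma ri_sq_sq: "ri sq (ri sq y) = y" by (rule psi_eqI3) (simp_all add: psi_sq)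

lemma psi_refl_top:
 assumes "n i $ 3 = 1" shows "psi (refl i y) = psi y - (n i $ 1 * psi y $ 1 + n i $ 2 * psi y $ 2 - 1) *\<^sub>R vector [n i $ 1, n i $ 2, 0]"
proof -
 define l where "l = hs y - y$3"
 have l: "l > 0" using hs_minus(1) by (simp add: l_def)
 have l': "hs (refl i y) - refl i y $ 3 = l" using lam_refl_top[OF assms, of y] by (simp add: lam_def l_def)
 have L: "L i y = n i $ 1 * y$1 + n i $ 2 * y$2 - l" by (simp add: L_def inner3 assms l_def)
 have r: "refl i y $ j = y $ j - L i y * n i $ j" for j by (simp add: refl_def)
 have p: "psi (refl i y) $ 1 = refl i y $ 1 / l" "psi (refl i y) $ 2 = refl i y $ 2 / l" "psi (refl i y) $ 3 = 1 / l"
  by (simp_all only: psi_nth l')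
 have q: "psi y $ 1 = y$1 / l" "psi y $ 2 = y$2 / l" "psi y $ 3 = 1 / l" by (simp_all add: psi_nth l_def)
 show ?thesis by (rule vec3_eqI) (use l in \<open>simp_all add: p q r L field_simps\<close>)
qed

lemma refl_steps: "refl pp (ri sp y) = tr 1 0 y" "refl pm (ri sp y) = tr (- 1) 0 y"
  "refl qp (ri sq y) = tr 0 1 y" "refl qm (ri sq y) = tr 0 (- 1) y"
proof -
 have t: "n pp $ 3 = 1" "n pm $ 3 = 1" "n qp $ 3 = 1" "n qm $ 3 = 1" by (simp_all add: n_tops)
 show "refl pp (ri sp y) = tr 1 0 y" by (rule psi_eqI3) (simp_all add: psi_refl_top[OF t(1)] psi_sp psi_tr hv_nth n_tops)
 show "refl pm (ri sp y) = tr (- 1) 0 y" by (rule psi_eqI3) (simp_all add: psi_refl_top[OF t(2)] psi_sp psi_tr hv_nth n_tops)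
 show "refl qp (ri sq y) = tr 0 1 y" by (rule psi_eqI3) (simp_all add: psi_refl_top[OF t(3)] psi_sq psi_tr hv_nth n_tops)
 show "refl qm (ri sq y) = tr 0 (- 1) y" by (rule psi_eqI3) (simp_all add: psi_refl_top[OF t(4)] psi_sq psi_tr hv_nth n_tops)
qed

lemma refl_top_cases:
 assumes "i \<in> {pp, pm, qp, qm}"
 obtains s a b where "(i, s) \<in> {(pp, sp), (pm, sp), (qp, sq), (qm, sq)}" "s \<in> symm" "!!y. lam (ri s y) = lam y"
  "!!y. refl i y = tr (of_int a) (of_int b) (ri s y)" "!!x z. \<exists>x' z'. \<forall>y. ri s (tr (of_int x) (of_int z) y) = tr (of_int x') (of_int z') (ri s y)"
proof -
 have l: "lam (ri sp y) = lam y" "lam (ri sq y) = lam y" for y by (simp_all add: lam_psi psi_sp psi_sq)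
 have r: "refl pp y = tr 1 0 (ri sp y)" "refl pm y = tr (- 1) 0 (ri sp y)" "refl qp y = tr 0 1 (ri sq y)" "refl qm y = tr 0 (- 1) (ri sq y)" for y
  using refl_steps[of "ri sp y"] refl_steps[of "ri sq y"] by (simp_all add: ri_sp_sp ri_sq_sq)
 have c: "\<exists>x' z'. \<forall>y. ri sp (tr (of_int x) (of_int z) y) = tr (of_int x') (of_int z') (ri sp y)"
  "\<exists>x' z'. \<forall>y. ri sq (tr (of_int x) (of_int z) y) = tr (of_int x') (of_int z') (ri sq y)" for x z
  unfolding ri_sp_tr ri_sq_tr of_int_minus[symmetric] by blast+
 show ?thesis using assms that[of sp 1 0] that[of sp "- 1" 0] that[of sq 0 1] that[of sq 0 "- 1"] sp(1) sq(1) l r c by auto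
qed

lemma ev_top:
 assumes "\<forall>i\<in>set w. n i $ 3 = 1"
 shows "\<exists>a b :: int. \<exists>m. m \<in> symm & (\<forall>y. lam (ri m y) = lam y) & (\<forall>y. ev w y = tr (of_int a) (of_int b) (ri m y))"
 using assms
proof (induction w)
 case Nil
 have r: "ri id y = y" for y by (simp only: ri_id id_apply)
 have "ev [] y = tr (of_int 0) (of_int 0) (ri id y)" "lam (ri id y) = lam y" for y unfolding r by (simp_all add: tr_0)
 thus ?case using symm_id by blast
next
 case (Cons i w)
 then obtain a b :: int and m where m: "m \<in> symm" "!!y. lam (ri m y) = lam y" "!!y. ev w y = tr (of_int a) (of_int b) (ri m y)" by auto
 have "n i $ 3 = 1" by (rule bspec[OF Cons.prems]) (rule list.set_intros(1))
 hence "i \<in> {pp, pm, qp, qm}" unfolding tops .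
 then obtain s and a' b' :: int where s: "s \<in> symm" "!!y. lam (ri s y) = lam y"
  "!!y. refl i y = tr (of_int a') (of_int b') (ri s y)"
  "!!x z. \<exists>x' z'. \<forall>y. ri s (tr (of_int x) (of_int z) y) = tr (of_int x') (of_int z') (ri s y)"
  by (rule refl_top_cases) (rule that)
 obtain x z :: int where xz: "!!y. ri s (tr (of_int a) (of_int b) y) = tr (of_int x) (of_int z) (ri s y)" using s(4) by blast
 have "ev (i # w) y = tr (of_int (a' + x)) (of_int (b' + z)) (ri (m \<circ> s) y)" for y by (simp add: m(3) s(3) xz tr_tr ri_comp[OF m(1) s(1)])
 moreover have "lam (ri (m \<circ> s) y) = lam y" for y by (simp add: ri_comp[OF m(1) s(1)] s(2) m(2))
 ultimately show ?case using symm_comp[OF m(1) s(1)] by blast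
qed

definition N :: "'c \<times> ('i => 'i) => 'c \<times> ('i => 'i) => (real^3 => real^3) set" where
 "N \<sigma> \<tau> = {f. \<exists>g\<in>Mor (fst \<sigma>) (fst \<tau>). \<forall>y. f (ri (snd \<tau>) y) = ri (snd \<sigma>) (g y)}"

lemma ri_surjE:
 assumes "k \<in> symm" obtains y where "z = ri k y" using orthogonal_transformation_surj[OF ri_orth[OF assms]] by (metis surjD)

lemma N_comp: "f \<in> N \<sigma> \<tau> ==> h \<in> N \<tau> \<upsilon> ==> f \<circ> h \<in> N \<sigma> \<upsilon>"
proof -
 assume "f \<in> N \<sigma> \<tau>" "h \<in> N \<tau> \<upsilon>"
 then obtain a b where a: "a \<in> Mor (fst \<sigma>) (fst \<tau>)" "!!y. f (ri (snd \<tau>) y) = ri (snd \<sigma>) (a y)"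
  and b: "b \<in> Mor (fst \<tau>) (fst \<upsilon>)" "!!y. h (ri (snd \<upsilon>) y) = ri (snd \<tau>) (b y)" unfolding N_def by blast
 show ?thesis unfolding N_def by (intro CollectI bexI[OF _ Mor_comp[OF a(1) b(1)]]) (simp add: a b)
qed

lemma N_id: "id \<in> N \<sigma> \<sigma>"
 unfolding N_def by (intro CollectI bexI[OF _ Mor_id]) simp

lemma N_tr_neg: "snd \<tau> \<in> symm ==> tr a b \<in> N \<sigma> \<tau> ==> tr (- a) (- b) \<in> N \<tau> \<sigma>"
proof -
 assume k: "snd \<tau> \<in> symm" and "tr a b \<in> N \<sigma> \<tau>"
 then obtain g where g: "g \<in> Mor (fst \<sigma>) (fst \<tau>)" "!!y. tr a b (ri (snd \<tau>) y) = ri (snd \<sigma>) (g y)" unfolding N_def by blast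
 have "tr (- a) (- b) (ri (snd \<sigma>) y) = ri (snd \<tau>) (finv g y)" for y
 proof -
  have "ri (snd \<sigma>) y = tr a b (ri (snd \<tau>) (finv g y))"
   using g(2)[of "finv g y"] Mor_inv(1)[OF g(1)] by (simp add: bij_is_surj surj_f_inv_f)
  thus ?thesis by (simp add: tr_tr tr_0)
 qed
 thus ?thesis unfolding N_def by (intro CollectI bexI[OF _ Mor_inv(2)[OF g(1)]]) simp
qed

lemma step_N:
 assumes ck: "(c, k) \<in> Fr" and st: "(i, s) \<in> {(pp, sp), (pm, sp), (qp, sq), (qm, sq)}"
  and r: "!!y. refl i (ri s y) = tr a b y" and s: "s \<in> symm"
 shows "tr a b \<in> N (c, k) (nb c (k i), gl c (k i) \<circ> k \<circ> s)" unfolding N_def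
proof (intro CollectI bexI allI)
 show "gen c (k i) \<in> Mor (fst (c, k)) (fst (nb c (k i), gl c (k i) \<circ> k \<circ> s))" by (simp add: gen_Mor)
 have k: "k \<in> symm" by (rule Fr_symm[OF ck])
 have gk: "gl c (k i) \<circ> k \<in> symm" by (rule symm_comp[OF gl_symm k])
 have ss: "ri s (ri s y) = y" for y using st ri_sp_sp ri_sq_sq by auto
 fix y
 have "ri (gl c (k i) \<circ> k \<circ> s) y = ri s (ri k (ri (gl c (k i)) y))" by (simp add: ri_comp[OF gk s] ri_comp[OF gl_symm k])
 hence "tr a b (ri (gl c (k i) \<circ> k \<circ> s) y) = refl i (ri k (ri (gl c (k i)) y))" by (simp add: r[symmetric] ss)
 thus "tr a b (ri (snd (nb c (k i), gl c (k i) \<circ> k \<circ> s)) y) = ri (snd (c, k)) (gen c (k i) y)" by (simp add: gen_def refl_ri[OF k])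
qed

lemma steps_N:
 assumes "\<sigma> \<in> Fr"
 shows "\<exists>\<tau>\<in>Fr. tr 1 0 \<in> N \<sigma> \<tau>" "\<exists>\<tau>\<in>Fr. tr (- 1) 0 \<in> N \<sigma> \<tau>" "\<exists>\<tau>\<in>Fr. tr 0 1 \<in> N \<sigma> \<tau>" "\<exists>\<tau>\<in>Fr. tr 0 (- 1) \<in> N \<sigma> \<tau>"
proof -
 obtain c k where ck: "\<sigma> = (c, k)" "(c, k) \<in> Fr" using assms by (cases \<sigma>) auto
 have *: "\<exists>\<tau>\<in>Fr. tr a b \<in> N \<sigma> \<tau>"
  if "(i, s) \<in> {(pp, sp), (pm, sp), (qp, sq), (qm, sq)}" "!!y. refl i (ri s y) = tr a b y" "s \<in> symm" for i s a b
  using step_N[OF ck(2) that] Fr_closed[OF ck(2) that(1)] unfolding ck(1) by blast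
 show "\<exists>\<tau>\<in>Fr. tr 1 0 \<in> N \<sigma> \<tau>" by (rule *[OF _ refl_steps(1) sp(1)]) simp
 show "\<exists>\<tau>\<in>Fr. tr (- 1) 0 \<in> N \<sigma> \<tau>" by (rule *[OF _ refl_steps(2) sp(1)]) simp
 show "\<exists>\<tau>\<in>Fr. tr 0 1 \<in> N \<sigma> \<tau>" by (rule *[OF _ refl_steps(3) sq(1)]) simp
 show "\<exists>\<tau>\<in>Fr. tr 0 (- 1) \<in> N \<sigma> \<tau>" by (rule *[OF _ refl_steps(4) sq(1)]) simp
qed

lemma tr_o: "tr a b \<circ> tr c d = tr (a + c) (b + d)" by (simp add: fun_eq_iff tr_tr)

lemma walk_N:
 assumes "\<sigma> \<in> Fr"
 shows "\<exists>\<tau>\<in>Fr. tr (of_int a) (of_int b) \<in> N \<sigma> \<tau>"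
proof -
 have ext: "\<exists>\<tau>'\<in>Fr. tr (x + x') (z + z') \<in> N \<sigma> \<tau>'"
  if "\<tau> \<in> Fr" "tr x z \<in> N \<sigma> \<tau>" "\<exists>\<tau>'\<in>Fr. tr x' z' \<in> N \<tau> \<tau>'" for x z x' z' \<tau>
  using that N_comp[of "tr x z" \<sigma> \<tau> "tr x' z'"] unfolding tr_o by blast
 have 0: "tr 0 0 = id" by (simp add: fun_eq_iff tr_0)
 have 1: "\<exists>\<tau>\<in>Fr. tr (of_int a) 0 \<in> N \<sigma> \<tau>"
 proof (induction a rule: int_induct[of _ 0])
  case base
  have "tr (of_int 0) 0 \<in> N \<sigma> \<sigma>" unfolding of_int_0 0 by (rule N_id)
  thus ?case using assms by blast
 next
  case (step1 i)
  then obtain \<tau> where t: "\<tau> \<in> Fr" "tr (of_int i) 0 \<in> N \<sigma> \<tau>" by blast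
  from ext[OF t steps_N(1)[OF t(1)]] show ?case by simp
 next
  case (step2 i)
  then obtain \<tau> where t: "\<tau> \<in> Fr" "tr (of_int i) 0 \<in> N \<sigma> \<tau>" by blast
  from ext[OF t steps_N(2)[OF t(1)]] show ?case by simp
 qed
 show ?thesis
 proof (induction b rule: int_induct[of _ 0])
  case base show ?case using 1 by simp
 next
  case (step1 i)
  then obtain \<tau> where t: "\<tau> \<in> Fr" "tr (of_int a) (of_int i) \<in> N \<sigma> \<tau>" by blast
  from ext[OF t steps_N(3)[OF t(1)]] show ?case by simp
 next
  case (step2 i)
  then obtain \<tau> where t: "\<tau> \<in> Fr" "tr (of_int a) (of_int i) \<in> N \<sigma> \<tau>" by blast
  from ext[OF t steps_N(4)[OF t(1)]] show ?case by simp
 qed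
qed

lemma N_tr:
 assumes \<sigma>: "(c, k) \<in> Fr" and f: "f \<in> N (c, k) (c, k)" and l: "!!y. lam (f y) = lam y"
 shows "\<exists>a b :: int. f = tr (of_int a) (of_int b)"
proof -
 have k: "k \<in> symm" by (rule Fr_symm[OF \<sigma>])
 obtain g where g: "g \<in> Mor c c" "!!y. f (ri k y) = ri k (g y)" using f unfolding N_def by auto
 have fw: "f \<in> whole"
 proof -
  have kw: "ri k \<in> whole" by (rule ri_whole[OF k])
  have "ri k \<circ> g \<circ> finv (ri k) \<in> whole" using whole_comp kw whole_inv(2)[OF kw] Mor_whole g(1) by blast
  moreover have "(ri k \<circ> g \<circ> finv (ri k)) y = f y" for y
   using g(2)[of "finv (ri k) y"] whole_inv(1)[OF kw] by (simp add: bij_is_surj surj_f_inv_f)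
  hence "ri k \<circ> g \<circ> finv (ri k) = f" by auto
  ultimately show ?thesis by simp
 qed
 obtain w m0 where w: "f = ev w \<circ> ri m0" "m0 \<in> symm" using fw by (rule wholeE)
 obtain x where x: "x \<in> P" "lam x = 1/2" using cusp_point by blast
 have "lam (ev w (ri m0 x)) = 1/2" using l[of x] x(2) by (simp add: w(1))
 moreover have "ri m0 x \<in> P" using x(1) ri_P[OF w(2)] by simp
 ultimately have "~ (\<forall>x\<in>P. lam (ev w x) > 1)" by force
 then obtain v where v: "weq w v" "\<forall>i\<in>set v. n i $ 3 = 1" using lam_dichotomy[of w] by blast
 obtain a b :: int and m where m: "m \<in> symm" "!!y. lam (ri m y) = lam y" "!!y. ev v y = tr (of_int a) (of_int b) (ri m y)"
  using ev_top[OF v(2)] by blast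
 define m' where "m' = m0 \<circ> m"
 have m's: "m' \<in> symm" unfolding m'_def by (rule symm_comp[OF w(2) m(1)])
 have fm: "f y = tr (of_int a) (of_int b) (ri m' y)" for y using weq_ev[OF v(1)] by (simp add: w(1) m(3) m'_def ri_comp[OF w(2) m(1)])
 have lm: "lam (ri m' y) = lam y" for y using l[of y] by (simp add: fm lam_tr)
 obtain \<tau> where \<tau>: "\<tau> \<in> Fr" "tr (of_int a) (of_int b) \<in> N (c, k) \<tau>" using walk_N[OF \<sigma>] by blast
 obtain c1 k1 where ck1: "\<tau> = (c1, k1)" by fastforce
 have k1: "k1 \<in> symm" using Fr_symm \<tau>(1) ck1 by blast
 have "tr (- of_int a) (- of_int b) \<in> N \<tau> (c, k)" by (rule N_tr_neg[OF _ \<tau>(2)]) (simp add: ck1 k1)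
 hence "tr (- of_int a) (- of_int b) \<circ> f \<in> N \<tau> (c, k)" by (rule N_comp[OF _ f])
 then obtain h where h: "h \<in> Mor c1 c" "!!y. (tr (- of_int a) (- of_int b) \<circ> f) (ri k y) = ri k1 (h y)"
  unfolding N_def ck1 by auto
 have rh: "ri m' (ri k y) = ri k1 (h y)" for y using h(2)[of y] by (simp add: fm tr_tr tr_0)
 obtain j where j: "j \<in> symm" "!!y. ri j y = h y"
 proof -
  have "ri m' \<circ> ri k = ri (k \<circ> m')" by (rule ri_comp[OF k m's, symmetric])
  moreover have "k \<circ> m' \<in> symm" by (rule symm_comp[OF k m's])
  moreover have "bij k1" by (rule symm_bij[OF k1])
  moreover have "finv k1 \<in> symm"
  proof -
   have "orthogonal_transformation (finv (ri k1))" by (rule orthogonal_transformation_inv[OF ri_orth[OF k1]])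
   moreover have "finv (ri k1) (n (finv k1 i)) = n i" for i
   proof (rule inv_f_eq[OF ri_inj[OF k1]])
    have "k1 (finv k1 i) = i" using \<open>bij k1\<close> by (simp add: bij_is_surj surj_f_inv_f)
    thus "ri k1 (n i) = n (finv k1 i)" using ri_n[OF k1, of "finv k1 i"] by simp
   qed
   ultimately show ?thesis unfolding symm_def by blast
  qed
  moreover from this have "ri (finv k1) (ri k1 y) = y" for y
  proof -
   have "k1 \<circ> finv k1 = id" using \<open>bij k1\<close> by (simp add: fun_eq_iff bij_is_surj surj_f_inv_f)
   thus ?thesis using ri_comp[OF k1 \<open>finv k1 \<in> symm\<close>] ri_id by (metis comp_apply id_apply)
  qed
  ultimately have s: "k \<circ> m' \<in> symm" "finv k1 \<in> symm" "!!y. ri (k \<circ> m') y = ri k1 (h y)" "!!y. ri (finv k1) (ri k1 y) = y"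
   using rh by (auto simp: fun_eq_iff)
  have "ri (k \<circ> m' \<circ> finv k1) y = h y" for y by (simp add: ri_comp[OF s(1,2)] s(3,4))
  thus ?thesis using that symm_comp[OF s(1,2)] by blast
 qed
 obtain u e where u: "h = ev u \<circ> ri e" "run (c1, id) u = (c, e)" "e \<in> symm" using MorE[OF h(1)] .
 have hj: "ev u \<circ> ri e = ev [] \<circ> ri j" using u(1) j(2) by (simp add: fun_eq_iff)
 have "weq u []" "e = j" using ev_ri_unique[OF u(3) j(1) hj] by auto
 hence c: "c1 = c" "e = id" using run_weq[of u "[]" id c1] u(2) symm_id by auto
 hence hid: "h y = y" for y using j(2)[of y] \<open>e = j\<close> ri_id by simp
 have "lam (ri k1 y) = lam (ri k y)" for y using rh[of y] lm[of "ri k y"] hid by simp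
 moreover have "hs (ri k1 y) = hs (ri k y)" for y by (simp add: hs_ri k k1)
 ultimately have z: "(ri k1 y) $ 3 = (ri k y) $ 3" for y by (simp add: lam_def)
 have "k1 ` {pp, pm, qp, qm} \<subseteq> k ` {pp, pm, qp, qm}"
 proof
  fix i assume "i \<in> k1 ` {pp, pm, qp, qm}"
  then obtain i1 where i1: "i = k1 i1" "i1 \<in> {pp, pm, qp, qm}" by blast
  obtain i2 where i2: "i = k i2" using symm_bij[OF k] by (metis bij_pointE)
  have "n i1 $ 3 = n i2 $ 3" using z[of "n i"] ri_n[OF k1, of i1] ri_n[OF k, of i2] i1(1) i2 by simp
  hence "i2 \<in> {pp, pm, qp, qm}" using i1(2) tops by metis
  thus "i \<in> k ` {pp, pm, qp, qm}" using i2 by blast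
 qed
 hence "k1 = k" using Fr_unique[of c k1 k] \<tau>(1) ck1 c(1) \<sigma> by simp
 hence "ri m' (ri k y) = ri k y" for y using rh[of y] hid by simp
 hence "ri m' y = y" for y using ri_surjE[OF k, of y] by metis
 hence "f = tr (of_int a) (of_int b)" using fm by (simp add: fun_eq_iff)
 thus ?thesis by blast
qed

definition lattice :: "'c => ('i => 'i) => int => int => bool" where
 "lattice c k a b \<longleftrightarrow> tr (of_int a) (of_int b) \<in> N (c, k) (c, k)"

lemma lattice_period:
 assumes \<sigma>: "\<sigma> \<in> Fr" and "!!m :: nat. \<exists>\<tau>\<in>Fr. tr (x m) (y m) \<in> N \<sigma> \<tau>"
 shows "\<exists>i j. i < j & tr (x j - x i) (y j - y i) \<in> N \<sigma> \<sigma>"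
proof -
 obtain T where T: "!!m. T m \<in> Fr" "!!m. tr (x m) (y m) \<in> N \<sigma> (T m)" using assms(2) by metis
 have "~ inj T"
 proof
  assume "inj T"
  hence "infinite (range T)" by (rule range_inj_infinite)
  thus False using finite_subset[of "range T" UNIV] by simp
 qed
 then obtain i j where ij: "T i = T j" "i ~= j" by (auto simp: inj_def)
 have *: "\<exists>i j. i < j & tr (x j - x i) (y j - y i) \<in> N \<sigma> \<sigma>" if "T i = T j" "i < j" for i j
 proof -
  have "snd (T i) \<in> symm" using Fr_symm T(1)[of i] by (cases "T i") auto
  hence "tr (- x i) (- y i) \<in> N (T i) \<sigma>" by (rule N_tr_neg[OF _ T(2)])
  hence "tr (x j) (y j) \<circ> tr (- x i) (- y i) \<in> N \<sigma> \<sigma>" using N_comp[OF T(2)[of j]] that(1) by metis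
  thus ?thesis using that(2) by (auto simp: tr_o)
 qed
 show ?thesis using *[of i j] *[of j i] ij by (cases "i < j") auto
qed

lemma lattice_props:
 assumes \<sigma>: "(c, k) \<in> Fr"
 shows "lattice c k a b ==> lattice c k a' b' ==> lattice c k (a + a') (b + b')"
  and "lattice c k a b ==> lattice c k (- a) (- b)"
  and "\<exists>m>0. lattice c k m 0" and "\<exists>m>0. lattice c k 0 m"
proof -
 have k: "k \<in> symm" by (rule Fr_symm[OF \<sigma>])
 show "lattice c k a b ==> lattice c k a' b' ==> lattice c k (a + a') (b + b')"
  unfolding lattice_def using N_comp[of "tr (of_int a) (of_int b)" "(c, k)" "(c, k)" "tr (of_int a') (of_int b')" "(c, k)"] by (simp add: tr_o)
 show "lattice c k a b ==> lattice c k (- a) (- b)"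
  unfolding lattice_def using N_tr_neg[of "(c, k)" "of_int a" "of_int b" "(c, k)"] k by simp
 have w: "\<exists>\<tau>\<in>Fr. tr (real m) 0 \<in> N (c, k) \<tau>" "\<exists>\<tau>\<in>Fr. tr 0 (real m) \<in> N (c, k) \<tau>" for m
  using walk_N[OF \<sigma>, of "int m" 0] walk_N[OF \<sigma>, of 0 "int m"] by simp_all
 obtain i j where "i < j" "tr (real j - real i) (0 - 0) \<in> N (c, k) (c, k)" using lattice_period[OF \<sigma> w(1)] by blast
 thus "\<exists>m>0. lattice c k m 0" unfolding lattice_def by (intro exI[of _ "int j - int i"]) simp
 obtain i j where "i < j" "tr (0 - 0) (real j - real i) \<in> N (c, k) (c, k)" using lattice_period[OF \<sigma> w(2)] by blast
 thus "\<exists>m>0. lattice c k 0 m" unfolding lattice_def by (intro exI[of _ "int j - int i"]) simp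
qed

end

context framed
begin

lemma cusp_frame:
 assumes g: "g \<in> whole"
 obtains c' k f where "(c', k) \<in> Fr" "f \<in> Mor c0 c'" "!!y. lam (g y) = lam (ri k (finv f y))"
proof -
 obtain w h' where w: "finv g = ev w \<circ> ri h'" "h' \<in> symm" using whole_inv(2)[OF g] by (rule wholeE)
 obtain c' h where run: "run (c0, id) w = (c', h)" by fastforce
 have h: "h \<in> symm" using run_symm[OF symm_id, of c0 w] run by simp
 define f where "f = ev w \<circ> ri h"
 have f: "f \<in> Mor c0 c'" unfolding f_def by (rule MorI[OF run])
 have kw: "finv (ri h') \<circ> ri h \<in> whole" using whole_comp whole_inv(2) ri_whole w(2) h by blast
 have bh': "bij (ri h')" using whole_inv(1) ri_whole w(2) by blast
 have gf: "g y = finv (ri h') (ri h (finv f y))" for y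
 proof -
  have "y = ev w (ri h (finv f y))" using Mor_inv(1)[OF f] by (metis f_def comp_apply bij_is_surj surj_f_inv_f)
  moreover have "finv g (g y) = y" using whole_inv(1)[OF g] by (simp add: bij_is_inj)
  ultimately have "ev w (ri h' (g y)) = ev w (ri h (finv f y))" using w(1) by (metis comp_apply)
  hence "ri h' (g y) = ri h (finv f y)" using ev_inj[of w] by (simp add: inj_eq)
  thus ?thesis using bh' by (metis bij_inv_eq_iff)
 qed
 have orth: "orthogonal_transformation (finv (ri h'))" by (rule orthogonal_transformation_inv[OF ri_orth[OF w(2)]])
 obtain k0 where k0: "k0 \<in> symm" "!!y. ri k0 y = finv (ri h') (ri h y)"
 proof -
  have bij: "bij h'" by (rule symm_bij[OF w(2)])
  have n: "finv (ri h') (n (finv h' i)) = n i" for i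
  proof (rule inv_f_eq[OF ri_inj[OF w(2)]])
   have "h' (finv h' i) = i" using bij by (simp add: bij_is_surj surj_f_inv_f)
   thus "ri h' (n i) = n (finv h' i)" using ri_n[OF w(2), of "finv h' i"] by simp
  qed
  note s = reflection_symm[OF orth n]
  have "ri (h \<circ> finv h') y = finv (ri h') (ri h y)" for y by (simp add: ri_comp[OF h s(1)] s(2))
  thus ?thesis using that symm_comp[OF h s(1)] by blast
 qed
 obtain v s where vs: "s = 1 \<or> s = - 1" "!!x. (ri k0 x) $ 3 = s * x $ v" using ri_vertex[OF k0(1)] by metis
 obtain k where k: "(c', k) \<in> Fr" "\<forall>i\<in>{pp, pm, qp, qm}. n (k i) $ v = s" using Fr_cover[OF vs(1)] by blast
 have ks: "k \<in> symm" by (rule Fr_symm[OF k(1)])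
 have "lam (ri k y) = lam (ri k0 y)" for y
 proof -
  obtain u r where ur: "r = 1 \<or> r = - 1" "!!x. (ri k x) $ 3 = r * x $ u" using ri_vertex[OF ks] by metis
  have t: "r * n (k i) $ u = 1" if "i \<in> {pp, pm, qp, qm}" for i
  proof -
   have "n i $ 3 = 1" using that tops by blast
   thus ?thesis using ur(2)[of "n (k i)"] ri_n[OF ks, of i] by simp
  qed
  have "u = v"
  proof (rule ccontr)
   assume "u ~= v"
   define a :: "real^3" where "a = (\<chi> j. if j = u then r else if j = v then - s else 1)"
   have "a $ i = 1 \<or> a $ i = - 1" for i using ur(1) vs(1) by (auto simp: a_def)
   then obtain j where j: "n j = a" using n_ex[of a] by blast
   obtain i where i: "j = k i" using symm_bij[OF ks] by (metis bij_pointE)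
   have nk: "n (k i) = a" using j unfolding i .
   have "n i $ 3 = r * n (k i) $ u" using ur(2)[of "n (k i)"] unfolding ri_n[OF ks] .
   hence "n i $ 3 = r * r" unfolding nk by (simp add: a_def)
   hence "n i $ 3 = 1" using ur(1) by auto
   hence "i \<in> {pp, pm, qp, qm}" using tops by blast
   hence "n (k i) $ v = s" using k(2) by blast
   thus False using \<open>u ~= v\<close> vs(1) unfolding nk by (auto simp: a_def)
  qed
  moreover have "r = s"
  proof -
   have "r * n (k pp) $ u = 1" "n (k pp) $ v = s" using t k(2) by auto
   thus ?thesis using \<open>u = v\<close> ur(1) vs(1) by auto
  qed
  ultimately show ?thesis by (simp add: lam_def hs_ri[OF ks] hs_ri[OF k0(1)] ur(2) vs(2))
 qed
 hence "lam (g y) = lam (ri k (finv f y))" for y by (simp add: gf k0(2)[symmetric])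
 thus ?thesis using that[OF k(1) f] by blast
qed

context
 fixes c0 :: 'c
begin

interpretation D: deck_action X "Mor c0 c0" by (rule deck_action_X)

definition horosphere :: "(real^3 => real^3) => (real^3) set" where
 "horosphere g = {x. lam (g x) = 1/2}"

lemma horosphere_bd: "g \<in> whole ==> horosphere g \<subseteq> bd"
proof
 fix x assume g: "g \<in> whole" and x: "x \<in> horosphere g"
 hence l: "lam (g x) = 1/2" by (simp add: horosphere_def)
 obtain V where "x \<in> V" "!!z. z \<in> V ==> z \<in> X \<longleftrightarrow> lam (g z) >= 1/2" using bd_nbhd[OF g l] by metis
 hence "x \<in> X" using l by simp
 thus "x \<in> bd" using g l unfolding bd_def by blast
qed

lemma torus_horosphere:
 assumes g: "g \<in> whole"
 shows "subtopology D.quot (D.orb ` horosphere g) homeomorphic_space torus"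
  and "connectedin D.quot (D.orb ` horosphere g)"
proof -
 obtain c' k f where ck: "(c', k) \<in> Fr" "f \<in> Mor c0 c'" and gl: "!!y. lam (g y) = lam (ri k (finv f y))"
  using cusp_frame[OF g] by blast
 have k: "k \<in> symm" by (rule Fr_symm[OF ck(1)])
 define u where "u = ri k \<circ> finv f"
 have fw: "f \<in> whole" "finv f \<in> whole" using Mor_whole ck(2) whole_inv(2) by blast+
 have u: "u \<in> whole" unfolding u_def by (rule whole_comp[OF ri_whole[OF k] fw(2)])
 have bu: "bij u" by (rule whole_inv(1)[OF u])
 have ui: "finv u (u x) = x" "u (finv u x) = x" for x using bu by (auto simp: bij_is_inj bij_is_surj surj_f_inv_f)
 have lu: "lam (g y) = lam (u y)" for y by (simp add: gl u_def)
 have conj: "(%y. u (\<gamma> (finv u y))) \<in> N (c', k) (c', k)" if "\<gamma> \<in> Mor c0 c0" for \<gamma>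
 proof -
  have "finv f \<circ> \<gamma> \<circ> f \<in> Mor c' c'" using Mor_comp Mor_inv(2)[OF ck(2)] ck(2) that by blast
  moreover have "finv u (ri k y) = f y" for y
  proof -
   have "u (f y) = ri k y" using Mor_inv(1)[OF ck(2)] by (simp add: u_def bij_is_inj)
   thus ?thesis using ui by metis
  qed
  ultimately show ?thesis unfolding N_def by (intro CollectI bexI[of _ "finv f \<circ> \<gamma> \<circ> f"]) (auto simp: u_def)
 qed
 have conj': "(%y. finv u (\<delta> (u y))) \<in> Mor c0 c0" if \<delta>: "\<delta> \<in> N (c', k) (c', k)" for \<delta>
 proof -
  obtain h where h: "h \<in> Mor c' c'" "!!y. \<delta> (ri k y) = ri k (h y)" using \<delta> unfolding N_def by auto
  have "f \<circ> h \<circ> finv f \<in> Mor c0 c0" using Mor_comp Mor_inv(2)[OF ck(2)] ck(2) h(1) by blast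
  moreover have "finv u (\<delta> (u y)) = (f \<circ> h \<circ> finv f) y" for y
  proof -
   have "u ((f \<circ> h \<circ> finv f) y) = \<delta> (u y)" using Mor_inv(1)[OF ck(2)] by (simp add: u_def h(2) bij_is_inj)
   thus ?thesis using ui by metis
  qed
  ultimately show ?thesis by (metis (no_types, lifting) ext)
 qed
 obtain \<alpha> \<beta> d :: int where L: "\<alpha> > 0" "d > 0"
  "!!x y. lattice c' k x y \<longleftrightarrow> (\<exists>i j. x = i * \<alpha> + j * \<beta> & y = j * d)"
 proof -
  obtain m where m: "m > 0" "lattice c' k m 0" using lattice_props(3)[OF ck(1)] by (elim exE conjE)
  obtain m' where m': "m' > 0" "lattice c' k 0 m'" using lattice_props(4)[OF ck(1)] by (elim exE conjE)
  show ?thesis by (rule lattice_basis[of "lattice c' k", OF lattice_props(1,2)[OF ck(1)] m m'], assumption+) (rule that)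
 qed
 define pt where "pt a b = (vector [a + b, a - b, 2] :: real^3)" for a b :: real
 have pth: "pt a b \<in> hyp3" for a b by (simp add: pt_def hyp3_def)
 define F where "F a b = finv u (psi_inv (pt a b))" for a b
 have psiF: "psi (u (F a b)) = pt a b" for a b by (simp add: F_def ui psi_psi_inv pth)
 have F_in: "F a b \<in> horosphere g" for a b unfolding horosphere_def mem_Collect_eq lu unfolding lam_psi psiF by (simp add: pt_def)
 have F_surj: "\<exists>a b. x = F a b" if "x \<in> horosphere g" for x
 proof -
  define v where "v = psi (u x)"
  have "lam (u x) = 1/2" using that unfolding horosphere_def mem_Collect_eq lu .
  hence "v $ 3 = 2" using psi_hyp3[of "u x"] unfolding lam_psi v_def by (simp add: hyp3_def field_simps)
  hence "pt ((v$1 + v$2) / 2) ((v$1 - v$2) / 2) = v" by (auto simp: pt_def vec_eq_iff forall_3 field_simps)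
  hence "F ((v$1 + v$2) / 2) ((v$1 - v$2) / 2) = x" by (simp add: F_def v_def psi_inv_psi ui)
  thus ?thesis by metis
 qed
 have F_tr: "u (F (a + a') (b + b')) = tr a' b' (u (F a b))" for a b a' b'
  by (rule psi_eqI3) (simp_all add: psiF psi_tr hv_nth, simp_all add: pt_def)
 have F_inj: "a = a' & b = b'" if "F a b = F a' b'" for a b a' b'
 proof -
  have "pt a b = pt a' b'" using that psiF by metis
  hence "a + b = a' + b'" "a - b = a' - b'" by (simp_all add: pt_def vec_eq_iff forall_3)
  thus ?thesis by simp
 qed
 have fib: "D.orb (F a b) = D.orb (F a' b') \<longleftrightarrow> (\<exists>x y. lattice c' k x y & a' = a + of_int x & b' = b + of_int y)" for a b a' b'
 proof
  assume "D.orb (F a b) = D.orb (F a' b')"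
  then obtain \<gamma> where \<gamma>: "\<gamma> \<in> Mor c0 c0" "F a' b' = \<gamma> (F a b)" using D.orb_eqD by blast
  have \<gamma>w: "\<gamma> \<in> whole" using Mor_whole \<gamma>(1) by blast
  define \<delta> where "\<delta> y = u (\<gamma> (finv u y))" for y
  have \<delta>N: "\<delta> \<in> N (c', k) (c', k)" unfolding \<delta>_def by (rule conj[OF \<gamma>(1)])
  have 1: "lam ((u \<circ> \<gamma>) (F a b)) <= 1/2" "lam (u (F a b)) <= 1/2"
   using F_in[of a' b'] F_in[of a b] \<gamma>(2) by (auto simp: horosphere_def lu)
  have "lam ((u \<circ> \<gamma>) y) = lam (u y)" for y by (rule lam_unique[OF whole_comp[OF u \<gamma>w] u 1])
  hence "lam (\<delta> y) = lam y" for y using ui(2)[of y] by (simp add: \<delta>_def)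
  then obtain x y :: int where xy: "\<delta> = tr (of_int x) (of_int y)" using N_tr[OF ck(1) \<delta>N] by blast
  have "u (F a' b') = \<delta> (u (F a b))" by (simp add: \<delta>_def \<gamma>(2) ui)
  also have "... = u (F (a + of_int x) (b + of_int y))" by (simp add: xy F_tr)
  finally have "F a' b' = F (a + of_int x) (b + of_int y)" using ui(1) by metis
  moreover have "lattice c' k x y" using \<delta>N xy by (simp add: lattice_def)
  ultimately show "\<exists>x y. lattice c' k x y & a' = a + of_int x & b' = b + of_int y" using F_inj by blast
 next
  assume "\<exists>x y. lattice c' k x y & a' = a + of_int x & b' = b + of_int y"
  then obtain x y where xy: "lattice c' k x y" "a' = a + of_int x" "b' = b + of_int y" by blast
  have "(%z. finv u (tr (of_int x) (of_int y) (u z))) \<in> Mor c0 c0" using conj' xy(1) unfolding lattice_def by blast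
  from D.orb_apply[OF this, of "F a b"] show "D.orb (F a b) = D.orb (F a' b')" by (simp add: xy(2,3) F_tr[symmetric] ui)
 qed
 define q where "q = (%(s, t). D.orb (F (s * of_int \<alpha> + t * of_int \<beta>) (t * of_int d)))"
 have qeq: "q (s, t) = q (s', t') \<longleftrightarrow> s - s' \<in> \<int> & t - t' \<in> \<int>" for s t s' t'
 proof -
  have "q (s, t) = q (s', t') \<longleftrightarrow> (\<exists>i j :: int. s' * of_int \<alpha> + t' * of_int \<beta> = s * of_int \<alpha> + t * of_int \<beta> + of_int (i * \<alpha> + j * \<beta>)
    & t' * of_int d = t * of_int d + of_int (j * d))" unfolding q_def prod.case fib L(3) by blast
  also have "... \<longleftrightarrow> (\<exists>i j :: int. s' = s + of_int i & t' = t + of_int j)"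
  proof -
   have "(s' * of_int \<alpha> + t' * of_int \<beta> = s * of_int \<alpha> + t * of_int \<beta> + of_int (i * \<alpha> + j * \<beta>)
    & t' * of_int d = t * of_int d + of_int (j * d)) \<longleftrightarrow> (s' = s + of_int i & t' = t + of_int j)" for i j :: int
   proof -
    have "t' * of_int d = t * of_int d + of_int (j * d) \<longleftrightarrow> t' * of_int d = (t + of_int j) * of_int d" by (simp add: algebra_simps)
    also have "... \<longleftrightarrow> t' = t + of_int j" using L(2) by simp
    finally have 1: "t' * of_int d = t * of_int d + of_int (j * d) \<longleftrightarrow> t' = t + of_int j" .
    have "s' * of_int \<alpha> + (t + of_int j) * of_int \<beta> = s * of_int \<alpha> + t * of_int \<beta> + of_int (i * \<alpha> + j * \<beta>)
      \<longleftrightarrow> s' * of_int \<alpha> = (s + of_int i) * of_int \<alpha>" by (simp add: algebra_simps)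
    also have "... \<longleftrightarrow> s' = s + of_int i" using L(1) by simp
    finally show ?thesis using 1 by auto
   qed
   thus ?thesis by simp
  qed
  also have "... \<longleftrightarrow> s - s' \<in> \<int> & t - t' \<in> \<int>"
  proof
   assume "\<exists>i j :: int. s' = s + of_int i & t' = t + of_int j"
   then obtain i j :: int where "s - s' = of_int (- i)" "t - t' = of_int (- j)" by auto
   thus "s - s' \<in> \<int> & t - t' \<in> \<int>" by (simp only: Ints_of_int simp_thms)
  next
   assume "s - s' \<in> \<int> & t - t' \<in> \<int>"
   then obtain i j :: int where "s - s' = of_int i" "t - t' = of_int j" by (auto elim!: Ints_cases)
   thus "\<exists>i j :: int. s' = s + of_int i & t' = t + of_int j" by (intro exI[of _ "- i"] exI[of _ "- j"]) simp
  qed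
  finally show ?thesis .
 qed
 have hX: "horosphere g \<subseteq> X" using horosphere_bd[OF g] by (auto simp: bd_def)
 have tq: "topspace (subtopology D.quot (D.orb ` horosphere g)) = D.orb ` horosphere g" using hX by (auto simp: D.topspace_quot)
 have range: "range q = D.orb ` horosphere g"
 proof (rule subset_antisym; rule subsetI)
  fix z assume "z \<in> range q"
  then obtain s t where "z = q (s, t)" by auto
  hence "z = D.orb (F (s * of_int \<alpha> + t * of_int \<beta>) (t * of_int d))" by (simp add: q_def)
  thus "z \<in> D.orb ` horosphere g" using F_in by blast
 next
  fix z assume "z \<in> D.orb ` horosphere g"
  then obtain x where x: "x \<in> horosphere g" "z = D.orb x" by blast
  then obtain a b where ab: "x = F a b" using F_surj by blast
  have "q ((a - (b / of_int d) * of_int \<beta>) / of_int \<alpha>, b / of_int d) = z" using L(1,2) by (simp add: q_def x(2) ab)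
  thus "z \<in> range q" by (rule range_eqI[OF sym])
 qed
 have "continuous_on UNIV (%(s, t). F (s * of_int \<alpha> + t * of_int \<beta>) (t * of_int d))"
 proof -
  have c0: "continuous_on UNIV (%x::real \<times> real. pt (fst x * of_int \<alpha> + snd x * of_int \<beta>) (snd x * of_int d))"
  proof -
   have "pt a b = a *\<^sub>R vector [1, 1, 0] + b *\<^sub>R vector [1, - 1, 0] + vector [0, 0, 2]" for a b
    by (simp add: pt_def vec_eq_iff forall_3)
   thus ?thesis by (simp only:) (intro continuous_intros)
  qed
  have "continuous_on UNIV (%x::real \<times> real. psi_inv (pt (fst x * of_int \<alpha> + snd x * of_int \<beta>) (snd x * of_int d)))"
   by (rule continuous_on_compose2[OF continuous_psi_inv[OF order_refl] c0]) (auto simp: pth)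
  hence "continuous_on UNIV (%x::real \<times> real. finv u (psi_inv (pt (fst x * of_int \<alpha> + snd x * of_int \<beta>) (snd x * of_int d))))"
   by (rule continuous_on_compose2[OF whole_continuous[OF whole_inv(2)[OF u], of UNIV]]) simp
  thus ?thesis by (simp add: F_def case_prod_unfold)
 qed
 hence "continuous_map euclidean (top_of_set X) (%(s, t). F (s * of_int \<alpha> + t * of_int \<beta>) (t * of_int d))"
  using F_in hX by (auto simp: continuous_map_in_subtopology)
 hence "continuous_map euclidean D.quot (D.orb \<circ> (%(s, t). F (s * of_int \<alpha> + t * of_int \<beta>) (t * of_int d)))"
  by (rule continuous_map_compose[OF _ D.continuous_map_orb])
 moreover have "D.orb \<circ> (%(s, t). F (s * of_int \<alpha> + t * of_int \<beta>) (t * of_int d)) = q"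
  by (simp add: fun_eq_iff q_def)
 ultimately have qc: "continuous_map euclidean D.quot q" by simp
 have qc': "continuous_map euclidean (subtopology D.quot (D.orb ` horosphere g)) q"
  unfolding continuous_map_in_subtopology using qc range by auto
 show "subtopology D.quot (D.orb ` horosphere g) homeomorphic_space torus"
  by (rule torus_quotient[OF qc' _ _ qeq]) (simp_all only: range tq Hausdorff_space_subtopology[OF Hausdorff_X])
 have "connectedin euclidean (UNIV :: (real \<times> real) set)" unfolding connectedin_iff_connected by (rule convex_connected[OF convex_UNIV])
 from connectedin_continuous_map_image[OF qc this] show "connectedin D.quot (D.orb ` horosphere g)" by (simp add: range)
qed

lemma open_horosphere:
 assumes g: "g \<in> whole"
 shows "openin (subtopology D.quot (D.orb ` bd)) (D.orb ` horosphere g)"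
proof -
 have "\<forall>x\<in>horosphere g. \<exists>V. open V & x \<in> V & (\<forall>z\<in>V. \<forall>g'\<in>whole. lam (g' z) <= 1/2 --> lam \<circ> g' = lam \<circ> g)"
 proof
  fix x assume "x \<in> horosphere g"
  hence "lam (g x) = 1/2" by (simp add: horosphere_def)
  thus "\<exists>V. open V & x \<in> V & (\<forall>z\<in>V. \<forall>g'\<in>whole. lam (g' z) <= 1/2 --> lam \<circ> g' = lam \<circ> g)"
   using bd_nbhd[OF g, of x] by metis
 qed
 then obtain V where V: "!!x. x \<in> horosphere g ==> open (V x) & x \<in> V x & (\<forall>z\<in>V x. \<forall>g'\<in>whole. lam (g' z) <= 1/2 --> lam \<circ> g' = lam \<circ> g)"
  by metis
 define O' where "O' = (\<Union>x\<in>horosphere g. V x)"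
 have "open O'" unfolding O'_def using V by blast
 hence o: "openin D.quot (D.orb ` (X \<inter> O'))" by (intro D.open_orb_image openin_open_Int)
 have "D.orb ` horosphere g = D.orb ` (X \<inter> O') \<inter> D.orb ` bd"
 proof (rule subset_antisym; rule subsetI)
  fix a assume "a \<in> D.orb ` horosphere g"
  then obtain x where x: "x \<in> horosphere g" "a = D.orb x" by blast
  have "x \<in> bd" using x(1) horosphere_bd[OF g] by blast
  moreover have "x \<in> O'" using V[OF x(1)] x(1) unfolding O'_def by blast
  moreover have "x \<in> X" using \<open>x \<in> bd\<close> by (simp add: bd_def)
  ultimately show "a \<in> D.orb ` (X \<inter> O') \<inter> D.orb ` bd" using x(2) by blast
 next
  fix a assume "a \<in> D.orb ` (X \<inter> O') \<inter> D.orb ` bd"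
  then obtain x y where x: "x \<in> X" "x \<in> O'" "a = D.orb x" and y: "y \<in> bd" "a = D.orb y" by blast
  obtain \<gamma> where \<gamma>: "\<gamma> \<in> Mor c0 c0" "x = \<gamma> y" using D.orb_eqD[of y x] x(3) y(2) by auto
  have "x \<in> bd" unfolding \<gamma>(2) using bd_whole[OF _ y(1)] Mor_whole \<gamma>(1) by blast
  then obtain g' where g': "g' \<in> whole" "lam (g' x) = 1/2" by (auto simp: bd_def)
  obtain x' where x': "x' \<in> horosphere g" "x \<in> V x'" using x(2) unfolding O'_def by blast
  have "lam (g' x) <= 1/2" using g'(2) by simp
  hence "lam \<circ> g' = lam \<circ> g" using V[OF x'(1)] x'(2) g'(1) by blast
  hence "lam (g x) = 1/2" using g'(2) by (metis comp_apply)
  hence "x \<in> horosphere g" by (simp add: horosphere_def)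
  thus "a \<in> D.orb ` horosphere g" using x(3) by blast
 qed
 thus ?thesis using o by (auto simp: openin_subtopology)
qed

lemma toroidal: "toroidal_boundary D.quot"
 unfolding toroidal_boundary_def boundary_quot
proof (intro conjI ballI)
 show "D.orb ` bd ~= {}" using cusp_point by blast
 define Y where "Y = subtopology D.quot (D.orb ` bd)"
 have tY: "topspace Y = D.orb ` bd" unfolding Y_def using D.topspace_quot by (auto simp: bd_def)
 fix C assume C: "C \<in> connected_components_of (subtopology D.quot (D.orb ` bd))"
 hence CY: "C \<in> connected_components_of Y" by (simp add: Y_def)
 obtain a where a: "a \<in> topspace Y" "C = Collect (connected_component_of Y a)" using CY by (auto simp: connected_components_of_def)
 obtain x where x: "x \<in> bd" "a = D.orb x" using a(1) tY by auto
 obtain g where g: "g \<in> whole" "lam (g x) = 1/2" using x(1) by (auto simp: bd_def)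
 define H where "H = D.orb ` horosphere g"
 have aH: "a \<in> H" using g(2) x(2) by (auto simp: H_def horosphere_def)
 have Hb: "H \<subseteq> D.orb ` bd" unfolding H_def by (rule image_mono[OF horosphere_bd[OF g(1)]])
 have conn: "connectedin Y H" unfolding Y_def connectedin_subtopology using torus_horosphere(2)[OF g(1)] Hb by (simp add: H_def)
 have oH: "openin Y H" unfolding Y_def H_def by (rule open_horosphere[OF g(1)])
 have "openin Y (topspace Y - H)"
 proof (subst openin_subopen, intro ballI)
  fix b assume b: "b \<in> topspace Y - H"
  then obtain y where y: "y \<in> bd" "b = D.orb y" using tY by auto
  obtain g' where g': "g' \<in> whole" "lam (g' y) = 1/2" using y(1) by (auto simp: bd_def)
  define H' where "H' = D.orb ` horosphere g'"
  have oH': "openin Y H'" unfolding Y_def H'_def by (rule open_horosphere[OF g'(1)])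
  have bH': "b \<in> H'" using g'(2) y(2) by (auto simp: H'_def horosphere_def)
  have "H' \<inter> H = {}"
  proof (rule ccontr)
   assume "H' \<inter> H ~= {}"
   then obtain u v where uv: "u \<in> horosphere g'" "v \<in> horosphere g" "D.orb u = D.orb v" unfolding H_def H'_def by blast
   then obtain \<gamma> where \<gamma>: "\<gamma> \<in> Mor c0 c0" "v = \<gamma> u" using D.orb_eqD by blast
   have \<gamma>w: "\<gamma> \<in> whole" using Mor_whole \<gamma>(1) by blast
   have "lam ((g \<circ> \<gamma>) y) = lam (g' y)"
    by (rule lam_unique[OF whole_comp[OF g(1) \<gamma>w] g'(1), of u]) (use uv \<gamma>(2) in \<open>simp_all add: horosphere_def\<close>)
   hence "\<gamma> y \<in> horosphere g" using g'(2) by (simp add: horosphere_def)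
   hence "D.orb (\<gamma> y) \<in> H" unfolding H_def by blast
   thus False using b y(2) D.orb_apply[OF \<gamma>(1), of y] by simp
  qed
  thus "\<exists>T. openin Y T & b \<in> T & T \<subseteq> topspace Y - H" using oH' bH' openin_subset[OF oH'] by blast
 qed
 hence clH: "closedin Y H" unfolding closedin_def using openin_subset[OF oH] by blast
 have connC: "connectedin Y C" using CY by (rule connectedin_connected_components_of)
 have aC: "a \<in> C" using a by (simp add: connected_component_of_refl)
 have "C \<subseteq> H" using connectedin_clopen_cases[OF connC clH oH] aC aH unfolding disjnt_def by blast
 moreover have "H \<subseteq> C" unfolding a(2) by (rule connected_component_of_maximal[OF conn aH])
 ultimately have "C = H" by blast
 thus "subtopology D.quot C homeomorphic_space torus" using torus_horosphere(1)[OF g(1)] by (simp add: H_def)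
qed

theorem toroidal_manifold:
 "manifold3 D.quot & compact_space D.quot & toroidal_boundary D.quot" using manifold_X compact_X toroidal by blast

end

end

section \<open>Cup products\<close>

fun cup_lin :: "('c => 'i => 'c) => ('c => 'i => 'i => 'i) => int \<times> 'c \<times> 'i \<times> 'i option => (('c \<times> 'i) \<times> int) list" where
 "cup_lin nb gl (a, c, i, None) = [((c, i), a), ((nb c i, gl c i i), a)]"
| "cup_lin nb gl (a, c, i, Some j) = [((c, i), a), ((nb c i, gl c i j), a), ((c, j), - a), ((nb c j, gl c j i), - a)]"

fun cup_quad :: "('c => 'i => 'c) => ('c => 'i => 'i => 'i) => int \<times> 'c \<times> 'i \<times> 'i option => (int \<times> ('c \<times> 'i) \<times> 'c \<times> 'i) list" where
 "cup_quad nb gl (a, c, i, None) = [(a, (c, i), (nb c i, gl c i i))]"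
| "cup_quad nb gl (a, c, i, Some j) = [(a, (c, i), (nb c i, gl c i j)), (- a, (c, j), (nb c j, gl c j i))]"

definition coeff_at :: "('e \<times> int) list => 'e => int" where
 "coeff_at xs e = sum_list (map snd (filter (%x. fst x = e) xs))"

definition cup_form :: "('c => 'i => int list) => (int \<times> ('c \<times> 'i) \<times> 'c \<times> 'i) list => nat => nat => int" where
 "cup_form lab qs i j = sum_list (map (%(a, e, e'). a * (lab (fst e) (snd e) ! i * lab (fst e') (snd e') ! j)) qs)"

text \<open>A certificate is a combination of the relations in \<open>cup_zero\<close>; the unknown \<open>w\<close> must cancel
 modulo \<open>m\<close>, and what is left is the bilinear form with matrix \<open>F\<close>.\<close>

definition cup_ok where
 "cup_ok nb gl nbrs lab ts m k F cert \<longleftrightarrow>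
  (let xs = concat (map (cup_lin nb gl) cert) in list_all (%x. fst x \<in> set ts \<or> coeff_at xs (fst x) mod m = 0) xs) &
  list_all (%(a, c, i, z). case z of None => True | Some j => j \<in> set (nbrs i)) cert &
  (let qs = concat (map (cup_quad nb gl) cert) in
   list_all (%i. list_all (%j. (cup_form lab qs i j - F ! i ! j) mod m = 0) [0..<k]) [0..<k])"

lemma sum_list_coeff_at:
 assumes "finite S" "fst ` set xs \<subseteq> S"
 shows "sum_list (map (%x. snd x * w (fst x)) xs) = (\<Sum>e\<in>S. coeff_at xs e * w e)" using assms(2)
proof (induction xs)
 case (Cons x xs)
 have "coeff_at (x # xs) e * w e = (if fst x = e then snd x * w e else 0) + coeff_at xs e * w e" for e by (simp add: coeff_at_def algebra_simps)
 thus ?case using Cons assms(1) by (simp add: sum.distrib)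
qed (simp add: coeff_at_def)

lemma sum_list_cup_form:
 "sum_list (map (%(a, e, e'). a * ((\<Sum>i<k. U i * lab (fst e) (snd e) ! i) * (\<Sum>j<k. V j * lab (fst e') (snd e') ! j))) qs)
  = (\<Sum>i<k. \<Sum>j<k. cup_form lab qs i j * (U i * V j))"
proof (induction qs)
 case (Cons q qs)
 obtain a e e' where q: "q = (a, e, e')" by (cases q)
 have "cup_form lab (q # qs) i j * (U i * V j) = a * (U i * lab (fst e) (snd e) ! i * (V j * lab (fst e') (snd e') ! j)) + cup_form lab qs i j * (U i * V j)" for i j
  by (simp add: cup_form_def q algebra_simps)
 moreover have "a * ((\<Sum>i<k. U i * lab (fst e) (snd e) ! i) * (\<Sum>j<k. V j * lab (fst e') (snd e') ! j))
   = (\<Sum>i<k. \<Sum>j<k. a * (U i * lab (fst e) (snd e) ! i * (V j * lab (fst e') (snd e') ! j)))"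
  by (subst sum_product) (simp only: sum_distrib_left)
 ultimately show ?case using Cons unfolding q by (simp add: sum.distrib)
qed (simp add: cup_form_def)

lemma sum_list_concat_map:
 "sum_list (map f (concat (map g xs))) = sum_list (map (%x. sum_list (map f (g x))) xs)"
 for f :: "'a => int" by (induction xs) simp_all

lemma (in ra_classes) cup_zero_form:
 assumes phi: "!!j c i. j < k ==> phi j c i = lab c i ! j" and nbrs: "!!i j. j \<in> set (nbrs i) ==> adj i j"
  and cup: "cup_zero U V" and ok: "cup_ok nb gl nbrs lab ts r k F cert"
 shows "r dvd (\<Sum>i<k. \<Sum>j<k. F ! i ! j * (U i * V j))"
proof -
 define l where "l = (%U (c, i). \<Sum>j<k. U j * lab c i ! j :: int)"
 have l: "l U e = (\<Sum>j<k. U j * lab (fst e) (snd e) ! j)" for U e by (simp add: l_def case_prod_unfold)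
 obtain w u v where h: "\<forall>c i. u c i = (\<Sum>j<k. U j * phi j c i)" "\<forall>c i. v c i = (\<Sum>j<k. V j * phi j c i)"
  "\<forall>(c, i)\<in>set ts. w c i = 0" "\<forall>c i. w c i + w (nb c i) (gl c i i) + u c i * v (nb c i) (gl c i i) = 0"
  "\<forall>c i j. adj i j --> w c i + w (nb c i) (gl c i j) + u c i * v (nb c i) (gl c i j) =
    w c j + w (nb c j) (gl c j i) + u c j * v (nb c j) (gl c j i) + 0" using cup unfolding cup_zero_def by (elim exE conjE)
 note u = h(1)[rule_format] and v = h(2)[rule_format]
 have w: "(c, i) \<in> set ts ==> w c i = 0" "w c i + w (nb c i) (gl c i i) + u c i * v (nb c i) (gl c i i) = 0"
  "adj i j ==> w c i + w (nb c i) (gl c i j) + u c i * v (nb c i) (gl c i j) =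
    w c j + w (nb c j) (gl c j i) + u c j * v (nb c j) (gl c j i)" for c i j
  using h(3) h(4)[rule_format, of c i] h(5)[rule_format, of i j c] by auto
 have lu: "u c i = l U (c, i)" "v c i = l V (c, i)" for c i by (simp_all add: u v l phi)
 define w' where "w' = (%(c, i). w c i)"
 define xs where "xs = concat (map (cup_lin nb gl) cert)"
 define qs where "qs = concat (map (cup_quad nb gl) cert)"
 have wm: "\<forall>x\<in>set xs. fst x \<in> set ts \<or> coeff_at xs (fst x) mod r = 0"
  and adj: "\<forall>(a, c, i, z)\<in>set cert. case z of None => True | Some j => j \<in> set (nbrs i)"
  and F: "\<forall>i\<in>set [0..<k]. \<forall>j\<in>set [0..<k]. (cup_form lab qs i j - F ! i ! j) mod r = 0"
  using ok unfolding cup_ok_def Let_def list_all_iff xs_def qs_def by blast+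
 define A where "A x = sum_list (map (%x. snd x * w' (fst x)) (cup_lin nb gl x))" for x
 define B where "B x = sum_list (map (%(a, e, e'). a * (l U e * l V e')) (cup_quad nb gl x))" for x
 have "A x + B x = 0" if x: "x \<in> set cert" for x
 proof -
  obtain a c i z where xe: "x = (a, c, i, z)" by (cases x)
  show ?thesis
  proof (cases z)
   case None
   have "A x + B x = a * (w c i + w (nb c i) (gl c i i) + u c i * v (nb c i) (gl c i i))"
    by (simp add: A_def B_def xe None w'_def lu algebra_simps)
   thus ?thesis unfolding w(2) by simp
  next
   case (Some j)
   have a: "adj i j" using adj x nbrs unfolding xe Some by fastforce
   have "A x + B x = a * ((w c i + w (nb c i) (gl c i j) + u c i * v (nb c i) (gl c i j)) -
     (w c j + w (nb c j) (gl c j i) + u c j * v (nb c j) (gl c j i)))" by (simp add: A_def B_def xe Some w'_def lu algebra_simps)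
   thus ?thesis unfolding w(3)[OF a] by simp
  qed
 qed
 hence "sum_list (map A cert) + sum_list (map B cert) = 0" by (induction cert) (simp_all add: algebra_simps)
 hence AB: "sum_list (map (%x. snd x * w' (fst x)) xs) + sum_list (map (%(a, e, e'). a * (l U e * l V e')) qs) = 0"
  unfolding xs_def qs_def sum_list_concat_map A_def B_def .
 have "r dvd (\<Sum>e\<in>fst ` set xs. coeff_at xs e * w' e)"
 proof (rule dvd_sum)
  fix e assume "e \<in> fst ` set xs"
  then obtain x where x: "x \<in> set xs" "e = fst x" by blast
  hence "e \<in> set ts \<or> coeff_at xs e mod r = 0" using wm by blast
  thus "r dvd coeff_at xs e * w' e"
  proof
   assume "e \<in> set ts"
   hence "w' e = 0" using w(1)[of "fst e" "snd e"] by (simp add: w'_def case_prod_unfold)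
   thus ?thesis by simp
  qed (simp add: mod_0_imp_dvd)
 qed
 hence "r dvd sum_list (map (%x. snd x * w' (fst x)) xs)" by (subst sum_list_coeff_at[of "fst ` set xs"]) simp_all
 moreover have "r dvd b" if "r dvd a" "a + b = 0" for a b :: int using that by (metis dvd_0_right dvd_add_right_iff)
 ultimately have "r dvd sum_list (map (%(a, e, e'). a * (l U e * l V e')) qs)" using AB by blast
 hence "r dvd (\<Sum>i<k. \<Sum>j<k. cup_form lab qs i j * (U i * V j))" unfolding l sum_list_cup_form .
 moreover have "r dvd (\<Sum>i<k. \<Sum>j<k. (cup_form lab qs i j - F ! i ! j) * (U i * V j))"
  using F by (intro dvd_sum dvd_mult2 mod_0_imp_dvd) simp
 ultimately have "r dvd (\<Sum>i<k. \<Sum>j<k. cup_form lab qs i j * (U i * V j)) - (\<Sum>i<k. \<Sum>j<k. (cup_form lab qs i j - F ! i ! j) * (U i * V j))"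
  by (rule dvd_diff)
 thus ?thesis by (simp add: sum_subtractf[symmetric] algebra_simps)
qed

section \<open>A manifold with toroidal boundary\<close>

 datatype cellB = B0 | B1 | B2 | B3 | B4 | B5 | B6 | B7
 datatype faceB = H0 | H1 | H2 | H3 | H4 | H5 | H6 | H7
 datatype symB = T0 | T1 | T2 | T3 | T4 | T5 | T6 | T7 | T8 | T9 | T10 | T11 | T12 | T13 | T14 | T15 | T16 |
 T17 | T18 | T19 | T20 | T21 | T22

primrec rowB :: "'a => 'a => 'a => 'a => 'a => 'a => 'a => 'a => faceB => 'a" where
 "rowB x0 x1 x2 x3 x4 x5 x6 x7 H0 = x0"
| "rowB x0 x1 x2 x3 x4 x5 x6 x7 H1 = x1"
| "rowB x0 x1 x2 x3 x4 x5 x6 x7 H2 = x2"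
| "rowB x0 x1 x2 x3 x4 x5 x6 x7 H3 = x3"
| "rowB x0 x1 x2 x3 x4 x5 x6 x7 H4 = x4"
| "rowB x0 x1 x2 x3 x4 x5 x6 x7 H5 = x5"
| "rowB x0 x1 x2 x3 x4 x5 x6 x7 H6 = x6"
| "rowB x0 x1 x2 x3 x4 x5 x6 x7 H7 = x7"

primrec nbB :: "cellB => faceB => cellB" where
 "nbB B0 = rowB B4 B6 B1 B7 B1 B7 B4 B2"
| "nbB B1 = rowB B5 B7 B0 B6 B0 B6 B5 B3"
| "nbB B2 = rowB B2 B0 B2 B5 B2 B4 B2 B7"
| "nbB B3 = rowB B3 B1 B3 B4 B3 B5 B3 B6"
| "nbB B4 = rowB B7 B3 B0 B5 B2 B5 B6 B0"
| "nbB B5 = rowB B6 B2 B1 B4 B3 B4 B7 B1"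
| "nbB B6 = rowB B4 B7 B1 B5 B1 B3 B0 B7"
| "nbB B7 = rowB B5 B6 B0 B4 B0 B2 B1 B6"

primrec actB :: "symB => faceB => faceB" where
 "actB T0 = rowB H0 H1 H2 H3 H4 H5 H6 H7"
| "actB T1 = rowB H0 H1 H4 H5 H2 H3 H6 H7"
| "actB T2 = rowB H0 H2 H1 H3 H4 H6 H5 H7"
| "actB T3 = rowB H1 H0 H3 H2 H5 H4 H7 H6"
| "actB T4 = rowB H1 H3 H5 H7 H0 H2 H4 H6"
| "actB T5 = rowB H1 H5 H0 H4 H3 H7 H2 H6"
| "actB T6 = rowB H2 H0 H6 H4 H3 H1 H7 H5"
| "actB T7 = rowB H2 H3 H0 H1 H6 H7 H4 H5"
| "actB T8 = rowB H2 H6 H3 H7 H0 H4 H1 H5"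
| "actB T9 = rowB H3 H1 H2 H0 H7 H5 H6 H4"
| "actB T10 = rowB H3 H2 H7 H6 H1 H0 H5 H4"
| "actB T11 = rowB H3 H7 H1 H5 H2 H6 H0 H4"
| "actB T12 = rowB H4 H0 H5 H1 H6 H2 H7 H3"
| "actB T13 = rowB H4 H6 H0 H2 H5 H7 H1 H3"
| "actB T14 = rowB H5 H1 H7 H3 H4 H0 H6 H2"
| "actB T15 = rowB H5 H4 H1 H0 H7 H6 H3 H2"
| "actB T16 = rowB H5 H7 H4 H6 H1 H3 H0 H2"
| "actB T17 = rowB H6 H2 H4 H0 H7 H3 H5 H1"
| "actB T18 = rowB H6 H4 H7 H5 H2 H0 H3 H1"
| "actB T19 = rowB H6 H7 H2 H3 H4 H5 H0 H1"
| "actB T20 = rowB H7 H3 H6 H2 H5 H1 H4 H0"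
| "actB T21 = rowB H7 H5 H3 H1 H6 H4 H2 H0"
| "actB T22 = rowB H7 H6 H5 H4 H3 H2 H1 H0"

primrec sB :: "cellB => faceB => symB" where
 "sB B0 = rowB T6 T22 T16 T13 T18 T8 T12 T18"
| "sB B1 = rowB T6 T22 T16 T13 T18 T8 T12 T18"
| "sB B2 = rowB T19 T16 T1 T21 T1 T3 T19 T7"
| "sB B3 = rowB T19 T16 T1 T21 T1 T3 T19 T7"
| "sB B4 = rowB T11 T20 T5 T18 T3 T16 T16 T4"
| "sB B5 = rowB T11 T20 T5 T18 T3 T16 T16 T4"
| "sB B6 = rowB T18 T16 T8 T17 T13 T7 T22 T18"
| "sB B7 = rowB T18 T16 T8 T17 T13 T7 T22 T18"

definition glB where "glB c i = actB (sB c i)"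

primrec kcB :: "cellB => bool list" where
 "kcB B0 = [False,False,False]"
| "kcB B1 = [True,False,False]"
| "kcB B2 = [False,True,False]"
| "kcB B3 = [True,True,False]"
| "kcB B4 = [False,False,True]"
| "kcB B5 = [True,False,True]"
| "kcB B6 = [False,True,True]"
| "kcB B7 = [True,True,True]"

primrec kfB :: "faceB => bool list" where
 "kfB H0 = [False,False,False]"
| "kfB H1 = [True,False,False]"
| "kfB H2 = [False,True,False]"
| "kfB H3 = [True,True,False]"
| "kfB H4 = [False,False,True]"
| "kfB H5 = [True,False,True]"
| "kfB H6 = [False,True,True]"
| "kfB H7 = [True,True,True]"

definition keyB where "keyB c i = kcB c @ kfB i"

primrec labB :: "cellB => faceB => int list" where
 "labB B0 = rowB [1,2,- 2,0] [0,0,0,0] [2,2,- 2,0] [0,0,0,0] [0,0,0,0] [- 1,0,0,0] [0,0,0,0] [0,0,0,0]"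
| "labB B1 = rowB [- 1,0,0,0] [0,0,- 1,0] [0,0,0,0] [1,0,- 1,0] [- 2,- 2,2,0] [0,0,- 1,0] [- 2,- 2,2,0] [- 3,- 4,4,0]"
| "labB B2 = rowB [- 1,1,0,0] [0,0,0,0] [- 3,- 5,5,- 1] [- 3,- 4,4,0] [3,5,- 5,1] [- 1,- 1,1,1] [1,- 1,0,0] [0,- 1,0,0]"
| "labB B3 = rowB [2,3,- 4,0] [3,4,- 4,0] [- 6,- 8,8,1] [0,0,0,0] [6,8,- 8,- 1] [3,4,- 4,- 1] [- 2,- 3,4,0] [1,1,- 1,0]"
| "labB B4 = rowB [1,1,- 1,- 1] [0,0,0,0] [- 1,- 2,2,0] [- 3,- 4,4,0] [1,1,- 1,- 1] [1,2,- 2,0] [1,0,- 1,0] [0,0,0,0]"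
| "labB B5 = rowB [1,0,- 1,1] [3,4,- 4,0] [1,0,0,0] [- 1,- 2,2,0] [- 3,- 4,4,1] [3,4,- 4,0] [0,0,0,0] [2,2,- 2,0]"
| "labB B6 = rowB [- 1,0,1,0] [0,0,0,- 1] [- 1,0,1,0] [- 1,0,1,- 1] [0,0,1,0] [- 1,- 1,1,0] [0,0,0,0] [2,3,- 3,- 1]"
| "labB B7 = rowB [0,0,0,0] [- 2,- 3,3,1] [0,0,0,0] [- 1,- 1,1,1] [1,0,0,0] [0,1,0,0] [0,0,1,0] [0,0,0,1]"

primrec nbrsB :: "faceB => faceB list" where
 "nbrsB H0 = [H1,H2,H4]"
| "nbrsB H1 = [H0,H3,H5]"
| "nbrsB H2 = [H0,H3,H6]"
| "nbrsB H3 = [H1,H2,H7]"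
| "nbrsB H4 = [H0,H5,H6]"
| "nbrsB H5 = [H1,H4,H7]"
| "nbrsB H6 = [H2,H4,H7]"
| "nbrsB H7 = [H3,H5,H6]"

definition tsB :: "(cellB \<times> faceB) list" where
 "tsB = [(B0,H3),(B0,H6),(B0,H1),(B0,H7),(B0,H4),(B7,H0),(B4,H1)]"

definition esB :: "(cellB \<times> faceB) list" where
 "esB = [(B7,H4),(B7,H5),(B7,H6),(B7,H7)]"

definition paramsB :: "(cellB \<times> faceB) list" where
 "paramsB = [(B1,H6),(B1,H7),(B1,H1),(B6,H1),(B6,H5)]"

definition progB :: "(cellB \<times> faceB \<times> faceB) list" where
 "progB = [(B0,H2,H3),(B5,H3,H7),(B5,H2,H3),(B0,H5,H4),(B6,H4,H6),(B6,H2,H6),(B6,H0,H2),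
 (B4,H2,H6),(B5,H5,H7),(B5,H1,H5),(B5,H0,H2),(B5,H4,H0),(B3,H4,H5),(B6,H7,H5),(B7,H5,
 H1),(B4,H4,H6),(B2,H4,H5),(B7,H3,H7),(B3,H0,H1),(B2,H6,H7)]"

definition relsB :: "(cellB \<times> faceB \<times> faceB) list" where
 "relsB = [(B0,H0,H1),(B3,H6,H2),(B2,H4,H6),(B0,H3,H7)]"

definition cellsB where
 "cellsB = [B0, B1, B2, B3, B4, B5, B6, B7]"

definition facesB where "facesB = [H0, H1, H2, H3, H4, H5, H6, H7]"

primrec nB :: "faceB => real^3" where
 "nB H0 = vector [- 1, - 1, - 1]"
| "nB H1 = vector [1, - 1, - 1]"
| "nB H2 = vector [- 1, 1, - 1]"
| "nB H3 = vector [1, 1, - 1]"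
| "nB H4 = vector [- 1, - 1, 1]"
| "nB H5 = vector [1, - 1, 1]"
| "nB H6 = vector [- 1, 1, 1]"
| "nB H7 = vector [1, 1, 1]"

primrec RB :: "symB => real^3 => real^3" where
 "RB T0 x = vector [x$1, x$2, x$3]"
| "RB T1 x = vector [x$1, x$3, x$2]"
| "RB T2 x = vector [x$2, x$1, x$3]"
| "RB T3 x = vector [- x$1, x$2, x$3]"
| "RB T4 x = vector [x$2, x$3, - x$1]"
| "RB T5 x = vector [x$3, - x$1, x$2]"
| "RB T6 x = vector [- x$2, x$3, x$1]"
| "RB T7 x = vector [x$1, - x$2, x$3]"
| "RB T8 x = vector [x$3, x$1, - x$2]"
| "RB T9 x = vector [- x$2, - x$1, x$3]"
| "RB T10 x = vector [- x$1, x$3, - x$2]"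
| "RB T11 x = vector [x$3, - x$2, - x$1]"
| "RB T12 x = vector [- x$3, x$1, x$2]"
| "RB T13 x = vector [x$2, - x$3, x$1]"
| "RB T14 x = vector [- x$3, x$2, - x$1]"
| "RB T15 x = vector [- x$1, - x$3, x$2]"
| "RB T16 x = vector [x$2, - x$1, - x$3]"
| "RB T17 x = vector [- x$3, - x$2, x$1]"
| "RB T18 x = vector [- x$2, x$1, - x$3]"
| "RB T19 x = vector [x$1, - x$3, - x$2]"
| "RB T20 x = vector [- x$3, - x$1, - x$2]"
| "RB T21 x = vector [- x$2, - x$3, - x$1]"
| "RB T22 x = vector [- x$1, - x$2, - x$3]"

primrec frB :: "cellB => symB list" where
 "frB B0 = [T6,T21,T7,T22,T8,T5]"
| "frB B1 = [T5,T22,T8,T6,T21,T7]"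
| "frB B2 = [T12,T22,T7,T20,T13,T4]"
| "frB B3 = [T13,T7,T20,T12,T22,T4]"
| "frB B4 = [T10,T1,T2,T16,T17,T11]"
| "frB B5 = [T17,T11,T16,T2,T10,T1]"
| "frB B6 = [T16,T14,T17,T15,T2,T19]"
| "frB B7 = [T15,T2,T19,T16,T14,T17]"

definition certsB :: "(int \<times> cellB \<times> faceB \<times> faceB option) list list" where
 "certsB = [[(1,B3,H2,Some H6)],[(1,B2,H0,Some H2)],[(1,B0,H4,Some H5),(2,B4,H0,Some H4),(2,
 B4,H4,Some H6),(2,B0,H0,Some H2),(1,B3,H3,Some H7),(2,B0,H7,None),(1,B0,H5,None),(1,B1,
 H1,Some H5),(2,B1,H1,Some H3),(2,B0,H2,Some H6),(1,B0,H0,Some H4),(1,B5,H0,Some H4),(1,B3,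
 H1,Some H3),(1,B7,H0,Some H1),(2,B0,H6,Some H7),(2,B2,H3,Some H7),(2,B1,H3,None),(1,B6,H5,
 None)]]"

definition formsB :: "int list list" where
 "formsB = [[2,1,2,1,0,2],[2,1,1,2,2,0],[0,0,0,0,1,2]]"

definition goodB :: "(int list \<times> nat) list" where
 "goodB = [([1,1,0,0,0,0],0),([2,2,0,0,0,0],0),([2,0,1,1,1,1],1),([0,1,1,1,1,1],2),
 ([1,2,1,1,1,1],0),([2,0,2,2,1,1],1),([0,1,2,2,1,1],2),([1,2,2,2,1,1],0),([1,0,1,
 1,2,2],1),([2,1,1,1,2,2],0),([0,2,1,1,2,2],2),([1,0,2,2,2,2],1),([2,1,2,2,2,2],
 0),([0,2,2,2,2,2],2)]"

instance cellB :: finite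
proof
 have "UNIV = set cellsB" unfolding cellsB_def by (auto intro: cellB.exhaust)
 thus "finite (UNIV :: cellB set)" by (metis List.finite_set)
qed

instance faceB :: finite
proof
 have "UNIV = set facesB" unfolding facesB_def by (auto intro: faceB.exhaust)
 thus "finite (UNIV :: faceB set)" by (metis List.finite_set)
qed

lemma cellsB: "set cellsB = UNIV" unfolding cellsB_def by (auto intro: cellB.exhaust)
lemma facesB: "set facesB = UNIV" "distinct facesB" unfolding facesB_def by (auto intro: faceB.exhaust)

lemma keyB_inj: "keyB c i = keyB d j ==> c = d & i = j"
proof -
 assume k: "keyB c i = keyB d j"
 have "length (kcB a) = 3" for a by (cases a) simp_all
 hence e: "kcB c = kcB d" "kfB i = kfB j" using k by (simp_all add: keyB_def)
 have "list_all (%a. list_all (%b. kcB a = kcB b --> a = b) cellsB) cellsB" by code_simp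
 hence "kcB a = kcB b --> a = b" for a b unfolding list_all_iff cellsB by blast
 moreover have "list_all (%a. list_all (%b. kfB a = kfB b --> a = b) facesB) facesB" by code_simp
 hence "kfB a = kfB b --> a = b" for a b unfolding list_all_iff facesB by blast
 ultimately show ?thesis using e by blast
qed

lemma gramB: "i ~= j ==> nB i \<bullet> nB j = (if j \<in> set (nbrsB i) then 1 else nB i \<bullet> nB j)"
  "i ~= j ==> j \<notin> set (nbrsB i) ==> nB i \<bullet> nB j <= - 1"
 by (cases i; cases j; simp add: inner3)+

lemma nB_3: "nB i \<bullet> nB i = 3" by (cases i; simp add: inner3)

interpretation B: ra_system UNIV nB 1
proof
 show "nB i \<bullet> nB i = 1\<^sup>2 + 2" for i by (simp add: nB_3)
 show "nB i \<bullet> nB j = 1\<^sup>2 \<or> nB i \<bullet> nB j <= 1\<^sup>2 - 2" if "i ~= j" for i j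
  using gramB[OF that] by (auto split: if_splits)
qed simp_all

lemma adjB: "B.adj i j \<longleftrightarrow> j \<in> set (nbrsB i)"
proof -
 have "i \<notin> set (nbrsB i)" by (cases i) simp_all
 moreover have "nB i \<bullet> nB j = 1" if "i ~= j" "j \<in> set (nbrsB i)" using gramB(1)[OF that(1)] that(2) by presburger
 moreover have "nB i \<bullet> nB j ~= 1" if "i ~= j" "j \<notin> set (nbrsB i)" using gramB(2)[OF that] by linarith
 ultimately show ?thesis unfolding B.adj_def by auto
qed

lemma spanB: "span (range nB) = UNIV"
proof -
 have "x \<in> span (range nB)" for x
 proof -
  have "x = (x$1 / 2) *\<^sub>R (nB H7 + nB H1) + (x$2 / 2) *\<^sub>R (nB H7 + nB H2) + (x$3 / 2) *\<^sub>R (nB H7 + nB H4)"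
   by (simp add: vec_eq_iff forall_3)
  also have "... \<in> span (range nB)" by (intro span_add span_scale span_base rangeI)
  finally show ?thesis .
 qed
 thus ?thesis by blast
qed

lemma actB_symm: "actB s \<in> B.symm"
proof -
 have "RB s (nB (actB s j)) = nB j" for j by (cases s; cases j; simp add: vec_eq_iff forall_3)
 moreover have "orthogonal_transformation (RB s)" unfolding orthogonal_transformation_def
  by (cases s; simp add: inner3 algebra_simps; intro linearI; simp add: vec_eq_iff forall_3)
 ultimately show ?thesis unfolding B.symm_def by blast
qed

lemma gluingB: "gluing_ok nbB glB nbrsB cellsB facesB" by code_simp
lemma freeB: "free_ok nbB glB nbrsB cellsB facesB" by code_simp

lemma ra_cellsB: "ra_cells nB 1 nbB glB"
 by (rule ra_cellsI[OF B.ra_system_axioms spanB _ adjB cellsB facesB gluingB freeB]) (simp add: glB_def actB_symm)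

definition frameB :: "(cellB \<times> (faceB => faceB)) set" where
 "frameB = {(c, actB s) | c s. s \<in> set (frB c)}"

lemma frameB_closed: "list_all (%c. list_all (%s. list_all (%(i, t). list_ex (%s'.
  list_all (%j. glB c (actB s i) (actB s (actB t j)) = actB s' j) facesB) (frB (nbB c (actB s i))))
  [(H7, T9), (H4, T9), (H5, T2), (H6, T2)]) (frB c)) cellsB" by code_simp

definition topsB where "topsB s = map (actB s) [H7, H4, H5, H6]"

lemma frameB_unique: "list_all (%c. list_all (%s. list_all (%s'.
  list_all (%i. i \<in> set (topsB s')) (topsB s) --> s = s') (frB c)) (frB c)) cellsB" by code_simp

definition vertsB :: "faceB list list" where
 "vertsB = [[H1, H3, H5, H7], [H0, H2, H4, H6], [H2, H3, H6, H7], [H0, H1, H4, H5], [H4, H5, H6, H7], [H0, H1, H2, H3]]"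

lemma frameB_cover: "list_all (%c. list_all (%v. list_ex (%s. list_all (%i. i \<in> set v) (topsB s)) (frB c)) vertsB) cellsB"
 by code_simp

lemma vertsB:
 assumes "s = 1 \<or> s = - 1"
 shows "\<exists>v\<in>set vertsB. \<forall>i\<in>set v. nB i $ j = s"
proof -
 have "j = 1 \<or> j = 2 \<or> j = 3" using exhaust_3[of j] by blast
 thus ?thesis using assms by (elim disjE) (simp_all add: vertsB_def)
qed

interpretation B: framed nB nbB glB H7 H4 H5 H6 "actB T9" "actB T2" frameB
proof (intro framed.intro framed_axioms.intro octahedron.intro octahedron_axioms.intro ra_cellsB)
 show "nB i $ k = 1 \<or> nB i $ k = - 1" for i k using exhaust_3[of k] by (cases i) auto
 show "\<exists>i. nB i = v" if "\<forall>k. v $ k = 1 \<or> v $ k = - 1" for v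
 proof -
  have "v = vector [v $ 1, v $ 2, v $ 3]" by (simp add: vec_eq_iff forall_3)
  moreover have "\<exists>i. nB i = vector [a, b, c]" if "a = 1 \<or> a = - 1" "b = 1 \<or> b = - 1" "c = 1 \<or> c = - 1" for a b c
   using that by (elim disjE) (metis nB.simps)+
  ultimately show ?thesis using that by metis
 qed
 show "nB H7 = vector [1, 1, 1]" "nB H4 = vector [- 1, - 1, 1]" "nB H5 = vector [1, - 1, 1]" "nB H6 = vector [- 1, 1, 1]" by simp_all
 show "nB (actB T9 i) = vector [- (nB i $ 2), - (nB i $ 1), nB i $ 3]" "nB (actB T2 i) = vector [nB i $ 2, nB i $ 1, nB i $ 3]" for i
  by (cases i; simp)+
 show "k \<in> B.symm" if "(c, k) \<in> frameB" for c k using that actB_symm by (auto simp: frameB_def)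
 show "(nbB c (k i), glB c (k i) \<circ> k \<circ> t) \<in> frameB"
  if kc: "(c, k) \<in> frameB" and it: "(i, t) \<in> {(H7, actB T9), (H4, actB T9), (H5, actB T2), (H6, actB T2)}" for c k i t
 proof -
  obtain s where s: "k = actB s" "s \<in> set (frB c)" using kc by (auto simp: frameB_def)
  obtain z where z: "(i, z) \<in> set [(H7, T9), (H4, T9), (H5, T2), (H6, T2)]" "t = actB z" using it by auto
  obtain s' where s': "s' \<in> set (frB (nbB c (actB s i)))" "\<forall>j. glB c (actB s i) (actB s (actB z j)) = actB s' j"
   using frameB_closed z(1) s(2) unfolding list_all_iff list_ex_iff cellsB facesB by blast
  have "glB c (k i) \<circ> k \<circ> t = actB s'" using s'(2) by (simp add: fun_eq_iff s(1) z(2))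
  thus ?thesis using s'(1) unfolding s(1) frameB_def by blast
 qed
 show "k = k'" if kk: "(c, k) \<in> frameB" "(c, k') \<in> frameB" "k ` {H7, H4, H5, H6} \<subseteq> k' ` {H7, H4, H5, H6}" for c k k'
 proof -
  obtain s s' where s: "k = actB s" "s \<in> set (frB c)" "k' = actB s'" "s' \<in> set (frB c)" using kk(1,2) by (auto simp: frameB_def)
  have "\<forall>i\<in>set (topsB s). i \<in> set (topsB s')" using kk(3) by (auto simp: s(1,3) topsB_def)
  hence "s = s'" using frameB_unique s(2,4) unfolding list_all_iff cellsB by blast
  thus ?thesis by (simp add: s)
 qed
 show "\<exists>k. (c, k) \<in> frameB & (\<forall>i\<in>{H7, H4, H5, H6}. nB (k i) $ j = s)" if ss: "s = 1 \<or> s = - 1" for c j s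
 proof -
  obtain v where v: "v \<in> set vertsB" "\<forall>i\<in>set v. nB i $ j = s" using vertsB[OF ss] by blast
  obtain z where z: "z \<in> set (frB c)" "\<forall>i\<in>set (topsB z). i \<in> set v"
   using frameB_cover v(1) unfolding list_all_iff list_ex_iff cellsB by blast
  hence "\<forall>i\<in>{H7, H4, H5, H6}. nB (actB z i) $ j = s" using v(2) by (auto simp: topsB_def)
  thus ?thesis using z(1) unfolding frameB_def by blast
 qed
qed

lemma progB_adj: "list_all (%(c, i, j). j \<in> set (nbrsB i)) (progB @ relsB)" by code_simp

interpretation B: ra_classes nB 1 nbB glB B0 tsB 4 "%j c i. labB c i ! j" "%j. esB ! j" 7
proof (rule ra_classesI[OF ra_cellsB adjB cellsB facesB(1) _ _ _ _ _ _ _ keyB_inj _ progB_adj])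
 show "tree_list nbB cellsB [B0] tsB" by code_simp
 show "lab_ok nbB glB nbrsB cellsB facesB labB 4" by code_simp
 show "list_all (%e. labB (fst e) (snd e) = replicate 4 0) tsB" by code_simp
 show "length esB = 4" by code_simp
 show "map (%e. labB (fst e) (snd e)) esB = units 4" by code_simp
 show "prime (7::int)" by simp
 show "certify nbB glB keyB 7 (%_ _. 1) tsB esB paramsB progB relsB cellsB facesB" by code_simp
qed simp

definition pivotB :: "int list => cellB \<times> faceB" where
 "pivotB al = (case find (%j. al ! j mod 3 ~= 0) [0..<4] of None => (B0,H0) | Some j => esB ! j)"

definition chiB :: "int list => bool" where
 "chiB al \<longleftrightarrow> cyc_pow 2 3 (dot al (labB (fst (pivotB al)) (snd (pivotB al)))) mod 7 ~= 1 &
  certify nbB glB keyB 7 (%c i. cyc_pow 2 3 (dot al (labB c i))) tsB [pivotB al] paramsB progB relsB cellsB facesB"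

definition antis :: "int list => int list list" where
 "antis p = [[0, p ! 0, p ! 1, p ! 2], [- (p ! 0), 0, p ! 3, p ! 4], [- (p ! 1), - (p ! 3), 0, p ! 5], [- (p ! 2), - (p ! 4), - (p ! 5), 0]]"

lemma certsB: "list_all2 (%f. cup_ok nbB glB nbrsB labB tsB 3 4 (antis f)) formsB certsB" by code_simp

lemma goodB: "list_all (%(p, i). i < 4 & list_ex (%j. antis p ! i ! j mod 3 ~= 0) [0..<4] & chiB (antis p ! i)) goodB"
 by code_simp

text \<open>The points modulo 3 of the Klein quadric on which the three linear forms vanish.\<close>

lemma pointsB: "filter (%p. list_all (%f. dot f p mod 3 = 0) formsB & (p ! 0 * p ! 5 - p ! 1 * p ! 4 + p ! 2 * p ! 3) mod 3 = 0)
  (List.n_lists 6 [0, 1, 2]) = replicate 6 0 # map fst goodB" by code_simp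

lemma chi_rigidB:
 assumes "chiB al" "length al = 4" "!!j. j < 4 ==> A j mod 3 = al ! j mod 3"
 shows "B.chi_rigid 7 3 2 A"
proof -
 note c = assms(1)[unfolded chiB_def]
 have len: "length (labB c i) = 4" for c i by (cases c; cases i) simp_all
 have "prime (7::int)" by simp
 moreover have "list_all (%(c, i, j). B.adj i j) (progB @ relsB)" using progB_adj by (simp only: adjB)
 ultimately show ?thesis by (intro B.chi_rigidI[OF refl len _ assms(2,3) keyB_inj cellsB facesB(1) conjunct2[OF c] _ conjunct1[OF c]])
qed

lemma no_free_quotientB: "l >= 2 ==> epi B.dg (free_group l) = {}"
proof (rule B.no_free_quotient[where r = 7 and e = 3 and b = 2])
 fix U V :: "nat => int"
 assume cup: "B.cup_zero U V"
  and ind: "!!s s'. s mod 3 ~= 0 \<or> s' mod 3 ~= 0 ==> \<exists>j<4. (s * U j + s' * V j) mod 3 ~= 0"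
 define P where "P i j = U i * V j - V i * U j" for i j
 define p where "p = map (%x. x mod 3) [P 0 1, P 0 2, P 0 3, P 1 2, P 1 3, P 2 3]"
 have less4: "i < 4 \<longleftrightarrow> i = 0 \<or> i = 1 \<or> i = 2 \<or> i = (3::nat)" for i by auto
 have anti: "antis p ! i ! j mod 3 = (- V i * U j + U i * V j) mod 3" if "i < 4" "j < 4" for i j using that unfolding less4
  by (elim disjE) (simp_all add: antis_def p_def P_def mod_minus_eq algebra_simps)
 have "list_all (%f. dot f p mod 3 = 0) formsB" unfolding list_all_iff
 proof
  fix f assume f: "f \<in> set formsB"
  then obtain cert where "cup_ok nbB glB nbrsB labB tsB 3 4 (antis f) cert" using certsB by (metis in_set_conv_nth list_all2_conv_all_nth)
  from B.cup_zero_form[OF refl _ cup this] have "3 dvd (\<Sum>i<4. \<Sum>j<4. antis f ! i ! j * (U i * V j))" by (simp add: adjB)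
  also have "(\<Sum>i<4. \<Sum>j<4. antis f ! i ! j * (U i * V j)) = f ! 0 * P 0 1 + f ! 1 * P 0 2 + f ! 2 * P 0 3 + f ! 3 * P 1 2 + f ! 4 * P 1 3 + f ! 5 * P 2 3"
   by (simp add: antis_def P_def eval_nat_numeral algebra_simps)
  finally have *: "(f ! 0 * P 0 1 + f ! 1 * P 0 2 + f ! 2 * P 0 3 + f ! 3 * P 1 2 + f ! 4 * P 1 3 + f ! 5 * P 2 3) mod 3 = 0" by simp
  have "list_all (%f. length f = 6) formsB" by code_simp
  hence "length f = 6" using f by (simp add: list_all_iff)
  then obtain a b c d e g where fe: "f = [a, b, c, d, e, g]" by (auto simp: eval_nat_numeral length_Suc_conv)
  have "[dot f p = a * P 0 1 + (b * P 0 2 + (c * P 0 3 + (d * P 1 2 + (e * P 1 3 + (g * P 2 3 + 0)))))] (mod 3)"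
   by (simp only: fe p_def list.map dot.simps) (intro cong_add cong_scalar_left; simp add: cong_def)
  thus "dot f p mod 3 = 0" using * by (simp add: fe cong_def ac_simps)
 qed
 moreover have "p ! 0 = P 0 1 mod 3" "p ! 1 = P 0 2 mod 3" "p ! 2 = P 0 3 mod 3" "p ! 3 = P 1 2 mod 3" "p ! 4 = P 1 3 mod 3" "p ! 5 = P 2 3 mod 3"
  by (simp_all add: p_def)
 hence "[p ! 0 * p ! 5 - p ! 1 * p ! 4 + p ! 2 * p ! 3 = P 0 1 * P 2 3 - P 0 2 * P 1 3 + P 0 3 * P 1 2] (mod 3)"
  by (simp only:) (intro cong_add cong_diff cong_mult; simp)
 hence "(p ! 0 * p ! 5 - p ! 1 * p ! 4 + p ! 2 * p ! 3) mod 3 = (P 0 1 * P 2 3 - P 0 2 * P 1 3 + P 0 3 * P 1 2) mod 3" by (simp only: cong_def)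
 moreover have "P 0 1 * P 2 3 - P 0 2 * P 1 3 + P 0 3 * P 1 2 = 0" by (simp add: P_def algebra_simps)
 moreover have "p \<in> set (List.n_lists 6 [0, 1, 2])"
 proof -
  have "x mod 3 = 0 \<or> x mod 3 = 1 \<or> x mod 3 = 2" for x :: int by presburger
  thus ?thesis by (auto simp: set_n_lists p_def)
 qed
 ultimately have "p \<in> set (filter (%p. list_all (%f. dot f p mod 3 = 0) formsB & (p ! 0 * p ! 5 - p ! 1 * p ! 4 + p ! 2 * p ! 3) mod 3 = 0) (List.n_lists 6 [0, 1, 2]))"
  by simp
 hence pm: "p = replicate 6 0 \<or> p \<in> set (map fst goodB)" unfolding pointsB by simp
 show "\<exists>s s'. (s mod 3 ~= 0 \<or> s' mod 3 ~= 0) & B.chi_rigid 7 3 2 (%j. s * U j + s' * V j)"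
 proof (cases "p = replicate 6 0")
  case True
  have "antis (replicate 6 0) = replicate 4 (replicate 4 0)" by code_simp
  hence "antis p ! i ! j mod 3 = 0" if "i < 4" "j < 4" for i j using that True by simp
  hence z: "(- V i * U j + U i * V j) mod 3 = 0" if "i < 4" "j < 4" for i j using anti that by simp
  have "- V i mod 3 = 0 & U i mod 3 = 0" if "i < 4" for i using ind[of "- V i" "U i"] z that by blast
  moreover obtain j where "j < 4" "U j mod 3 ~= 0" using ind[of 1 0] by auto
  ultimately show ?thesis by blast
 next
  case False
  then obtain i where i: "(p, i) \<in> set goodB" using pm by auto
  have g: "i < 4" "\<exists>j\<in>set [0..<4]. antis p ! i ! j mod 3 ~= 0" "chiB (antis p ! i)"
   using goodB i unfolding list_all_iff list_ex_iff by blast+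
  have len: "length (antis p ! i) = 4" using g(1) unfolding less4 by (elim disjE) (simp_all add: antis_def)
  obtain j where j: "j < 4" "antis p ! i ! j mod 3 ~= 0" using g(2) by auto
  have "B.chi_rigid 7 3 2 (%j. - V i * U j + U i * V j)" by (rule chi_rigidB[OF g(3) len]) (simp only: anti[OF g(1)])
  moreover have "- V i mod 3 ~= 0 \<or> U i mod 3 ~= 0"
  proof (rule ccontr)
   assume "~ ?thesis"
   hence "3 dvd - V i" "3 dvd U i" by (auto simp: dvd_eq_mod_eq_0)
   hence "3 dvd - V i * U j + U i * V j" by (intro dvd_add dvd_mult2)
   thus False using j anti[OF g(1) j(1)] by (simp add: dvd_eq_mod_eq_0)
  qed
  ultimately show ?thesis by blast
 qed
next
 fix m' :: int assume "0 < m'" "m' < 3"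
 hence "m' = 1 \<or> m' = 2" by arith
 thus "2 ^ nat m' mod 7 ~= (1::int)" by auto
qed simp_all

theorem toroidal_example:
 "\<exists>M :: (real^3) set topology. manifold3 M & compact_space M & toroidal_boundary M &
  (\<forall>x\<in>topspace M. manifold_betti1 M x = 4 & manifold_corank M x = 1)"
proof (intro exI conjI ballI)
 let ?M = "deck_action.quot B.X B.Gam"
 show "manifold3 ?M" "compact_space ?M" "toroidal_boundary ?M" using B.toroidal_manifold by blast+
 fix x assume x: "x \<in> topspace ?M"
 note inv = B.manifold_invariants[OF B.deck_action_X B.simply_connected_X no_free_quotientB x]
 show "manifold_betti1 ?M x = 4" using inv(1) by (simp add: numeral_eq_enat)
 show "manifold_corank ?M x = 1" by (rule inv(2))
qed

theorem theorem1p2: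
  shows "(\<exists>M :: (real^3) set topology.
            closed_hyperbolic_manifold3 M \<and>
            (\<forall>x\<in>topspace M. manifold_betti1 M x = 5 \<and> manifold_corank M x = 1)) \<and>
         (\<exists>M :: (real^3) set topology.
            manifold3 M \<and> compact_space M \<and> toroidal_boundary M \<and>
            (\<forall>x\<in>topspace M. manifold_betti1 M x = 4 \<and> manifold_corank M x = 1))"
  using closed_example toroidal_example by blast

end
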